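(* Let $q:\mathbb{R}\to\mathbb{C}$ be $1$-periodic with $q\in L_1[0,1]$ and Fourier coefficients $q_n=\int_0^1 q(x)e^{-i2\pi nx}\,dx$ (with $q_0=0$). Let $p\ge0$ be an integer, $q\in W_1^p[0,1]$, and let $s$ be an integer with $0\le s\le p$ such that $q^{(k)}(0)=q^{(k)}(1)$ for $k=0,\dots,s-1$. Suppose there are constants $c>0$, $\varepsilon>0$, $N_0$ such that for all $n>N_0$: $q_n\sim q_{-n}$, $|q_n|>cn^{-s-1}$, and at least one of $\operatorname{Re}(q_nq_{-n})\ge0$ or $|\operatorname{Im}(q_nq_{-n})|\ge\varepsilon|q_nq_{-n}|$ holds. Then there is $N$ such that for all $|n|>N$ and all $t\in[0,\pi]$ the eigenvalue $\lambda_n(t)$ of $L_t(q)$ is simple. Moreover, for $0<\rho<\pi/2$ fixed and sufficiently small, uniformly in $t\in[0,\rho]$, the two eigenvalues of $L_t(q)$ in the disk $\{\lambda:|\lambda-(2\pi n+t)^2|<15\pi n\rho\}$ ($n>N$) are, for $j=1,2$, $(2\pi n+t)^2-4\pi nt+(-1)^j\sqrt{(4\pi nt)^2+q_{2n}q_{-2n}}+O(1/n),$ and, uniformly in $t\in[\pi-\rho,\pi]$, the eigenvalues $\lambda_{n,j}(t)$ of $L_t(q)$ near $(2\pi n+t)^2$ satisfy $\lambda_{n,j}(t)=(2\pi n+t)^2-2\pi(2n+1)(t-\pi)+(-1)^j\sqrt{(2\pi(2n+1)(t-\pi))^2+q_{2n+1}q_{-2n-1}}+O(1/n),$ while uniformly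 in $t\in[\rho,\pi-\rho]$, $\lambda_n(t)=(2\pi n+t)^2+O(\ln|n|/|n|)$ with normalized eigenfunction $e^{i(2\pi n+t)x}+O(1/n)$.
   Context: For $t\in(-\pi,\pi]$, $L_t(q)$ is the operator in $L_2[0,1]$ generated by $-y''+q(x)y$ with boundary conditions $y(1)=e^{it}y(0)$, $y'(1)=e^{it}y'(0)$. $W_1^p[0,1]$: functions whose derivatives up to order $p$ lie in $L_1[0,1]$. $a_n\sim b_n$ means $a_n=O(b_n)$ and $b_n=O(a_n)$. A formula $f(n,t)=O(h(n))$ holds uniformly in $t\in A$ if there are $M,N'$ independent of $t$ with $|f(n,t)|\le M|h(n)|$ for all $t\in A$, $|n|\ge N'$. The eigenvalues $\lambda_n(t)$, $|n|$ large, are enumerated so that $\lambda_n$ is continuous on $[0,\pi]$ and $\lambda_n(t)=(2\pi n+t)^2+O(\ln|n|/|n|)$ uniformly on $[\rho,\pi-\rho]$. *)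

theory Defs
  imports "HOL-Analysis.Analysis"
begin

definition fcoef :: "(real \<Rightarrow> complex) \<Rightarrow> int \<Rightarrow> complex" where
  "fcoef q n = integral {0..1} (\<lambda>x. q x * exp (- \<i> * of_real (2 * pi * of_int n * x)))"

text \<open>q in W_1^p[0,1]: there are functions d 0, ..., d p, all in L_1[0,1], with d 0 = q a.e.
  on [0,1] and d k absolutely continuous with derivative d (k+1) for k < p.
  d k is the (absolutely continuous representative of the) k-th derivative of q.\<close>
definition sobolev_W1 :: "(real \<Rightarrow> complex) \<Rightarrow> nat \<Rightarrow> (nat \<Rightarrow> real \<Rightarrow> complex) \<Rightarrow> bool" where
  "sobolev_W1 q p d \<longleftrightarrow>
     (\<forall>k\<le>p. d k absolutely_integrable_on {0..1}) \<and>
     (AE x in lebesgue_on {0..1}. d 0 x = q x) \<and>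
     (\<forall>k<p. \<forall>x\<in>{0..1}. d k x = d k 0 + integral {0..x} (d (Suc k)))"

text \<open>(y, y1) solves -y'' + q y - lam y = f on [0,1] (y1 = y'), with y' absolutely continuous,
  together with the boundary conditions y(1) = e^{it} y(0), y'(1) = e^{it} y'(0).
  For f = 0 these are the eigenfunctions of L_t(q) for lam; for f an eigenfunction,
  solutions are associated functions.\<close>
definition floq_sol :: "(real \<Rightarrow> complex) \<Rightarrow> real \<Rightarrow> complex \<Rightarrow> (real \<Rightarrow> complex)
    \<Rightarrow> (real \<Rightarrow> complex) \<Rightarrow> (real \<Rightarrow> complex) \<Rightarrow> bool" where
  "floq_sol q t lam f y y1 \<longleftrightarrow>
     continuous_on {0..1} y \<and> continuous_on {0..1} y1 \<and>
     (\<lambda>s. (q s - lam) * y s - f s) integrable_on {0..1} \<and>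
     (\<forall>x\<in>{0..1}. y x = y 0 + integral {0..x} y1) \<and>
     (\<forall>x\<in>{0..1}. y1 x = y1 0 + integral {0..x} (\<lambda>s. (q s - lam) * y s - f s)) \<and>
     y 1 = exp (\<i> * of_real t) * y 0 \<and> y1 1 = exp (\<i> * of_real t) * y1 0"

definition is_eigenvalue :: "(real \<Rightarrow> complex) \<Rightarrow> real \<Rightarrow> complex \<Rightarrow> bool" where
  "is_eigenvalue q t lam \<longleftrightarrow>
     (\<exists>y y1. floq_sol q t lam (\<lambda>_. 0) y y1 \<and> (\<exists>x\<in>{0..1}. y x \<noteq> 0))"

definition simple_eigenvalue :: "(real \<Rightarrow> complex) \<Rightarrow> real \<Rightarrow> complex \<Rightarrow> bool" where
  "simple_eigenvalue q t lam \<longleftrightarrow>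
     (\<exists>y y1. floq_sol q t lam (\<lambda>_. 0) y y1 \<and> (\<exists>x\<in>{0..1}. y x \<noteq> 0) \<and>
        (\<forall>z z1. floq_sol q t lam (\<lambda>_. 0) z z1 \<longrightarrow> (\<exists>c. \<forall>x\<in>{0..1}. z x = c * y x)) \<and>
        \<not> (\<exists>z z1. floq_sol q t lam y z z1))"

definition eig_enumeration :: "(real \<Rightarrow> complex) \<Rightarrow> (int \<Rightarrow> real \<Rightarrow> complex) \<Rightarrow> bool" where
  "eig_enumeration q lam \<longleftrightarrow>
     (\<exists>N'. \<forall>n. \<bar>n\<bar> \<ge> N' \<longrightarrow>
        (\<forall>t\<in>{0..pi}. is_eigenvalue q t (lam n t)) \<and> continuous_on {0..pi} (lam n)) \<and>
     (\<forall>\<rho>. 0 < \<rho> \<and> \<rho> < pi/2 \<longrightarrow> (\<exists>M N'. \<forall>n. \<forall>t\<in>{\<rho>..pi-\<rho>}. \<bar>n\<bar> \<ge> N' \<longrightarrow>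
        norm (lam n t - (of_real ((2 * pi *  of_int n + t)^2))) \<le> M * ln \<bar>n\<bar> / \<bar>n\<bar>))"

end

theory Submission
	imports Defs "HOL-Complex_Analysis.Complex_Analysis"
begin

text \<open>Put \<open>lam = \<mu>\<^sup>2\<close>. A number is an eigenvalue of \<open>L_t(q)\<close> iff the discriminant (the trace of the monodromy matrix)
equals \<open>2 cos t\<close>, and it is simple if moreover the derivative of the discriminant does not vanish. A gauge transformation
by a WKB exponent \<open>\<sigma> = \<i> \<mu> + T\<close>, with \<open>T\<close> a polynomial in \<open>1 / (2 \<i> \<mu>)\<close> built from \<open>q, ..., q^(s-1)\<close>, makes the
monodromy matrix diagonal up to entries \<open>n12(\<mu>)\<close>, \<open>n12(-\<mu>)\<close> which near \<open>\<mu> = \<pi> m\<close> equal \<open>q_m / (2 \<pi> \<i> m) + o(m^(-s-2))\<close>.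
With \<open>n11(\<mu>) n11(-\<mu>) - n12(\<mu>) n12(-\<mu>) = 1\<close> a multiple large eigenvalue would force
\<open>- (2 \<pi> m sin t)\<^sup>2 = q_m q_(-m) (1 + o(1))\<close>, which the hypothesis on the Fourier coefficients excludes.

For the asymptotics the trivial gauge \<open>T = 0\<close> suffices. With \<open>\<eta> = \<mu> - \<pi> m\<close> and \<open>\<tau>\<close> the distance of \<open>t\<close> to \<open>0\<close> or \<open>\<pi>\<close>, the
eigenvalue equation reads \<open>\<eta>\<^sup>2 = w0\<^sup>2 + O(m^(-2)) (\<bar>\<eta>\<bar> + \<bar>w0\<bar> + m^(-2))\<close> with \<open>w0\<^sup>2 = \<tau>\<^sup>2 + q_m q_(-m) / (2 \<pi> m)\<^sup>2\<close>. The hypothesis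
bounds \<open>\<tau>\<close> and \<open>q_m / m\<close> by \<open>w0\<close>, hence \<open>\<eta> = \<plusminus> w0 + O(m^(-2))\<close>. Rouche's theorem gives exactly two roots in the disc, and
a divided difference shows that the two roots take opposite signs. Since no eigenvalue lies on the boundary circle,
the continuous enumeration stays in these discs for \<open>t\<close> near \<open>0\<close> and \<open>\<pi>\<close>.\<close>

text \<open>The coefficient is merely integrable, so solutions are pairs of absolutely continuous
  functions given by integral equations, and all perturbation bounds are taken in mean. Why there
  are two gauges: the hypothesis bounds |q_m| from below only by c m^(-s-1), so in the argument for
  simplicity the normalised off-diagonal entries must be known up to o(m^(-s-1)). Each endpoint
  condition on a derivative of \<open>q\<close> allows one more step of the WKB recursion, and each
  step gains one power of 1/\<mu>. The eigenvalue formulas, in contrast, ask for an error O(1/m) in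
  \<lambda>, that is O(m^(-2)) in \<mu>, whatever s is; there q_0 = 0 already makes
  \<open>n11 \<mu>\<close> equal to e^(i\<mu>) up to O(\<mu>^(-2)) with T = 0. The order of the two
  parts is forced: Rouche's theorem counts zeros with multiplicity, so simplicity has to be known
  before a disc can be said to contain two different eigenvalues.\<close>

abbreviation L1 :: "(real => 'a::{banach,second_countable_topology}) => bool" where "L1 f \<equiv> f absolutely_integrable_on {0..1}"

section \<open>Integrable functions on the unit interval and approximation in mean\<close>

lemma L1_mult_continuous:
	fixes f g :: "real => complex"
	assumes "f absolutely_integrable_on {a..b}" "continuous_on {a..b} g"
	shows "(\<lambda>x. f x * g x) absolutely_integrable_on {a..b}"
proof -
	have bil: "bilinear ((*) :: complex => complex => complex)"
		by (simp add: bilinear_conv_bounded_bilinear bounded_bilinear_mult)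
	have meas: "g \<in> borel_measurable (lebesgue_on {a..b})"
		by (rule continuous_imp_measurable_on_sets_lebesgue[OF assms(2)]) simp
	have bd: "bounded (g ` {a..b})"
		by (intro compact_imp_bounded compact_continuous_image assms) simp
	have "(\<lambda>x. g x * f x) absolutely_integrable_on {a..b}"
		by (rule absolutely_integrable_bounded_measurable_product[OF bil meas _ bd assms(1)]) simp
	then show ?thesis by (simp add: mult.commute)
qed

lemma L1_mult_continuous':
	fixes f g :: "real => complex"
	assumes "f absolutely_integrable_on {a..b}" "continuous_on {a..b} g"
	shows "(\<lambda>x. g x * f x) absolutely_integrable_on {a..b}"
	using L1_mult_continuous[OF assms] by (simp add: mult.commute)

lemma L1_Icc_mono:
	fixes f :: "real => 'a::euclidean_space"
	assumes "L1 f" "x \<in> {0..1}"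
	shows "f absolutely_integrable_on {0..x}"
	using absolutely_integrable_on_subinterval[OF assms(1), of 0 x] assms(2) by auto

lemma L1_integrable:
	"f absolutely_integrable_on S ==> f integrable_on S" for f :: "real => 'a::euclidean_space"
	by (simp add: absolutely_integrable_on_def)

lemma L1_norm_integrable:
	"f absolutely_integrable_on S ==> (\<lambda>x. norm (f x)) integrable_on S" for f :: "real => 'a::euclidean_space"
	by (simp add: absolutely_integrable_on_def)

lemma norm_integral_le:
	fixes f :: "real => complex"
	assumes "L1 f" "x \<in> {0..1}"
		and "h integrable_on {0..1}" "\<And>u. u \<in> {0..1} ==> norm (f u) <= h u"
	shows "norm (integral {0..x} f) <= integral {0..1} h"
proof -
	have hx: "h integrable_on {0..x}"
		using assms(2,3) integrable_on_subinterval[of h "{0..1}" 0 x] by auto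
	have "norm (integral {0..x} f) <= integral {0..x} h"
		by (intro integral_norm_bound_integral hx L1_integrable
				L1_Icc_mono[OF assms(1,2)]) (use assms(2,4) in auto)
	also have "\<dots> <= integral {0..1} h"
		by (intro integral_subset_le hx assms(3)) (use assms(2) in \<open>auto intro!: order_trans[OF norm_ge_zero assms(4)]\<close>)
	finally show ?thesis .
qed

text \<open>A measurable function is a limit of continuous ones off a null set. Projecting the
  approximants radially onto the ball of radius \<open>B\<close> keeps them continuous, leaves the
  limit unchanged and supplies the constant majorant for dominated convergence.\<close>

lemma measurable_on_approx_bounded:
	fixes f :: "real => complex"
	assumes f: "f \<in> borel_measurable (lebesgue_on {0..1})" and B: "B > 0" "\<And>x. x \<in> {0..1} ==> norm (f x) <= B"
		and e: "e > 0"
	shows "\<exists>g. continuous_on UNIV g \<and> integral {0..1} (\<lambda>x. norm (f x - g x)) < e"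
proof -
	have "f measurable_on {0..1}"
		using f by (simp add: measurable_on_iff_borel_measurable)
	then obtain N g where N: "negligible N" and g: "\<And>n. continuous_on UNIV (g n :: real => complex)"
		and lim: "\<And>x. x \<notin> N ==> (\<lambda>n. g n x) \<longlonglongrightarrow> (if x \<in> {0..1} then f x else 0)"
		unfolding measurable_on_def by metis
	define h where "h n x = (B / max B (norm (g n x))) *\<^sub>R g n x" for n x
	have mx: "max B t > 0" for t using B by (auto simp: max_def)
	have mx0: "max B t \<noteq> 0" for t using mx[of t] by linarith
	have hc: "continuous_on UNIV (h n)" for n
		unfolding h_def by (intro continuous_intros g) (use mx0 in auto)
	have hB: "norm (h n x) <= B" for n x
	proof -
		have "norm (h n x) = B * (norm (g n x) / max B (norm (g n x)))"
			unfolding h_def using B mx[of "norm (g n x)"] by (simp add: abs_mult)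
		also have "\<dots> <= B*1" using B mx[of "norm (g n x)"] by (intro mult_left_mono) auto
		finally show ?thesis by simp
	qed
	have fi: "f integrable_on {0..1}"
		by (rule L1_integrable,
				rule measurable_bounded_by_integrable_imp_absolutely_integrable[OF f _ _ B(2)]) auto
	have lim2: "(\<lambda>n. norm (f x - h n x)) \<longlonglongrightarrow> 0" if "x \<in> {0..1} - N" for x
	proof -
		have "(\<lambda>n. norm (f x - h n x)) \<longlonglongrightarrow> norm (f x - (B / max B (norm (f x))) *\<^sub>R f x)"
			unfolding h_def using lim[of x] that mx0 by (intro tendsto_intros) auto
		moreover have "max B (norm (f x)) = B" using B(2)[of x] that by auto
		ultimately show ?thesis using B by simp
	qed
	\<comment> \<open>Set to 0 on the null set, so that convergence holds at every point while the
	  integrals stay the same.\<close>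
	define k where "k n x = (if x \<in> N then 0 else norm (f x - h n x))" for n x
	have ki: "(\<lambda>x. norm (f x - h n x)) integrable_on {0..1}" for n
	proof -
		have "L1 (\<lambda>x. f x - h n x)"
		proof (rule measurable_bounded_by_integrable_imp_absolutely_integrable[where g="\<lambda>x. B+B"])
			show "(\<lambda>x. f x - h n x) \<in> borel_measurable (lebesgue_on {0..1})"
				by (intro borel_measurable_diff f continuous_imp_measurable_on_sets_lebesgue
						continuous_on_subset[OF hc]) auto
			show "norm (f x - h n x) <= B + B" if "x \<in> {0..1}" for x
				using norm_triangle_ineq4[of "f x" "h n x"] B(2)[OF that] hB[of n x] by linarith
		qed auto
		then show ?thesis by (simp add: absolutely_integrable_on_def)
	qed
	have kk: "integral {0..1} (k n) = integral {0..1} (\<lambda>x. norm (f x - h n x))" for n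
		by (rule integral_spike[OF N]) (auto simp: k_def)
	have "(\<lambda>n. integral {0..1} (k n)) \<longlonglongrightarrow> integral {0..1::real} (\<lambda>x. 0::real)"
	proof (rule dominated_convergence(2)[where h="\<lambda>x. B+B"])
		show "k n integrable_on {0..1}" for n
			by (rule integrable_spike[OF ki[of n] N]) (auto simp: k_def)
		show "norm (k n x) <= B + B" if "x \<in> {0..1}" for n x
			using norm_triangle_ineq4[of "f x" "h n x"] B(2)[OF that] hB[of n x] B(1)
			by (auto simp: k_def)
		show "(\<lambda>n. k n x) \<longlonglongrightarrow> 0" if "x \<in> {0..1}" for x
			using lim2[of x] that by (cases "x \<in> N") (auto simp: k_def)
	qed auto
	then have "(\<lambda>n. integral {0..1} (\<lambda>x. norm (f x - h n x))) \<longlonglongrightarrow> 0" by (simp add: kk)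
	then have "\<forall>\<^sub>F n in sequentially. integral {0..1} (\<lambda>x. norm (f x - h n x)) < e"
		using e by (rule order_tendstoD)
	then show ?thesis using hc eventually_happens by force
qed

text \<open>Replacing \<open>f\<close> by 0 where its norm exceeds n + 1 costs a mean error that
  tends to 0 by dominated convergence; the bounded remainder falls under
  \<open>measurable_on_approx_bounded\<close>.\<close>

lemma L1_approx_continuous:
	fixes f :: "real => complex"
	assumes f: "L1 f" and e: "e > 0"
	shows "\<exists>g. continuous_on UNIV g \<and> integral {0..1} (\<lambda>x. norm (f x - g x)) < e"
proof -
	define t where "t n x = (if norm (f x) <= real (Suc n) then f x else 0)" for n x
	have fm: "f \<in> borel_measurable (lebesgue_on {0..1})"
		using f by (simp add: absolutely_integrable_measurable)
	have tm: "t n \<in> borel_measurable (lebesgue_on {0..1})" for n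
	proof -
		have "{x \<in> space (lebesgue_on {0..1}). norm (f x) <= real (Suc n)} \<in> sets (lebesgue_on {0..1})"
			using fm by measurable
		then have "(\<lambda>x. if norm (f x) <= real (Suc n) then f x else 0) \<in> borel_measurable (lebesgue_on {0..1})"
			by (rule measurable_If[OF fm borel_measurable_const])
		then show ?thesis unfolding t_def .
	qed
	have ti: "L1 (\<lambda>x. f x - t n x)" for n
		by (rule measurable_bounded_by_integrable_imp_absolutely_integrable[where g="\<lambda>x. norm (f x)"])
			 (use f in \<open>auto intro!: borel_measurable_diff[OF fm tm] simp: absolutely_integrable_on_def\<close>, auto simp: t_def)
	have "(\<lambda>n. integral {0..1} (\<lambda>x. norm (f x - t n x))) \<longlonglongrightarrow> integral {0..1::real} (\<lambda>x. 0::real)"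
	proof (rule dominated_convergence(2)[where h="\<lambda>x. norm (f x)"])
		show "(\<lambda>x. norm (f x - t n x)) integrable_on {0..1}" for n
			using ti[of n] by (simp add: absolutely_integrable_on_def)
		show "(\<lambda>x. norm (f x)) integrable_on {0..1}" using f by (simp add: absolutely_integrable_on_def)
		show "norm (norm (f x - t n x)) <= norm (f x)" for n x by (auto simp: t_def)
		show "(\<lambda>n. norm (f x - t n x)) \<longlonglongrightarrow> 0" for x
		proof (rule tendsto_eventually)
			obtain m where "norm (f x) <= real m" using real_arch_simple by blast
			then show "\<forall>\<^sub>F n in sequentially. norm (f x - t n x) = 0"
				by (auto simp: eventually_sequentially t_def intro!: exI[of _ m])
		qed
	qed
	then have "(\<lambda>n. integral {0..1} (\<lambda>x. norm (f x - t n x))) \<longlonglongrightarrow> 0" by simp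
	then have "\<forall>\<^sub>F n in sequentially. integral {0..1} (\<lambda>x. norm (f x - t n x)) < e/2"
		by (rule order_tendstoD) (use e in auto)
	then obtain n where n: "integral {0..1} (\<lambda>x. norm (f x - t n x)) < e/2"
		using eventually_happens by force
	have tB: "norm (t n x) <= real (Suc n)" for x by (simp add: t_def)
	obtain g where g: "continuous_on UNIV g" "integral {0..1} (\<lambda>x. norm (t n x - g x)) < e/2"
		using measurable_on_approx_bounded[OF tm[of n] _ tB, of "e/2"] e by auto
	have tg: "(\<lambda>x. norm (t n x - g x)) integrable_on {0..1}"
	proof -
		have "L1 (\<lambda>x. f x - (f x - t n x))"
			by (rule set_integral_diff(1)[OF f ti])
		moreover have "L1 g"
			by (intro absolutely_integrable_continuous_real continuous_on_subset[OF g(1)]) auto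
		ultimately have "(\<lambda>x. (f x - (f x - t n x)) - g x) absolutely_integrable_on {0..1}"
			by (rule set_integral_diff(1))
		then show ?thesis by (simp add: absolutely_integrable_on_def)
	qed
	have ft: "(\<lambda>x. norm (f x - t n x)) integrable_on {0..1}"
		using ti[of n] by (simp add: absolutely_integrable_on_def)
	have gi: "L1 g"
		by (intro absolutely_integrable_continuous_real continuous_on_subset[OF g(1)]) auto
	have fg: "(\<lambda>x. norm (f x - g x)) integrable_on {0..1}"
		using set_integral_diff(1)[OF f gi] by (simp add: absolutely_integrable_on_def)
	have "integral {0..1} (\<lambda>x. norm (f x - g x)) <= integral {0..1} (\<lambda>x. norm (f x - t n x) + norm (t n x - g x))"
		by (intro integral_le fg integrable_add ft tg) (metis diff_add_cancel add_diff_eq norm_triangle_ineq)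
	also have "\<dots> = integral {0..1} (\<lambda>x. norm (f x - t n x)) + integral {0..1} (\<lambda>x. norm (t n x - g x))"
		by (intro integral_add ft tg)
	also have "\<dots> < e" using n g(2) by simp
	finally show ?thesis using g(1) by blast
qed

text \<open>Stone-Weierstrass applied to a continuous approximant: on an interval of length 1 a
  uniform error is also a mean error. The explicit derivative serves later integrations by
  parts.\<close>

lemma L1_approx_polynomial:
	fixes f :: "real => complex"
	assumes f: "L1 f" and e: "e > 0"
	obtains g g' where "\<And>x. (g has_vector_derivative g' x) (at x)" "continuous_on UNIV g'"
		"continuous_on UNIV g" "integral {0..1} (\<lambda>x. norm (f x - g x)) < e"
proof -
	obtain h where h: "continuous_on UNIV h" "integral {0..1} (\<lambda>x. norm (f x - h x)) < e/2"
		using L1_approx_continuous[OF f, of "e/2"] e by auto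
	have "continuous_on {0..1} h" using h(1) continuous_on_subset by blast
	then obtain g where g: "polynomial_function g" "\<And>x. x \<in> {0..1} ==> norm (h x - g x) < e/2"
		using Stone_Weierstrass_polynomial_function[of "{0..1::real}" h "e/2"] e by auto
	obtain g' where g': "polynomial_function g'" "\<And>x. (g has_vector_derivative g' x) (at x)"
		using has_vector_derivative_polynomial_function[OF g(1)] by blast
	have gc: "continuous_on A g" "continuous_on A g'" for A
		using g(1) g'(1) by (auto intro: continuous_on_polymonial_function)
	have hi: "L1 h" "L1 g"
		by (auto intro!: absolutely_integrable_continuous_real gc continuous_on_subset[OF h(1)])
	have i1: "(\<lambda>x. norm (f x - h x)) integrable_on {0..1}" "(\<lambda>x. norm (f x - g x)) integrable_on {0..1}"
		using set_integral_diff(1)[OF f hi(1)] set_integral_diff(1)[OF f hi(2)]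
		by (simp_all add: absolutely_integrable_on_def)
	have "integral {0..1} (\<lambda>x. norm (f x - g x)) <= integral {0..1} (\<lambda>x. norm (f x - h x) + e/2)"
	proof (intro integral_le i1 integrable_add)
		show "norm (f x - g x) <= norm (f x - h x) + e/2" if "x \<in> {0..1}" for x
			using norm_triangle_ineq[of "f x - h x" "h x - g x"] g(2)[OF that] by simp
	qed auto
	also have "\<dots> = integral {0..1} (\<lambda>x. norm (f x - h x)) + e/2"
		using i1 by (subst integral_add) auto
	also have "\<dots> < e" using h(2) by simp
	finally show ?thesis by (rule that[OF g'(2) gc(2) gc(1)])
qed

section \<open>Absolutely continuous functions on the unit interval\<close>

text \<open>Absolute continuity with a named derivative. \<open>f'\<close> is determined only up to
  a null set, and the calculus runs through the integral identity, so differentiation almost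
  everywhere never enters.\<close>

definition ac :: "(real => complex) => (real => complex) => bool" where
	"ac f f' \<longleftrightarrow> f' absolutely_integrable_on {0..1} \<and> (\<forall>x\<in>{0..1}. f x = f 0 + integral {0..x} f')"

lemma acD: "ac f f' ==> f' absolutely_integrable_on {0..1}"
	"ac f f' ==> x \<in> {0..1} ==> f x = f 0 + integral {0..x} f'"
	unfolding ac_def by blast+

lemma acI: "L1 f' ==> (\<And>x. x \<in> {0..1} ==> f x = f 0 + integral {0..x} f') ==> ac f f'"
	unfolding ac_def by blast+

lemma ac_integral: "L1 f ==> ac (\<lambda>x. c + integral {0..x} f) f"
	by (rule acI) simp_all

lemma ac_continuous:
	assumes "ac f f'"
	shows "continuous_on {0..1} f"
proof -
	have "continuous_on {0..1} (\<lambda>x. f 0 + integral {0..x} f')"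
		by (intro continuous_intros indefinite_integral_continuous_1 L1_integrable acD[OF assms])
	then show ?thesis using acD(2)[OF assms] by (metis (no_types, lifting) continuous_on_eq)
qed

lemma ac_absolutely_integrable: "ac f f' ==> f absolutely_integrable_on {0..1}"
	by (rule absolutely_integrable_continuous_real[OF ac_continuous])

lemma ac_C1:
	assumes "\<And>x. x \<in> {0..1} ==> (f has_vector_derivative f' x) (at x within {0..1})" "continuous_on {0..1} f'"
	shows "ac f f'"
proof (rule acI)
	show "L1 f'" by (rule absolutely_integrable_continuous_real) fact
	show "f x = f 0 + integral {0..x} f'" if "x \<in> {0..1}" for x
	proof -
		have "(f' has_integral (f x - f 0)) {0..x}"
		proof (rule fundamental_theorem_of_calculus)
			show "(f has_vector_derivative f' u) (at u within {0..x})" if "u \<in> {0..x}" for u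
				by (rule has_vector_derivative_within_subset[OF assms(1)]) (use that \<open>x \<in> {0..1}\<close> in auto)
		qed (use that in auto)
		then show ?thesis by (simp add: integral_unique)
	qed
qed

lemma ac_const: "ac (\<lambda>x. c) (\<lambda>x. 0)"
	by (rule acI[OF absolutely_integrable_continuous_real]) simp_all

lemma ac_cmult:
	assumes "ac f f'"
	shows "ac (\<lambda>x. c * f x) (\<lambda>x. c * f' x)"
proof (rule acI)
	show "L1 (\<lambda>x. c * f' x)"
		using acD(1)[OF assms] by (intro set_integrable_mult_right)
	show "c * f x = c * f 0 + integral {0..x} (\<lambda>x. c * f' x)" if "x \<in> {0..1}" for x
		using acD(2)[OF assms that] by (simp add: algebra_simps)
qed

lemma ac_add:
	assumes "ac f f'" "ac g g'"
	shows "ac (\<lambda>x. f x + g x) (\<lambda>x. f' x + g' x)"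
proof (rule acI)
	show "L1 (\<lambda>x. f' x + g' x)"
		using assms acD(1) by (intro set_integral_add) auto
	show "f x + g x = f 0 + g 0 + integral {0..x} (\<lambda>x. f' x + g' x)" if "x \<in> {0..1}" for x
	proof -
		have "integral {0..x} (\<lambda>x. f' x + g' x) = integral {0..x} f' + integral {0..x} g'"
			by (intro integral_add L1_integrable L1_Icc_mono[OF _ that]
					acD(1)[OF assms(1)] acD(1)[OF assms(2)])
		then show ?thesis using acD(2)[OF assms(1) that] acD(2)[OF assms(2) that] by (simp add: algebra_simps)
	qed
qed

lemma ac_uminus: "ac f f' ==> ac (\<lambda>x. - f x) (\<lambda>x. - f' x)"
	using ac_cmult[of f f' "-1"] by simp

lemma ac_diff: "ac f f' ==> ac g g' ==> ac (\<lambda>x. f x - g x) (\<lambda>x. f' x - g' x)"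
	using ac_add[of f f' "\<lambda>x. - g x" "\<lambda>x. - g' x"] ac_uminus by simp

lemma ac_cong:
	assumes "ac f f'" "\<And>x. x \<in> {0..1} ==> f x = g x" "\<And>x. x \<in> {0..1} ==> f' x = g' x"
	shows "ac g g'"
proof (rule acI)
	show "L1 g'"
		by (rule absolutely_integrable_spike[OF acD(1)[OF assms(1)] negligible_empty]) (simp add: assms(3))
	show "g x = g 0 + integral {0..x} g'" if "x \<in> {0..1}" for x
	proof -
		have "integral {0..x} g' = integral {0..x} f'"
			by (rule integral_cong) (use assms(3) that in auto)
		then show ?thesis using acD(2)[OF assms(1) that] assms(2)[OF that] assms(2)[of 0] by simp
	qed
qed

lemma norm_integral_mult_le:
	fixes f g :: "real => complex"
	assumes f: "L1 f"
		and g: "continuous_on {0..1} g" "\<And>u. u \<in> {0..1} ==> norm (g u) <= d"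
		and x: "x \<in> {0..1}"
	shows "norm (integral {0..x} (\<lambda>u. f u * g u)) <= d * integral {0..1} (\<lambda>u. norm (f u))"
proof -
	have d: "d >= 0" using g(2)[of 0] norm_ge_zero[of "g 0"] by (meson atLeastAtMost_iff order_trans zero_le_one order_refl)
	have "norm (integral {0..x} (\<lambda>u. f u * g u)) <= integral {0..1} (\<lambda>u. d * norm (f u))"
	proof (rule norm_integral_le[OF L1_mult_continuous[OF f g(1)] x])
		show "(\<lambda>u. d * norm (f u)) integrable_on {0..1}"
			using L1_norm_integrable[OF f] by (rule integrable_on_mult_right)
		show "norm (f u * g u) <= d * norm (f u)" if "u \<in> {0..1}" for u
			using mult_left_mono[OF g(2)[OF that], of "norm (f u)"] by (simp add: norm_mult mult.commute)
	qed
	then show ?thesis by simp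
qed

lemma ac_bounded:
	assumes "continuous_on {0..1} (f :: real => complex)"
	obtains B where "B > 0" "\<And>u. u \<in> {0..1} ==> norm (f u) <= B"
proof -
	have "bounded (f ` {0..1})"
		by (intro compact_imp_bounded compact_continuous_image assms) simp
	then obtain B where "B > 0" "\<forall>u\<in>{0..1}. norm (f u) <= B"
		unfolding bounded_pos by blast
	then show ?thesis using that by blast
qed

text \<open>The product rule is obtained from the smooth case by approximation in mean.\<close>

lemma integral_parts_C1:
	assumes g: "\<And>x. x \<in> {0..1} ==> (g has_vector_derivative g' x) (at x within {0..1})"
		and g'c: "continuous_on {0..1} g'"
		and f: "ac f f'" and x: "x \<in> {0..1}"
	shows "f x * g x = f 0 * g 0 + integral {0..x} (\<lambda>u. f' u * g u + f u * g' u)"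
proof -
	have gc: "continuous_on {0..1} g"
		by (rule ac_continuous[OF ac_C1[OF g g'c]])
	obtain B where B: "B > 0" "\<And>u. u \<in> {0..1} ==> norm (g u) <= B" using ac_bounded[OF gc] by blast
	have g'i: "L1 g'" by (rule absolutely_integrable_continuous_real[OF g'c])
	define L where "L = integral {0..1} (\<lambda>u. norm (g' u))"
	have L: "L >= 0" unfolding L_def
		by (rule integral_nonneg) (use L1_norm_integrable[OF g'i] in auto)
	have fi: "L1 f'" by (rule acD[OF f])
	have "norm (f x * g x - f 0 * g 0 - integral {0..x} (\<lambda>u. f' u * g u + f u * g' u)) <= e" if e: "e > 0" for e
	proof -
		\<comment> \<open>Chosen so that the three errors \<open>d*B\<close>, \<open>B*d\<close> and
		  \<open>d*L\<close> at the end add up to \<open>e\<close>.\<close>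
		define d where "d = e / (2*B + L)"
		have d: "d > 0" using e B L by (simp add: d_def)
		obtain p p' where p: "\<And>x. (p has_vector_derivative p' x) (at x)" "continuous_on UNIV p'"
			"continuous_on UNIV p" "integral {0..1} (\<lambda>x. norm (f' x - p x)) < d"
			using L1_approx_polynomial[OF fi d] by blast
		have pc: "continuous_on A p" for A using p(3) continuous_on_subset by blast
		have pi: "L1 p" by (intro absolutely_integrable_continuous_real pc)
		define P where "P y = f 0 + integral {0..y} p" for y
		have di: "L1 (\<lambda>u. f' u - p u)" by (rule set_integral_diff(1)[OF fi pi])
		have Pder: "(P has_vector_derivative p u) (at u within {0..1})" if "u \<in> {0..1}" for u
			unfolding P_def using integral_has_vector_derivative[OF pc that]
			by (auto intro!: derivative_eq_intros)
		have Pac: "ac P p" by (rule ac_C1[OF Pder pc])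
		have close: "norm (f y - P y) <= d" if "y \<in> {0..1}" for y
		proof -
			have "f y - P y = integral {0..y} (\<lambda>u. f' u - p u)"
				unfolding P_def acD(2)[OF f that]
				by (subst integral_diff) (simp_all add: L1_integrable L1_Icc_mono[OF _ that] fi pi)
			also have "norm \<dots> <= integral {0..1} (\<lambda>u. norm (f' u - p u))"
				by (rule norm_integral_le[OF di that L1_norm_integrable[OF di]]) simp
			finally show ?thesis using p(4) by simp
		qed
		have "ac (\<lambda>y. P y * g y) (\<lambda>u. p u * g u + P u * g' u)"
		proof (rule ac_C1)
			show "((\<lambda>y. P y * g y) has_vector_derivative p u * g u + P u * g' u) (at u within {0..1})"
				if "u \<in> {0..1}" for u
				using has_vector_derivative_mult[OF Pder[OF that] g[OF that]]
				by (simp add: algebra_simps)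
			show "continuous_on {0..1} (\<lambda>u. p u * g u + P u * g' u)"
				by (intro continuous_intros pc gc g'c ac_continuous[OF Pac])
		qed
		then have P: "P x * g x = P 0 * g 0 + integral {0..x} (\<lambda>u. p u * g u + P u * g' u)"
			and Pi: "L1 (\<lambda>u. p u * g u + P u * g' u)"
			using acD(1) acD(2)[OF _ x] by blast+
		have P0: "P 0 = f 0" by (simp add: P_def)
		have Fi: "L1 (\<lambda>u. f' u * g u + f u * g' u)"
			by (intro set_integral_add L1_mult_continuous gc g'c fi ac_absolutely_integrable[OF f])
		have Di: "L1 (\<lambda>u. (p u - f' u) * g u)"
			"L1 (\<lambda>u. g' u * (P u - f u))"
			by (intro L1_mult_continuous continuous_intros gc g'i set_integral_diff(1)[OF pi fi]
					ac_continuous[OF f] ac_continuous[OF Pac])+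
		have "f x * g x - f 0 * g 0 - integral {0..x} (\<lambda>u. f' u * g u + f u * g' u)
			 = (f x - P x) * g x + (integral {0..x} (\<lambda>u. p u * g u + P u * g' u) - integral {0..x} (\<lambda>u. f' u * g u + f u * g' u))"
			using P P0 by (simp add: algebra_simps)
		also have "integral {0..x} (\<lambda>u. p u * g u + P u * g' u) - integral {0..x} (\<lambda>u. f' u * g u + f u * g' u)
			 = integral {0..x} (\<lambda>u. (p u * g u + P u * g' u) - (f' u * g u + f u * g' u))"
			by (simp only: integral_diff[OF L1_integrable[OF L1_Icc_mono[OF Pi x]] L1_integrable[OF L1_Icc_mono[OF Fi x]]])
		also have "\<dots> = integral {0..x} (\<lambda>u. (p u - f' u) * g u + g' u * (P u - f u))"
			by (rule integral_cong) (simp add: algebra_simps)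
		also have "\<dots> = integral {0..x} (\<lambda>u. (p u - f' u) * g u) + integral {0..x} (\<lambda>u. g' u * (P u - f u))"
			by (rule integral_add[OF L1_integrable[OF L1_Icc_mono[OF Di(1) x]] L1_integrable[OF L1_Icc_mono[OF Di(2) x]]])
		finally have eq: "f x * g x - f 0 * g 0 - integral {0..x} (\<lambda>u. f' u * g u + f u * g' u)
			 = (f x - P x) * g x + (integral {0..x} (\<lambda>u. (p u - f' u) * g u) + integral {0..x} (\<lambda>u. g' u * (P u - f u)))" .
		have I1: "norm (integral {0..x} (\<lambda>u. (p u - f' u) * g u)) <= B * integral {0..1} (\<lambda>u. norm (p u - f' u))"
			by (rule norm_integral_mult_le[OF set_integral_diff(1)[OF pi fi] gc B(2) x])
		also have "\<dots> <= B*d" using p(4) B by (intro mult_left_mono) (auto simp: norm_minus_commute)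
		finally have I1: "norm (integral {0..x} (\<lambda>u. (p u - f' u) * g u)) <= B*d" .
		have I2: "norm (integral {0..x} (\<lambda>u. g' u * (P u - f u))) <= d * integral {0..1} (\<lambda>u. norm (g' u))"
			by (rule norm_integral_mult_le[OF g'i _ _ x])
				 (use close in \<open>auto intro!: continuous_intros ac_continuous[OF f] ac_continuous[OF Pac] simp: norm_minus_commute\<close>)
		have "norm (f x * g x - f 0 * g 0 - integral {0..x} (\<lambda>u. f' u * g u + f u * g' u))
			<= norm (f x - P x) * norm (g x) + (norm (integral {0..x} (\<lambda>u. (p u - f' u) * g u)) + norm (integral {0..x} (\<lambda>u. g' u * (P u - f u))))"
			unfolding eq by (intro order_trans[OF norm_triangle_ineq] add_mono norm_triangle_ineq) (simp add: norm_mult)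
		also have "\<dots> <= d*B + (B*d + d*L)"
			using I2 unfolding L_def[symmetric]
			by (intro add_mono mult_mono B(2) x close I1) (use B d in auto)
		also have "\<dots> = d * (2*B+L)" by (simp add: algebra_simps)
		also have "\<dots> = e" using B L by (simp add: d_def)
		finally show ?thesis .
	qed
	then have "norm (f x * g x - f 0 * g 0 - integral {0..x} (\<lambda>u. f' u * g u + f u * g' u)) <= 0"
		by (meson dense_ge)
	then show ?thesis by (simp add: algebra_simps)
qed

text \<open>Now the second factor is general too: \<open>g'\<close> is replaced by a continuous
  \<open>p\<close> close to it in mean, whose primitive \<open>G\<close> is smooth enough for
  \<open>integral_parts_C1\<close>. The errors are controlled by the supremum of \<open>f\<close>
  and the mean of |f'|.\<close>

lemma ac_mult:
	assumes f: "ac f f'" and g: "ac g g'"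
	shows "ac (\<lambda>x. f x * g x) (\<lambda>x. f' x * g x + f x * g' x)"
proof (rule acI)
	have fi: "L1 f'" and gi: "L1 g'"
		using acD(1) f g by blast+
	have fc: "continuous_on {0..1} f" and gc: "continuous_on {0..1} g"
		using ac_continuous f g by blast+
	show Fi: "L1 (\<lambda>x. f' x * g x + f x * g' x)"
		by (rule set_integral_add(1)[OF L1_mult_continuous[OF fi gc]
					L1_mult_continuous'[OF gi fc]])
	obtain B where B: "B > 0" "\<And>u. u \<in> {0..1} ==> norm (f u) <= B" using ac_bounded[OF fc] by blast
	define L where "L = integral {0..1} (\<lambda>u. norm (f' u))"
	have L: "L >= 0" unfolding L_def
		by (rule integral_nonneg) (use L1_norm_integrable[OF fi] in auto)
	fix x :: real assume x: "x \<in> {0..1}"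
	have "norm (f x * g x - f 0 * g 0 - integral {0..x} (\<lambda>u. f' u * g u + f u * g' u)) <= e" if e: "e > 0" for e
	proof -
		define d where "d = e / (2*B + L)"
		have d: "d > 0" using e B L by (simp add: d_def)
		obtain p p' where p: "\<And>x. (p has_vector_derivative p' x) (at x)" "continuous_on UNIV p'"
			"continuous_on UNIV p" "integral {0..1} (\<lambda>x. norm (g' x - p x)) < d"
			using L1_approx_polynomial[OF gi d] by blast
		have pc: "continuous_on A p" for A by (rule continuous_on_subset[OF p(3)]) simp
		have pi: "L1 p" by (intro absolutely_integrable_continuous_real pc)
		have di: "L1 (\<lambda>u. g' u - p u)" by (rule set_integral_diff(1)[OF gi pi])
		have dn: "(\<lambda>u. norm (g' u - p u)) integrable_on {0..1}" by (rule L1_norm_integrable[OF di])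
		define G where "G y = g 0 + integral {0..y} p" for y
		have Gder: "(G has_vector_derivative p u) (at u within {0..1})" if "u \<in> {0..1}" for u
			unfolding G_def using integral_has_vector_derivative[OF pc that]
			by (auto intro!: derivative_eq_intros)
		have Gac: "ac G p" by (rule ac_C1[OF Gder pc])
		have Gc: "continuous_on {0..1} G" by (rule ac_continuous[OF Gac])
		have close: "norm (g y - G y) <= d" if "y \<in> {0..1}" for y
		proof -
			have "g y - G y = integral {0..y} (\<lambda>u. g' u - p u)"
				unfolding G_def acD(2)[OF g that]
				by (subst integral_diff) (simp_all add: L1_integrable L1_Icc_mono[OF _ that] gi pi)
			also have "norm \<dots> <= integral {0..1} (\<lambda>u. norm (g' u - p u))"
				by (rule norm_integral_le[OF di that dn]) simp
			finally show ?thesis using p(4) by simp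
		qed
		have Pi: "L1 (\<lambda>u. f' u * G u + f u * p u)"
			by (rule set_integral_add(1)[OF L1_mult_continuous[OF fi Gc]
						L1_mult_continuous'[OF pi fc]])
		have P: "f x * G x = f 0 * G 0 + integral {0..x} (\<lambda>u. f' u * G u + f u * p u)"
			by (rule integral_parts_C1[OF Gder pc f x])
		have G0: "G 0 = g 0" by (simp add: G_def)
		have Di: "L1 (\<lambda>u. f' u * (G u - g u))"
				 "L1 (\<lambda>u. (p u - g' u) * f u)"
			by (intro L1_mult_continuous continuous_intros Gc gc fi fc set_integral_diff(1)[OF pi gi])+
		have "integral {0..x} (\<lambda>u. f' u * G u + f u * p u) - integral {0..x} (\<lambda>u. f' u * g u + f u * g' u)
			 = integral {0..x} (\<lambda>u. (f' u * G u + f u * p u) - (f' u * g u + f u * g' u))"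
			by (simp only: integral_diff[OF L1_integrable[OF L1_Icc_mono[OF Pi x]] L1_integrable[OF L1_Icc_mono[OF Fi x]]])
		also have "\<dots> = integral {0..x} (\<lambda>u. f' u * (G u - g u) + (p u - g' u) * f u)"
			by (rule integral_cong) (simp add: algebra_simps)
		also have "\<dots> = integral {0..x} (\<lambda>u. f' u * (G u - g u)) + integral {0..x} (\<lambda>u. (p u - g' u) * f u)"
			by (rule integral_add[OF L1_integrable[OF L1_Icc_mono[OF Di(1) x]] L1_integrable[OF L1_Icc_mono[OF Di(2) x]]])
		finally have I: "integral {0..x} (\<lambda>u. f' u * G u + f u * p u) - integral {0..x} (\<lambda>u. f' u * g u + f u * g' u)
			 = integral {0..x} (\<lambda>u. f' u * (G u - g u)) + integral {0..x} (\<lambda>u. (p u - g' u) * f u)" .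
		have I1: "norm (integral {0..x} (\<lambda>u. f' u * (G u - g u))) <= d*L"
			unfolding L_def
			by (rule norm_integral_mult_le[OF fi _ _ x]) (use close in \<open>auto intro!: continuous_intros Gc gc simp: norm_minus_commute\<close>)
		have I2: "norm (integral {0..x} (\<lambda>u. (p u - g' u) * f u)) <= B * integral {0..1} (\<lambda>u. norm (p u - g' u))"
			by (rule norm_integral_mult_le[OF set_integral_diff(1)[OF pi gi] fc B(2) x])
		also have "\<dots> <= B*d" using p(4) B by (intro mult_left_mono) (auto simp: norm_minus_commute)
		finally have I2: "norm (integral {0..x} (\<lambda>u. (p u - g' u) * f u)) <= B*d" .
		have "f x * g x - f 0 * g 0 - integral {0..x} (\<lambda>u. f' u * g u + f u * g' u)
			= f x * (g x - G x) + (integral {0..x} (\<lambda>u. f' u * (G u - g u)) + integral {0..x} (\<lambda>u. (p u - g' u) * f u))"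
			using P G0 unfolding I[symmetric] by (simp add: algebra_simps)
		also have "norm \<dots> <= norm (f x) * norm (g x - G x) + (norm (integral {0..x} (\<lambda>u. f' u * (G u - g u))) + norm (integral {0..x} (\<lambda>u. (p u - g' u) * f u)))"
			by (intro order_trans[OF norm_triangle_ineq] add_mono norm_triangle_ineq) (simp add: norm_mult)
		also have "\<dots> <= B*d + (d*L + B*d)"
			by (intro add_mono mult_mono B(2) x close I1 I2) (use B in auto)
		also have "\<dots> = d * (2*B+L)" by (simp add: algebra_simps)
		also have "\<dots> = e" using B L by (simp add: d_def)
		finally show ?thesis .
	qed
	then have "norm (f x * g x - f 0 * g 0 - integral {0..x} (\<lambda>u. f' u * g u + f u * g' u)) <= 0"
		by (meson dense_ge)
	then show "f x * g x = f 0 * g 0 + integral {0..x} (\<lambda>u. f' u * g u + f u * g' u)"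
		by (simp add: algebra_simps)
qed

lemma ac_exp_integral:
	assumes "continuous_on {0..1} f"
	shows "ac (\<lambda>x. exp (integral {0..x} f)) (\<lambda>x. f x * exp (integral {0..x} f))"
proof (rule ac_C1)
	show "((\<lambda>x. exp (integral {0..x} f)) has_vector_derivative f x * exp (integral {0..x} f)) (at x within {0..1})"
		if "x \<in> {0..1}" for x
	proof -
		have "(exp has_field_derivative exp (integral {0..x} f)) (at (integral {0..x} f))"
			by (rule DERIV_exp)
		from field_vector_diff_chain_within[OF integral_has_vector_derivative[OF assms that]
				has_field_derivative_at_within[OF this]]
		show ?thesis by (simp add: o_def mult.commute)
	qed
	show "continuous_on {0..1} (\<lambda>x. f x * exp (integral {0..x} f))"
		by (intro continuous_intros assms indefinite_integral_continuous_1 integrable_continuous_real)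
qed

section \<open>The initial value problem\<close>

lemma norm_mult_integrable:
	fixes k :: "real => complex"
	assumes "L1 k" "continuous_on {0..1} f"
	shows "(\<lambda>s. norm (k s) * norm (f s :: complex)) integrable_on {0..1}"
	using L1_norm_integrable[OF L1_mult_continuous[OF assms]]
	by (simp add: norm_mult)

lemma norm_mult_weight_integrable:
	fixes k :: "real => complex"
	assumes k: "L1 k"
	shows "(\<lambda>s. norm (k s) * exp (L * s)) integrable_on {0..1}"
proof -
	have "continuous_on {0..1} (\<lambda>s. complex_of_real (exp (L * s)))" by (intro continuous_intros)
	from norm_mult_integrable[OF k this] show ?thesis by (simp del: of_real_exp)
qed

lemma integrable_Icc_mono:
	fixes f :: "real => 'a::euclidean_space"
	assumes "f integrable_on {0..1}" "x \<in> {0..1}"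
	shows "f integrable_on {0..x}"
	using integrable_on_subinterval[OF assms(1), of 0 x] assms(2) by auto

text \<open>Makes the Volterra operator with kernel \<open>k\<close> a contraction in a weighted
  supremum norm. Split \<open>k\<close> into a continuous part bounded by B and a rest of mass below
  1/4. With \<Lambda> = 4B the continuous part contributes at most B/\<Lambda> = 1/4 of the weight
  at x, and the rest at most another 1/4.\<close>

lemma exponential_weight:
	fixes k :: "real => complex"
	assumes k: "L1 k"
	obtains \<Lambda> where "\<Lambda> >= 0" "\<And>x. x \<in> {0..1} ==> integral {0..x} (\<lambda>s. norm (k s) * exp (\<Lambda> * s)) <= exp (\<Lambda> * x) / 2"
proof -
	obtain p where p: "continuous_on UNIV p" "integral {0..1} (\<lambda>x. norm (k x - p x)) < 1/4"
		using L1_approx_continuous[OF k, of "1/4"] by auto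
	have pc: "continuous_on {0..1} p" by (rule continuous_on_subset[OF p(1)]) simp
	obtain B where B: "B > 0" "\<And>u. u \<in> {0..1} ==> norm (p u) <= B" using ac_bounded[OF pc] by blast
	define L where "L = 4*B"
	have L: "L > 0" using B by (simp add: L_def)
	have kp: "L1 (\<lambda>s. k s - p s)"
		by (rule set_integral_diff(1)[OF k absolutely_integrable_continuous_real[OF pc]])
	have kpn: "(\<lambda>s. norm (k s - p s)) integrable_on {0..1}"
		by (rule L1_norm_integrable[OF kp])
	have ke: "(\<lambda>s. norm (k s) * exp (L * s)) integrable_on {0..1}"
		by (rule norm_mult_weight_integrable[OF k])
	show ?thesis
	proof (rule that[of L])
		fix x :: real assume x: "x \<in> {0..1}"
		have ex: "((\<lambda>s. exp (L * s)) has_integral (exp (L*x) / L - exp (L*0) / L)) {0..x}"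
			by (rule fundamental_theorem_of_calculus)
				 (use x L in \<open>auto intro!: derivative_eq_intros simp: has_real_derivative_iff_has_vector_derivative[symmetric]\<close>)
		have i1: "(\<lambda>s. norm (k s - p s) * exp (L*x)) integrable_on {0..x}"
			by (intro integrable_on_mult_left integrable_Icc_mono[OF kpn x])
		have i2: "(\<lambda>s. B * exp (L * s)) integrable_on {0..x}"
			using ex by (intro integrable_on_mult_right) (auto simp: integrable_on_def)
		have "integral {0..x} (\<lambda>s. norm (k s) * exp (L * s)) <= integral {0..x} (\<lambda>s. norm (k s - p s) * exp (L*x) + B * exp (L * s))"
		proof (rule integral_le[OF integrable_Icc_mono[OF ke x] integrable_add[OF i1 i2]])
			fix s assume s: "s \<in> {0..x}"
			have "norm (k s) <= norm (k s - p s) + norm (p s)" by (metis diff_add_cancel norm_triangle_ineq)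
			also have "\<dots> <= norm (k s - p s) + B" using B(2)[of s] s x by auto
			finally have "norm (k s) * exp (L * s) <= (norm (k s - p s) + B) * exp (L * s)"
				by (rule mult_right_mono) simp
			also have "\<dots> = norm (k s - p s) * exp (L * s) + B * exp (L * s)" by (simp add: algebra_simps)
			also have "norm (k s - p s) * exp (L * s) <= norm (k s - p s) * exp (L*x)"
				using s L by (intro mult_left_mono) auto
			finally show "norm (k s) * exp (L * s) <= norm (k s - p s) * exp (L*x) + B * exp (L * s)" by simp
		qed
		also have "\<dots> = integral {0..x} (\<lambda>s. norm (k s - p s)) * exp (L*x) + B * (exp (L*x) / L - exp (L*0) / L)"
			by (subst integral_add[OF i1 i2]) (simp add: integral_unique[OF ex])
		also have "\<dots> <= 1/4 * exp (L*x) + B * (exp (L*x) / L)"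
		proof (intro add_mono mult_right_mono mult_left_mono)
			have "integral {0..x} (\<lambda>s. norm (k s - p s)) <= integral {0..1} (\<lambda>s. norm (k s - p s))"
				by (rule integral_subset_le[OF _ integrable_Icc_mono[OF kpn x] kpn]) (use x in auto)
			then show "integral {0..x} (\<lambda>s. norm (k s - p s)) <= 1/4" using p(2) by simp
		qed (use B L in auto)
		also have "\<dots> = exp (L*x) / 2" using B by (simp add: L_def)
		finally show "integral {0..x} (\<lambda>s. norm (k s) * exp (L * s)) <= exp (L*x) / 2" .
	qed (use L in simp)
qed

lemma weighted_integral_le:
	fixes k u :: "real => complex"
	assumes k: "L1 k" and u: "continuous_on {0..1} u"
		and w: "\<And>x. x \<in> {0..1} ==> integral {0..x} (\<lambda>s. norm (k s) * exp (L * s)) <= exp (L*x) / 2"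
		and b: "\<And>s. s \<in> {0..1} ==> norm (u s) <= A * exp (L * s)" and A: "A >= 0" and x: "x \<in> {0..1}"
	shows "integral {0..x} (\<lambda>s. norm (k s) * norm (u s)) <= A/2 * exp (L*x)"
proof -
	have ke: "(\<lambda>s. norm (k s) * exp (L * s)) integrable_on {0..1}"
		by (rule norm_mult_weight_integrable[OF k])
	have "integral {0..x} (\<lambda>s. norm (k s) * norm (u s)) <= integral {0..x} (\<lambda>s. A * (norm (k s) * exp (L * s)))"
	proof (rule integral_le[OF integrable_Icc_mono[OF norm_mult_integrable[OF k u] x]
				integrable_on_mult_right[OF integrable_Icc_mono[OF ke x]]])
		fix s assume "s \<in> {0..x}"
		then show "norm (k s) * norm (u s) <= A * (norm (k s) * exp (L * s))"
			using mult_left_mono[OF b[of s], of "norm (k s)"] x by (auto simp: algebra_simps)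
	qed
	also have "\<dots> = A * integral {0..x} (\<lambda>s. norm (k s) * exp (L * s))" by simp
	also have "\<dots> <= A * (exp (L*x) / 2)" by (intro mult_left_mono w x A)
	finally show ?thesis by simp
qed

text \<open>At the point where |f| e^(-Lx) is maximal, the integral term is at most half of that
  maximum and can be absorbed. The constant depends on \<open>k\<close> only.\<close>

lemma gronwall:
	fixes k :: "real => complex"
	assumes k: "L1 k"
	obtains C where "C >= 0" "\<And>f \<epsilon> x. continuous_on {0..1} (f :: real => complex) ==> \<epsilon> >= 0 ==>
			(\<And>x. x \<in> {0..1} ==> norm (f x) <= \<epsilon> + integral {0..x} (\<lambda>s. norm (k s) * norm (f s))) ==>
			x \<in> {0..1} ==> norm (f x) <= C*\<epsilon>"
proof -
	obtain L where L: "L >= 0" "\<And>x. x \<in> {0..1} ==> integral {0..x} (\<lambda>s. norm (k s) * exp (L * s)) <= exp (L*x) / 2"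
		using exponential_weight[OF k] by blast
	show ?thesis
	proof (rule that[of "2 * exp L"])
		fix f :: "real => complex" and e x :: real
		assume f: "continuous_on {0..1} f" and e: "e >= 0"
			and b: "\<And>x. x \<in> {0..1} ==> norm (f x) <= e + integral {0..x} (\<lambda>s. norm (k s) * norm (f s))"
			and x: "x \<in> {0..1}"
		have "continuous_on {0..1} (\<lambda>x. norm (f x) * exp (- L*x))" by (intro continuous_intros f)
		then obtain x0 where x0: "x0 \<in> {0..1}" "\<And>x. x \<in> {0..1} ==> norm (f x) * exp (- L*x) <= norm (f x0) * exp (- L*x0)"
			using continuous_attains_sup[of "{0..1::real}" "\<lambda>x. norm (f x) * exp (- L*x)"] by auto
		define S where "S = norm (f x0) * exp (- L*x0)"
		have S: "norm (f x) <= S * exp (L*x)" if "x \<in> {0..1}" for x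
		proof -
			have "norm (f x) = (norm (f x) * exp (- L*x)) * exp (L*x)" by (simp add: exp_minus)
			also have "\<dots> <= S * exp (L*x)" unfolding S_def by (intro mult_right_mono x0 that) simp
			finally show ?thesis .
		qed
		have S0: "S >= 0" by (simp add: S_def)
		have "norm (f x0) <= e + S/2 * exp (L*x0)"
			using b[OF x0(1)] weighted_integral_le[OF k f L(2) S S0 x0(1)] by linarith
		then have "S <= (e + S/2 * exp (L*x0)) * exp (- L*x0)" unfolding S_def by (intro mult_right_mono) auto
		also have "\<dots> = e * exp (- L*x0) + S/2" by (simp add: algebra_simps exp_minus)
		also have "\<dots> <= e*1 + S/2" using e L x0 by (intro add_mono mult_left_mono) auto
		finally have "S <= 2*e" by simp
		have "norm (f x) <= S * exp (L*x)" by (rule S[OF x])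
		also have "\<dots> <= (2*e) * exp L" using \<open>S <= 2 * e\<close> L x e S0 by (intro mult_mono) (auto simp: mult_left_le)
		finally show "norm (f x) <= 2 * exp L * e" by (simp add: algebra_simps)
	qed simp
qed

text \<open>First-order form of -u'' + k u = g with v = u'. With k = q - \<lambda> the sign of g
  matches that of the right-hand side in \<open>floq_sol\<close>.\<close>

definition sol :: "(real => complex) => (real => complex) => (real => complex) => (real => complex) => bool" where
	"sol k g u v \<longleftrightarrow> ac u v \<and> ac v (\<lambda>s. k s * u s - g s)"

lemma sol_cong:
	assumes "sol k g u v" "\<And>x. x \<in> {0..1} ==> k x * u x - g x = k' x * u' x - g' x"
		"\<And>x. x \<in> {0..1} ==> u x = u' x" "\<And>x. x \<in> {0..1} ==> v x = v' x"
	shows "sol k' g' u' v'"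
	using assms unfolding sol_def by (auto intro: ac_cong)

lemma sol_linear:
	assumes "sol k g u v" "sol k g' u' v'"
	shows "sol k (\<lambda>x. a * g x + b * g' x) (\<lambda>x. a * u x + b * u' x) (\<lambda>x. a * v x + b * v' x)"
	unfolding sol_def
proof
	show "ac (\<lambda>x. a * u x + b * u' x) (\<lambda>x. a * v x + b * v' x)"
		using assms by (intro ac_add ac_cmult) (auto simp: sol_def)
	have "ac (\<lambda>x. a * v x + b * v' x) (\<lambda>x. a * (k x * u x - g x) + b * (k x * u' x - g' x))"
		using assms by (intro ac_add ac_cmult) (auto simp: sol_def)
	then show "ac (\<lambda>x. a * v x + b * v' x) (\<lambda>x. k x * (a * u x + b * u' x) - (a * g x + b * g' x))"
		by (rule ac_cong) (simp_all add: algebra_simps)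
qed

lemma sol_continuous: "sol k g u v ==> continuous_on {0..1} u" "sol k g u v ==> continuous_on {0..1} v"
	by (auto simp: sol_def intro: ac_continuous)

lemma norm_integral_continuous_le:
	fixes f :: "real => complex"
	assumes "L1 f" "\<And>u. u \<in> {0..1} ==> norm (f u) <= c" "x \<in> {0..1}"
	shows "norm (integral {0..x} f) <= c"
	using norm_integral_le[OF assms(1,3), of "\<lambda>_. c"] assms(2) by (simp add: integrable_const_ivl)

lemma norm_double_integral_le:
	fixes f :: "real => complex"
	assumes f: "L1 f" and x: "x \<in> {0..1}"
	shows "norm (integral {0..x} (\<lambda>y. integral {0..y} f)) <= integral {0..x} (\<lambda>s. norm (f s))"
proof -
	let ?c = "integral {0..x} (\<lambda>s. norm (f s))"
	have n: "(\<lambda>s. norm (f s)) integrable_on {0..1}" by (rule L1_norm_integrable[OF f])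
	have c0: "?c >= 0" by (rule integral_nonneg[OF integrable_Icc_mono[OF n x]]) simp
	have "norm (integral {0..x} (\<lambda>y. integral {0..y} f)) <= integral {0..x} (\<lambda>y. ?c)"
	proof (rule integral_norm_bound_integral)
		show "(\<lambda>y. integral {0..y} f) integrable_on {0..x}"
			by (rule integrable_Icc_mono[OF integrable_continuous_real[OF indefinite_integral_continuous_1[OF L1_integrable[OF f]]] x])
		fix y assume y: "y \<in> {0..x}"
		then have y1: "y \<in> {0..1}" using x by auto
		have "norm (integral {0..y} f) <= integral {0..y} (\<lambda>s. norm (f s))"
			by (rule integral_norm_bound_integral[OF L1_integrable[OF L1_Icc_mono[OF f y1]] integrable_Icc_mono[OF n y1]]) simp
		also have "\<dots> <= ?c"
			by (rule integral_subset_le[OF _ integrable_Icc_mono[OF n y1] integrable_Icc_mono[OF n x]]) (use y in auto)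
		finally show "norm (integral {0..y} f) <= ?c" .
	qed (rule integrable_const_ivl)
	also have "\<dots> = x * ?c" using x by simp
	also have "\<dots> <= 1 * ?c" using x c0 by (intro mult_right_mono) auto
	finally show ?thesis by simp
qed

text \<open>The constant depends on \<open>k\<close> alone; this one bound yields uniqueness as well
  as continuity and differentiability in the spectral parameter. Integrating twice turns the system
  into the hypothesis of \<open>gronwall\<close>, and \<open>v\<close> is then read off from its own
  integral equation.\<close>

lemma sol_bound:
	assumes k: "L1 k"
	shows "\<exists>C\<ge>0. \<forall>g u v e. sol k g u v \<and> continuous_on {0..1} g \<and> norm (u 0) <= e \<and> norm (v 0) <= e \<and>
		 (\<forall>x\<in>{0..1}. norm (g x) <= e) --> (\<forall>x\<in>{0..1}. norm (u x) <= C*e \<and> norm (v x) <= C*e)"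
proof -
	obtain C where C: "C >= 0" "\<And>f \<epsilon> x. continuous_on {0..1} (f :: real => complex) ==> \<epsilon> >= 0 ==>
			(\<And>x. x \<in> {0..1} ==> norm (f x) <= \<epsilon> + integral {0..x} (\<lambda>s. norm (k s) * norm (f s))) ==>
			x \<in> {0..1} ==> norm (f x) <= C*\<epsilon>"
		using gronwall[OF k] by blast
	define K where "K = integral {0..1} (\<lambda>s. norm (k s))"
	have K0: "K >= 0" unfolding K_def by (rule integral_nonneg[OF L1_norm_integrable[OF k]]) simp
	have main: "norm (u x) <= (3*C + (2 + 3*C*K)) * e \<and> norm (v x) <= (3*C + (2 + 3*C*K)) * e"
		if s: "sol k g u v" and g: "continuous_on {0..1} g" "\<And>x. x \<in> {0..1} ==> norm (g x) <= e"
			and i: "norm (u 0) <= e" "norm (v 0) <= e" and x: "x \<in> {0..1}" for g u v :: "real => complex" and e x :: real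
	proof -
		have e: "e >= 0" using i(1) norm_ge_zero order_trans by blast
		have uc: "continuous_on {0..1} u" and vc: "continuous_on {0..1} v" using sol_continuous[OF s] .
		have ku: "L1 (\<lambda>s. k s * u s)" by (rule L1_mult_continuous[OF k uc])
		have gi: "L1 g" by (rule absolutely_integrable_continuous_real[OF g(1)])
		have v: "v y = (v 0 - integral {0..y} g) + integral {0..y} (\<lambda>s. k s * u s)" if y: "y \<in> {0..1}" for y
		proof -
			have "v y = v 0 + integral {0..y} (\<lambda>s. k s * u s - g s)" using s y acD(2) unfolding sol_def by blast
			also have "integral {0..y} (\<lambda>s. k s * u s - g s) = integral {0..y} (\<lambda>s. k s * u s) - integral {0..y} g"
				by (rule integral_diff[OF L1_integrable[OF L1_Icc_mono[OF ku y]]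
							L1_integrable[OF L1_Icc_mono[OF gi y]]])
			finally show ?thesis by simp
		qed
		have v1: "norm (v 0 - integral {0..y} g) <= 2*e" if y: "y \<in> {0..1}" for y
			using norm_integral_continuous_le[OF gi g(2) y] i(2) norm_triangle_ineq4[of "v 0" "integral {0..y} g"] by linarith
		have ub: "norm (u y) <= 3*e + integral {0..y} (\<lambda>s. norm (k s) * norm (u s))" if y: "y \<in> {0..1}" for y
		proof -
			have c1: "continuous_on {0..1} (\<lambda>y. v 0 - integral {0..y} g)"
				by (intro continuous_intros indefinite_integral_continuous_1 L1_integrable[OF gi])
			have c2: "continuous_on {0..1} (\<lambda>y. integral {0..y} (\<lambda>s. k s * u s))"
				by (intro indefinite_integral_continuous_1 L1_integrable[OF ku])
			have "u y = u 0 + integral {0..y} v" using s y acD(2) unfolding sol_def by blast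
			also have "integral {0..y} v = integral {0..y} (\<lambda>y. (v 0 - integral {0..y} g) + integral {0..y} (\<lambda>s. k s * u s))"
				by (rule integral_cong, rule v) (use y in auto)
			also have "\<dots> = integral {0..y} (\<lambda>y. (v 0 - integral {0..y} g)) + integral {0..y} (\<lambda>y. integral {0..y} (\<lambda>s. k s * u s))"
				by (rule integral_add[OF integrable_Icc_mono[OF integrable_continuous_real[OF c1] y] integrable_Icc_mono[OF integrable_continuous_real[OF c2] y]])
			finally have uy: "u y = u 0 + (integral {0..y} (\<lambda>y. (v 0 - integral {0..y} g)) + integral {0..y} (\<lambda>y. integral {0..y} (\<lambda>s. k s * u s)))" .
			have "norm (u y) <= norm (u 0) + (norm (integral {0..y} (\<lambda>y. (v 0 - integral {0..y} g))) + norm (integral {0..y} (\<lambda>y. integral {0..y} (\<lambda>s. k s * u s))))"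
				unfolding uy by (intro order_trans[OF norm_triangle_ineq] add_left_mono norm_triangle_ineq)
			moreover have "norm (integral {0..y} (\<lambda>y. (v 0 - integral {0..y} g))) <= 2*e"
				by (rule norm_integral_continuous_le[OF absolutely_integrable_continuous_real[OF c1] v1 y])
			moreover have "norm (integral {0..y} (\<lambda>y. integral {0..y} (\<lambda>s. k s * u s))) <= integral {0..y} (\<lambda>s. norm (k s) * norm (u s))"
				using norm_double_integral_le[OF ku y] by (simp add: norm_mult)
			ultimately show ?thesis using i(1) by linarith
		qed
		have ub': "norm (u y) <= C * (3*e)" if "y \<in> {0..1}" for y
			by (rule C(2)[OF uc _ ub that]) (use e in auto)
		have "norm (integral {0..x} (\<lambda>s. k s * u s)) <= (C * (3*e)) * K"
			unfolding K_def by (rule norm_integral_mult_le[OF k uc ub' x])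
		then have vb: "norm (v x) <= 2*e + (C * (3*e)) * K"
			unfolding v[OF x] using v1[OF x] norm_triangle_ineq[of "v 0 - integral {0..x} g" "integral {0..x} (\<lambda>s. k s * u s)"]
			by linarith
		have nn: "0 <= C*e" "0 <= C*e*K" using C e K0 by auto
		have "norm (u x) <= (3*C + (2 + 3*C*K)) * e"
			using ub'[OF x] nn e by (simp add: algebra_simps)
		moreover have "norm (v x) <= (3*C + (2 + 3*C*K)) * e"
			using vb nn by (simp add: algebra_simps)
		ultimately show ?thesis ..
	qed
	have "0 <= 3*C + (2 + 3*C*K)" using C(1) K0 by simp
	moreover have "\<forall>g u v e. sol k g u v \<and> continuous_on {0..1} g \<and> norm (u 0) <= e \<and> norm (v 0) <= e \<and>
		 (\<forall>x\<in>{0..1}. norm (g x) <= e) --> (\<forall>x\<in>{0..1}. norm (u x) <= (3*C + (2 + 3*C*K)) * e \<and> norm (v x) <= (3*C + (2 + 3*C*K)) * e)"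
		(is "\<forall>g u v e. ?P g u v e --> ?Q g u v e")
	proof (intro allI impI)
		fix g u v e assume "?P g u v e"
		then have a: "sol k g u v" "continuous_on {0..1} g" "\<And>x. x \<in> {0..1} ==> norm (g x) <= e" "norm (u 0) <= e" "norm (v 0) <= e"
			by blast+
		show "?Q g u v e" by (intro ballI main[OF a])
	qed
	ultimately show ?thesis by blast
qed

lemma sol_unique:
	assumes k: "L1 k" and s: "sol k g u v" "sol k g u' v'" and i: "u 0 = u' 0" "v 0 = v' 0"
		and x: "x \<in> {0..1}"
	shows "u x = u' x" "v x = v' x"
proof -
	have "sol k (\<lambda>x. 0) (\<lambda>x. u x - u' x) (\<lambda>x. v x - v' x)"
		using sol_linear[OF s, of 1 "-1"] by simp
	then have D: "sol k (\<lambda>x. 0) (\<lambda>x. u x - u' x) (\<lambda>x. v x - v' x)" .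
	obtain C where C: "\<forall>g u v e. sol k g u v \<and> continuous_on {0..1} g \<and> norm (u 0) <= e \<and> norm (v 0) <= e \<and>
		 (\<forall>x\<in>{0..1}. norm (g x) <= e) --> (\<forall>x\<in>{0..1}. norm (u x) <= C*e \<and> norm (v x) <= C*e)"
		using sol_bound[OF k] by blast
	have "norm (u x - u' x) <= C*0 \<and> norm (v x - v' x) <= C*0"
		by (rule C[rule_format, OF conjI[OF D] x]) (use i in simp)
	then show "u x = u' x" "v x = v' x" by auto
qed

text \<open>Neumann series: \<open>J\<close> is the twice integrated Volterra operator, and by the
  exponential weight each application of it halves the bound on the iterates. The sum converges
  uniformly and solves u = W + J u.\<close>

lemma sol_exists:
	assumes k: "L1 k" and g: "continuous_on {0..1} g"
	shows "\<exists>u v. sol k g u v \<and> u 0 = u0 \<and> v 0 = v0"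
proof -
	obtain L where L: "L >= 0" "\<And>x. x \<in> {0..1} ==> integral {0..x} (\<lambda>s. norm (k s) * exp (L * s)) <= exp (L*x) / 2"
		using exponential_weight[OF k] by blast
	define W where "W x = u0 + integral {0..x} (\<lambda>y. v0 - integral {0..y} g)" for x
	define J where "J u x = integral {0..x} (\<lambda>y. integral {0..y} (\<lambda>s. k s * u s))" for u x
	define U where "U n = (J ^^ n) W" for n
	have gi: "continuous_on {0..1} (\<lambda>y. v0 - integral {0..y} g)"
		by (intro continuous_intros indefinite_integral_continuous_1 integrable_continuous_real g)
	have Wc: "continuous_on {0..1} W" unfolding W_def
		by (intro continuous_intros indefinite_integral_continuous_1 integrable_continuous_real gi)
	have ic: "continuous_on {0..1} (\<lambda>y. integral {0..y} (\<lambda>s. k s * u s))" if "continuous_on {0..1} u" for u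
		by (intro indefinite_integral_continuous_1 L1_integrable L1_mult_continuous k that)
	have Jc: "continuous_on {0..1} (J u)" if "continuous_on {0..1} u" for u
		unfolding J_def by (intro indefinite_integral_continuous_1 integrable_continuous_real ic that)
	have Jb: "norm (J u x) <= integral {0..x} (\<lambda>s. norm (k s) * norm (u s))" if "continuous_on {0..1} u" "x \<in> {0..1}" for u x
		unfolding J_def using norm_double_integral_le[OF L1_mult_continuous[OF k that(1)] that(2)]
		by (simp add: norm_mult)
	obtain A where A: "A > 0" "\<And>u. u \<in> {0..1} ==> norm (W u) <= A" using ac_bounded[OF Wc] by blast
	have Uc: "continuous_on {0..1} (U n)" for n
		by (induction n) (auto simp: U_def Wc Jc)
	have Ub: "norm (U n x) <= A * (1/2)^n * exp (L*x)" if "x \<in> {0..1}" for n x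
		using that
	proof (induction n arbitrary: x)
		case 0
		have "norm (W x) <= A*1" using A(2)[OF 0] by simp
		also have "\<dots> <= A * exp (L*x)" using A L 0 by (intro mult_left_mono) auto
		finally show ?case by (simp add: U_def)
	next
		case (Suc n)
		have "norm (U (Suc n) x) <= integral {0..x} (\<lambda>s. norm (k s) * norm (U n s))"
			using Jb[OF Uc[of n] Suc.prems] by (simp add: U_def)
		also have "\<dots> <= A * (1/2)^n / 2 * exp (L*x)"
			by (rule weighted_integral_le[OF k Uc L(2) Suc.IH]) (use A Suc.prems in auto)
		finally show ?case by simp
	qed
	define u where "u x = (\<Sum>n. U n x)" for x
	have ul: "uniform_limit {0..1} (\<lambda>n x. \<Sum>i<n. U i x) u sequentially"
		unfolding u_def
	proof (rule Weierstrass_m_test)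
		show "norm (U n x) <= A * exp L * (1/2)^n" if "x \<in> {0..1}" for n x
		proof -
			have "norm (U n x) <= A * (1/2)^n * exp (L*x)" by (rule Ub[OF that])
			also have "\<dots> <= A * (1/2)^n * exp L" using A L that by (intro mult_left_mono) (auto simp: mult_left_le)
			finally show ?thesis by (simp add: algebra_simps)
		qed
		show "summable (\<lambda>n. A * exp L * (1/2)^n :: real)" by (intro summable_mult) simp
	qed
	have Sc: "continuous_on {0..1} (\<lambda>x. \<Sum>i<n. U i x)" for n by (intro continuous_intros Uc)
	have uc: "continuous_on {0..1} u"
		by (rule uniform_limit_theorem[OF always_eventually ul]) (auto simp: Sc)
	have Jdiff: "J a x - J b x = J (\<lambda>x. a x - b x) x" if "continuous_on {0..1} a" "continuous_on {0..1} b" "x \<in> {0..1}" for a b x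
	proof -
		have "J a x - J b x = integral {0..x} (\<lambda>y. integral {0..y} (\<lambda>s. k s * a s) - integral {0..y} (\<lambda>s. k s * b s))"
			unfolding J_def
			by (rule integral_diff[symmetric]) (rule integrable_Icc_mono[OF integrable_continuous_real[OF ic] that(3)], rule that)+
		also have "\<dots> = J (\<lambda>x. a x - b x) x"
			unfolding J_def
		proof (rule integral_cong)
			fix y assume "y \<in> {0..x}"
			then have y: "y \<in> {0..1}" using that by auto
			show "integral {0..y} (\<lambda>s. k s * a s) - integral {0..y} (\<lambda>s. k s * b s) = integral {0..y} (\<lambda>s. k s * (a s - b s))"
				unfolding right_diff_distrib
				by (rule integral_diff[symmetric])
					 (rule L1_integrable[OF L1_Icc_mono[OF L1_mult_continuous[OF k] y]], rule that)+
		qed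
		finally show ?thesis .
	qed
	have Jsum: "(\<Sum>i<Suc n. U i x) = W x + J (\<lambda>x. \<Sum>i<n. U i x) x" if x: "x \<in> {0..1}" for n x
	proof (induction n)
		case 0
		then show ?case by (simp add: U_def J_def)
	next
		case (Suc n)
		have "J (\<lambda>x. \<Sum>i<Suc n. U i x) x - J (\<lambda>x. \<Sum>i<n. U i x) x = J (\<lambda>x. (\<Sum>i<Suc n. U i x) - (\<Sum>i<n. U i x)) x"
			by (rule Jdiff[OF Sc Sc x])
		also have "\<dots> = U (Suc n) x" by (simp add: U_def)
		finally show ?case using Suc by (simp add: algebra_simps)
	qed
	have fixp: "u x = W x + J u x" if x: "x \<in> {0..1}" for x
	proof -
		define K where "K = integral {0..1} (\<lambda>s. norm (k s))"
		have K0: "K >= 0" unfolding K_def by (rule integral_nonneg[OF L1_norm_integrable[OF k]]) simp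
		have "(\<lambda>n. J (\<lambda>x. \<Sum>i<n. U i x) x) \<longlonglongrightarrow> J u x"
		proof (rule LIMSEQ_I)
			fix r :: real assume r: "r > 0"
			have "\<forall>\<^sub>F n in sequentially. \<forall>x\<in>{0..1}. dist (\<Sum>i<n. U i x) (u x) < r / (K + 1)"
				using uniform_limitD[OF ul, of "r / (K+1)"] r K0 by simp
			then obtain N where "\<forall>n\<ge>N. \<forall>y\<in>{0..1}. norm ((\<Sum>i<n. U i y) - u y) < r / (K + 1)"
				unfolding eventually_sequentially dist_norm by blast
			then have N: "norm ((\<Sum>i<n. U i y) - u y) < r / (K + 1)" if "n >= N" "y \<in> {0..1}" for n y
				using that by blast
			have "norm (J (\<lambda>x. \<Sum>i<n. U i x) x - J u x) < r" if n: "n >= N" for n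
			proof -
				have dc: "continuous_on {0..1} (\<lambda>x. (\<Sum>i<n. U i x) - u x)" by (intro continuous_intros Sc uc)
				have "norm (J (\<lambda>x. \<Sum>i<n. U i x) x - J u x) <= integral {0..x} (\<lambda>s. norm (k s) * norm ((\<Sum>i<n. U i s) - u s))"
					unfolding Jdiff[OF Sc uc x] by (rule Jb[OF dc x])
				also have "\<dots> <= integral {0..1} (\<lambda>s. norm (k s) * norm ((\<Sum>i<n. U i s) - u s))"
					by (rule integral_subset_le[OF _ integrable_Icc_mono[OF norm_mult_integrable[OF k dc] x] norm_mult_integrable[OF k dc]]) (use x in auto)
				also have "\<dots> <= integral {0..1} (\<lambda>s. norm (k s) * (r / (K + 1)))"
					by (rule integral_le[OF norm_mult_integrable[OF k dc] integrable_on_mult_left[OF L1_norm_integrable[OF k]]])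
						 (rule mult_left_mono[OF less_imp_le[OF N[OF n]]], simp_all)
				also have "\<dots> = K * (r / (K + 1))" by (simp add: K_def)
				also have "\<dots> < r" using r K0 by (simp add: field_simps)
				finally show ?thesis .
			qed
			then show "\<exists>N. \<forall>n\<ge>N. norm (J (\<lambda>x. \<Sum>i<n. U i x) x - J u x) < r" by blast
		qed
		then have "(\<lambda>n. \<Sum>i<Suc n. U i x) \<longlonglongrightarrow> W x + J u x"
			unfolding Jsum[OF x] by (intro tendsto_intros)
		moreover have "(\<lambda>n. \<Sum>i<Suc n. U i x) \<longlonglongrightarrow> u x"
			using tendsto_uniform_limitI[OF ul x] by (rule LIMSEQ_Suc)
		ultimately show ?thesis using LIMSEQ_unique by blast
	qed
	define v where "v x = v0 + integral {0..x} (\<lambda>s. k s * u s - g s)" for x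
	have kui: "L1 (\<lambda>s. k s * u s)" by (rule L1_mult_continuous[OF k uc])
	have ggi: "L1 g" by (rule absolutely_integrable_continuous_real[OF g])
	have kugi: "L1 (\<lambda>s. k s * u s - g s)" by (rule set_integral_diff(1)[OF kui ggi])
	have acv: "ac v (\<lambda>s. k s * u s - g s)"
		unfolding v_def by (rule ac_integral[OF kugi])
	have vi: "L1 v" by (rule ac_absolutely_integrable[OF acv])
	have u0: "u 0 = u0" using fixp[of 0] by (simp add: W_def J_def)
	have "ac u v"
	proof (rule acI[OF vi])
		fix x :: real assume x: "x \<in> {0..1}"
		have "u x = u0 + (integral {0..x} (\<lambda>y. v0 - integral {0..y} g) + integral {0..x} (\<lambda>y. integral {0..y} (\<lambda>s. k s * u s)))"
			using fixp[OF x] by (simp add: W_def J_def)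
		also have "integral {0..x} (\<lambda>y. v0 - integral {0..y} g) + integral {0..x} (\<lambda>y. integral {0..y} (\<lambda>s. k s * u s))
			= integral {0..x} (\<lambda>y. (v0 - integral {0..y} g) + integral {0..y} (\<lambda>s. k s * u s))"
			by (rule integral_add[symmetric, OF integrable_Icc_mono[OF integrable_continuous_real[OF gi] x]
						integrable_Icc_mono[OF integrable_continuous_real[OF ic[OF uc]] x]])
		also have "\<dots> = integral {0..x} v"
		proof (rule integral_cong)
			fix y assume "y \<in> {0..x}"
			then have y: "y \<in> {0..1}" using x by auto
			show "(v0 - integral {0..y} g) + integral {0..y} (\<lambda>s. k s * u s) = v y"
				unfolding v_def by (subst integral_diff[OF L1_integrable[OF L1_Icc_mono[OF kui y]]
							L1_integrable[OF L1_Icc_mono[OF ggi y]]]) simp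
		qed
		finally show "u x = u 0 + integral {0..x} v" by (simp add: u0)
	qed
	then have "sol k g u v" using acv by (simp add: sol_def)
	moreover have "v 0 = v0" by (simp add: v_def)
	ultimately show ?thesis using u0 by blast
qed

section \<open>Monodromy matrix and Hill discriminant\<close>

text \<open>Only the values on [0,1] are determined by the equation and the initial data; outside,
  the chosen pair is arbitrary.\<close>

definition fsol :: "(real => complex) => complex => complex => complex => (real => complex) \<times> (real => complex)" where
	"fsol q lam a b = (SOME p. sol (\<lambda>x. q x - lam) (\<lambda>_. 0) (fst p) (snd p) \<and> fst p 0 = a \<and> snd p 0 = b)"

definition "M11 q = (\<lambda>lam. fst (fsol q lam 1 0) 1)"
definition "M12 q = (\<lambda>lam. fst (fsol q lam 0 1) 1)"
definition "M21 q = (\<lambda>lam. snd (fsol q lam 1 0) 1)"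
definition "M22 q = (\<lambda>lam. snd (fsol q lam 0 1) 1)"
definition "hill q lam = M11 q lam + M22 q lam"

context
	fixes q :: "real => complex"
	assumes q: "L1 q"
begin

lemma shift_integrable: "L1 (\<lambda>x. q x - lam)"
	by (rule set_integral_diff(1)[OF q absolutely_integrable_continuous_real]) simp

lemma fsol: "sol (\<lambda>x. q x - lam) (\<lambda>_. 0) (fst (fsol q lam a b)) (snd (fsol q lam a b))"
	"fst (fsol q lam a b) 0 = a" "snd (fsol q lam a b) 0 = b"
proof -
	have "\<exists>p. sol (\<lambda>x. q x - lam) (\<lambda>_. 0) (fst p) (snd p) \<and> fst p 0 = a \<and> snd p 0 = b"
		using sol_exists[OF shift_integrable[of lam], of "\<lambda>_. 0" a b] by simp
	from someI_ex[OF this, folded fsol_def]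
	show "sol (\<lambda>x. q x - lam) (\<lambda>_. 0) (fst (fsol q lam a b)) (snd (fsol q lam a b))"
		"fst (fsol q lam a b) 0 = a" "snd (fsol q lam a b) 0 = b" by blast+
qed

lemma sol_at_1:
	assumes s: "sol (\<lambda>x. q x - lam) (\<lambda>_. 0) u v"
	shows "u 1 = M11 q lam * u 0 + M12 q lam * v 0" "v 1 = M21 q lam * u 0 + M22 q lam * v 0"
proof -
	note l = sol_linear[OF fsol(1)[of lam 1 0] fsol(1)[of lam 0 1], of "u 0" "v 0"]
	have "sol (\<lambda>x. q x - lam) (\<lambda>_. 0) (\<lambda>x. u 0 * fst (fsol q lam 1 0) x + v 0 * fst (fsol q lam 0 1) x)
		 (\<lambda>x. u 0 * snd (fsol q lam 1 0) x + v 0 * snd (fsol q lam 0 1) x)"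
		using l by simp
	from sol_unique[OF shift_integrable s this, of 1]
	show "u 1 = M11 q lam * u 0 + M12 q lam * v 0" "v 1 = M21 q lam * u 0 + M22 q lam * v 0"
		by (simp_all add: fsol M11_def M12_def M21_def M22_def mult.commute)
qed

text \<open>The Wronskian of the two fundamental solutions has derivative 0 and equals 1 at the left
  end.\<close>

lemma det_monodromy: "M11 q lam * M22 q lam - M12 q lam * M21 q lam = 1"
proof -
	define k where "k = (\<lambda>x. q x - lam)"
	define u v u' v' where "u = fst (fsol q lam 1 0)" "v = snd (fsol q lam 1 0)" "u' = fst (fsol q lam 0 1)" "v' = snd (fsol q lam 0 1)"
	have s: "ac u v" "ac v (\<lambda>s. k s * u s)" "ac u' v'" "ac v' (\<lambda>s. k s * u' s)"
		using fsol(1)[of lam 1 0] fsol(1)[of lam 0 1] unfolding sol_def u_v_u'_v'_def k_def by simp_all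
	have "ac (\<lambda>x. u x * v' x - u' x * v x) (\<lambda>x. (v x * v' x + u x * (k x * u' x)) - (v' x * v x + u' x * (k x * u x)))"
		by (intro ac_diff ac_mult s)
	then have "ac (\<lambda>x. u x * v' x - u' x * v x) (\<lambda>x. 0)"
		by (rule ac_cong) (simp_all add: algebra_simps)
	from acD(2)[OF this, of 1]
	have "u 1 * v' 1 - u' 1 * v 1 = u 0 * v' 0 - u' 0 * v 0" by simp
	then show ?thesis by (simp add: M11_def M12_def M21_def M22_def u_v_u'_v'_def fsol)
qed

text \<open>The derivative of a solution with respect to the spectral parameter solves the same
	equation with the solution itself as right-hand side, exactly as an associated function does.\<close>

lemma fsol_deriv:
	assumes s: "sol (\<lambda>x. q x - lam) (fst (fsol q lam a b)) du dv" and i: "du 0 = 0" "dv 0 = 0"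
	shows "((\<lambda>l. fst (fsol q l a b) 1) has_field_derivative du 1) (at lam)"
		"((\<lambda>l. snd (fsol q l a b) 1) has_field_derivative dv 1) (at lam)"
proof -
	define k where "k = (\<lambda>x. q x - lam)"
	define U where "U l = fst (fsol q l a b)" for l
	define V where "V l = snd (fsol q l a b)" for l
	have sl: "sol (\<lambda>x. q x - l) (\<lambda>_. 0) (U l) (V l)" and U0: "U l 0 = a" "V l 0 = b" for l
		using fsol unfolding U_def V_def by auto
	have Uc: "continuous_on {0..1} (U l)" for l by (rule sol_continuous[OF sl])
	have s: "sol k (U lam) du dv" using s by (simp add: k_def U_def)
	obtain C where C0: "C >= 0" and C: "\<forall>g u v e. sol k g u v \<and> continuous_on {0..1} g \<and> norm (u 0) <= e \<and> norm (v 0) <= e \<and>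
		 (\<forall>x\<in>{0..1}. norm (g x) <= e) --> (\<forall>x\<in>{0..1}. norm (u x) <= C*e \<and> norm (v x) <= C*e)"
		using sol_bound[OF shift_integrable[of lam, folded k_def]] by blast
	obtain B where B: "B > 0" "\<And>x. x \<in> {0..1} ==> norm (U lam x) <= B" using ac_bounded[OF Uc] by blast
	\<comment> \<open>Uniform distance on [0,1] between the solutions for \<open>l\<close> and for
	  \<open>lam\<close>.\<close>
	define S where "S l = Sup ((\<lambda>x. norm (U l x - U lam x)) ` {0..1})" for l
	have Sb: "norm (U l x - U lam x) <= S l" if "x \<in> {0..1}" for l x
		unfolding S_def
		by (rule cSup_upper[OF imageI[OF that]])
			 (intro bounded_imp_bdd_above compact_imp_bounded compact_continuous_image continuous_intros Uc, simp)
	have Sle: "S l <= c" if "\<And>x. x \<in> {0..1} ==> norm (U l x - U lam x) <= c" for l c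
		unfolding S_def by (rule cSup_least) (use that in auto)
	have diff: "sol k (\<lambda>x. (l - lam) * U l x) (\<lambda>x. U l x - U lam x) (\<lambda>x. V l x - V lam x)" for l
	proof -
		have "sol k (\<lambda>x. (l - lam) * U l x) (U l) (V l)"
			by (rule sol_cong[OF sl[of l]]) (simp_all add: k_def algebra_simps)
		from sol_linear[OF this sl[of lam, folded k_def], of 1 "-1"] show ?thesis by simp
	qed
	\<comment> \<open>The right-hand side of the equation for the difference contains
	  \<open>U l\<close> itself, for which no bound is at hand. It is estimated by B + S l, and the
	  \<open>S l\<close> term is absorbed for \<open>l\<close> close to \<open>lam\<close>.\<close>
	have S1: "S l <= 2*C*B * norm (l - lam)" if l: "C * norm (l - lam) <= 1/2" for l
	proof -
		have "S l <= C * (norm (l - lam) * (B + S l))"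
		proof (rule Sle)
			fix x :: real assume x: "x \<in> {0..1}"
			have gc: "continuous_on {0..1} (\<lambda>x. (l - lam) * U l x)" by (intro continuous_intros Uc)
			have "norm ((l - lam) * U l y) <= norm (l - lam) * (B + S l)" if "y \<in> {0..1}" for y
			proof -
				have "norm (U l y) <= B + S l"
					using norm_triangle_ineq[of "U lam y" "U l y - U lam y"] B(2)[OF that] Sb[OF that, of l] by simp
				then show ?thesis by (simp add: norm_mult mult_left_mono)
			qed
			moreover have "B + S l >= 0" using B(1) Sb[of 0 l] norm_ge_zero[of "U l 0 - U lam 0"] by (simp add: U0)
			ultimately show "norm (U l x - U lam x) <= C * (norm (l - lam) * (B + S l))"
				using C[rule_format, OF conjI[OF diff[of l] conjI[OF gc]] x, of "norm (l - lam) * (B + S l)"]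
				by (simp add: U0)
		qed
		also have "\<dots> = (C * norm (l - lam)) * S l + C*B * norm (l - lam)" by (simp add: algebra_simps)
		also have "\<dots> <= 1/2 * S l + C*B * norm (l - lam)"
			using Sb[of 0 l] by (intro add_right_mono mult_right_mono l) (simp add: U0)
		finally show ?thesis by simp
	qed
	\<comment> \<open>The difference quotient minus \<open>du\<close> solves the same equation with
	  right-hand side \<open>U l\<close> - \<open>U lam\<close> and zero initial data, so it is as
	  small as \<open>S l\<close>.\<close>
	have D: "norm ((U l 1 - U lam 1) / (l - lam) - du 1) <= C * S l \<and> norm ((V l 1 - V lam 1) / (l - lam) - dv 1) <= C * S l"
		if l: "l \<noteq> lam" for l
	proof -
		have "sol k (\<lambda>x. U l x - U lam x) (\<lambda>x. (U l x - U lam x) / (l - lam) - du x) (\<lambda>x. (V l x - V lam x) / (l - lam) - dv x)"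
		proof (rule sol_cong[OF sol_linear[OF diff[of l] s, of "1/(l-lam)" "-1"]])
			have c: "1 / (l - lam) * ((l - lam) * w) = w" for w using l by simp
			show "k x * (1 / (l - lam) * (U l x - U lam x) + - 1 * du x) - (1 / (l - lam) * ((l - lam) * U l x) + - 1 * U lam x)
				 = k x * ((U l x - U lam x) / (l - lam) - du x) - (U l x - U lam x)" for x
				unfolding c by simp
		qed simp_all
		note s1 = this
		have gc: "continuous_on {0..1} (\<lambda>x. U l x - U lam x)" by (intro continuous_intros Uc)
		have "S l >= 0" using Sb[of 0 l] by (simp add: U0)
		then show ?thesis
			using C[rule_format, OF conjI[OF s1 conjI[OF gc]], of "S l" 1] Sb[of _ l] by (simp add: U0 i)
	qed
	have lim0: "((\<lambda>l. C * (2*C*B * norm (l - lam))) \<longlongrightarrow> 0) (at lam)"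
		by (auto intro!: tendsto_eq_intros)
	have near: "\<forall>\<^sub>F l in at lam. C * norm (l - lam) < 1/2 \<and> l \<noteq> lam"
	proof (rule eventually_conj)
		have "((\<lambda>l. C * norm (l - lam)) \<longlongrightarrow> 0) (at lam)" by (auto intro!: tendsto_eq_intros)
		then show "\<forall>\<^sub>F l in at lam. C * norm (l - lam) < 1/2" by (rule order_tendstoD) simp
		show "\<forall>\<^sub>F l in at lam. l \<noteq> lam" by (simp add: eventually_at_filter)
	qed
	have "((\<lambda>l. (U l 1 - U lam 1) / (l - lam) - du 1) \<longlongrightarrow> 0) (at lam)"
	proof (rule Lim_null_comparison[OF _ lim0])
		show "\<forall>\<^sub>F l in at lam. norm ((U l 1 - U lam 1) / (l - lam) - du 1) <= C * (2*C*B * norm (l - lam))"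
			using near by eventually_elim (use D S1 C0 in \<open>meson less_imp_le mult_left_mono order_trans\<close>)
	qed
	then show "((\<lambda>l. fst (fsol q l a b) 1) has_field_derivative du 1) (at lam)"
		unfolding has_field_derivative_iff U_def by (simp add: LIM_zero_iff)
	have "((\<lambda>l. (V l 1 - V lam 1) / (l - lam) - dv 1) \<longlongrightarrow> 0) (at lam)"
	proof (rule Lim_null_comparison[OF _ lim0])
		show "\<forall>\<^sub>F l in at lam. norm ((V l 1 - V lam 1) / (l - lam) - dv 1) <= C * (2*C*B * norm (l - lam))"
			using near by eventually_elim (use D S1 C0 in \<open>meson less_imp_le mult_left_mono order_trans\<close>)
	qed
	then show "((\<lambda>l. snd (fsol q l a b) 1) has_field_derivative dv 1) (at lam)"
		unfolding has_field_derivative_iff V_def by (simp add: LIM_zero_iff)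
qed

text \<open>Linearity in the initial values at the right end is the point: it expresses the end
  values of an associated function for an arbitrary eigenvector through the derivative of the
  monodromy matrix.\<close>

lemma monodromy_deriv:
	obtains du dv where
		"\<And>a b. sol (\<lambda>x. q x - lam) (fst (fsol q lam a b)) (du a b) (dv a b)"
		"\<And>a b. du a b 0 = 0" "\<And>a b. dv a b 0 = 0"
		"(M11 q has_field_derivative du 1 0 1) (at lam)" "(M21 q has_field_derivative dv 1 0 1) (at lam)"
		"(M12 q has_field_derivative du 0 1 1) (at lam)" "(M22 q has_field_derivative dv 0 1 1) (at lam)"
		"\<And>a b. du a b 1 = a * du 1 0 1 + b * du 0 1 1" "\<And>a b. dv a b 1 = a * dv 1 0 1 + b * dv 0 1 1"
proof -
	have "\<exists>u v. sol (\<lambda>x. q x - lam) (fst (fsol q lam a b)) u v \<and> u 0 = 0 \<and> v 0 = 0" for a b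
		by (rule sol_exists[OF shift_integrable sol_continuous(1)[OF fsol(1)]])
	then obtain du dv where d: "\<And>a b. sol (\<lambda>x. q x - lam) (fst (fsol q lam a b)) (du a b) (dv a b)"
		"\<And>a b. du a b 0 = 0" "\<And>a b. dv a b 0 = 0" by metis
	have lin: "du a b 1 = a * du 1 0 1 + b * du 0 1 1 \<and> dv a b 1 = a * dv 1 0 1 + b * dv 0 1 1" for a b
	proof -
		have l: "sol (\<lambda>x. q x - lam) (\<lambda>x. a * fst (fsol q lam 1 0) x + b * fst (fsol q lam 0 1) x)
			 (\<lambda>x. a * du 1 0 x + b * du 0 1 x) (\<lambda>x. a * dv 1 0 x + b * dv 0 1 x)"
			by (rule sol_linear[OF d(1) d(1)])
		have f: "sol (\<lambda>x. q x - lam) (\<lambda>_. 0) (\<lambda>x. a * fst (fsol q lam 1 0) x + b * fst (fsol q lam 0 1) x)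
			 (\<lambda>x. a * snd (fsol q lam 1 0) x + b * snd (fsol q lam 0 1) x)"
			using sol_linear[OF fsol(1)[of lam 1 0] fsol(1)[of lam 0 1], of a b] by simp
		have e: "fst (fsol q lam a b) x = a * fst (fsol q lam 1 0) x + b * fst (fsol q lam 0 1) x" if "x \<in> {0..1}" for x
			by (rule sol_unique(1)[OF shift_integrable fsol(1) f _ _ that]) (simp_all add: fsol)
		have l': "sol (\<lambda>x. q x - lam) (fst (fsol q lam a b)) (\<lambda>x. a * du 1 0 x + b * du 0 1 x) (\<lambda>x. a * dv 1 0 x + b * dv 0 1 x)"
			by (rule sol_cong[OF l]) (simp_all add: e)
		have z: "sol (\<lambda>x. q x - lam) (\<lambda>_. 0) (\<lambda>x. du a b x - (a * du 1 0 x + b * du 0 1 x)) (\<lambda>x. dv a b x - (a * dv 1 0 x + b * dv 0 1 x))"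
			by (rule sol_cong[OF sol_linear[OF d(1)[of a b] l', of 1 "-1"]]) (simp_all add: algebra_simps)
		show ?thesis using sol_at_1[OF z] by (simp add: d)
	qed
	show ?thesis
	proof (rule that[of du dv])
		note d10 = fsol_deriv[OF d(1) d(2,3), of 1 0] and d01 = fsol_deriv[OF d(1) d(2,3), of 0 1]
		show "(M11 q has_field_derivative du 1 0 1) (at lam)" using d10(1) unfolding M11_def .
		show "(M21 q has_field_derivative dv 1 0 1) (at lam)" using d10(2) unfolding M21_def .
		show "(M12 q has_field_derivative du 0 1 1) (at lam)" using d01(1) unfolding M12_def .
		show "(M22 q has_field_derivative dv 0 1 1) (at lam)" using d01(2) unfolding M22_def .
	qed (rule d | rule conjunct1[OF lin] | rule conjunct2[OF lin])+
qed

lemma monodromy_holomorphic: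
	"M11 q holomorphic_on S" "M12 q holomorphic_on S" "M21 q holomorphic_on S" "M22 q holomorphic_on S"
proof -
	have "M11 q field_differentiable at z \<and> M12 q field_differentiable at z \<and> M21 q field_differentiable at z \<and> M22 q field_differentiable at z" for z
	proof (rule monodromy_deriv[of z], goal_cases)
		case (1 du dv)
		show ?case using 1(4-7) unfolding field_differentiable_def by blast
	qed
	then show "M11 q holomorphic_on S" "M12 q holomorphic_on S" "M21 q holomorphic_on S" "M22 q holomorphic_on S"
		unfolding holomorphic_on_def by (meson field_differentiable_at_within)+
qed

lemma hill_holomorphic: "hill q holomorphic_on S"
	unfolding hill_def[abs_def] by (intro holomorphic_intros monodromy_holomorphic)

section \<open>Floquet eigenvalues and their simplicity in terms of the monodromy matrix\<close>

lemma floq_sol_iff: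
	assumes f: "continuous_on {0..1} f"
	shows "floq_sol q t lam f y y1 \<longleftrightarrow> sol (\<lambda>x. q x - lam) f y y1 \<and> y 1 = exp (\<i> * of_real t) * y 0 \<and> y1 1 = exp (\<i> * of_real t) * y1 0"
proof
	assume a: "floq_sol q t lam f y y1"
	then have c: "continuous_on {0..1} y" "continuous_on {0..1} y1"
		and yi: "\<And>x. x \<in> {0..1} ==> y x = y 0 + integral {0..x} y1"
		and y1i: "\<And>x. x \<in> {0..1} ==> y1 x = y1 0 + integral {0..x} (\<lambda>s. (q s - lam) * y s - f s)"
		and b: "y 1 = exp (\<i> * of_real t) * y 0 \<and> y1 1 = exp (\<i> * of_real t) * y1 0"
		unfolding floq_sol_def by blast+
	have "ac y y1" by (rule acI[OF absolutely_integrable_continuous_real[OF c(2)] yi])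
	moreover have "ac y1 (\<lambda>s. (q s - lam) * y s - f s)"
		by (rule acI[OF set_integral_diff(1)[OF L1_mult_continuous[OF shift_integrable c(1)] absolutely_integrable_continuous_real[OF f]] y1i])
	ultimately have "sol (\<lambda>x. q x - lam) f y y1" unfolding sol_def ..
	then show "sol (\<lambda>x. q x - lam) f y y1 \<and> y 1 = exp (\<i> * of_real t) * y 0 \<and> y1 1 = exp (\<i> * of_real t) * y1 0"
		using b ..
next
	assume a: "sol (\<lambda>x. q x - lam) f y y1 \<and> y 1 = exp (\<i> * of_real t) * y 0 \<and> y1 1 = exp (\<i> * of_real t) * y1 0"
	then have s: "sol (\<lambda>x. q x - lam) f y y1" ..
	then have 1: "ac y y1" and 2: "ac y1 (\<lambda>s. (q s - lam) * y s - f s)" unfolding sol_def by (rule conjunct1, rule conjunct2)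
	show "floq_sol q t lam f y y1"
		unfolding floq_sol_def
		by (intro conjI ballI sol_continuous[OF s] L1_integrable[OF acD(1)[OF 2]] acD(2)[OF 1] acD(2)[OF 2]
				conjunct1[OF conjunct2[OF a]] conjunct2[OF conjunct2[OF a]])
qed

text \<open>Converts nontriviality of the function into nontriviality of its initial vector. If
  \<open>y\<close> vanishes, so does the primitive of \<open>y1\<close>, whose one-sided derivative
  at 0 is \<open>y1 0\<close>.\<close>

lemma sol_nonzero_iff:
	assumes s: "sol (\<lambda>x. q x - lam) (\<lambda>_. 0) y y1"
	shows "(\<exists>x\<in>{0..1}. y x \<noteq> 0) \<longleftrightarrow> y 0 \<noteq> 0 \<or> y1 0 \<noteq> 0"
proof
	assume "\<exists>x\<in>{0..1}. y x \<noteq> 0"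
	moreover have "y x = 0" if "y 0 = 0" "y1 0 = 0" "x \<in> {0..1}" for x
	proof -
		have z: "sol (\<lambda>x. q x - lam) (\<lambda>_. 0) (\<lambda>_. 0) (\<lambda>_. 0)"
			using sol_linear[OF s s, of 0 0] by simp
		show ?thesis by (rule sol_unique(1)[OF shift_integrable s z]) (use that in auto)
	qed
	ultimately show "y 0 \<noteq> 0 \<or> y1 0 \<noteq> 0" by blast
next
	assume nz: "y 0 \<noteq> 0 \<or> y1 0 \<noteq> 0"
	show "\<exists>x\<in>{0..1}. y x \<noteq> 0"
	proof (rule ccontr)
		assume "\<not> ?thesis"
		then have z: "y x = 0" if "x \<in> {0..1}" for x using that by blast
		have y1c: "continuous_on {0..1} y1" by (rule sol_continuous[OF s])
		have yi: "y x = y 0 + integral {0..x} y1" if "x \<in> {0..1}" for x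
			using s that acD(2) unfolding sol_def by blast
		have "((\<lambda>x. integral {0..x} y1) has_vector_derivative y1 0) (at 0 within {0..1})"
			by (rule integral_has_vector_derivative[OF y1c]) simp
		moreover have "((\<lambda>x. integral {0..x} y1) has_vector_derivative 0) (at 0 within {0..1})"
			by (rule has_vector_derivative_transform[of 0 "{0..1}" _ "\<lambda>_. 0"]) (use yi z in auto)
		ultimately have "y1 0 = 0"
			using vector_derivative_unique_within[of 0 "{0..1::real}"] by (simp add: trivial_limit_within islimpt_Icc)
		then show False using nz z[of 0] by simp
	qed
qed

lemma is_eigenvalue_iff_null_vector:
	"is_eigenvalue q t lam \<longleftrightarrow> (\<exists>a b. (a \<noteq> 0 \<or> b \<noteq> 0) \<and>
		 M11 q lam * a + M12 q lam * b = exp (\<i> * of_real t) * a \<and> M21 q lam * a + M22 q lam * b = exp (\<i> * of_real t) * b)"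
proof
	assume "is_eigenvalue q t lam"
	then obtain y y1 where s: "sol (\<lambda>x. q x - lam) (\<lambda>_. 0) y y1" and b: "y 1 = exp (\<i> * of_real t) * y 0" "y1 1 = exp (\<i> * of_real t) * y1 0"
		and n: "\<exists>x\<in>{0..1}. y x \<noteq> 0"
		unfolding is_eigenvalue_def floq_sol_iff[OF continuous_on_const] by blast
	then show "\<exists>a b. (a \<noteq> 0 \<or> b \<noteq> 0) \<and>
		 M11 q lam * a + M12 q lam * b = exp (\<i> * of_real t) * a \<and> M21 q lam * a + M22 q lam * b = exp (\<i> * of_real t) * b"
		using sol_at_1[OF s] sol_nonzero_iff[OF s] by metis
next
	assume "\<exists>a b. (a \<noteq> 0 \<or> b \<noteq> 0) \<and>
		 M11 q lam * a + M12 q lam * b = exp (\<i> * of_real t) * a \<and> M21 q lam * a + M22 q lam * b = exp (\<i> * of_real t) * b"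
	then obtain a b where ab: "a \<noteq> 0 \<or> b \<noteq> 0" "M11 q lam * a + M12 q lam * b = exp (\<i> * of_real t) * a"
		"M21 q lam * a + M22 q lam * b = exp (\<i> * of_real t) * b" by blast
	have s: "sol (\<lambda>x. q x - lam) (\<lambda>_. 0) (fst (fsol q lam a b)) (snd (fsol q lam a b))" by (rule fsol)
	show "is_eigenvalue q t lam"
		unfolding is_eigenvalue_def floq_sol_iff[OF continuous_on_const]
		using s sol_at_1[OF s] sol_nonzero_iff[OF s] ab by (metis fsol(2,3))
qed

text \<open>Since the monodromy matrix has determinant 1, its characteristic polynomial at e is 1 -
  e \<open>hill\<close> + e^2 = -e (\<open>hill\<close> - (e + 1/e)), and e + 1/e = 2 cos t for e =
  e^(it).\<close>

lemma char_poly_zero_iff: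
	"(M11 q lam - exp (\<i> * of_real t)) * (M22 q lam - exp (\<i> * of_real t)) - M12 q lam * M21 q lam = 0
		\<longleftrightarrow> hill q lam = 2 * cos (of_real t)"
proof -
	define e where "e = exp (\<i> * complex_of_real t)"
	have e: "e \<noteq> 0" by (simp add: e_def)
	have c: "2 * cos (complex_of_real t) = e + 1/e"
		by (simp add: cos_exp_eq e_def exp_minus inverse_eq_divide)
	have "(M11 q lam - e) * (M22 q lam - e) - M12 q lam * M21 q lam = 1 - e * hill q lam + e*e"
		using det_monodromy[of lam] by (simp add: hill_def algebra_simps)
	also have "\<dots> = - e * (hill q lam - (e + 1/e))" using e by (simp add: field_simps)
	finally show ?thesis using e c unfolding e_def[symmetric] by simp
qed

lemma is_eigenvalue_iff: "is_eigenvalue q t lam \<longleftrightarrow> hill q lam = 2 * cos (of_real t)"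
proof -
	define e where "e = exp (\<i> * complex_of_real t)"
	define A B C D where "A = M11 q lam - e" "B = M12 q lam" "C = M21 q lam" "D = M22 q lam - e"
	have "is_eigenvalue q t lam \<longleftrightarrow> (\<exists>a b. (a \<noteq> 0 \<or> b \<noteq> 0) \<and> A*a + B*b = 0 \<and> C*a + D*b = 0)"
		unfolding is_eigenvalue_iff_null_vector e_def[symmetric] A_B_C_D_def by (simp add: algebra_simps)
	also have "\<dots> \<longleftrightarrow> A*D - B*C = 0"
	proof
		assume "\<exists>a b. (a \<noteq> 0 \<or> b \<noteq> 0) \<and> A*a + B*b = 0 \<and> C*a + D*b = 0"
		then obtain a b where ab: "a \<noteq> 0 \<or> b \<noteq> 0" "A*a + B*b = 0" "C*a + D*b = 0" by blast
		have "(A*D - B*C) * a = D * (A*a + B*b) - B * (C*a + D*b)"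
			"(A*D - B*C) * b = A * (C*a + D*b) - C * (A*a + B*b)" by (simp_all add: algebra_simps)
		then show "A*D - B*C = 0" using ab by auto
	next
		assume d: "A*D - B*C = 0"
		show "\<exists>a b. (a \<noteq> 0 \<or> b \<noteq> 0) \<and> A*a + B*b = 0 \<and> C*a + D*b = 0"
		proof (cases "A = 0 \<and> B = 0")
			case True
			show ?thesis
			proof (cases "C = 0 \<and> D = 0")
				case True
				then show ?thesis using \<open>A = 0 \<and> B = 0\<close> by (intro exI[of _ 1]) auto
			next
				case False
				then show ?thesis using \<open>A = 0 \<and> B = 0\<close> by (intro exI[of _ D] exI[of _ "- C"]) auto
			qed
		next
			case False
			then show ?thesis using d by (intro exI[of _ B] exI[of _ "- A"]) (auto simp: algebra_simps)
		qed
	qed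
	also have "\<dots> \<longleftrightarrow> hill q lam = 2 * cos (of_real t)"
		using char_poly_zero_iff[of lam t] by (simp add: A_B_C_D_def e_def)
	finally show ?thesis .
qed

text \<open>Let N = M - e^(it) be the singular matrix and M' the derivative of M in \<lambda>. The
  trace of adj(N) M' is -e^(it) times the derivative of \<open>hill\<close>, hence nonzero. So N is
  not 0, which gives a one-dimensional eigenspace. An associated function would give N z = -M' y
  with N y = 0; applying adj(N) kills the left side, while adj(N) M' y is that nonzero trace times
  y.\<close>

lemma simple_eigenvalueI:
	assumes h: "hill q lam = 2 * cos (of_real t)" and d: "deriv (hill q) lam \<noteq> 0"
	shows "simple_eigenvalue q t lam"
proof -
	define e where "e = exp (\<i> * complex_of_real t)"
	have e: "e \<noteq> 0" by (simp add: e_def)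
	define A B C D where "A = M11 q lam - e" "B = M12 q lam" "C = M21 q lam" "D = M22 q lam - e"
	obtain du dv where s: "\<And>a b. sol (\<lambda>x. q x - lam) (fst (fsol q lam a b)) (du a b) (dv a b)"
		and i: "\<And>a b. du a b 0 = 0" "\<And>a b. dv a b 0 = 0"
		and m: "(M11 q has_field_derivative du 1 0 1) (at lam)" "(M21 q has_field_derivative dv 1 0 1) (at lam)"
		"(M12 q has_field_derivative du 0 1 1) (at lam)" "(M22 q has_field_derivative dv 0 1 1) (at lam)"
		and lin: "\<And>a b. du a b 1 = a * du 1 0 1 + b * du 0 1 1" "\<And>a b. dv a b 1 = a * dv 1 0 1 + b * dv 0 1 1"
		by (rule monodromy_deriv[of lam]) blast
	define m11 m12 m21 m22 where "m11 = du 1 0 1" "m12 = du 0 1 1" "m21 = dv 1 0 1" "m22 = dv 0 1 1"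
	note mdef = m11_m12_m21_m22_def
	have "(hill q has_field_derivative m11 + m22) (at lam)"
		unfolding hill_def[abs_def] mdef by (intro derivative_intros m)
	then have d: "m11 + m22 \<noteq> 0" using d by (simp add: DERIV_imp_deriv)
	have "((\<lambda>l. M11 q l * M22 q l - M12 q l * M21 q l) has_field_derivative
			(m11 * M22 q lam + m22 * M11 q lam) - (m12 * M21 q lam + m21 * M12 q lam)) (at lam)"
		unfolding mdef by (rule derivative_eq_intros m refl | simp)+
	moreover have "((\<lambda>l. M11 q l * M22 q l - M12 q l * M21 q l) has_field_derivative 0) (at lam)"
		by (simp add: det_monodromy)
	ultimately have "(m11 * M22 q lam + m22 * M11 q lam) - (m12 * M21 q lam + m21 * M12 q lam) = 0"
		by (rule DERIV_unique)
	\<comment> \<open>Differentiating det M = 1 gives trace(adj(M) M') = 0, and adj(M - e) = adj(M) - e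
	  for 2 x 2 matrices.\<close>
	then have tr: "D*m11 + A*m22 - C*m12 - B*m21 = - e * (m11 + m22)"
		unfolding A_B_C_D_def by (simp add: algebra_simps)
	then have nz: "D*m11 + A*m22 - C*m12 - B*m21 \<noteq> 0" using e d by simp
	have det: "A*D - B*C = 0"
		using char_poly_zero_iff[of lam t] h by (simp add: A_B_C_D_def e_def)
	obtain a b where ab: "a \<noteq> 0 \<or> b \<noteq> 0" "A*a + B*b = 0" "C*a + D*b = 0"
		using is_eigenvalue_iff[of t lam] h unfolding is_eigenvalue_iff_null_vector e_def[symmetric] A_B_C_D_def
		by (auto simp: algebra_simps)
	define y y1 where "y = fst (fsol q lam a b)" "y1 = snd (fsol q lam a b)"
	have y: "sol (\<lambda>x. q x - lam) (\<lambda>_. 0) y y1" "y 0 = a" "y1 0 = b"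
		unfolding y_y1_def by (rule fsol)+
	have bc: "floq_sol q t lam (\<lambda>_. 0) w w1 \<longleftrightarrow> sol (\<lambda>x. q x - lam) (\<lambda>_. 0) w w1 \<and> A * w 0 + B * w1 0 = 0 \<and> C * w 0 + D * w1 0 = 0" for w w1
		unfolding floq_sol_iff[OF continuous_on_const] e_def[symmetric] A_B_C_D_def
		using sol_at_1[of lam w w1] by (auto simp: algebra_simps)
	have yfl: "floq_sol q t lam (\<lambda>_. 0) y y1" using y ab by (simp add: bc)
	have ynz: "\<exists>x\<in>{0..1}. y x \<noteq> 0" using sol_nonzero_iff[OF y(1)] y ab by simp
	have uniq: "\<exists>c. \<forall>x\<in>{0..1}. z x = c * y x" if z: "floq_sol q t lam (\<lambda>_. 0) z z1" for z z1
	proof -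
		have zs: "sol (\<lambda>x. q x - lam) (\<lambda>_. 0) z z1" "A * z 0 + B * z1 0 = 0" "C * z 0 + D * z1 0 = 0"
			using z by (auto simp: bc)
		have ABCD: "A \<noteq> 0 \<or> B \<noteq> 0 \<or> C \<noteq> 0 \<or> D \<noteq> 0" using nz by auto
		have cross: "a * z1 0 - b * z 0 = 0"
		proof -
			have "A * (a * z1 0 - b * z 0) = z1 0 * (A*a + B*b) - b * (A * z 0 + B * z1 0)"
				"B * (a * z1 0 - b * z 0) = a * (A * z 0 + B * z1 0) - z 0 * (A*a + B*b)"
				"C * (a * z1 0 - b * z 0) = z1 0 * (C*a + D*b) - b * (C * z 0 + D * z1 0)"
				"D * (a * z1 0 - b * z 0) = a * (C * z 0 + D * z1 0) - z 0 * (C*a + D*b)" by (simp_all add: algebra_simps)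
			then show ?thesis using ABCD ab zs by auto
		qed
		obtain c where c: "z 0 = c*a" "z1 0 = c*b"
		proof (cases "a = 0")
			case True
			then show ?thesis using ab(1) cross that[of "z1 0 / b"] by auto
		next
			case False
			then show ?thesis using cross that[of "z 0 / a"] by (auto simp: field_simps)
		qed
		have cy: "sol (\<lambda>x. q x - lam) (\<lambda>_. 0) (\<lambda>x. c * y x) (\<lambda>x. c * y1 x)"
			using sol_linear[OF y(1) y(1), of c 0] by simp
		have "z x = c * y x" if "x \<in> {0..1}" for x
			by (rule sol_unique(1)[OF shift_integrable zs(1) cy _ _ that]) (simp_all add: y c)
		then show ?thesis by blast
	qed
	have noassoc: "\<not> floq_sol q t lam y z z1" for z z1
	proof
		assume z: "floq_sol q t lam y z z1"
		then have zs: "sol (\<lambda>x. q x - lam) y z z1" and zb: "z 1 = e * z 0" "z1 1 = e * z1 0"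
			unfolding floq_sol_iff[OF sol_continuous(1)[OF y(1)]] e_def by simp_all
		have "sol (\<lambda>x. q x - lam) (\<lambda>_. 0) (\<lambda>x. z x - du a b x) (\<lambda>x. z1 x - dv a b x)"
			using sol_linear[OF zs s[of a b, folded y_y1_def], of 1 "-1"] by simp
		from sol_at_1[OF this]
		have "z 1 - du a b 1 = M11 q lam * z 0 + M12 q lam * z1 0" "z1 1 - dv a b 1 = M21 q lam * z 0 + M22 q lam * z1 0"
			by (simp_all add: i)
		then have r: "A * z 0 + B * z1 0 = - (m11*a + m12*b)" "C * z 0 + D * z1 0 = - (m21*a + m22*b)"
			unfolding zb lin[of a b] mdef A_B_C_D_def by (simp_all add: algebra_simps)
		let ?T = "D*m11 + A*m22 - C*m12 - B*m21"
		\<comment> \<open>First component of the identity adj(N) M' y = trace(adj(N) M') y, valid because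
		  the vector y = (a, b) is in the kernel of N.\<close>
		have "a * ?T = D * (m11*a + m12*b) - B * (m21*a + m22*b) - m12 * (C*a + D*b) + m22 * (A*a + B*b)"
			by (simp add: algebra_simps)
		also have "\<dots> = - D * (A * z 0 + B * z1 0) + B * (C * z 0 + D * z1 0)"
			unfolding r ab by (simp add: algebra_simps)
		also have "\<dots> = - (A*D - B*C) * z 0" by (simp add: algebra_simps)
		finally have "a = 0" using nz det by simp
		have "b * ?T = A * (m21*a + m22*b) - C * (m11*a + m12*b) - m21 * (A*a + B*b) + m11 * (C*a + D*b)"
			by (simp add: algebra_simps)
		also have "\<dots> = - A * (C * z 0 + D * z1 0) + C * (A * z 0 + B * z1 0)"
			unfolding r ab by (simp add: algebra_simps)
		also have "\<dots> = - (A*D - B*C) * z1 0" by (simp add: algebra_simps)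
		finally have "b = 0" using nz det by simp
		then show False using ab \<open>a = 0\<close> by simp
	qed
	show ?thesis unfolding simple_eigenvalue_def using yfl ynz uniq noassoc by blast
qed

end

section \<open>Solutions in a WKB gauge\<close>

abbreviation pim :: "int => complex" where "pim m \<equiv> of_real pi * of_int m"

definition emode :: "int => real => complex" where
	"emode m x = exp (- \<i> * of_real (2*pi * of_int m * x))"

definition zeta :: "complex => complex" where "zeta \<mu> = 1 / (2*\<i>*\<mu>)"

lemma zeta_minus: "zeta (- \<mu>) = - zeta \<mu>" by (simp add: zeta_def)
lemma norm_zeta: "norm (zeta \<mu>) = 1 / (2 * norm \<mu>)" by (simp add: zeta_def norm_divide norm_mult)

text \<open>With \<open>\<sigma> = \<i> \<mu> + T (zeta \<mu>)\<close> the function \<open>exp (\<integral> \<sigma>)\<close> solves the equation with spectral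
	parameter \<open>\<mu>\<^sup>2\<close> up to the error \<open>\<sigma>' + \<sigma>\<^sup>2 - (q - \<mu>\<^sup>2) = z\<^sup>s A + z\<^sup>s\<^sup>+\<^sup>1 X z\<close>, \<open>z = zeta \<mu>\<close>.
	The function \<open>ds\<close> plays the role of the derivative of \<open>q\<close> of order \<open>s\<close>.\<close>

lemma norm_exp_minus_1: "norm (exp c - 1) <= 2 * norm c" if "norm c <= 1/2" for c :: complex
	using norm_exp_bounds(2)[OF that] norm_ge_zero[of c] by linarith

locale gauge =
	fixes q :: "real => complex" and s :: nat and T T' X :: "complex => real => complex"
		and A ds e e' :: "real => complex" and K :: real
	assumes q: "L1 q"
		and T_ac: "\<And>z. ac (T z) (T' z)" and T_per: "\<And>z. T z 1 = T z 0"
		and T_hol: "(\<lambda>z. T z 0) holomorphic_on UNIV"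
		and K: "K >= 0"
		and T_bound: "\<And>z x. norm z <= 1 ==> x \<in> {0..1} ==> norm (T z x) <= K * norm z"
		and A_int: "L1 A"
		and X_cont: "\<And>z. continuous_on {0..1} (X z)"
		and X_bound: "\<And>z x. norm z <= 1 ==> x \<in> {0..1} ==> norm (X z x) <= K"
		and X_lip: "\<And>z x. norm z <= 1 ==> x \<in> {0..1} ==> norm (X z x - X 0 x) <= K * norm z"
		and R_eq: "\<And>z x. z \<noteq> 0 ==> x \<in> {0..1} ==>
				T' z x + T z x / z + (T z x)\<^sup>2 - q x = z ^ s * A x + z ^ Suc s * X z x"
		and A_eq: "\<And>x. x \<in> {0..1} ==> A x = (-1) ^ Suc s * ds x + e x"
		and ds_int: "L1 ds"
		and ds_coef: "\<And>m. integral {0..1} (\<lambda>x. ds x * emode m x) = (2*pi*\<i> * of_int m) ^ s * fcoef q m"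
		and e_ac: "ac e e'" and e_per: "e 1 = e 0"
begin

definition sg :: "complex => real => complex" where "sg \<mu> x = \<i>*\<mu> + T (zeta \<mu>) x"
definition w :: "complex => real => complex" where "w \<mu> x = sg \<mu> x - sg (- \<mu>) x"
text \<open>By \<open>R_eq\<close> this is the residual \<sigma>' + \<sigma>^2 - (q - \<mu>^2) of
  the exponent \<sigma> = \<open>sg \<mu>\<close>, since 1 / \<open>zeta \<mu>\<close> =
  2i\<mu>.\<close>

definition rr :: "complex => real => complex" where
	"rr \<mu> x = zeta \<mu> ^ s * A x + zeta \<mu> ^ Suc s * X (zeta \<mu>) x"
definition ff :: "complex => real => complex" where "ff \<mu> x = exp (integral {0..x} (sg \<mu>))"
text \<open>The oscillating factor, close to e^(-2i\<mu>x), through which the amplitudes of the two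
  WKB exponentials are coupled.\<close>

definition kap :: "complex => real => complex" where "kap \<mu> x = ff (- \<mu>) x / ff \<mu> x"

lemma zeta_small: "1 + K <= norm \<mu> ==> norm (zeta \<mu>) <= 1"
	unfolding norm_zeta using K by (subst divide_le_eq_1_pos) auto

lemma w_minus: "w (- \<mu>) x = - w \<mu> x" by (simp add: w_def)
lemma ff_nz: "ff \<mu> x \<noteq> 0" by (simp add: ff_def)
lemma kap_minus: "kap (- \<mu>) x = 1 / kap \<mu> x" by (simp add: kap_def)
lemma sg_ac: "ac (sg \<mu>) (T' (zeta \<mu>))"
	using ac_add[OF ac_const T_ac, of "\<i>*\<mu>" "zeta \<mu>"] by (simp add: sg_def[abs_def])

lemma sg_per: "sg \<mu> 1 = sg \<mu> 0" by (simp add: sg_def T_per)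

lemma ff_ac: "ac (ff \<mu>) (\<lambda>x. sg \<mu> x * ff \<mu> x)"
	unfolding ff_def[abs_def] by (rule ac_exp_integral[OF ac_continuous[OF sg_ac]])

lemma T_zeta_bound: "1 + K <= norm \<mu> ==> x \<in> {0..1} ==> norm (T (zeta \<mu>) x) <= K / (2 * norm \<mu>)"
	using T_bound[OF zeta_small, of \<mu> x] by (simp add: norm_zeta)

lemma w_eq: "w \<mu> x = 2*\<i>*\<mu> + (T (zeta \<mu>) x - T (zeta (- \<mu>)) x)"
	by (simp add: w_def sg_def)

lemma w_bound:
	assumes "1 + K <= norm \<mu>" "x \<in> {0..1}"
	shows "norm (w \<mu> x - 2*\<i>*\<mu>) <= K / norm \<mu>" "norm \<mu> <= norm (w \<mu> x)"
proof -
	have "norm (w \<mu> x - 2*\<i>*\<mu>) <= norm (T (zeta \<mu>) x) + norm (T (zeta (- \<mu>)) x)"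
		unfolding w_eq using norm_triangle_ineq4 by simp
	also have "\<dots> <= K / (2 * norm \<mu>) + K / (2 * norm (- \<mu>))"
		by (intro add_mono T_zeta_bound) (use assms in auto)
	finally show 1: "norm (w \<mu> x - 2*\<i>*\<mu>) <= K / norm \<mu>" by (simp add: field_simps)
	have "K / norm \<mu> <= norm \<mu>"
	proof -
		have "K*1 <= norm \<mu> * norm \<mu>" using K assms(1) by (intro mult_mono) auto
		then show ?thesis using K assms(1) by (simp add: divide_simps)
	qed
	moreover have "norm (2*\<i>*\<mu>) <= norm (w \<mu> x) + norm (w \<mu> x - 2*\<i>*\<mu>)"
		by (metis norm_minus_commute norm_triangle_sub)
	ultimately show "norm \<mu> <= norm (w \<mu> x)" using 1 by (simp add: norm_mult)
qed

text \<open>The two expressions P = (y' - \<sigma>_- y) f_- and G = (\<sigma>_+ y - y') f_+ are the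
  amplitudes of y along the WKB exponentials: w y = P / f_- + G / f_+. In P' the terms with y'
  cancel, and what remains is minus the residual times y f_-, which is rewritten through P and
  G.\<close>

lemma gauge_sol_P:
	assumes mu: "1 + K <= norm \<mu>" and y: "sol (\<lambda>x. q x - \<mu>\<^sup>2) (\<lambda>_. 0) y y1"
	shows "ac (\<lambda>x. (y1 x - sg (- \<mu>) x * y x) * ff (- \<mu>) x)
		(\<lambda>x. - (rr (- \<mu>) x / w \<mu> x) * ((y1 x - sg (- \<mu>) x * y x) * ff (- \<mu>) x + kap \<mu> x * ((sg \<mu> x * y x - y1 x) * ff \<mu> x)))"
proof -
	have mu0: "\<mu> \<noteq> 0" using mu K by auto
	have y1: "ac y y1" and y2: "ac y1 (\<lambda>x. (q x - \<mu>\<^sup>2) * y x - 0)" using y by (simp_all add: sol_def)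
	have "ac (\<lambda>x. (y1 x - sg (- \<mu>) x * y x) * ff (- \<mu>) x)
		 (\<lambda>x. (((q x - \<mu>\<^sup>2) * y x - 0) - (T' (zeta (- \<mu>)) x * y x + sg (- \<mu>) x * y1 x)) * ff (- \<mu>) x
				 + (y1 x - sg (- \<mu>) x * y x) * (sg (- \<mu>) x * ff (- \<mu>) x))"
		by (intro ac_mult ac_diff y1 y2 sg_ac ff_ac)
	then show ?thesis
	proof (rule ac_cong)
		fix x :: real assume x: "x \<in> {0..1}"
		have wnz: "w \<mu> x \<noteq> 0" using w_bound(2)[OF mu x] mu0 by auto
		define \<sigma> t r f where "\<sigma> = sg (- \<mu>) x" "t = T (zeta (- \<mu>)) x" "r = rr (- \<mu>) x" "f = ff (- \<mu>) x"
		have "zeta (- \<mu>) \<noteq> 0" using mu0 by (simp add: zeta_def)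
		from R_eq[OF this x] have "T' (zeta (- \<mu>)) x = r - t / zeta (- \<mu>) - t\<^sup>2 + q x"
			by (simp add: \<sigma>_t_r_f_def rr_def algebra_simps)
		also have "t / zeta (- \<mu>) = - (2*\<i>*\<mu>) * t" by (simp add: zeta_def)
		finally have T': "T' (zeta (- \<mu>)) x = r - \<sigma>\<^sup>2 + (q x - \<mu>\<^sup>2)"
			by (simp add: \<sigma>_t_r_f_def sg_def power2_eq_square algebra_simps)
		have gy: "kap \<mu> x * ((sg \<mu> x * y x - y1 x) * ff \<mu> x) = (sg \<mu> x * y x - y1 x) * f"
			using ff_nz[of \<mu> x] by (simp add: kap_def \<sigma>_t_r_f_def)
		have "(y1 x - \<sigma> * y x) * f + (sg \<mu> x * y x - y1 x) * f = w \<mu> x * y x * f"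
			by (simp add: w_def \<sigma>_t_r_f_def algebra_simps)
		then have R: "- (r / w \<mu> x) * ((y1 x - \<sigma> * y x) * f + kap \<mu> x * ((sg \<mu> x * y x - y1 x) * ff \<mu> x)) = - r * y x * f"
			using wnz unfolding gy by simp
		show "(((q x - \<mu>\<^sup>2) * y x - 0) - (T' (zeta (- \<mu>)) x * y x + sg (- \<mu>) x * y1 x)) * ff (- \<mu>) x
				 + (y1 x - sg (- \<mu>) x * y x) * (sg (- \<mu>) x * ff (- \<mu>) x) =
			- (rr (- \<mu>) x / w \<mu> x) * ((y1 x - sg (- \<mu>) x * y x) * ff (- \<mu>) x + kap \<mu> x * ((sg \<mu> x * y x - y1 x) * ff \<mu> x))"
			unfolding \<sigma>_t_r_f_def(1,3,4)[symmetric] R unfolding T' by (simp add: power2_eq_square algebra_simps)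
	qed simp
qed

text \<open>Changing the sign of \<mu> exchanges the two amplitudes up to sign, so this is
  \<open>gauge_sol_P\<close> at -\<mu>.\<close>

lemma gauge_sol_G:
	assumes mu: "1 + K <= norm \<mu>" and y: "sol (\<lambda>x. q x - \<mu>\<^sup>2) (\<lambda>_. 0) y y1"
	shows "ac (\<lambda>x. (sg \<mu> x * y x - y1 x) * ff \<mu> x)
		(\<lambda>x. (rr \<mu> x / w \<mu> x) * ((y1 x - sg (- \<mu>) x * y x) * ff (- \<mu>) x / kap \<mu> x + (sg \<mu> x * y x - y1 x) * ff \<mu> x))"
proof -
	have "1 + K <= norm (- \<mu>)" "sol (\<lambda>x. q x - (- \<mu>)\<^sup>2) (\<lambda>_. 0) y y1" using mu y by simp_all
	from ac_uminus[OF gauge_sol_P[OF this]] show ?thesis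
	proof (rule ac_cong)
		fix x :: real
		define p g where "p = (y1 x - sg (- \<mu>) x * y x) * ff (- \<mu>) x" "g = (sg \<mu> x * y x - y1 x) * ff \<mu> x"
		have 1: "(y1 x - sg \<mu> x * y x) * ff \<mu> x = - g" and 2: "(sg (- \<mu>) x * y x - y1 x) * ff (- \<mu>) x = - p"
			by (simp_all add: p_g_def algebra_simps)
		show "- ((y1 x - sg (- (- \<mu>)) x * y x) * ff (- (- \<mu>)) x) = (sg \<mu> x * y x - y1 x) * ff \<mu> x"
			by (simp add: algebra_simps)
		show "- (- (rr (- (- \<mu>)) x / w (- \<mu>) x) * ((y1 x - sg (- (- \<mu>)) x * y x) * ff (- (- \<mu>)) x +
					kap (- \<mu>) x * ((sg (- \<mu>) x * y x - y1 x) * ff (- \<mu>) x)))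
			 = rr \<mu> x / w \<mu> x * ((y1 x - sg (- \<mu>) x * y x) * ff (- \<mu>) x / kap \<mu> x + (sg \<mu> x * y x - y1 x) * ff \<mu> x)"
			unfolding minus_minus 1 2 w_minus kap_minus p_g_def[symmetric]
			by (simp add: algebra_simps add_divide_distrib diff_divide_distrib)
	qed
qed

definition mass :: real where "mass = integral {0..1} (\<lambda>x. norm (A x) + K)"

lemma mass_integrable: "(\<lambda>x. norm (A x) + K) integrable_on {0..1}"
	by (intro integrable_add L1_norm_integrable[OF A_int] integrable_const_ivl)

lemma mass_nonneg: "mass >= 0"
	unfolding mass_def by (rule integral_nonneg[OF mass_integrable]) (simp add: K)

lemma norm_exp_le: "norm (exp c) <= exp a" if "Re c <= a" for c :: complex
	using that by simp

lemma kap_eq: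
	assumes "x \<in> {0..1}"
	shows "kap \<mu> x = exp (- (2*\<i>*\<mu> * of_real x) + integral {0..x} (\<lambda>u. T (zeta (- \<mu>)) u - T (zeta \<mu>) u))"
proof -
	have c: "continuous_on {0..1} (T z)" for z by (rule ac_continuous[OF T_ac])
	have i: "T z integrable_on {0..x}" for z
		by (rule integrable_Icc_mono[OF integrable_continuous_real[OF c] assms])
	have "integral {0..x} (sg \<mu>) = \<i>*\<mu> * of_real x + integral {0..x} (T (zeta \<mu>))" for \<mu>
		unfolding sg_def[abs_def] using assms
		by (subst integral_add[OF integrable_const_ivl i]) (simp add: scaleR_conv_of_real)
	then have "kap \<mu> x = exp (- (2*\<i>*\<mu> * of_real x) + (integral {0..x} (T (zeta (- \<mu>))) - integral {0..x} (T (zeta \<mu>))))"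
		unfolding kap_def ff_def by (simp add: exp_diff[symmetric] algebra_simps)
	then show ?thesis by (simp add: integral_diff[OF i i])
qed

lemma T_diff_integral_bound:
	assumes mu: "1 + K <= norm \<mu>" and x: "x \<in> {0..1}"
	shows "norm (integral {0..x} (\<lambda>u. T (zeta (- \<mu>)) u - T (zeta \<mu>) u)) <= K / norm \<mu>"
proof (rule norm_integral_continuous_le[OF absolutely_integrable_continuous_real _ x])
	show "continuous_on {0..1} (\<lambda>u. T (zeta (- \<mu>)) u - T (zeta \<mu>) u)"
		by (intro continuous_intros ac_continuous[OF T_ac])
	fix u :: real assume u: "u \<in> {0..1}"
	have "T (zeta (- \<mu>)) u - T (zeta \<mu>) u = - (w \<mu> u - 2*\<i>*\<mu>)" by (simp add: w_eq)
	then show "norm (T (zeta (- \<mu>)) u - T (zeta \<mu>) u) <= K / norm \<mu>"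
		using w_bound(1)[OF mu u] by (simp only: norm_minus_cancel)
qed

text \<open>In the exponent 5 the oscillation contributes 2 |Im \<mu>| x <= 4 and the gauge
  correction at most K / |\<mu>| <= 1.\<close>

lemma kap_bound:
	assumes mu: "1 + K <= norm \<mu>" "\<bar>Im \<mu>\<bar> <= 2" and x: "x \<in> {0..1}"
	shows "norm (kap \<mu> x) <= exp 5"
proof -
	let ?I = "integral {0..x} (\<lambda>u. T (zeta (- \<mu>)) u - T (zeta \<mu>) u)"
	have "Re ?I <= K / norm \<mu>" using complex_Re_le_cmod[of ?I] T_diff_integral_bound[OF mu(1) x] by linarith
	also have "\<dots> <= 1" using mu(1) K by (simp add: divide_simps)
	finally have 1: "Re ?I <= 1" .
	have "2 * Im \<mu> * x <= 4*1" using mu(2) x by (intro mult_mono) auto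
	moreover have "Re (- (2*\<i>*\<mu> * of_real x) + ?I) = 2 * Im \<mu> * x + Re ?I" by simp
	ultimately have "Re (- (2*\<i>*\<mu> * of_real x) + ?I) <= 5" using 1 by linarith
	then show ?thesis unfolding kap_eq[OF x] by (rule norm_exp_le)
qed

lemma rr_w_bound:
	assumes mu: "1 + K <= norm \<mu>" and x: "x \<in> {0..1}"
	shows "norm (rr \<mu> x / w \<mu> x) <= (norm (zeta \<mu>)) ^ s / norm \<mu> * (norm (A x) + K)"
proof -
	have "norm (rr \<mu> x) <= norm (zeta \<mu>) ^ s * norm (A x) + norm (zeta \<mu>) ^ s * norm (zeta \<mu>) * norm (X (zeta \<mu>) x)"
		unfolding rr_def by (rule order_trans[OF norm_triangle_ineq]) (simp add: norm_mult norm_power)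
	also have "\<dots> <= norm (zeta \<mu>) ^ s * norm (A x) + norm (zeta \<mu>) ^ s * 1*K"
		by (intro add_mono mult_mono X_bound zeta_small mu x order_refl) auto
	finally have r: "norm (rr \<mu> x) <= norm (zeta \<mu>) ^ s * (norm (A x) + K)" by (simp add: algebra_simps)
	have "norm (rr \<mu> x / w \<mu> x) <= norm (zeta \<mu>) ^ s * (norm (A x) + K) / norm \<mu>"
		unfolding norm_divide using mu K w_bound(2)[OF mu x] by (intro frac_le r) auto
	then show ?thesis by simp
qed

text \<open>Bounds the integrated coefficients of the amplitude system: \<open>rr\<close> /
  \<open>w\<close> has mean at most |zeta|^s / |\<mu>| times \<open>mass\<close>, and 1 + exp 5
  dominates 1 + |kap|.\<close>

definition rate :: "complex => real" where "rate \<mu> = norm (zeta \<mu>) ^ s / norm \<mu> * ((1 + exp 5) * mass)"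

lemma rate_nonneg: "rate \<mu> >= 0" using mass_nonneg by (simp add: rate_def)

text \<open>With S the joint maximum of both amplitudes, integration gives S <= M + S
  \<open>rate\<close> <= M + S/4, so S <= 2M. The increments and the variation of G are then at most
  2M \<open>rate\<close>. The variation is recorded for the Riemann-Lebesgue estimates.\<close>

lemma PG_bound:
	assumes mu: "1 + K <= norm \<mu>" "\<bar>Im \<mu>\<bar> <= 2" "rate \<mu> <= 1/4"
		and P: "ac P (\<lambda>x. - (rr (- \<mu>) x / w \<mu> x) * (P x + kap \<mu> x * G x))"
		and G: "ac G (\<lambda>x. (rr \<mu> x / w \<mu> x) * (P x / kap \<mu> x + G x))"
		and M: "norm (P 0) <= M" "norm (G 0) <= M" and x: "x \<in> {0..1}"
	shows "norm (P x) <= 2*M" "norm (G x) <= 2*M" "norm (P x - P 0) <= 2*M * rate \<mu>" "norm (G x - G 0) <= 2*M * rate \<mu>"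
		"integral {0..1} (\<lambda>x. norm ((rr \<mu> x / w \<mu> x) * (P x / kap \<mu> x + G x))) <= 2*M * rate \<mu>"
proof -
	have Pc: "continuous_on {0..1} P" and Gc: "continuous_on {0..1} G" using P G ac_continuous by blast+
	have "continuous_on {0..1} (\<lambda>x. max (norm (P x)) (norm (G x)))" by (intro continuous_intros Pc Gc)
	then obtain x0 where x0: "x0 \<in> {0..1}" "\<forall>x\<in>{0..1}. max (norm (P x)) (norm (G x)) <= max (norm (P x0)) (norm (G x0))"
		using continuous_attains_sup[of "{0..1::real}" "\<lambda>x. max (norm (P x)) (norm (G x))"] by auto
	define S where "S = max (norm (P x0)) (norm (G x0))"
	have S: "norm (P x) <= S" "norm (G x) <= S" if "x \<in> {0..1}" for x using x0(2) that by (auto simp: S_def)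
	have S0: "S >= 0" by (simp add: S_def le_max_iff_disj)
	have nmu: "1 + K <= norm (- \<mu>)" "\<bar>Im (- \<mu>)\<bar> <= 2" using mu by auto
	let ?c = "norm (zeta \<mu>) ^ s / norm \<mu>"
	have P': "norm (- (rr (- \<mu>) x / w \<mu> x) * (P x + kap \<mu> x * G x)) <= (?c * ((1 + exp 5) * S)) * (norm (A x) + K)" if x: "x \<in> {0..1}" for x
	proof -
		have r: "norm (rr (- \<mu>) x / w \<mu> x) <= ?c * (norm (A x) + K)"
			using rr_w_bound[OF nmu(1) x] by (simp add: w_minus zeta_minus)
		have "norm (P x + kap \<mu> x * G x) <= norm (P x) + norm (kap \<mu> x) * norm (G x)"
			by (rule order_trans[OF norm_triangle_ineq]) (simp add: norm_mult)
		also have "\<dots> <= S + exp 5 * S" by (intro add_mono mult_mono S x kap_bound mu) auto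
		finally have p: "norm (P x + kap \<mu> x * G x) <= (1 + exp 5) * S" by (simp add: algebra_simps)
		have "norm (- (rr (- \<mu>) x / w \<mu> x) * (P x + kap \<mu> x * G x)) <= (?c * (norm (A x) + K)) * ((1 + exp 5) * S)"
			unfolding norm_mult norm_minus_cancel by (intro mult_mono r p) (use K in auto)
		then show ?thesis by (simp only: mult.commute mult.left_commute mult.assoc)
	qed
	have G': "norm ((rr \<mu> x / w \<mu> x) * (P x / kap \<mu> x + G x)) <= (?c * ((1 + exp 5) * S)) * (norm (A x) + K)" if x: "x \<in> {0..1}" for x
	proof -
		have r: "norm (rr \<mu> x / w \<mu> x) <= ?c * (norm (A x) + K)"
			by (rule rr_w_bound[OF mu(1) x])
		have "P x / kap \<mu> x = P x * kap (- \<mu>) x" by (simp add: kap_minus)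
		then have "norm (P x / kap \<mu> x + G x) <= norm (P x) * norm (kap (- \<mu>) x) + norm (G x)"
			by (metis norm_mult norm_triangle_ineq)
		also have "\<dots> <= S * exp 5 + S" by (intro add_mono mult_mono S x kap_bound nmu S0) auto
		finally have p: "norm (P x / kap \<mu> x + G x) <= (1 + exp 5) * S" by (simp add: algebra_simps)
		have "norm ((rr \<mu> x / w \<mu> x) * (P x / kap \<mu> x + G x)) <= (?c * (norm (A x) + K)) * ((1 + exp 5) * S)"
			unfolding norm_mult by (intro mult_mono r p) (use K in auto)
		then show ?thesis by (simp only: mult.commute mult.left_commute mult.assoc)
	qed
	have mi: "(\<lambda>x. (?c * ((1 + exp 5) * S)) * (norm (A x) + K)) integrable_on {0..1}"
		by (intro integrable_on_mult_right mass_integrable)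
	have mi2: "integral {0..1} (\<lambda>x. (?c * ((1 + exp 5) * S)) * (norm (A x) + K)) = S * rate \<mu>"
		by (simp add: rate_def mass_def)
	have dP: "norm (P x - P 0) <= S * rate \<mu>" if x: "x \<in> {0..1}" for x
		using norm_integral_le[OF acD(1)[OF P] x mi P'] unfolding mi2 acD(2)[OF P x] by simp
	have dG: "norm (G x - G 0) <= S * rate \<mu>" if x: "x \<in> {0..1}" for x
		using norm_integral_le[OF acD(1)[OF G] x mi G'] unfolding mi2 acD(2)[OF G x] by simp
	have "S * rate \<mu> <= S * (1/4)" using mu(3) S0 by (intro mult_left_mono) auto
	then have "norm (P x0) <= M + S/4" "norm (G x0) <= M + S/4"
		using dP[OF x0(1)] dG[OF x0(1)] M norm_triangle_sub[of "P x0" "P 0"] norm_triangle_sub[of "G x0" "G 0"] by linarith+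
	then have "S <= M + S/4" by (simp add: S_def)
	moreover have "M >= 0" using M(1) norm_ge_zero order_trans by blast
	ultimately have SM: "S <= 2*M" by linarith
	show "norm (P x) <= 2*M" "norm (G x) <= 2*M" using S[OF x] SM by linarith+
	have "S * rate \<mu> <= 2*M * rate \<mu>" by (intro mult_right_mono SM rate_nonneg)
	then show "norm (P x - P 0) <= 2*M * rate \<mu>" "norm (G x - G 0) <= 2*M * rate \<mu>" using dP[OF x] dG[OF x] by linarith+
	have "integral {0..1} (\<lambda>x. norm ((rr \<mu> x / w \<mu> x) * (P x / kap \<mu> x + G x))) <= S * rate \<mu>"
		unfolding mi2[symmetric] by (rule integral_le[OF L1_norm_integrable[OF acD(1)[OF G]] mi G'])
	also have "\<dots> <= 2*M * rate \<mu>" by fact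
	finally show "integral {0..1} (\<lambda>x. norm ((rr \<mu> x / w \<mu> x) * (P x / kap \<mu> x + G x))) <= 2*M * rate \<mu>" .
qed

text \<open>The initial values are those for which the two amplitudes start at \<open>a\<close> and
  \<open>b\<close>; see \<open>PG_0\<close>.\<close>

definition yy :: "complex => complex => complex => real => complex" where
	"yy \<mu> a b = fst (fsol q (\<mu>\<^sup>2) ((a + b) / w \<mu> 0) ((sg \<mu> 0 * a + sg (- \<mu>) 0 * b) / w \<mu> 0))"
definition yy' :: "complex => complex => complex => real => complex" where
	"yy' \<mu> a b = snd (fsol q (\<mu>\<^sup>2) ((a + b) / w \<mu> 0) ((sg \<mu> 0 * a + sg (- \<mu>) 0 * b) / w \<mu> 0))"
definition PP :: "complex => complex => complex => real => complex" where
	"PP \<mu> a b x = (yy' \<mu> a b x - sg (- \<mu>) x * yy \<mu> a b x) * ff (- \<mu>) x"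
definition GG :: "complex => complex => complex => real => complex" where
	"GG \<mu> a b x = (sg \<mu> x * yy \<mu> a b x - yy' \<mu> a b x) * ff \<mu> x"

text \<open>The first row of the monodromy matrix in the basis of the initial values of \<open>sg \<mu>\<close>, \<open>sg (- \<mu>)\<close>;
	by symmetry the second row is \<open>n12 (- \<mu>)\<close>, \<open>n11 (- \<mu>)\<close>.\<close>

definition n11 :: "complex => complex" where
	"n11 \<mu> = (M21 q (\<mu>\<^sup>2) + M22 q (\<mu>\<^sup>2) * sg \<mu> 0 - sg (- \<mu>) 0 * (M11 q (\<mu>\<^sup>2) + M12 q (\<mu>\<^sup>2) * sg \<mu> 0)) / w \<mu> 0"
definition n12 :: "complex => complex" where
	"n12 \<mu> = (M21 q (\<mu>\<^sup>2) + M22 q (\<mu>\<^sup>2) * sg (- \<mu>) 0 - sg (- \<mu>) 0 * (M11 q (\<mu>\<^sup>2) + M12 q (\<mu>\<^sup>2) * sg (- \<mu>) 0)) / w \<mu> 0"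

lemma w0_nz: "1 + K <= norm \<mu> ==> w \<mu> 0 \<noteq> 0"
	using w_bound(2)[of \<mu> 0] K by auto

lemma ff_0: "ff \<mu> 0 = 1" by (simp add: ff_def)

lemma PG_0:
	assumes "1 + K <= norm \<mu>"
	shows "PP \<mu> a b 0 = a" "GG \<mu> a b 0 = b"
proof -
	note nz = w0_nz[OF assms]
	have d: "sg \<mu> 0 - sg (- \<mu>) 0 = w \<mu> 0" by (simp add: w_def)
	have "(sg \<mu> 0 * a + sg (- \<mu>) 0 * b) / w \<mu> 0 - sg (- \<mu>) 0 * ((a + b) / w \<mu> 0) = (sg \<mu> 0 - sg (- \<mu>) 0) * a / w \<mu> 0"
		by (simp add: diff_divide_distrib[symmetric] algebra_simps)
	then show "PP \<mu> a b 0 = a" unfolding PP_def yy_def yy'_def fsol(2,3)[OF q] d ff_0 using nz by simp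
	have "sg \<mu> 0 * ((a + b) / w \<mu> 0) - (sg \<mu> 0 * a + sg (- \<mu>) 0 * b) / w \<mu> 0 = (sg \<mu> 0 - sg (- \<mu>) 0) * b / w \<mu> 0"
		by (simp add: diff_divide_distrib[symmetric] algebra_simps)
	then show "GG \<mu> a b 0 = b" unfolding GG_def yy_def yy'_def fsol(2,3)[OF q] d ff_0 using nz by simp
qed

lemma PG_ac:
	assumes "1 + K <= norm \<mu>"
	shows "ac (PP \<mu> a b) (\<lambda>x. - (rr (- \<mu>) x / w \<mu> x) * (PP \<mu> a b x + kap \<mu> x * GG \<mu> a b x))"
		"ac (GG \<mu> a b) (\<lambda>x. (rr \<mu> x / w \<mu> x) * (PP \<mu> a b x / kap \<mu> x + GG \<mu> a b x))"
proof -
	have y: "sol (\<lambda>x. q x - \<mu>\<^sup>2) (\<lambda>_. 0) (yy \<mu> a b) (yy' \<mu> a b)" unfolding yy_def yy'_def by (rule fsol[OF q])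
	show "ac (PP \<mu> a b) (\<lambda>x. - (rr (- \<mu>) x / w \<mu> x) * (PP \<mu> a b x + kap \<mu> x * GG \<mu> a b x))"
		unfolding PP_def[abs_def] GG_def[abs_def] by (rule gauge_sol_P[OF assms y])
	show "ac (GG \<mu> a b) (\<lambda>x. (rr \<mu> x / w \<mu> x) * (PP \<mu> a b x / kap \<mu> x + GG \<mu> a b x))"
		unfolding PP_def[abs_def] GG_def[abs_def] by (rule gauge_sol_G[OF assms y])
qed

lemma PP_1:
	assumes "1 + K <= norm \<mu>"
	shows "PP \<mu> a b 1 = (n11 \<mu> * a + n12 \<mu> * b) * ff (- \<mu>) 1"
proof -
	define S where "S = w \<mu> 0"
	have nz: "S \<noteq> 0" using w0_nz[OF assms] by (simp add: S_def)
	have y: "sol (\<lambda>x. q x - \<mu>\<^sup>2) (\<lambda>_. 0) (yy \<mu> a b) (yy' \<mu> a b)" unfolding yy_def yy'_def by (rule fsol[OF q])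
	have i: "yy \<mu> a b 0 = (a + b) / S" "yy' \<mu> a b 0 = (sg \<mu> 0 * a + sg (- \<mu>) 0 * b) / S"
		unfolding yy_def yy'_def S_def by (rule fsol[OF q])+
	have "yy' \<mu> a b 1 - sg (- \<mu>) 0 * yy \<mu> a b 1 = n11 \<mu> * a + n12 \<mu> * b"
		unfolding sol_at_1[OF q y] i n11_def n12_def S_def[symmetric] using nz
		by (simp add: divide_simps) (simp add: algebra_simps)
	then show ?thesis by (simp add: PP_def sg_per)
qed

text \<open>The entries at \<mu> and -\<mu> form the monodromy matrix conjugated to the basis (1, sg
  \<mu>), (1, sg(-\<mu>)), and conjugation preserves trace and determinant.\<close>

lemma hill_eq:
	assumes "1 + K <= norm \<mu>"
	shows "hill q (\<mu>\<^sup>2) = n11 \<mu> + n11 (- \<mu>)" "n11 \<mu> * n11 (- \<mu>) - n12 \<mu> * n12 (- \<mu>) = 1"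
proof -
	define S a b m11 m12 m21 m22 where "S = w \<mu> 0" "a = sg \<mu> 0" "b = sg (- \<mu>) 0"
		"m11 = M11 q (\<mu>\<^sup>2)" "m12 = M12 q (\<mu>\<^sup>2)" "m21 = M21 q (\<mu>\<^sup>2)" "m22 = M22 q (\<mu>\<^sup>2)"
	note d = S_a_b_m11_m12_m21_m22_def
	have nz: "S \<noteq> 0" using w0_nz[OF assms] by (simp add: d)
	have S: "S = a - b" by (simp add: d w_def)
	have det: "m11*m22 - m12*m21 = 1" unfolding d by (rule det_monodromy[OF q])
	have n: "n11 \<mu> = (m21 + m22*a - b * (m11 + m12*a)) / S" "n11 (- \<mu>) = (a * (m11 + m12*b) - (m21 + m22*b)) / S"
		"n12 \<mu> = (m21 + m22*b - b * (m11 + m12*b)) / S" "n12 (- \<mu>) = (a * (m11 + m12*a) - (m21 + m22*a)) / S"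
		unfolding n11_def n12_def w_minus d by (simp_all add: minus_divide_right[symmetric] minus_divide_left)
	have "n11 \<mu> + n11 (- \<mu>) = ((m11 + m22) * (a - b)) / S"
		unfolding n add_divide_distrib[symmetric] by (simp add: algebra_simps)
	then show "hill q (\<mu>\<^sup>2) = n11 \<mu> + n11 (- \<mu>)" using nz unfolding S[symmetric] by (simp add: hill_def d)
	have "n11 \<mu> * n11 (- \<mu>) - n12 \<mu> * n12 (- \<mu>) = ((m11*m22 - m12*m21) * ((a - b) * (a - b))) / (S*S)"
		unfolding n by (simp add: diff_divide_distrib[symmetric]) (simp add: algebra_simps)
	then show "n11 \<mu> * n11 (- \<mu>) - n12 \<mu> * n12 (- \<mu>) = 1" using nz unfolding S[symmetric] det by simp
qed

lemma sg_0_holomorphic: "(\<lambda>\<mu>. sg \<mu> 0) holomorphic_on - {0}"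
proof -
	have z: "zeta holomorphic_on - {0}"
		unfolding zeta_def by (intro holomorphic_intros) auto
	have "(\<lambda>\<mu>. T (zeta \<mu>) 0) holomorphic_on - {0}"
		using holomorphic_on_compose_gen[OF z T_hol] by (simp add: o_def)
	then show ?thesis unfolding sg_def by (intro holomorphic_intros)
qed

lemma sg_minus_0_holomorphic: "(\<lambda>\<mu>. sg (- \<mu>) 0) holomorphic_on - {0}"
proof -
	have 1: "uminus holomorphic_on - {0::complex}" by (intro holomorphic_intros)
	have 2: "uminus ` (- {0}) \<subseteq> - {0::complex}" by auto
	from holomorphic_on_compose_gen[OF 1 sg_0_holomorphic 2] show ?thesis by (simp only: o_def)
qed

lemma n_holomorphic:
	"n11 holomorphic_on {\<mu>. norm \<mu> > 1 + K}" "n12 holomorphic_on {\<mu>. norm \<mu> > 1 + K}"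
proof -
	let ?D = "{\<mu>::complex. norm \<mu> > 1 + K}"
	have D: "?D \<subseteq> - {0}" using K by auto
	have s: "(\<lambda>\<mu>. sg \<mu> 0) holomorphic_on ?D" "(\<lambda>\<mu>. sg (- \<mu>) 0) holomorphic_on ?D"
		using sg_0_holomorphic sg_minus_0_holomorphic holomorphic_on_subset[OF _ D] by blast+
	have sq: "(\<lambda>\<mu>. \<mu>\<^sup>2) holomorphic_on ?D" by (intro holomorphic_intros)
	have m: "(\<lambda>\<mu>. f (\<mu>\<^sup>2)) holomorphic_on ?D" if "f holomorphic_on UNIV" for f
		using holomorphic_on_compose_gen[OF sq that] by (simp add: o_def)
	have nz: "sg \<mu> 0 - sg (- \<mu>) 0 \<noteq> 0" if "\<mu> \<in> ?D" for \<mu> using w0_nz[of \<mu>] that by (simp add: w_def)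
	show "n11 holomorphic_on ?D" unfolding n11_def[abs_def] w_def
		by (intro holomorphic_on_divide holomorphic_on_diff holomorphic_on_add holomorphic_on_mult s m monodromy_holomorphic q nz)
	show "n12 holomorphic_on ?D" unfolding n12_def[abs_def] w_def
		by (intro holomorphic_on_divide holomorphic_on_diff holomorphic_on_add holomorphic_on_mult s m monodromy_holomorphic q nz)
qed

lemma ff_1: "ff \<mu> 1 = exp (\<i>*\<mu> + integral {0..1} (T (zeta \<mu>)))"
proof -
	have "T z integrable_on {0..1}" for z by (rule integrable_continuous_real[OF ac_continuous[OF T_ac]])
	then show ?thesis unfolding ff_def sg_def[abs_def]
		by (subst integral_add[OF integrable_const_ivl]) simp_all
qed

lemma T_integral_bound:
	assumes "1 + K <= norm \<mu>"
	shows "norm (integral {0..1} (T (zeta \<mu>))) <= K / (2 * norm \<mu>)"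
	by (rule norm_integral_continuous_le[OF ac_absolutely_integrable[OF T_ac] T_zeta_bound[OF assms]]) simp_all

lemma ff_inverse:
	"1 / ff (- \<mu>) 1 = exp (\<i>*\<mu>) * exp (- integral {0..1} (T (zeta (- \<mu>))))"
proof -
	have "exp (\<i> * - \<mu> + I) * (exp (\<i>*\<mu>) * exp (- I)) = 1" for I
		unfolding exp_add[symmetric] by simp
	from this[of "integral {0..1} (T (zeta (- \<mu>)))"] show ?thesis
		unfolding ff_1 by (metis (no_types, lifting) exp_not_eq_zero nonzero_eq_divide_eq mult.commute)
qed

lemma rate_le: "1 + K <= norm \<mu> ==> rate \<mu> <= (1 + exp 5) * mass / norm \<mu>"
proof -
	assume mu: "1 + K <= norm \<mu>"
	have "norm (zeta \<mu>) ^ s <= 1" by (intro power_le_one zeta_small mu) simp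
	then have "norm (zeta \<mu>) ^ s / norm \<mu> * ((1 + exp 5) * mass) <= 1 / norm \<mu> * ((1 + exp 5) * mass)"
		using mass_nonneg by (intro mult_right_mono divide_right_mono) auto
	then show ?thesis by (simp add: rate_def)
qed

lemma rate_small: "1 + K + 4 * ((1 + exp 5) * mass) <= norm \<mu> ==> rate \<mu> <= 1/4"
proof -
	assume mu: "1 + K + 4 * ((1 + exp 5) * mass) <= norm \<mu>"
	have m: "(1 + exp 5) * mass >= 0" using mass_nonneg by simp
	have "rate \<mu> <= (1 + exp 5) * mass / norm \<mu>" using mu m by (intro rate_le) linarith
	also have "\<dots> <= 1/4"
	proof -
		have "4 * ((1 + exp 5) * mass) <= norm \<mu>" "norm \<mu> > 0" using mu K m by linarith+
		then show ?thesis by (simp add: divide_le_eq)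
	qed
	finally show ?thesis .
qed

text \<open>\<open>n11\<close> is the end value of an amplitude, 1 + O(rate), divided by
  \<open>ff (- \<mu>) 1\<close>, which is e^(-i\<mu>) (1 + O(1/\<mu>)). The strip |Im \<mu>| <= 2 is
  wider than the one used later, leaving room for Cauchy's estimate on unit discs.\<close>

lemma strip_bound:
	obtains R C where "R > 1 + K" "C >= 0"
		"\<And>\<mu>. norm \<mu> >= R ==> \<bar>Im \<mu>\<bar> <= 2 ==> norm (n11 \<mu> - exp (\<i>*\<mu>)) <= C / norm \<mu>"
		"\<And>\<mu>. norm \<mu> >= R ==> \<bar>Im \<mu>\<bar> <= 2 ==> norm (n12 \<mu>) <= C / norm \<mu>"
proof -
	define D where "D = (1 + exp 5) * mass"
	have D: "D >= 0" using mass_nonneg by (simp add: D_def)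
	define C where "C = exp 2 * (4*D + K)"
	have C: "C >= 0" using D K by (simp add: C_def)
	have main: "norm (n11 \<mu> - exp (\<i>*\<mu>)) <= C / norm \<mu> \<and> norm (n12 \<mu>) <= C / norm \<mu>"
		if mu: "norm \<mu> >= 2 + K + 4*D" "\<bar>Im \<mu>\<bar> <= 2" for \<mu>
	proof -
		have m1: "1 + K <= norm \<mu>" "1 + K <= norm (- \<mu>)" using mu D by auto
		have m0: "norm \<mu> > 0" using m1 K by linarith
		have r: "rate \<mu> <= 1/4" by (rule rate_small) (use mu in \<open>simp add: D_def\<close>)
		have rD: "rate \<mu> <= D / norm \<mu>" using rate_le[OF m1(1)] by (simp add: D_def)
		define \<tau> where "\<tau> = - integral {0..1} (T (zeta (- \<mu>)))"
		have t: "norm \<tau> <= K / (2 * norm \<mu>)" using T_integral_bound[OF m1(2)] by (simp add: \<tau>_def)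
		also have "\<dots> <= 1/2" using m1(1) K m0 by (simp add: field_simps)
		finally have t2: "norm \<tau> <= 1/2" .
		have et: "norm (exp \<tau> - 1) <= 2 * norm \<tau>" by (rule norm_exp_minus_1[OF t2])
		also have "\<dots> <= K / norm \<mu>" using t by simp
		finally have et: "norm (exp \<tau> - 1) <= K / norm \<mu>" .
		have et2: "norm (exp \<tau>) <= 2" by (rule exp_bound_half[OF t2])
		have em: "norm (exp (\<i>*\<mu>)) <= exp 2" using mu(2) by (intro norm_exp_le) simp
		have n: "n11 \<mu> = PP \<mu> 1 0 1 * (exp (\<i>*\<mu>) * exp \<tau>)" "n12 \<mu> = PP \<mu> 0 1 1 * (exp (\<i>*\<mu>) * exp \<tau>)"
			unfolding PP_1[OF m1(1)] \<tau>_def ff_inverse[symmetric] using ff_nz[of "- \<mu>" 1] by simp_all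
		have p: "norm (PP \<mu> 1 0 1 - 1) <= 2 * rate \<mu>"
			using PG_bound(3)[OF m1(1) mu(2) r PG_ac[OF m1(1)], of 1 0 1 1] by (simp add: PG_0[OF m1(1)])
		have p2: "norm (PP \<mu> 0 1 1) <= 2 * rate \<mu>"
			using PG_bound(3)[OF m1(1) mu(2) r PG_ac[OF m1(1)], of 0 1 1 1] by (simp add: PG_0[OF m1(1)])
		have "n11 \<mu> - exp (\<i>*\<mu>) = exp (\<i>*\<mu>) * ((PP \<mu> 1 0 1 - 1) * exp \<tau> + (exp \<tau> - 1))"
			unfolding n by (simp add: algebra_simps)
		also have "norm \<dots> <= exp 2 * ((2 * rate \<mu>) * 2 + K / norm \<mu>)"
			unfolding norm_mult
		proof (intro mult_mono em)
			have "norm ((PP \<mu> 1 0 1 - 1) * exp \<tau>) <= (2 * rate \<mu>) * 2"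
				unfolding norm_mult by (intro mult_mono p et2) (auto simp: rate_nonneg)
			then show "norm ((PP \<mu> 1 0 1 - 1) * exp \<tau> + (exp \<tau> - 1)) <= (2 * rate \<mu>) * 2 + K / norm \<mu>"
				using norm_triangle_ineq[of "(PP \<mu> 1 0 1 - 1) * exp \<tau>" "exp \<tau> - 1"] et by linarith
		qed auto
		also have "\<dots> <= exp 2 * ((2 * (D / norm \<mu>)) * 2 + K / norm \<mu>)"
			using rD by (intro mult_left_mono add_right_mono mult_right_mono) auto
		also have "\<dots> = C / norm \<mu>" by (simp add: C_def algebra_simps add_divide_distrib)
		finally have A: "norm (n11 \<mu> - exp (\<i>*\<mu>)) <= C / norm \<mu>" .
		have "norm (n12 \<mu>) <= (2 * rate \<mu>) * (exp 2 * 2)"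
			unfolding n norm_mult by (intro mult_mono p2 em et2) (auto simp: rate_nonneg)
		also have "\<dots> <= (2 * (D / norm \<mu>)) * (exp 2 * 2)" using rD by (intro mult_right_mono) auto
		also have "\<dots> = exp 2 * (4*D) / norm \<mu>" by simp
		also have "\<dots> <= C / norm \<mu>" unfolding C_def using K by (intro divide_right_mono mult_left_mono) auto
		finally show ?thesis using A by blast
	qed
	show ?thesis by (rule that[of "2 + K + 4*D" C]) (use main C D in auto)
qed

end

section \<open>Order symbols uniform on the unit interval\<close>

lemma emode_0: "emode m 0 = 1" by (simp add: emode_def)
lemma emode_1: "emode m 1 = 1"
proof -
	have "emode m 1 = cis (2*pi * of_int (- m))" by (simp add: emode_def cis_conv_exp mult_ac)
	then show ?thesis by (metis cis_multiple_2pi Ints_of_int)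
qed
lemma norm_emode: "norm (emode m x) = 1" by (simp add: emode_def)

lemma emode_continuous: "continuous_on A (emode m)"
	unfolding emode_def by (intro continuous_intros)

lemma emode_ac: "ac (emode m) (\<lambda>x. - (2*pi*\<i> * of_int m) * emode m x)"
proof (rule ac_C1)
	show "(emode m has_vector_derivative - (2*pi*\<i> * of_int m) * emode m x) (at x within {0..1})" for x
	proof -
		have "((\<lambda>z. exp (- (2*pi*\<i> * of_int m) * z)) has_field_derivative - (2*pi*\<i> * of_int m) * exp (- (2*pi*\<i> * of_int m) * of_real x)) (at (of_real x))"
			by (rule derivative_eq_intros refl | simp)+
		from has_vector_derivative_real_field[OF this, of "{0..1}"] show ?thesis
			by (simp add: emode_def[abs_def] o_def mult_ac)
	qed
	show "continuous_on {0..1} (\<lambda>x. - (2*pi*\<i> * of_int m) * emode m x)"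
		by (intro continuous_intros emode_continuous)
qed

lemma integral_emode_parts:
	assumes f: "ac f f'" and m: "m \<noteq> 0" and x: "x \<in> {0..1}"
	shows "integral {0..x} (\<lambda>u. f u * emode m u)
		= (f 0 - f x * emode m x + integral {0..x} (\<lambda>u. f' u * emode m u)) / (2*pi*\<i> * of_int m)"
proof -
	define c where "c = 2*pi*\<i> * complex_of_int m"
	have c: "c \<noteq> 0" using m by (simp add: c_def)
	have fi: "L1 f'" by (rule acD[OF f])
	note i1 = L1_Icc_mono[OF L1_mult_continuous[OF fi emode_continuous] x, THEN L1_integrable]
	have "L1 (\<lambda>u. f u * (- c * emode m u))"
		by (intro absolutely_integrable_continuous_real continuous_intros emode_continuous ac_continuous[OF f])
	note i2 = L1_Icc_mono[OF this x, THEN L1_integrable]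
	have "f x * emode m x = f 0 * emode m 0 + integral {0..x} (\<lambda>u. f' u * emode m u + f u * (- c * emode m u))"
		using acD(2)[OF ac_mult[OF f emode_ac[of m, folded c_def]] x] .
	also have "integral {0..x} (\<lambda>u. f' u * emode m u + f u * (- c * emode m u))
			= integral {0..x} (\<lambda>u. f' u * emode m u) + integral {0..x} (\<lambda>u. f u * (- c * emode m u))"
		by (rule integral_add[OF i1 i2])
	also have "(\<lambda>u. f u * (- c * emode m u)) = (\<lambda>u. - c * (f u * emode m u))" by (simp add: mult_ac)
	also have "integral {0..x} (\<lambda>u. - c * (f u * emode m u)) = - c * integral {0..x} (\<lambda>u. f u * emode m u)" by simp
	finally show ?thesis unfolding c_def[symmetric] using c by (simp add: emode_0 field_simps)
qed

text \<open>Functions on \<open>[0,1]\<close> depending on a parameter \<open>p\<close> with \<open>\<bar>m p\<bar> \<rightarrow> \<infinity>\<close>: \<open>bd k\<close> means \<open>O(\<bar>m\<bar>^(-k))\<close>,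
	\<open>sm k\<close> means \<open>o(\<bar>m\<bar>^(-k))\<close>, and \<open>bv k\<close> means \<open>O(\<bar>m\<bar>^(-k))\<close> together with the total variation.\<close>

locale scale =
	fixes F :: "'p filter" and m :: "'p => int"
	assumes m_lim: "filterlim (\<lambda>p. real_of_int \<bar>m p\<bar>) at_top F"
begin

abbreviation hh :: "'p => real" where "hh p \<equiv> real_of_int \<bar>m p\<bar>"

definition bd :: "nat => ('p => real => complex) => bool" where
	"bd k f \<longleftrightarrow> (\<exists>c. \<forall>\<^sub>F p in F. \<forall>x\<in>{0..1}. norm (f p x) * hh p ^ k <= c)"
definition sm :: "nat => ('p => real => complex) => bool" where
	"sm k f \<longleftrightarrow> (\<forall>\<delta>>0. \<forall>\<^sub>F p in F. \<forall>x\<in>{0..1}. norm (f p x) * hh p ^ k <= \<delta>)"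
definition bv :: "nat => ('p => real => complex) => bool" where
	"bv k f \<longleftrightarrow> (\<exists>f' c. \<forall>\<^sub>F p in F. ac (f p) (f' p) \<and> (\<forall>x\<in>{0..1}. norm (f p x) * hh p ^ k <= c) \<and>
		 integral {0..1} (\<lambda>x. norm (f' p x)) * hh p ^ k <= c)"

lemma hh_ge: "\<forall>\<^sub>F p in F. hh p >= c"
	using m_lim by (simp add: filterlim_at_top)

lemma bd_cong: "bd k f ==> \<forall>\<^sub>F p in F. \<forall>x\<in>{0..1}. f p x = g p x ==> bd k g"
proof -
	assume b: "bd k f" and e: "\<forall>\<^sub>F p in F. \<forall>x\<in>{0..1}. f p x = g p x"
	obtain c where c: "\<forall>\<^sub>F p in F. \<forall>x\<in>{0..1}. norm (f p x) * hh p ^ k <= c" using b unfolding bd_def by blast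
	have "\<forall>\<^sub>F p in F. \<forall>x\<in>{0..1}. norm (g p x) * hh p ^ k <= c" using c e by eventually_elim simp
	then show ?thesis unfolding bd_def by blast
qed

lemma sm_cong: "sm k f ==> \<forall>\<^sub>F p in F. \<forall>x\<in>{0..1}. f p x = g p x ==> sm k g"
	unfolding sm_def
proof (intro allI impI)
	fix \<delta> :: real
	assume b: "\<forall>\<delta>>0. \<forall>\<^sub>F p in F. \<forall>x\<in>{0..1}. norm (f p x) * hh p ^ k <= \<delta>" and \<delta>: "\<delta> > 0"
		and e: "\<forall>\<^sub>F p in F. \<forall>x\<in>{0..1}. f p x = g p x"
	have c: "\<forall>\<^sub>F p in F. \<forall>x\<in>{0..1}. norm (f p x) * hh p ^ k <= \<delta>" using b \<delta> by blast
	show "\<forall>\<^sub>F p in F. \<forall>x\<in>{0..1}. norm (g p x) * hh p ^ k <= \<delta>" using c e by eventually_elim simp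
qed

lemma sm_imp_bd: "sm k f ==> bd k f"
	unfolding sm_def bd_def by (meson zero_less_one)

lemma bd_add: assumes "bd k f" "bd k g" shows "bd k (\<lambda>p x. f p x + g p x)"
proof -
	obtain c where c: "\<forall>\<^sub>F p in F. \<forall>x\<in>{0..1}. norm (f p x) * hh p ^ k <= c" using assms unfolding bd_def by blast
	obtain d where d: "\<forall>\<^sub>F p in F. \<forall>x\<in>{0..1}. norm (g p x) * hh p ^ k <= d" using assms unfolding bd_def by blast
	have "\<forall>\<^sub>F p in F. \<forall>x\<in>{0..1}. norm (f p x + g p x) * hh p ^ k <= c + d"
		using c d
	proof eventually_elim
		case (elim p)
		show ?case
		proof
			fix x :: real assume x: "x \<in> {0..1}"
			have "norm (f p x + g p x) * hh p ^ k <= (norm (f p x) + norm (g p x)) * hh p ^ k"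
				by (intro mult_right_mono norm_triangle_ineq) simp
			then show "norm (f p x + g p x) * hh p ^ k <= c + d" using elim x by (fastforce simp: distrib_right)
		qed
	qed
	then show ?thesis unfolding bd_def by blast
qed

lemma sm_add: assumes "sm k f" "sm k g" shows "sm k (\<lambda>p x. f p x + g p x)"
	unfolding sm_def
proof (intro allI impI)
	fix \<delta> :: real assume \<delta>: "\<delta> > 0"
	have c: "\<forall>\<^sub>F p in F. \<forall>x\<in>{0..1}. norm (f p x) * hh p ^ k <= \<delta>/2" using assms(1) \<delta> half_gt_zero unfolding sm_def by blast
	have d: "\<forall>\<^sub>F p in F. \<forall>x\<in>{0..1}. norm (g p x) * hh p ^ k <= \<delta>/2" using assms(2) \<delta> half_gt_zero unfolding sm_def by blast
	show "\<forall>\<^sub>F p in F. \<forall>x\<in>{0..1}. norm (f p x + g p x) * hh p ^ k <= \<delta>"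
		using c d
	proof eventually_elim
		case (elim p)
		show ?case
		proof
			fix x :: real assume x: "x \<in> {0..1}"
			have "norm (f p x + g p x) * hh p ^ k <= (norm (f p x) + norm (g p x)) * hh p ^ k"
				by (intro mult_right_mono norm_triangle_ineq) simp
			then show "norm (f p x + g p x) * hh p ^ k <= \<delta>" using elim x by (fastforce simp: distrib_right)
		qed
	qed
qed

lemma bd_mult: assumes "bd j f" "bd k g" shows "bd (j + k) (\<lambda>p x. f p x * g p x)"
proof -
	obtain c where c: "\<forall>\<^sub>F p in F. \<forall>x\<in>{0..1}. norm (f p x) * hh p ^ j <= c" using assms unfolding bd_def by blast
	obtain d where d: "\<forall>\<^sub>F p in F. \<forall>x\<in>{0..1}. norm (g p x) * hh p ^ k <= d" using assms unfolding bd_def by blast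
	have "\<forall>\<^sub>F p in F. \<forall>x\<in>{0..1}. norm (f p x * g p x) * hh p ^ (j + k) <= max c 0 * d"
		using c d
	proof eventually_elim
		case (elim p)
		show ?case
		proof
			fix x :: real assume x: "x \<in> {0..1}"
			have "norm (f p x * g p x) * hh p ^ (j + k) = (norm (f p x) * hh p ^ j) * (norm (g p x) * hh p ^ k)"
				by (simp add: norm_mult power_add mult_ac)
			also have "\<dots> <= max c 0 * d" using elim x by (intro mult_mono) (auto simp: le_max_iff_disj)
			finally show "norm (f p x * g p x) * hh p ^ (j + k) <= max c 0 * d" .
		qed
	qed
	then show ?thesis unfolding bd_def by blast
qed

lemma sm_mult: assumes "sm j f" "bd k g" shows "sm (j + k) (\<lambda>p x. f p x * g p x)"
	unfolding sm_def
proof (intro allI impI)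
	fix \<delta> :: real assume \<delta>: "\<delta> > 0"
	obtain d where d: "\<forall>\<^sub>F p in F. \<forall>x\<in>{0..1}. norm (g p x) * hh p ^ k <= d" using assms unfolding bd_def by blast
	define d' where "d' = max d 1"
	have d': "d' > 0" "d <= d'" by (auto simp: d'_def)
	have c: "\<forall>\<^sub>F p in F. \<forall>x\<in>{0..1}. norm (f p x) * hh p ^ j <= \<delta>/d'" using assms(1) \<delta> d' divide_pos_pos unfolding sm_def by blast
	show "\<forall>\<^sub>F p in F. \<forall>x\<in>{0..1}. norm (f p x * g p x) * hh p ^ (j + k) <= \<delta>"
		using c d
	proof eventually_elim
		case (elim p)
		show ?case
		proof
			fix x :: real assume x: "x \<in> {0..1}"
			have "norm (f p x * g p x) * hh p ^ (j + k) = (norm (f p x) * hh p ^ j) * (norm (g p x) * hh p ^ k)"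
				by (simp add: norm_mult power_add mult_ac)
			also have "\<dots> <= (\<delta>/d') * d'" using elim x d' \<delta> by (intro mult_mono) (auto intro: order_trans)
			also have "\<dots> = \<delta>" using d' by simp
			finally show "norm (f p x * g p x) * hh p ^ (j + k) <= \<delta>" .
		qed
	qed
qed

lemma bd_imp_sm: assumes "bd (Suc k) f" shows "sm k f"
	unfolding sm_def
proof (intro allI impI)
	fix \<delta> :: real assume \<delta>: "\<delta> > 0"
	obtain c where c: "\<forall>\<^sub>F p in F. \<forall>x\<in>{0..1}. norm (f p x) * hh p ^ Suc k <= c" using assms unfolding bd_def by blast
	show "\<forall>\<^sub>F p in F. \<forall>x\<in>{0..1}. norm (f p x) * hh p ^ k <= \<delta>"
		using c hh_ge[of "max 1 (c/\<delta>)"]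
	proof eventually_elim
		case (elim p)
		show ?case
		proof
			fix x :: real assume x: "x \<in> {0..1}"
			have h: "hh p >= 1" "c <= \<delta> * hh p" using elim(2) \<delta> by (auto simp: field_simps)
			have "(norm (f p x) * hh p ^ k) * hh p <= c" using elim(1) x by (simp add: mult_ac)
			also have "\<dots> <= \<delta> * hh p" by (rule h)
			finally show "norm (f p x) * hh p ^ k <= \<delta>" using h(1) by (simp add: mult_le_cancel_right)
		qed
	qed
qed

lemma bd_Suc: "bd (Suc k) f ==> bd k f" by (rule sm_imp_bd[OF bd_imp_sm])

lemma bd_le: "bd k f ==> j <= k ==> bd j f"
	by (induction k) (auto simp: le_Suc_eq intro: bd_Suc)

lemma sm_le: "sm k f ==> j <= k ==> sm j f"
proof (induction k)
	case (Suc k)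
	then show ?case using sm_imp_bd bd_imp_sm by (auto simp: le_Suc_eq)
qed simp

lemma bd_const: "continuous_on {0..1} f ==> bd 0 (\<lambda>_. f)"
proof -
	assume "continuous_on {0..1} f"
	then obtain B where "\<And>u. u \<in> {0..1} ==> norm (f u) <= B" using ac_bounded by blast
	then show ?thesis unfolding bd_def by (intro exI[of _ B] always_eventually) simp
qed

lemma sm_diff: "sm k f ==> sm k g ==> sm k (\<lambda>p x. f p x - g p x)"
	using sm_add[of k f "\<lambda>p x. - g p x"] by (simp add: sm_def)

lemma sm_integral:
	assumes f: "L1 f" and c: "\<forall>\<^sub>F p in F. continuous_on {0..1} (g p)" and b: "sm k g"
	shows "sm k (\<lambda>p x. integral {0..x} (\<lambda>u. f u * g p u))"
	unfolding sm_def
proof (intro allI impI)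
	fix \<delta> :: real assume \<delta>: "\<delta> > 0"
	define L where "L = integral {0..1} (\<lambda>u. norm (f u))"
	have L: "L >= 0" unfolding L_def by (rule integral_nonneg[OF L1_norm_integrable[OF f]]) simp
	define d where "d = \<delta> / (L + 1)"
	have "d > 0" using \<delta> L by (simp add: d_def)
	then have d: "\<forall>\<^sub>F p in F. \<forall>x\<in>{0..1}. norm (g p x) * hh p ^ k <= d" using b unfolding sm_def by blast
	show "\<forall>\<^sub>F p in F. \<forall>x\<in>{0..1}. norm (integral {0..x} (\<lambda>u. f u * g p u)) * hh p ^ k <= \<delta>"
		using c d hh_ge[of 1]
	proof eventually_elim
		case (elim p)
		show ?case
		proof
			fix x :: real assume x: "x \<in> {0..1}"
			have h: "hh p ^ k > 0" using elim(3) by simp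
			have "norm (integral {0..x} (\<lambda>u. f u * g p u)) <= (d / hh p ^ k) * L"
				unfolding L_def
				by (rule norm_integral_mult_le[OF f elim(1) _ x]) (use elim(2) h in \<open>simp add: pos_le_divide_eq\<close>)
			then have "norm (integral {0..x} (\<lambda>u. f u * g p u)) * hh p ^ k <= ((d / hh p ^ k) * L) * hh p ^ k"
				by (intro mult_right_mono) auto
			also have "\<dots> = d*L" using h by simp
			also have "\<dots> <= \<delta>" using \<delta> L by (simp add: d_def field_simps)
			finally show "norm (integral {0..x} (\<lambda>u. f u * g p u)) * hh p ^ k <= \<delta>" .
		qed
	qed
qed

lemma bv_imp_bd: "bv k f ==> bd k f"
	unfolding bv_def bd_def by (elim exE, rule exI, erule eventually_mono, elim conjE, assumption)

lemma bv_const: "ac f f' ==> bv 0 (\<lambda>_. f)"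
proof -
	assume f: "ac f f'"
	obtain B where B: "\<And>u. u \<in> {0..1} ==> norm (f u) <= B" using ac_bounded[OF ac_continuous[OF f]] by blast
	show ?thesis unfolding bv_def
		by (rule exI[of _ "\<lambda>_. f'"], rule exI[of _ "max B (integral {0..1} (\<lambda>x. norm (f' x)))"])
			 (use f B in \<open>auto simp: le_max_iff_disj\<close>)
qed

lemma bv_add: assumes "bv k f" "bv k g" shows "bv k (\<lambda>p x. f p x + g p x)"
proof -
	obtain f' c where c: "\<forall>\<^sub>F p in F. ac (f p) (f' p) \<and> (\<forall>x\<in>{0..1}. norm (f p x) * hh p ^ k <= c) \<and>
		 integral {0..1} (\<lambda>x. norm (f' p x)) * hh p ^ k <= c" using assms unfolding bv_def by blast
	obtain g' d where d: "\<forall>\<^sub>F p in F. ac (g p) (g' p) \<and> (\<forall>x\<in>{0..1}. norm (g p x) * hh p ^ k <= d) \<and>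
		 integral {0..1} (\<lambda>x. norm (g' p x)) * hh p ^ k <= d" using assms unfolding bv_def by blast
	have "\<forall>\<^sub>F p in F. ac (\<lambda>x. f p x + g p x) (\<lambda>x. f' p x + g' p x) \<and> (\<forall>x\<in>{0..1}. norm (f p x + g p x) * hh p ^ k <= c + d) \<and>
		 integral {0..1} (\<lambda>x. norm (f' p x + g' p x)) * hh p ^ k <= c + d"
		using c d
	proof eventually_elim
		case (elim p)
		have a: "ac (f p) (f' p)" "ac (g p) (g' p)" using elim by blast+
		note n = L1_norm_integrable[OF acD(1)]
		have "integral {0..1} (\<lambda>x. norm (f' p x + g' p x)) <= integral {0..1} (\<lambda>x. norm (f' p x) + norm (g' p x))"
			by (rule integral_le[OF n[OF ac_add[OF a]] integrable_add[OF n[OF a(1)] n[OF a(2)]]]) (rule norm_triangle_ineq)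
		also have "\<dots> = integral {0..1} (\<lambda>x. norm (f' p x)) + integral {0..1} (\<lambda>x. norm (g' p x))"
			by (rule integral_add[OF n[OF a(1)] n[OF a(2)]])
		finally have "integral {0..1} (\<lambda>x. norm (f' p x + g' p x)) * hh p ^ k <= (integral {0..1} (\<lambda>x. norm (f' p x)) + integral {0..1} (\<lambda>x. norm (g' p x))) * hh p ^ k"
			by (intro mult_right_mono) auto
		moreover have "norm (f p x + g p x) * hh p ^ k <= (norm (f p x) + norm (g p x)) * hh p ^ k" for x
			by (intro mult_right_mono norm_triangle_ineq) simp
		moreover have "(norm (f p x) + norm (g p x)) * hh p ^ k <= c + d" if "x \<in> {0..1}" for x
			using elim that unfolding distrib_right by (intro add_mono) blast+
		moreover have "(integral {0..1} (\<lambda>x. norm (f' p x)) + integral {0..1} (\<lambda>x. norm (g' p x))) * hh p ^ k <= c + d"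
			using elim unfolding distrib_right by (intro add_mono) blast+
		ultimately show ?case using ac_add[OF a] by (intro conjI ballI) (assumption, blast intro: order_trans, linarith)
	qed
	then show ?thesis unfolding bv_def by (intro exI)
qed

lemma bv_mult: assumes "bv j f" "bv k g" shows "bv (j + k) (\<lambda>p x. f p x * g p x)"
proof -
	obtain f' c where c: "\<forall>\<^sub>F p in F. ac (f p) (f' p) \<and> (\<forall>x\<in>{0..1}. norm (f p x) * hh p ^ j <= c) \<and>
		 integral {0..1} (\<lambda>x. norm (f' p x)) * hh p ^ j <= c" using assms unfolding bv_def by blast
	obtain g' d where d: "\<forall>\<^sub>F p in F. ac (g p) (g' p) \<and> (\<forall>x\<in>{0..1}. norm (g p x) * hh p ^ k <= d) \<and>
		 integral {0..1} (\<lambda>x. norm (g' p x)) * hh p ^ k <= d" using assms unfolding bv_def by blast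
	have "\<forall>\<^sub>F p in F. ac (\<lambda>x. f p x * g p x) (\<lambda>x. f' p x * g p x + f p x * g' p x) \<and> (\<forall>x\<in>{0..1}. norm (f p x * g p x) * hh p ^ (j + k) <= 2 * (c*d)) \<and>
		 integral {0..1} (\<lambda>x. norm (f' p x * g p x + f p x * g' p x)) * hh p ^ (j + k) <= 2 * (c*d)"
		using c d hh_ge[of 1]
	proof eventually_elim
		case (elim p)
		have a: "ac (f p) (f' p)" "ac (g p) (g' p)" using elim by blast+
		have h: "hh p ^ j > 0" "hh p ^ k > 0" using elim(3) by simp_all
		have b1: "norm (f p x) <= c / hh p ^ j" "norm (g p x) <= d / hh p ^ k" if "x \<in> {0..1}" for x
			using elim(1,2) that h by (simp_all add: pos_le_divide_eq)
		have b2: "integral {0..1} (\<lambda>x. norm (f' p x)) <= c / hh p ^ j" "integral {0..1} (\<lambda>x. norm (g' p x)) <= d / hh p ^ k"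
			using elim(1,2) h by (simp_all add: pos_le_divide_eq)
		have pos: "c / hh p ^ j >= 0" "d / hh p ^ k >= 0"
			by (rule order_trans[OF norm_ge_zero b1(1)[of 0]], simp) (rule order_trans[OF norm_ge_zero b1(2)[of 0]], simp)
		have cd: "c >= 0" "d >= 0" using pos h by (simp_all only: pos_le_divide_eq mult_zero_left)
		note n = L1_norm_integrable[OF acD(1)]
		have "integral {0..1} (\<lambda>x. norm (f' p x * g p x + f p x * g' p x)) <= integral {0..1} (\<lambda>x. norm (f' p x) * (d / hh p ^ k) + (c / hh p ^ j) * norm (g' p x))"
		proof (rule integral_le[OF n[OF ac_mult[OF a]] integrable_add[OF integrable_on_mult_left[OF n[OF a(1)]] integrable_on_mult_right[OF n[OF a(2)]]]])
			fix x :: real assume x: "x \<in> {0..1}"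
			have "norm (f' p x * g p x + f p x * g' p x) <= norm (f' p x) * norm (g p x) + norm (f p x) * norm (g' p x)"
				by (rule order_trans[OF norm_triangle_ineq]) (simp only: norm_mult order_refl)
			also have "\<dots> <= norm (f' p x) * (d / hh p ^ k) + (c / hh p ^ j) * norm (g' p x)"
				by (intro add_mono mult_left_mono mult_right_mono b1 x) auto
			finally show "norm (f' p x * g p x + f p x * g' p x) <= norm (f' p x) * (d / hh p ^ k) + (c / hh p ^ j) * norm (g' p x)" .
		qed
		also have "\<dots> = integral {0..1} (\<lambda>x. norm (f' p x)) * (d / hh p ^ k) + (c / hh p ^ j) * integral {0..1} (\<lambda>x. norm (g' p x))"
			by (subst integral_add[OF integrable_on_mult_left[OF n[OF a(1)]] integrable_on_mult_right[OF n[OF a(2)]]]) simp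
		also have "\<dots> <= (c / hh p ^ j) * (d / hh p ^ k) + (c / hh p ^ j) * (d / hh p ^ k)"
			by (intro add_mono mult_left_mono mult_right_mono b2 pos)
		also have "\<dots> = 2 * (c*d) / hh p ^ (j + k)" by (simp add: power_add)
		finally have I: "integral {0..1} (\<lambda>x. norm (f' p x * g p x + f p x * g' p x)) * hh p ^ (j + k) <= 2 * (c*d)"
			using h by (simp add: pos_le_divide_eq power_add)
		have "norm (f p x * g p x) * hh p ^ (j + k) <= 2 * (c*d)" if x: "x \<in> {0..1}" for x
		proof -
			have "norm (f p x * g p x) <= (c / hh p ^ j) * (d / hh p ^ k)"
				unfolding norm_mult by (intro mult_mono b1 x pos) auto
			then have "norm (f p x * g p x) * hh p ^ (j + k) <= c*d" using h by (simp add: pos_le_divide_eq power_add)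
			also have "\<dots> <= 2 * (c*d)" using cd by simp
			finally show ?thesis .
		qed
		then show ?case using I ac_mult[OF a] by blast
	qed
	then show ?thesis unfolding bv_def by (intro exI)
qed

lemma bv_Suc: assumes "bv (Suc k) f" shows "bv k f"
proof -
	obtain f' c where c: "\<forall>\<^sub>F p in F. ac (f p) (f' p) \<and> (\<forall>x\<in>{0..1}. norm (f p x) * hh p ^ Suc k <= c) \<and>
		 integral {0..1} (\<lambda>x. norm (f' p x)) * hh p ^ Suc k <= c" using assms unfolding bv_def by blast
	have "\<forall>\<^sub>F p in F. ac (f p) (f' p) \<and> (\<forall>x\<in>{0..1}. norm (f p x) * hh p ^ k <= c) \<and>
		 integral {0..1} (\<lambda>x. norm (f' p x)) * hh p ^ k <= c"
		using c hh_ge[of 1]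
	proof eventually_elim
		case (elim p)
		have a: "ac (f p) (f' p)" using elim by blast
		have le: "t * hh p ^ k <= t * hh p ^ Suc k" if "t >= 0" for t
			using that elim(2) by (intro mult_left_mono power_increasing) auto
		have "integral {0..1} (\<lambda>x. norm (f' p x)) >= 0"
			by (rule integral_nonneg[OF L1_norm_integrable[OF acD(1)[OF a]]]) simp
		from le[OF this] le[OF norm_ge_zero] show ?case using elim by (meson order_trans)
	qed
	then show ?thesis unfolding bv_def by blast
qed

lemma bv_le: "bv k f ==> j <= k ==> bv j f"
	by (induction k) (auto simp: le_Suc_eq intro: bv_Suc)

text \<open>A Riemann-Lebesgue lemma with a moving factor, uniform in the endpoint x.
  \<open>f\<close> is replaced by a smooth \<open>r\<close> close in mean; then r g is integrated by
  parts against the mode. The variation bound in \<open>bv\<close> keeps the resulting integral of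
  (r g)' of the same order as g, so that this part gains 1/|m|.\<close>

lemma sm_riemann_lebesgue:
	assumes f: "L1 f" and g: "bv k g"
	shows "sm k (\<lambda>p x. integral {0..x} (\<lambda>u. f u * g p u * emode (m p) u))"
	unfolding sm_def
proof (intro allI impI)
	fix \<delta> :: real assume \<delta>: "\<delta> > 0"
	obtain g' c0 where c0: "\<forall>\<^sub>F p in F. ac (g p) (g' p) \<and> (\<forall>x\<in>{0..1}. norm (g p x) * hh p ^ k <= c0) \<and>
		 integral {0..1} (\<lambda>x. norm (g' p x)) * hh p ^ k <= c0" using g unfolding bv_def by blast
	define c where "c = max c0 1"
	have c: "c > 0" "c0 <= c" by (auto simp: c_def)
	define d where "d = \<delta> / (2*c)"
	have d: "d > 0" using \<delta> c by (simp add: d_def)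
	obtain r r' where r: "\<And>x. (r has_vector_derivative r' x) (at x)" "continuous_on UNIV r'"
		"continuous_on UNIV r" "integral {0..1} (\<lambda>x. norm (f x - r x)) < d"
		using L1_approx_polynomial[OF f d] by blast
	have rc: "continuous_on {0..1} r" "continuous_on {0..1} r'" using r(2,3) by (auto intro: continuous_on_subset)
	have rac: "ac r r'" by (rule ac_C1[OF has_vector_derivative_at_within[OF r(1)] rc(2)])
	have fr: "L1 (\<lambda>u. f u - r u)"
		by (rule set_integral_diff(1)[OF f absolutely_integrable_continuous_real[OF rc(1)]])
	obtain B1 where B1: "B1 > 0" "\<And>u. u \<in> {0..1} ==> norm (r u) <= B1" using ac_bounded[OF rc(1)] by blast
	obtain B2 where B2: "B2 > 0" "\<And>u. u \<in> {0..1} ==> norm (r' u) <= B2" using ac_bounded[OF rc(2)] by blast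
	define B where "B = B1 + B2"
	have B: "B > 0" "\<And>u. u \<in> {0..1} ==> norm (r u) <= B" "\<And>u. u \<in> {0..1} ==> norm (r' u) <= B"
		using B1 B2 by (auto simp: B_def intro: add_increasing add_increasing2 less_imp_le)
	show "\<forall>\<^sub>F p in F. \<forall>x\<in>{0..1}. norm (integral {0..x} (\<lambda>u. f u * g p u * emode (m p) u)) * hh p ^ k <= \<delta>"
		\<comment> \<open>The smooth part is at most 4 B b / |m|; beyond 8 B c / \<delta> this is below b
		  d, the bound of the rough part.\<close>
		using c0 hh_ge[of 1] hh_ge[of "8*B*c/\<delta>"]
	proof eventually_elim
		case (elim p)
		have a: "ac (g p) (g' p)" using elim by blast
		have gc: "continuous_on {0..1} (g p)" by (rule ac_continuous[OF a])
		have h: "hh p ^ k > 0" "hh p > 0" and m0: "m p \<noteq> 0" using elim(2) by auto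
		define b where "b = c / hh p ^ k"
		have b0: "b > 0" using c h by (simp add: b_def)
		have b1: "norm (g p x) <= b" if "x \<in> {0..1}" for x
			using elim(1) that h c(2) unfolding b_def by (auto simp: pos_le_divide_eq intro: order_trans)
		have b2: "integral {0..1} (\<lambda>x. norm (g' p x)) <= b"
			using elim(1) h c(2) unfolding b_def by (auto simp: pos_le_divide_eq intro: order_trans)
		show ?case
		proof
			fix x :: real assume x: "x \<in> {0..1}"
			have gec: "continuous_on {0..1} (\<lambda>u. g p u * emode (m p) u)" by (intro continuous_intros gc emode_continuous)
			note i1 = L1_Icc_mono[OF L1_mult_continuous[OF fr gec] x, THEN L1_integrable]
			note i2 = L1_Icc_mono[OF absolutely_integrable_continuous_real[OF continuous_on_mult[OF rc(1) gec]] x, THEN L1_integrable]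
			have "integral {0..x} (\<lambda>u. f u * g p u * emode (m p) u)
					= integral {0..x} (\<lambda>u. (f u - r u) * (g p u * emode (m p) u) + r u * (g p u * emode (m p) u))"
				by (rule integral_cong) (simp add: algebra_simps)
			also have "\<dots> = integral {0..x} (\<lambda>u. (f u - r u) * (g p u * emode (m p) u)) + integral {0..x} (\<lambda>u. r u * (g p u * emode (m p) u))"
				by (rule integral_add[OF i1 i2])
			finally have split: "integral {0..x} (\<lambda>u. f u * g p u * emode (m p) u) = integral {0..x} (\<lambda>u. (f u - r u) * (g p u * emode (m p) u)) + integral {0..x} (\<lambda>u. r u * (g p u * emode (m p) u))" .
			have I1: "norm (integral {0..x} (\<lambda>u. (f u - r u) * (g p u * emode (m p) u))) <= b * integral {0..1} (\<lambda>u. norm (f u - r u))"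
				by (rule norm_integral_mult_le[OF fr gec _ x]) (simp add: norm_mult norm_emode b1)
			also have "\<dots> <= b*d" using r(4) b0 by (intro mult_left_mono) auto
			finally have I1: "norm (integral {0..x} (\<lambda>u. (f u - r u) * (g p u * emode (m p) u))) <= b*d" .
			let ?D = "\<lambda>u. r' u * g p u + r u * g' p u"
			have rg: "ac (\<lambda>u. r u * g p u) ?D" by (rule ac_mult[OF rac a])
			have nD: "norm (integral {0..x} (\<lambda>u. ?D u * emode (m p) u)) <= integral {0..1} (\<lambda>u. B*b + B * norm (g' p u))"
			proof (rule norm_integral_le[OF L1_mult_continuous[OF acD(1)[OF rg] emode_continuous] x])
				show "(\<lambda>u. B*b + B * norm (g' p u)) integrable_on {0..1}"
					by (intro integrable_add integrable_const_ivl integrable_on_mult_right L1_norm_integrable[OF acD(1)[OF a]])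
				fix u :: real assume u: "u \<in> {0..1}"
				have "norm (?D u * emode (m p) u) <= norm (r' u) * norm (g p u) + norm (r u) * norm (g' p u)"
					unfolding norm_mult norm_emode mult_1_right by (rule order_trans[OF norm_triangle_ineq]) (simp only: norm_mult order_refl)
				also have "\<dots> <= B*b + B * norm (g' p u)"
					by (intro add_mono mult_mono B b1 u) (use B in auto)
				finally show "norm (?D u * emode (m p) u) <= B*b + B * norm (g' p u)" .
			qed
			also have "\<dots> = B*b + B * integral {0..1} (\<lambda>u. norm (g' p u))"
				by (subst integral_add[OF integrable_const_ivl integrable_on_mult_right[OF L1_norm_integrable[OF acD(1)[OF a]]]]) simp
			also have "\<dots> <= B*b + B*b" using b2 B by (intro add_left_mono mult_left_mono) auto
			finally have nD: "norm (integral {0..x} (\<lambda>u. ?D u * emode (m p) u)) <= 2 * (B*b)" by simp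
			have rgb: "norm (r u * g p u) <= B*b" if "u \<in> {0..1}" for u
				unfolding norm_mult by (intro mult_mono B b1 that) (use B in auto)
			have "integral {0..x} (\<lambda>u. r u * (g p u * emode (m p) u)) = integral {0..x} (\<lambda>u. (r u * g p u) * emode (m p) u)"
				by (simp add: mult.assoc)
			also have "\<dots> = (r 0 * g p 0 - r x * g p x * emode (m p) x + integral {0..x} (\<lambda>u. ?D u * emode (m p) u)) / (2*pi*\<i> * of_int (m p))"
				by (rule integral_emode_parts[OF rg m0 x])
			also have "norm \<dots> = norm (r 0 * g p 0 - r x * g p x * emode (m p) x + integral {0..x} (\<lambda>u. ?D u * emode (m p) u)) / (2*pi * hh p)"
				by (simp add: norm_divide norm_mult)
			also have "\<dots> <= (B*b + B*b + 2 * (B*b)) / (1 * hh p)"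
			proof (rule frac_le)
				have "norm (r 0 * g p 0 - r x * g p x * emode (m p) x) <= norm (r 0 * g p 0) + norm (r x * g p x * emode (m p) x)"
					by (rule norm_triangle_ineq4)
				also have "\<dots> <= B*b + B*b" using rgb[of 0] rgb[OF x] by (simp add: norm_mult norm_emode)
				finally show "norm (r 0 * g p 0 - r x * g p x * emode (m p) x + integral {0..x} (\<lambda>u. ?D u * emode (m p) u)) <= B*b + B*b + 2 * (B*b)"
					using nD norm_triangle_ineq[of "r 0 * g p 0 - r x * g p x * emode (m p) x" "integral {0..x} (\<lambda>u. ?D u * emode (m p) u)"] by linarith
				show "1 * hh p <= 2*pi * hh p" using pi_ge_two h by (intro mult_right_mono) auto
			qed (use h B b0 in auto)
			finally have I2: "norm (integral {0..x} (\<lambda>u. r u * (g p u * emode (m p) u))) <= 4*B*b / hh p" by simp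
			have "4*B*b / hh p <= b*d"
			proof -
				have "8*B*c <= \<delta> * hh p" using elim(3) \<delta> by (simp add: field_simps)
				then have "4*B <= d * hh p" using c by (simp add: d_def field_simps)
				then have "4*B*b <= d * hh p * b" using b0 by (intro mult_right_mono) auto
				then show ?thesis using h(2) by (simp add: pos_divide_le_eq mult_ac)
			qed
			then have "norm (integral {0..x} (\<lambda>u. f u * g p u * emode (m p) u)) <= b*d + b*d"
				unfolding split by (rule order_trans[OF norm_triangle_ineq add_mono[OF I1 order_trans[OF I2]]])
			also have "\<dots> = \<delta> / hh p ^ k" using c by (simp add: b_def d_def)
			finally show "norm (integral {0..x} (\<lambda>u. f u * g p u * emode (m p) u)) * hh p ^ k <= \<delta>"
				using h by (simp add: pos_le_divide_eq)
		qed
	qed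
qed

end

section \<open>The off-diagonal element near a resonance\<close>

text \<open>Pairs (m, \<mu>) with |m| tending to infinity and \<mu> within C/|m| of \<pi> m. Putting
  \<mu> into the filter makes every eventual statement uniform over these \<mu>.\<close>

definition near :: "real => (int \<times> complex) filter" where
	"near C = inf (filtercomap (\<lambda>p. real_of_int \<bar>fst p\<bar>) at_top)
		 (principal {p. norm (snd p - pim (fst p)) <= C / real_of_int \<bar>fst p\<bar>})"

lemma near_lim: "filterlim (\<lambda>p. real_of_int \<bar>fst p\<bar>) at_top (near C)"
	unfolding near_def by (rule filterlim_mono[OF filterlim_filtercomap order_refl inf_le1])

lemma eventually_near:
	"eventually P (near C) \<longleftrightarrow> (\<exists>N. \<forall>m \<mu>. real_of_int \<bar>m\<bar> >= N -->
		 norm (\<mu> - pim m) <= C / real_of_int \<bar>m\<bar> --> P (m, \<mu>))"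
	unfolding near_def eventually_inf_principal eventually_filtercomap_at_top_linorder by auto

lemma (in scale) bd_power: "bd k f ==> bd (n * k) (\<lambda>p x. f p x ^ n)"
proof (induction n)
	case 0
	then show ?case using bd_const[of "\<lambda>_. 1"] by simp
next
	case (Suc n)
	then show ?case using bd_mult[of k f "n * k" "\<lambda>p x. f p x ^ n"] by simp
qed

lemma (in scale) sm_at_1:
	assumes "sm k f"
	shows "sm k (\<lambda>p x. f p 1)"
	unfolding sm_def
proof (intro allI impI)
	fix \<delta> :: real assume "\<delta> > 0"
	then have "\<forall>\<^sub>F p in F. \<forall>x\<in>{0..1}. norm (f p x) * hh p ^ k <= \<delta>" using assms unfolding sm_def by blast
	then show "\<forall>\<^sub>F p in F. \<forall>x\<in>{0..1::real}. norm (f p 1) * hh p ^ k <= \<delta>" by eventually_elim simp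
qed

lemma (in scale) bdI: "\<forall>\<^sub>F p in F. \<forall>x\<in>{0..1}. norm (f p x) * hh p ^ k <= c ==> bd k f"
	unfolding bd_def by blast

context gauge
begin

lemma w_continuous: "continuous_on {0..1} (w \<mu>)"
	unfolding w_def[abs_def] by (intro continuous_intros ac_continuous[OF sg_ac])

lemma kap_continuous: "continuous_on {0..1} (kap \<mu>)"
	unfolding kap_def[abs_def] by (intro continuous_intros ac_continuous[OF ff_ac]) (simp add: ff_nz)

lemma PG_continuous:
	assumes "1 + K <= norm \<mu>"
	shows "continuous_on {0..1} (PP \<mu> a b)" "continuous_on {0..1} (GG \<mu> a b)"
	by (rule ac_continuous[OF PG_ac(1)[OF assms]], rule ac_continuous[OF PG_ac(2)[OF assms]])

lemma winv_continuous:
	assumes "1 + K <= norm \<mu>"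
	shows "continuous_on {0..1} (\<lambda>x. 1 / w \<mu> x)"
proof -
	have "w \<mu> x \<noteq> 0" if "x \<in> {0..1}" for x using w_bound(2)[OF assms that] assms K by auto
	then show ?thesis by (intro continuous_intros w_continuous) auto
qed

text \<open>Equals \<open>w\<close> times the solution times \<open>ff (- \<mu>)\<close>: the factor
  of the residual in the derivative of \<open>PP \<mu> 0 1\<close>.\<close>

definition H :: "complex => real => complex" where "H \<mu> x = PP \<mu> 0 1 x + kap \<mu> x * GG \<mu> 0 1 x"

lemma H_continuous: "1 + K <= norm \<mu> ==> continuous_on {0..1} (H \<mu>)"
	unfolding H_def[abs_def] by (intro continuous_intros kap_continuous PG_continuous)

text \<open>Isolates the leading term. Replacing 1/\<open>w\<close> by \<open>zeta\<close> costs
  O(m^(-3)) (see \<open>winv_bd\<close>), and the term with \<open>X\<close> carries one more factor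
  \<open>zeta\<close>.\<close>

lemma PP_expand:
	assumes mu: "1 + K <= norm \<mu>" and x: "x \<in> {0..1}"
	shows "PP \<mu> 0 1 x = - (zeta (- \<mu>) ^ s) * (zeta \<mu> * integral {0..x} (\<lambda>u. A u * H \<mu> u)
		 + integral {0..x} (\<lambda>u. A u * ((1 / w \<mu> u - zeta \<mu>) * H \<mu> u))
		 - zeta \<mu> * integral {0..x} (\<lambda>u. X (zeta (- \<mu>)) u * (1 / w \<mu> u * H \<mu> u)))"
proof -
	note Hc = H_continuous[OF mu] and wc = winv_continuous[OF mu]
	have c1: "continuous_on {0..1} (\<lambda>u. (1 / w \<mu> u - zeta \<mu>) * H \<mu> u)"
		and c2: "continuous_on {0..1} (\<lambda>u. X (zeta (- \<mu>)) u * (1 / w \<mu> u * H \<mu> u))"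
		by (intro continuous_intros Hc wc X_cont)+
	note i1 = L1_Icc_mono[OF L1_mult_continuous[OF A_int Hc] x, THEN L1_integrable]
	note i2 = L1_Icc_mono[OF L1_mult_continuous[OF A_int c1] x, THEN L1_integrable]
	note i3 = L1_Icc_mono[OF absolutely_integrable_continuous_real[OF c2] x, THEN L1_integrable]
	define Z where "Z = - (zeta (- \<mu>) ^ s)"
	have "PP \<mu> 0 1 x = integral {0..x} (\<lambda>x. - (rr (- \<mu>) x / w \<mu> x) * H \<mu> x)"
		using acD(2)[OF PG_ac(1)[OF mu] x, of 0 1] PG_0[OF mu] by (simp add: H_def)
	also have "\<dots> = integral {0..x} (\<lambda>u. Z * ((zeta \<mu> * (A u * H \<mu> u) + A u * ((1 / w \<mu> u - zeta \<mu>) * H \<mu> u)) - zeta \<mu> * (X (zeta (- \<mu>)) u * (1 / w \<mu> u * H \<mu> u))))"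
		by (rule integral_cong) (simp add: rr_def Z_def zeta_minus algebra_simps add_divide_distrib diff_divide_distrib)
	also have "\<dots> = Z * integral {0..x} (\<lambda>u. (zeta \<mu> * (A u * H \<mu> u) + A u * ((1 / w \<mu> u - zeta \<mu>) * H \<mu> u)) - zeta \<mu> * (X (zeta (- \<mu>)) u * (1 / w \<mu> u * H \<mu> u)))"
		by simp
	also have "integral {0..x} (\<lambda>u. (zeta \<mu> * (A u * H \<mu> u) + A u * ((1 / w \<mu> u - zeta \<mu>) * H \<mu> u)) - zeta \<mu> * (X (zeta (- \<mu>)) u * (1 / w \<mu> u * H \<mu> u)))
		 = integral {0..x} (\<lambda>u. zeta \<mu> * (A u * H \<mu> u) + A u * ((1 / w \<mu> u - zeta \<mu>) * H \<mu> u)) - integral {0..x} (\<lambda>u. zeta \<mu> * (X (zeta (- \<mu>)) u * (1 / w \<mu> u * H \<mu> u)))"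
		by (rule integral_diff[OF integrable_add[OF integrable_on_mult_right[OF i1] i2] integrable_on_mult_right[OF i3]])
	also have "integral {0..x} (\<lambda>u. zeta \<mu> * (A u * H \<mu> u) + A u * ((1 / w \<mu> u - zeta \<mu>) * H \<mu> u))
		 = integral {0..x} (\<lambda>u. zeta \<mu> * (A u * H \<mu> u)) + integral {0..x} (\<lambda>u. A u * ((1 / w \<mu> u - zeta \<mu>) * H \<mu> u))"
		by (rule integral_add[OF integrable_on_mult_right[OF i1] i2])
	finally show ?thesis unfolding Z_def by (simp only: integral_mult_right)
qed

text \<open>\<open>kap\<close> with the fast mode \<open>emode m\<close> divided out. Near \<pi> m
  it is 1 + O(1/m), also in variation, so it is admissible as moving factor in
  \<open>sm_riemann_lebesgue\<close>.\<close>

definition kap0 :: "int \<times> complex => real => complex" where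
	"kap0 p x = exp (integral {0..x} (\<lambda>u. - (2*\<i>) * (snd p - pim (fst p)) + (T (zeta (- snd p)) u - T (zeta (snd p)) u)))"

abbreviation dkap0 :: "int \<times> complex => real => complex" where
	"dkap0 p x \<equiv> - (2*\<i>) * (snd p - pim (fst p)) + (T (zeta (- snd p)) x - T (zeta (snd p)) x)"

lemma dkap0_continuous: "continuous_on {0..1} (dkap0 p)"
	by (intro continuous_intros ac_continuous[OF T_ac])

lemma kap0_ac: "ac (kap0 p) (\<lambda>x. dkap0 p x * kap0 p x)"
	unfolding kap0_def[abs_def] by (rule ac_exp_integral[OF dkap0_continuous])

lemma kap_kap0:
	assumes "x \<in> {0..1}"
	shows "kap \<mu> x = kap0 (m, \<mu>) x * emode m x"
proof -
	have i: "(\<lambda>u. T (zeta (- \<mu>)) u - T (zeta \<mu>) u) integrable_on {0..x}"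
		by (rule integrable_Icc_mono[OF integrable_continuous_real assms]) (intro continuous_intros ac_continuous[OF T_ac])
	have "integral {0..x} (dkap0 (m, \<mu>)) = - (2*\<i>) * (\<mu> - pim m) * of_real x + integral {0..x} (\<lambda>u. T (zeta (- \<mu>)) u - T (zeta \<mu>) u)"
		unfolding fst_conv snd_conv using assms
		by (subst integral_add[OF integrable_const_ivl i]) (simp add: scaleR_conv_of_real)
	then have "kap0 (m, \<mu>) x = exp (- (2*\<i>) * (\<mu> - pim m) * of_real x + integral {0..x} (\<lambda>u. T (zeta (- \<mu>)) u - T (zeta \<mu>) u))"
		unfolding kap0_def by (simp only:)
	then show ?thesis
		unfolding emode_def kap_eq[OF assms] by (simp only: exp_add[symmetric]) (simp add: algebra_simps)
qed

context
	fixes C0 :: real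
	assumes C0: "C0 >= 0"
begin

interpretation scale "near C0" fst
	by unfold_locales (rule near_lim)

lemma near_basic:
	"\<forall>\<^sub>F p in near C0. 1 + K <= norm (snd p) \<and> \<bar>Im (snd p)\<bar> <= 2 \<and> rate (snd p) <= 1/4 \<and> hh p <= norm (snd p) \<and> hh p >= 1
		 \<and> norm (snd p - pim (fst p)) <= C0 / hh p"
	unfolding eventually_near
proof (intro exI[of _ "1 + K + 4 * ((1 + exp 5) * mass) + C0"] allI impI)
	fix m :: int and \<mu> :: complex
	assume N: "1 + K + 4 * ((1 + exp 5) * mass) + C0 <= real_of_int \<bar>m\<bar>" and c: "norm (\<mu> - pim m) <= C0 / real_of_int \<bar>m\<bar>"
	define h where "h = real_of_int \<bar>m\<bar>"
	have ms: "(1 + exp 5) * mass >= 0" using mass_nonneg by simp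
	have h: "h >= 1" "h >= C0" "h >= 1 + K + 4 * ((1 + exp 5) * mass)" "h >= 1 + K" using N K C0 ms by (auto simp: h_def)
	have d: "norm (\<mu> - pim m) <= 1"
		using c h(1,2) unfolding h_def[symmetric] by (smt (verit) divide_le_eq_1)
	have "norm (pim m :: complex) = pi*h" by (simp add: norm_mult h_def)
	moreover have "3*h <= pi*h" using pi_gt3 h(1) by (intro mult_right_mono) auto
	ultimately have mu: "h <= norm \<mu>" using norm_triangle_sub[of "pim m" \<mu>] d h(1)
		unfolding norm_minus_commute[of "pim m"] by linarith
	have "Im \<mu> = Im (\<mu> - pim m)" by simp
	then have "\<bar>Im \<mu>\<bar> <= 2" using abs_Im_le_cmod[of "\<mu> - pim m"] d by linarith
	moreover have "rate \<mu> <= 1/4" by (rule rate_small) (use mu h(3) in linarith)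
	ultimately show "1 + K <= norm (snd (m, \<mu>)) \<and> \<bar>Im (snd (m, \<mu>))\<bar> <= 2 \<and> rate (snd (m, \<mu>)) <= 1/4 \<and> real_of_int \<bar>fst (m, \<mu>)\<bar> <= norm (snd (m, \<mu>)) \<and> real_of_int \<bar>fst (m, \<mu>)\<bar> >= 1
		 \<and> norm (snd (m, \<mu>) - pim (fst (m, \<mu>))) <= C0 / real_of_int \<bar>fst (m, \<mu>)\<bar>"
		using h mu c by (simp add: h_def)
qed

lemma zeta_bd: "bd 1 (\<lambda>p x. zeta (snd p))"
proof (rule bdI[where c=1])
	show "\<forall>\<^sub>F p in near C0. \<forall>x\<in>{0..1}. norm (zeta (snd p)) * hh p ^ 1 <= 1"
		using near_basic
	proof eventually_elim
		case (elim p)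
		have "hh p <= 2 * norm (snd p)" "norm (snd p) > 0" using elim by linarith+
		then show ?case by (simp add: norm_zeta)
	qed
qed

lemma zeta_minus_bd: "bd 1 (\<lambda>p x. zeta (- snd p))"
	using zeta_bd by (simp add: bd_def zeta_minus)

lemma winv_bd: "bd 3 (\<lambda>p x. 1 / w (snd p) x - zeta (snd p))"
proof (rule bdI[where c=K])
	show "\<forall>\<^sub>F p in near C0. \<forall>x\<in>{0..1}. norm (1 / w (snd p) x - zeta (snd p)) * hh p ^ 3 <= K"
		using near_basic
	proof eventually_elim
		case (elim p)
		show ?case
		proof
			fix x :: real assume x: "x \<in> {0..1}"
			define \<mu> where "\<mu> = snd p"
			have mu: "1 + K <= norm \<mu>" "hh p <= norm \<mu>" "norm \<mu> > 0" "hh p >= 1" using elim K unfolding \<mu>_def by linarith+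
			have nz: "w \<mu> x \<noteq> 0" "\<mu> \<noteq> 0" using w_bound(2)[OF mu(1) x] mu(3) by auto
			have "1 / w \<mu> x - zeta \<mu> = - (w \<mu> x - 2*\<i>*\<mu>) / (w \<mu> x * (2*\<i>*\<mu>))"
				using nz by (simp add: zeta_def divide_simps)
			also have "norm \<dots> = norm (w \<mu> x - 2*\<i>*\<mu>) / (norm (w \<mu> x) * (2 * norm \<mu>))"
				by (simp add: norm_divide norm_mult norm_minus_commute)
			also have "\<dots> <= (K / norm \<mu>) / (norm \<mu> * (1 * norm \<mu>))"
				using w_bound[OF mu(1) x] mu K by (intro frac_le mult_mono) auto
			also have "\<dots> = K / norm \<mu> ^ 3" by (simp add: power3_eq_cube)
			finally have "norm (1 / w \<mu> x - zeta \<mu>) * hh p ^ 3 <= (K / norm \<mu> ^ 3) * norm \<mu> ^ 3"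
				using mu K by (intro mult_mono power_mono) auto
			then show "norm (1 / w (snd p) x - zeta (snd p)) * hh p ^ 3 <= K" using mu(3) by (simp add: \<mu>_def)
		qed
	qed
qed

lemma kap0_bounds:
	"\<forall>\<^sub>F p in near C0. \<forall>x\<in>{0..1}. norm (dkap0 p x) <= (2*C0 + K) / hh p \<and> norm (kap0 p x - 1) <= 2 * (2*C0 + K) / hh p \<and> norm (kap0 p x) <= 2"
	using near_basic hh_ge[of "2 * (2*C0 + K)"]
proof eventually_elim
	case (elim p)
	have mu: "1 + K <= norm (snd p)" "hh p <= norm (snd p)" "norm (snd p) > 0" "hh p >= 1"
		"norm (snd p - pim (fst p)) <= C0 / hh p" using elim K by linarith+
	have d: "norm (dkap0 p x) <= (2*C0 + K) / hh p" if x: "x \<in> {0..1}" for x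
	proof -
		have "T (zeta (- snd p)) x - T (zeta (snd p)) x = - (w (snd p) x - 2*\<i> * snd p)" by (simp add: w_eq)
		then have "norm (T (zeta (- snd p)) x - T (zeta (snd p)) x) <= K / norm (snd p)"
			using w_bound(1)[OF mu(1) x] by (simp only: norm_minus_cancel)
		also have "\<dots> <= K / hh p" using mu K by (intro divide_left_mono) auto
		finally have "norm (T (zeta (- snd p)) x - T (zeta (snd p)) x) <= K / hh p" .
		moreover have "norm (- (2*\<i>) * (snd p - pim (fst p))) <= 2 * (C0 / hh p)"
			unfolding norm_mult norm_minus_cancel using mu(5) by simp
		ultimately have "norm (dkap0 p x) <= 2 * (C0 / hh p) + K / hh p"
			by (rule order_trans[OF norm_triangle_ineq add_mono, rotated])
		then show ?thesis by (simp add: add_divide_distrib)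
	qed
	show ?case
	proof (intro ballI conjI d)
		fix x :: real assume x: "x \<in> {0..1}"
		have I: "norm (integral {0..x} (dkap0 p)) <= (2*C0 + K) / hh p"
			by (rule norm_integral_continuous_le[OF absolutely_integrable_continuous_real[OF dkap0_continuous] d x])
		also have "\<dots> <= 1/2" using elim(2) mu(4) by (simp add: field_simps)
		finally have I2: "norm (integral {0..x} (dkap0 p)) <= 1/2" .
		show "norm (kap0 p x) <= 2" unfolding kap0_def by (rule exp_bound_half[OF I2])
		show "norm (kap0 p x - 1) <= 2 * (2*C0 + K) / hh p"
			unfolding kap0_def times_divide_eq_right[symmetric]
			by (rule order_trans[OF norm_exp_minus_1[OF I2] mult_left_mono[OF I]]) simp
	qed
qed

lemma dkap0_bd: "bd 1 (\<lambda>p x. dkap0 p x * kap0 p x)"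
proof (rule bdI[where c="2 * (2*C0 + K)"])
	show "\<forall>\<^sub>F p in near C0. \<forall>x\<in>{0..1}. norm (dkap0 p x * kap0 p x) * hh p ^ 1 <= 2 * (2*C0 + K)"
		using kap0_bounds hh_ge[of 1]
	proof eventually_elim
		case (elim p)
		show ?case
		proof
			fix x :: real assume x: "x \<in> {0..1}"
			have h: "hh p > 0" using elim(2) by linarith
			have "norm (dkap0 p x * kap0 p x) <= (2*C0 + K) / hh p * 2"
				unfolding norm_mult using elim(1) x C0 K by (intro mult_mono) auto
			then have "norm (dkap0 p x * kap0 p x) * hh p <= ((2*C0 + K) / hh p * 2) * hh p" using h by (intro mult_right_mono) auto
			then show "norm (dkap0 p x * kap0 p x) * hh p ^ 1 <= 2 * (2*C0 + K)" using h by simp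
		qed
	qed
qed

lemma kap0_minus_1_bv: "bv 1 (\<lambda>p x. kap0 p x - 1)"
	unfolding bv_def
proof (intro exI[of _ "\<lambda>p x. dkap0 p x * kap0 p x"] exI[of _ "2 * (2*C0 + K)"])
	show "\<forall>\<^sub>F p in near C0. ac (\<lambda>x. kap0 p x - 1) (\<lambda>x. dkap0 p x * kap0 p x) \<and>
		 (\<forall>x\<in>{0..1}. norm (kap0 p x - 1) * hh p ^ 1 <= 2 * (2*C0 + K)) \<and> integral {0..1} (\<lambda>x. norm (dkap0 p x * kap0 p x)) * hh p ^ 1 <= 2 * (2*C0 + K)"
		using kap0_bounds hh_ge[of 1]
	proof eventually_elim
		case (elim p)
		have h: "hh p > 0" using elim(2) by linarith
		have a: "ac (\<lambda>x. kap0 p x - 1) (\<lambda>x. dkap0 p x * kap0 p x)"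
			using ac_diff[OF kap0_ac ac_const, of p 1] by simp
		have b: "norm (dkap0 p x * kap0 p x) <= (2*C0 + K) / hh p * 2" if "x \<in> {0..1}" for x
			unfolding norm_mult using elim(1) that C0 K by (intro mult_mono) auto
		have "integral {0..1} (\<lambda>x. norm (dkap0 p x * kap0 p x)) <= integral {0..1::real} (\<lambda>x. (2*C0 + K) / hh p * 2)"
			by (rule integral_le[OF L1_norm_integrable[OF acD(1)[OF a]] integrable_const_ivl b])
		then have "integral {0..1} (\<lambda>x. norm (dkap0 p x * kap0 p x)) * hh p <= ((2*C0 + K) / hh p * 2) * hh p"
			using h by (intro mult_right_mono) auto
		also have "\<dots> = 2 * (2*C0 + K)" using h by simp
		finally show ?case using a elim(1) h by (simp add: pos_le_divide_eq)
	qed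
qed

lemma const_bv: "bv 0 (\<lambda>_ _. c)" by (rule bv_const[OF ac_const])

lemma kap0_bv: "bv 0 kap0"
	using bv_add[OF bv_le[OF kap0_minus_1_bv, of 0] const_bv[of 1]] by simp

lemma rate_bound: "\<forall>\<^sub>F p in near C0. rate (snd p) * hh p ^ Suc s <= (1 + exp 5) * mass"
	using near_basic
proof eventually_elim
	case (elim p)
	have mu: "hh p <= norm (snd p)" "norm (snd p) > 0" "hh p >= 1" using elim K by linarith+
	have "norm (zeta (snd p)) * hh p <= 1"
	proof -
		have "hh p <= 2 * norm (snd p)" "norm (snd p) > 0" using mu by linarith+
		then show ?thesis by (simp add: norm_zeta)
	qed
	then have 1: "(norm (zeta (snd p)) * hh p) ^ s <= 1" by (intro power_le_one) auto
	have 2: "hh p / norm (snd p) <= 1" using mu by simp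
	have "rate (snd p) * hh p ^ Suc s = (norm (zeta (snd p)) * hh p) ^ s * (hh p / norm (snd p)) * ((1 + exp 5) * mass)"
		by (simp add: rate_def power_mult_distrib)
	also have "\<dots> <= (1*1) * ((1 + exp 5) * mass)"
		using mass_nonneg mu by (intro mult_right_mono mult_mono 1 2) auto
	finally show ?case by simp
qed

lemma PP_bd: "bd (Suc s) (\<lambda>p. PP (snd p) 0 1)"
proof (rule bdI[where c="2 * ((1 + exp 5) * mass)"])
	show "\<forall>\<^sub>F p in near C0. \<forall>x\<in>{0..1}. norm (PP (snd p) 0 1 x) * hh p ^ Suc s <= 2 * ((1 + exp 5) * mass)"
		using near_basic rate_bound
	proof eventually_elim
		case (elim p)
		have mu: "1 + K <= norm (snd p)" "\<bar>Im (snd p)\<bar> <= 2" "rate (snd p) <= 1/4" using elim by auto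
		show ?case
		proof
			fix x :: real assume x: "x \<in> {0..1}"
			have "norm (PP (snd p) 0 1 x) <= 2 * rate (snd p)"
				using PG_bound(3)[OF mu PG_ac[OF mu(1)] _ _ x, of 0 1 1] by (simp add: PG_0[OF mu(1)])
			then have "norm (PP (snd p) 0 1 x) * hh p ^ Suc s <= 2 * rate (snd p) * hh p ^ Suc s" by (intro mult_right_mono) auto
			then show "norm (PP (snd p) 0 1 x) * hh p ^ Suc s <= 2 * ((1 + exp 5) * mass)" using elim(2) by linarith
		qed
	qed
qed

text \<open>The variation is the mean of |GG'|, the last estimate in \<open>PG_bound\<close>. A
  bound on values alone would not allow the integration by parts in
  \<open>sm_riemann_lebesgue\<close>.\<close>

lemma GG_minus_1_bv: "bv (Suc s) (\<lambda>p x. GG (snd p) 0 1 x - 1)"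
	unfolding bv_def
proof (intro exI[of _ "\<lambda>p x. (rr (snd p) x / w (snd p) x) * (PP (snd p) 0 1 x / kap (snd p) x + GG (snd p) 0 1 x)"] exI[of _ "2 * ((1 + exp 5) * mass)"])
	show "\<forall>\<^sub>F p in near C0. ac (\<lambda>x. GG (snd p) 0 1 x - 1) (\<lambda>x. (rr (snd p) x / w (snd p) x) * (PP (snd p) 0 1 x / kap (snd p) x + GG (snd p) 0 1 x)) \<and>
		 (\<forall>x\<in>{0..1}. norm (GG (snd p) 0 1 x - 1) * hh p ^ Suc s <= 2 * ((1 + exp 5) * mass)) \<and>
		 integral {0..1} (\<lambda>x. norm ((rr (snd p) x / w (snd p) x) * (PP (snd p) 0 1 x / kap (snd p) x + GG (snd p) 0 1 x))) * hh p ^ Suc s <= 2 * ((1 + exp 5) * mass)"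
		using near_basic rate_bound
	proof eventually_elim
		case (elim p)
		have mu: "1 + K <= norm (snd p)" "\<bar>Im (snd p)\<bar> <= 2" "rate (snd p) <= 1/4" using elim by auto
		have a: "ac (\<lambda>x. GG (snd p) 0 1 x - 1) (\<lambda>x. (rr (snd p) x / w (snd p) x) * (PP (snd p) 0 1 x / kap (snd p) x + GG (snd p) 0 1 x))"
			using ac_diff[OF PG_ac(2)[OF mu(1)] ac_const, of 0 1 1] by simp
		have r: "2 * rate (snd p) * hh p ^ Suc s <= 2 * ((1 + exp 5) * mass)" using elim(2) by linarith
		have 1: "norm (GG (snd p) 0 1 x - 1) * hh p ^ Suc s <= 2 * ((1 + exp 5) * mass)" if x: "x \<in> {0..1}" for x
		proof -
			have "norm (GG (snd p) 0 1 x - 1) <= 2 * rate (snd p)"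
				using PG_bound(4)[OF mu PG_ac[OF mu(1)] _ _ x, of 0 1 1] by (simp add: PG_0[OF mu(1)])
			then have "norm (GG (snd p) 0 1 x - 1) * hh p ^ Suc s <= 2 * rate (snd p) * hh p ^ Suc s" by (intro mult_right_mono) auto
			then show ?thesis using r by linarith
		qed
		have "integral {0..1} (\<lambda>x. norm ((rr (snd p) x / w (snd p) x) * (PP (snd p) 0 1 x / kap (snd p) x + GG (snd p) 0 1 x))) <= 2 * rate (snd p)"
			using PG_bound(5)[OF mu PG_ac[OF mu(1)], of 0 1 1 0] by (simp add: PG_0[OF mu(1)])
		then have "integral {0..1} (\<lambda>x. norm ((rr (snd p) x / w (snd p) x) * (PP (snd p) 0 1 x / kap (snd p) x + GG (snd p) 0 1 x))) * hh p ^ Suc s <= 2 * rate (snd p) * hh p ^ Suc s"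
			by (intro mult_right_mono) auto
		then show ?case using a 1 r by (meson order_trans)
	qed
qed

lemma GG_bv: "bv 0 (\<lambda>p. GG (snd p) 0 1)"
	using bv_add[OF bv_le[OF GG_minus_1_bv, of 0] const_bv[of 1]] by simp

lemma kap_bd: "bd 0 (\<lambda>p. kap (snd p))"
proof (rule bdI[where c="exp 5"])
	show "\<forall>\<^sub>F p in near C0. \<forall>x\<in>{0..1}. norm (kap (snd p) x) * hh p ^ 0 <= exp 5"
		using near_basic by eventually_elim (simp add: kap_bound)
qed

lemma H_bd: "bd 0 (\<lambda>p. H (snd p))"
	unfolding H_def using bd_add[OF bd_le[OF PP_bd, of 0] bd_mult[OF kap_bd bv_imp_bd[OF GG_bv], simplified]] by simp

text \<open>\<open>H\<close> is a small amplitude \<open>PP\<close> plus \<open>GG\<close> times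
  \<open>kap0\<close> times a fast mode; the first part is small by \<open>PP_bd\<close>, the second
  by Riemann-Lebesgue.\<close>

lemma integral_mult_H_sm:
	assumes f: "L1 f"
	shows "sm 0 (\<lambda>p x. integral {0..x} (\<lambda>u. f u * H (snd p) u))"
proof -
	have 1: "sm 0 (\<lambda>p x. integral {0..x} (\<lambda>u. f u * PP (snd p) 0 1 u))"
		by (rule sm_integral[OF f _ bd_imp_sm[OF bd_le[OF PP_bd]]])
			 (use near_basic in eventually_elim, simp_all add: PG_continuous)
	have 2: "sm 0 (\<lambda>p x. integral {0..x} (\<lambda>u. f u * (kap0 p u * GG (snd p) 0 1 u) * emode (fst p) u))"
		using sm_riemann_lebesgue[OF f bv_mult[OF kap0_bv GG_bv]] by simp
	show ?thesis
	proof (rule sm_cong[OF sm_add[OF 1 2]])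
		show "\<forall>\<^sub>F p in near C0. \<forall>x\<in>{0..1}. integral {0..x} (\<lambda>u. f u * PP (snd p) 0 1 u) + integral {0..x} (\<lambda>u. f u * (kap0 p u * GG (snd p) 0 1 u) * emode (fst p) u)
			 = integral {0..x} (\<lambda>u. f u * H (snd p) u)"
			using near_basic
		proof eventually_elim
			case (elim p)
			then have mu: "1 + K <= norm (snd p)" by blast
			show ?case
			proof
				fix x :: real assume x: "x \<in> {0..1}"
				note c = PG_continuous[OF mu, of 0 1] ac_continuous[OF kap0_ac, of p] emode_continuous
				note i1 = L1_Icc_mono[OF L1_mult_continuous[OF f c(1)] x, THEN L1_integrable]
				note i2 = L1_Icc_mono[OF L1_mult_continuous[OF L1_mult_continuous[OF f continuous_on_mult[OF c(3) c(2)]] c(4)] x, THEN L1_integrable]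
				show "integral {0..x} (\<lambda>u. f u * PP (snd p) 0 1 u) + integral {0..x} (\<lambda>u. f u * (kap0 p u * GG (snd p) 0 1 u) * emode (fst p) u)
					 = integral {0..x} (\<lambda>u. f u * H (snd p) u)"
					unfolding integral_add[OF i1 i2, symmetric]
				proof (rule integral_cong)
					fix u assume "u \<in> {0..x}"
					then have u: "u \<in> {0..1}" using x by auto
					show "f u * PP (snd p) 0 1 u + f u * (kap0 p u * GG (snd p) 0 1 u) * emode (fst p) u = f u * H (snd p) u"
						unfolding H_def kap_kap0[OF u, of "snd p" "fst p"] by (simp add: algebra_simps)
				qed
			qed
		qed
	qed
qed

lemma ds_coef_sm: "sm 0 (\<lambda>p x. (2*pi*\<i> * of_int (fst p)) ^ s * fcoef q (fst p))"
proof -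
	have "sm 0 (\<lambda>p x. integral {0..x} (\<lambda>u. ds u * 1 * emode (fst p) u))"
		by (rule sm_riemann_lebesgue[OF ds_int const_bv])
	from sm_at_1[OF this] show ?thesis by (simp add: ds_coef)
qed

lemma fcoef_sm: "sm s (\<lambda>p x. fcoef q (fst p))"
	unfolding sm_def
proof (intro allI impI)
	fix \<delta> :: real assume "\<delta> > 0"
	then have "\<forall>\<^sub>F p in near C0. \<forall>x\<in>{0..1::real}. norm ((2*pi*\<i> * of_int (fst p)) ^ s * fcoef q (fst p)) * hh p ^ 0 <= \<delta>"
		using ds_coef_sm unfolding sm_def by blast
	then show "\<forall>\<^sub>F p in near C0. \<forall>x\<in>{0..1::real}. norm (fcoef q (fst p)) * hh p ^ s <= \<delta>"
	proof eventually_elim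
		case (elim p)
		have "norm ((2*pi*\<i> * of_int (fst p)) ^ s * fcoef q (fst p)) <= \<delta>" using elim[rule_format, of 0] by simp
		moreover have "norm ((2*pi*\<i> * of_int (fst p)) ^ s * fcoef q (fst p)) = norm (fcoef q (fst p)) * (2*pi * hh p) ^ s"
			by (simp add: norm_mult norm_power)
		moreover have "norm (fcoef q (fst p)) * hh p ^ s <= norm (fcoef q (fst p)) * (2*pi * hh p) ^ s"
		proof (intro mult_left_mono power_mono)
			have "1 * hh p <= (2*pi) * hh p" using pi_gt3 by (intro mult_right_mono) auto
			then show "hh p <= 2*pi * hh p" by simp
		qed auto
		ultimately show ?case by auto
	qed
qed

text \<open>By \<open>A_eq\<close>, \<open>A\<close> is a signed \<open>ds\<close> plus the smoother
  \<open>e\<close>. On \<open>ds\<close>, the difference \<open>kap0\<close> - 1 is O(1/m) in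
  variation, so Riemann-Lebesgue leaves the exact coefficient of \<open>ds\<close> up to o(1/m). On
  \<open>e\<close>, integration by parts gains 1/m; periodicity of \<open>e\<close> reduces the
  boundary term to e(0) (1 - kap0(1)), which tends to 0.\<close>

lemma A_kap0_integral_sm:
	"sm 1 (\<lambda>p x. integral {0..1} (\<lambda>u. A u * kap0 p u * emode (fst p) u)
		 - (-1) ^ Suc s * ((2*pi*\<i> * of_int (fst p)) ^ s * fcoef q (fst p)))"
proof -
	have a1: "sm 1 (\<lambda>p x. integral {0..1} (\<lambda>u. ds u * (kap0 p u - 1) * emode (fst p) u))"
		by (rule sm_at_1[OF sm_riemann_lebesgue[OF ds_int kap0_minus_1_bv]])
	have minv: "bd 1 (\<lambda>p x. 1 / (2*pi*\<i> * of_int (fst p)))"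
	proof (rule bdI[where c=1])
		show "\<forall>\<^sub>F p in near C0. \<forall>x\<in>{0..1::real}. norm (1 / (2*pi*\<i> * of_int (fst p))) * hh p ^ 1 <= 1"
			using hh_ge[of 1]
		proof eventually_elim
			case (elim p)
			have "norm (1 / (2*pi*\<i> * of_int (fst p))) * hh p ^ 1 = 1 / (2*pi)"
				using elim by (simp add: norm_divide norm_mult)
			then show ?case using pi_gt3 by simp
		qed
	qed
	have ec: "continuous_on {0..1} e" by (rule ac_continuous[OF e_ac])
	have b1: "sm 0 (\<lambda>p x. integral {0..1} (\<lambda>u. e' u * kap0 p u * emode (fst p) u))"
		by (rule sm_at_1[OF sm_riemann_lebesgue[OF acD(1)[OF e_ac] kap0_bv]])
	have dk: "bd 1 (\<lambda>p x. e x * (dkap0 p x * kap0 p x) * emode (fst p) x)"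
	proof -
		have "bd (0 + 1) (\<lambda>p x. e x * (dkap0 p x * kap0 p x))" by (rule bd_mult[OF bd_const[OF ec] dkap0_bd])
		then show ?thesis unfolding bd_def by (simp add: norm_mult norm_emode)
	qed
	have "sm 0 (\<lambda>p x. integral {0..x} (\<lambda>u. 1 * (e u * (dkap0 p u * kap0 p u) * emode (fst p) u)))"
		by (rule sm_integral[OF absolutely_integrable_continuous_real _ bd_imp_sm])
			 (use dk in \<open>auto intro!: always_eventually continuous_intros ec ac_continuous[OF T_ac] ac_continuous[OF kap0_ac] emode_continuous\<close>)
	from sm_at_1[OF this] have b2: "sm 0 (\<lambda>p x. integral {0..1} (\<lambda>u. e u * (dkap0 p u * kap0 p u) * emode (fst p) u))" by simp
	have b3: "sm 0 (\<lambda>p x. e 0 * (1 - kap0 p 1))"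
	proof -
		have "bd 1 (\<lambda>p x. (- e 0) * (kap0 p x - 1))"
			using bd_mult[OF bd_const[of "\<lambda>_. - e 0"] bv_imp_bd[OF kap0_minus_1_bv]] by simp
		from sm_at_1[OF bd_imp_sm[of 0, unfolded One_nat_def[symmetric], OF this]] show ?thesis by (simp add: algebra_simps)
	qed
	have "sm (0 + 1) (\<lambda>p x. (e 0 * (1 - kap0 p 1) + (integral {0..1} (\<lambda>u. e' u * kap0 p u * emode (fst p) u) + integral {0..1} (\<lambda>u. e u * (dkap0 p u * kap0 p u) * emode (fst p) u)))
			* (1 / (2*pi*\<i> * of_int (fst p))))"
		by (intro sm_mult sm_add b1 b2 b3 minv)
	then have a2: "sm 1 (\<lambda>p x. integral {0..1} (\<lambda>u. e u * kap0 p u * emode (fst p) u))"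
		unfolding add_0
	proof (rule sm_cong)
		show "\<forall>\<^sub>F p in near C0. \<forall>x\<in>{0..1::real}. (e 0 * (1 - kap0 p 1) + (integral {0..1} (\<lambda>u. e' u * kap0 p u * emode (fst p) u) + integral {0..1} (\<lambda>u. e u * (dkap0 p u * kap0 p u) * emode (fst p) u)))
			* (1 / (2*pi*\<i> * of_int (fst p))) = integral {0..1} (\<lambda>u. e u * kap0 p u * emode (fst p) u)"
			using hh_ge[of 1]
		proof eventually_elim
			case (elim p)
			have m0: "fst p \<noteq> 0" using elim by auto
			have k0: "kap0 p 0 = 1" by (simp add: kap0_def)
			have ack: "ac (\<lambda>u. e u * kap0 p u) (\<lambda>u. e' u * kap0 p u + e u * (dkap0 p u * kap0 p u))"
				by (rule ac_mult[OF e_ac kap0_ac])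
			note c = ac_continuous[OF kap0_ac, of p] emode_continuous[of "{0..1}" "fst p"]
			have i1: "(\<lambda>u. e' u * kap0 p u * emode (fst p) u) integrable_on {0..1}"
				by (intro L1_integrable L1_mult_continuous acD(1)[OF e_ac] c)
			have i2: "(\<lambda>u. e u * (dkap0 p u * kap0 p u) * emode (fst p) u) integrable_on {0..1}"
				by (intro integrable_continuous_real continuous_intros ec c dkap0_continuous)
			have "integral {0..1} (\<lambda>u. e u * kap0 p u * emode (fst p) u) =
				 (e 0 * kap0 p 0 - e 1 * kap0 p 1 * emode (fst p) 1 + integral {0..1} (\<lambda>u. (e' u * kap0 p u + e u * (dkap0 p u * kap0 p u)) * emode (fst p) u)) / (2*pi*\<i> * of_int (fst p))"
				by (rule integral_emode_parts[OF ack m0]) simp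
			also have "integral {0..1} (\<lambda>u. (e' u * kap0 p u + e u * (dkap0 p u * kap0 p u)) * emode (fst p) u)
				 = integral {0..1} (\<lambda>u. e' u * kap0 p u * emode (fst p) u) + integral {0..1} (\<lambda>u. e u * (dkap0 p u * kap0 p u) * emode (fst p) u)"
				unfolding integral_add[OF i1 i2, symmetric] by (rule integral_cong) (simp add: algebra_simps)
			also have "e 0 * kap0 p 0 - e 1 * kap0 p 1 * emode (fst p) 1 = e 0 * (1 - kap0 p 1)"
				by (simp add: k0 e_per emode_1 algebra_simps)
			finally show ?case by simp
		qed
	qed
	have neg1: "bd 0 (\<lambda>p x. (-1) ^ Suc s)" using bd_const[of "\<lambda>_. (-1) ^ Suc s"] by simp
	have "sm 1 (\<lambda>p x. integral {0..1} (\<lambda>u. ds u * (kap0 p u - 1) * emode (fst p) u) * (-1) ^ Suc s + integral {0..1} (\<lambda>u. e u * kap0 p u * emode (fst p) u))"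
		by (rule sm_add[OF sm_mult[OF a1 neg1, unfolded add_0_right] a2])
	then show ?thesis
	proof (rule sm_cong)
		show "\<forall>\<^sub>F p in near C0. \<forall>x\<in>{0..1::real}. integral {0..1} (\<lambda>u. ds u * (kap0 p u - 1) * emode (fst p) u) * (-1) ^ Suc s + integral {0..1} (\<lambda>u. e u * kap0 p u * emode (fst p) u)
			= integral {0..1} (\<lambda>u. A u * kap0 p u * emode (fst p) u) - (-1) ^ Suc s * ((2*pi*\<i> * of_int (fst p)) ^ s * fcoef q (fst p))"
		proof (intro always_eventually allI ballI)
			fix p :: "int \<times> complex"
			note c = ac_continuous[OF kap0_ac, of p] emode_continuous[of "{0..1}" "fst p"]
			have c2: "continuous_on {0..1} (\<lambda>u. kap0 p u - 1)" by (intro continuous_intros c)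
			have j1: "(\<lambda>u. ds u * (kap0 p u - 1) * emode (fst p) u) integrable_on {0..1}"
				by (intro L1_integrable L1_mult_continuous ds_int c c2)
			have j2: "(\<lambda>u. e u * kap0 p u * emode (fst p) u) integrable_on {0..1}"
				by (intro integrable_continuous_real continuous_intros ec c)
			have j3: "(\<lambda>u. ds u * emode (fst p) u) integrable_on {0..1}"
				by (intro L1_integrable L1_mult_continuous ds_int c)
			have "integral {0..1} (\<lambda>u. A u * kap0 p u * emode (fst p) u)
				= integral {0..1} (\<lambda>u. (-1) ^ Suc s * (ds u * (kap0 p u - 1) * emode (fst p) u) + (e u * kap0 p u * emode (fst p) u + (-1) ^ Suc s * (ds u * emode (fst p) u)))"
				by (rule integral_cong) (simp add: A_eq algebra_simps)
			also have "\<dots> = integral {0..1} (\<lambda>u. (-1) ^ Suc s * (ds u * (kap0 p u - 1) * emode (fst p) u)) + integral {0..1} (\<lambda>u. e u * kap0 p u * emode (fst p) u + (-1) ^ Suc s * (ds u * emode (fst p) u))"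
				by (rule integral_add[OF integrable_on_mult_right[OF j1] integrable_add[OF j2 integrable_on_mult_right[OF j3]]])
			also have "integral {0..1} (\<lambda>u. e u * kap0 p u * emode (fst p) u + (-1) ^ Suc s * (ds u * emode (fst p) u))
				= integral {0..1} (\<lambda>u. e u * kap0 p u * emode (fst p) u) + integral {0..1} (\<lambda>u. (-1) ^ Suc s * (ds u * emode (fst p) u))"
				by (rule integral_add[OF j2 integrable_on_mult_right[OF j3]])
			finally show "integral {0..1} (\<lambda>u. ds u * (kap0 p u - 1) * emode (fst p) u) * (-1) ^ Suc s + integral {0..1} (\<lambda>u. e u * kap0 p u * emode (fst p) u)
				= integral {0..1} (\<lambda>u. A u * kap0 p u * emode (fst p) u) - (-1) ^ Suc s * ((2*pi*\<i> * of_int (fst p)) ^ s * fcoef q (fst p))"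
				unfolding integral_mult_right ds_coef by (simp only: algebra_simps)
		qed
	qed
qed

text \<open>The two remainders of \<open>PP_expand\<close> have to be o(m^(-2)) before the factor
  zeta^s. For the one with \<open>X\<close>, the moving function \<open>X (zeta (- \<mu>))\<close>
  is first replaced by the fixed \<open>X 0\<close>, at a cost O(1/m), so that
  \<open>integral_mult_H_sm\<close> applies.\<close>

lemma PP_first_order:
	"sm (Suc (Suc s)) (\<lambda>p x. PP (snd p) 0 1 x + zeta (- snd p) ^ s * zeta (snd p) * integral {0..x} (\<lambda>u. A u * H (snd p) u))"
proof -
	have J1: "sm 2 (\<lambda>p x. integral {0..x} (\<lambda>u. A u * ((1 / w (snd p) u - zeta (snd p)) * H (snd p) u)))"
	proof (rule sm_integral[OF A_int _ bd_imp_sm])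
		show "\<forall>\<^sub>F p in near C0. continuous_on {0..1} (\<lambda>u. (1 / w (snd p) u - zeta (snd p)) * H (snd p) u)"
			using near_basic by eventually_elim (intro continuous_intros winv_continuous H_continuous, blast+)
		show "bd (Suc 2) (\<lambda>p u. (1 / w (snd p) u - zeta (snd p)) * H (snd p) u)"
			using bd_mult[OF winv_bd H_bd] by (simp add: numeral_3_eq_3 numeral_2_eq_2)
	qed
	have X0: "X 0 absolutely_integrable_on {0..1}" by (rule absolutely_integrable_continuous_real[OF X_cont])
	have K1: "sm 1 (\<lambda>p x. zeta (snd p) * integral {0..x} (\<lambda>u. X 0 u * H (snd p) u))"
		using sm_mult[OF integral_mult_H_sm[OF X0] zeta_bd] by (simp add: mult.commute)
	have Xd: "bd 1 (\<lambda>p u. X (zeta (- snd p)) u - X 0 u)"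
	proof (rule bdI[where c=K])
		show "\<forall>\<^sub>F p in near C0. \<forall>u\<in>{0..1}. norm (X (zeta (- snd p)) u - X 0 u) * hh p ^ 1 <= K"
			using near_basic
		proof eventually_elim
			case (elim p)
			have mu: "1 + K <= norm (- snd p)" "hh p <= 2 * norm (snd p)" "norm (snd p) > 0" using elim K by auto
			show ?case
			proof
				fix u :: real assume u: "u \<in> {0..1}"
				have "norm (X (zeta (- snd p)) u - X 0 u) * hh p <= (K * norm (zeta (- snd p))) * hh p"
					by (intro mult_right_mono X_lip zeta_small mu u) auto
				also have "\<dots> = K * (hh p / (2 * norm (snd p)))" by (simp add: norm_zeta)
				also have "\<dots> <= K*1" using mu K by (intro mult_left_mono) auto
				finally show "norm (X (zeta (- snd p)) u - X 0 u) * hh p ^ 1 <= K" by simp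
			qed
		qed
	qed
	have Xb: "bd 0 (\<lambda>p u. X (zeta (- snd p)) u)"
	proof (rule bdI[where c=K])
		show "\<forall>\<^sub>F p in near C0. \<forall>u\<in>{0..1}. norm (X (zeta (- snd p)) u) * hh p ^ 0 <= K"
			using near_basic by eventually_elim (simp add: X_bound zeta_small)
	qed
	have rest: "bd 2 (\<lambda>p u. X (zeta (- snd p)) u * (1 / w (snd p) u * H (snd p) u) - zeta (snd p) * (X 0 u * H (snd p) u))"
	proof -
		have 1: "bd 2 (\<lambda>p u. (X (zeta (- snd p)) u * (1 / w (snd p) u - zeta (snd p))) * H (snd p) u)"
			by (rule bd_le[OF bd_mult[OF bd_mult[OF Xb winv_bd] H_bd]]) simp
		have 2: "bd 2 (\<lambda>p u. ((X (zeta (- snd p)) u - X 0 u) * zeta (snd p)) * H (snd p) u)"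
			by (rule bd_le[OF bd_mult[OF bd_mult[OF Xd zeta_bd] H_bd]]) simp
		show ?thesis by (rule bd_cong[OF bd_add[OF 1 2]]) (simp add: algebra_simps)
	qed
	have K2: "sm 1 (\<lambda>p x. integral {0..x} (\<lambda>u. 1 * (X (zeta (- snd p)) u * (1 / w (snd p) u * H (snd p) u) - zeta (snd p) * (X 0 u * H (snd p) u))))"
	proof (rule sm_integral[OF absolutely_integrable_continuous_real _ bd_imp_sm])
		show "\<forall>\<^sub>F p in near C0. continuous_on {0..1} (\<lambda>u. X (zeta (- snd p)) u * (1 / w (snd p) u * H (snd p) u) - zeta (snd p) * (X 0 u * H (snd p) u))"
			using near_basic by eventually_elim (intro continuous_intros winv_continuous H_continuous X_cont, blast+)
		show "bd (Suc 1) (\<lambda>p u. X (zeta (- snd p)) u * (1 / w (snd p) u * H (snd p) u) - zeta (snd p) * (X 0 u * H (snd p) u))"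
			using rest by (simp add: numeral_2_eq_2)
	qed simp
	have J2: "sm 1 (\<lambda>p x. integral {0..x} (\<lambda>u. X (zeta (- snd p)) u * (1 / w (snd p) u * H (snd p) u)))"
	proof (rule sm_cong[OF sm_add[OF K1 K2]])
		show "\<forall>\<^sub>F p in near C0. \<forall>x\<in>{0..1}. zeta (snd p) * integral {0..x} (\<lambda>u. X 0 u * H (snd p) u)
			 + integral {0..x} (\<lambda>u. 1 * (X (zeta (- snd p)) u * (1 / w (snd p) u * H (snd p) u) - zeta (snd p) * (X 0 u * H (snd p) u)))
			 = integral {0..x} (\<lambda>u. X (zeta (- snd p)) u * (1 / w (snd p) u * H (snd p) u))"
			using near_basic
		proof eventually_elim
			case (elim p)
			then have mu: "1 + K <= norm (snd p)" by blast
			show ?case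
			proof
				fix x :: real assume x: "x \<in> {0..1}"
				have i1: "(\<lambda>u. X (zeta (- snd p)) u * (1 / w (snd p) u * H (snd p) u)) integrable_on {0..x}"
					by (rule integrable_Icc_mono[OF integrable_continuous_real x]) (intro continuous_intros winv_continuous H_continuous X_cont mu)
				have i2: "(\<lambda>u. zeta (snd p) * (X 0 u * H (snd p) u)) integrable_on {0..x}"
					by (rule integrable_Icc_mono[OF integrable_continuous_real x]) (intro continuous_intros H_continuous X_cont mu)
				show "zeta (snd p) * integral {0..x} (\<lambda>u. X 0 u * H (snd p) u)
					 + integral {0..x} (\<lambda>u. 1 * (X (zeta (- snd p)) u * (1 / w (snd p) u * H (snd p) u) - zeta (snd p) * (X 0 u * H (snd p) u)))
					 = integral {0..x} (\<lambda>u. X (zeta (- snd p)) u * (1 / w (snd p) u * H (snd p) u))"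
					unfolding mult_1 integral_diff[OF i1 i2] by (simp only: integral_mult_right) simp
			qed
		qed
	qed
	have zJ2: "sm 2 (\<lambda>p x. zeta (snd p) * integral {0..x} (\<lambda>u. X (zeta (- snd p)) u * (1 / w (snd p) u * H (snd p) u)))"
		using sm_mult[OF J2 zeta_bd] by (simp add: mult.commute numeral_2_eq_2)
	have zs: "bd s (\<lambda>p x. - (zeta (- snd p) ^ s))"
		using bd_power[OF zeta_minus_bd, of s] by (simp add: bd_def)
	have "sm (2 + s) (\<lambda>p x. (integral {0..x} (\<lambda>u. A u * ((1 / w (snd p) u - zeta (snd p)) * H (snd p) u))
		 - zeta (snd p) * integral {0..x} (\<lambda>u. X (zeta (- snd p)) u * (1 / w (snd p) u * H (snd p) u))) * - (zeta (- snd p) ^ s))"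
		by (rule sm_mult[OF sm_diff[OF J1 zJ2] zs])
	then have "sm (Suc (Suc s)) (\<lambda>p x. (integral {0..x} (\<lambda>u. A u * ((1 / w (snd p) u - zeta (snd p)) * H (snd p) u))
		 - zeta (snd p) * integral {0..x} (\<lambda>u. X (zeta (- snd p)) u * (1 / w (snd p) u * H (snd p) u))) * - (zeta (- snd p) ^ s))"
		by simp
	then show ?thesis
	proof (rule sm_cong)
		show "\<forall>\<^sub>F p in near C0. \<forall>x\<in>{0..1}. (integral {0..x} (\<lambda>u. A u * ((1 / w (snd p) u - zeta (snd p)) * H (snd p) u))
		 - zeta (snd p) * integral {0..x} (\<lambda>u. X (zeta (- snd p)) u * (1 / w (snd p) u * H (snd p) u))) * - (zeta (- snd p) ^ s)
			= PP (snd p) 0 1 x + zeta (- snd p) ^ s * zeta (snd p) * integral {0..x} (\<lambda>u. A u * H (snd p) u)"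
			using near_basic
		proof eventually_elim
			case (elim p)
			then have mu: "1 + K <= norm (snd p)" by blast
			show ?case
			proof
				fix x :: real assume x: "x \<in> {0..1}"
				have alg: "(j1 - z*j2) * - Z = - Z * (z*i + j1 - z*j2) + Z*z*i" for j1 j2 z Z i :: complex
					by (simp add: algebra_simps)
				show "(integral {0..x} (\<lambda>u. A u * ((1 / w (snd p) u - zeta (snd p)) * H (snd p) u))
					 - zeta (snd p) * integral {0..x} (\<lambda>u. X (zeta (- snd p)) u * (1 / w (snd p) u * H (snd p) u))) * - (zeta (- snd p) ^ s)
					 = PP (snd p) 0 1 x + zeta (- snd p) ^ s * zeta (snd p) * integral {0..x} (\<lambda>u. A u * H (snd p) u)"
					unfolding PP_expand[OF mu x] by (rule alg)
			qed
		qed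
	qed
qed

lemma zeta_powers_bd: "bd (Suc s) (\<lambda>p x. zeta (- snd p) ^ s * zeta (snd p))"
	using bd_mult[OF bd_power[OF zeta_minus_bd, of s] zeta_bd] by simp

text \<open>Improves \<open>PP_bd\<close> from O to o. For s = 0 this gain is essential in
  \<open>IA_sm\<close>, where the integral of \<open>A\<close> against \<open>PP\<close> must be
  o(1/m).\<close>

lemma PP_sm: "sm (Suc s) (\<lambda>p. PP (snd p) 0 1)"
proof -
	have "sm (0 + Suc s) (\<lambda>p x. integral {0..x} (\<lambda>u. A u * H (snd p) u) * (zeta (- snd p) ^ s * zeta (snd p)))"
		by (rule sm_mult[OF integral_mult_H_sm[OF A_int] zeta_powers_bd])
	from sm_diff[OF sm_le[OF PP_first_order, of "Suc s"] this[unfolded add_0]]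
	show ?thesis by (simp add: mult.commute)
qed

text \<open>Splits \<open>H\<close> into \<open>PP\<close>, the mode times \<open>kap0\<close>, and
  the mode times \<open>kap0\<close> (\<open>GG\<close> - 1). The middle piece carries the Fourier
  coefficient; the others are small by \<open>PP_sm\<close> and by Riemann-Lebesgue with the
  variation of \<open>GG\<close>.\<close>

lemma IA_sm:
	"sm 1 (\<lambda>p x. integral {0..1} (\<lambda>u. A u * H (snd p) u) - (-1) ^ Suc s * ((2*pi*\<i> * of_int (fst p)) ^ s * fcoef q (fst p)))"
proof -
	have "sm (Suc s) (\<lambda>p x. integral {0..x} (\<lambda>u. A u * PP (snd p) 0 1 u))"
		by (rule sm_integral[OF A_int _ PP_sm]) (use near_basic in eventually_elim, simp_all add: PG_continuous)
	from sm_at_1[OF sm_le[OF this, of 1]] have 1: "sm 1 (\<lambda>p x. integral {0..1} (\<lambda>u. A u * PP (snd p) 0 1 u))" by simp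
	have "sm (0 + Suc s) (\<lambda>p x. integral {0..x} (\<lambda>u. A u * (kap0 p u * (GG (snd p) 0 1 u - 1)) * emode (fst p) u))"
		by (rule sm_riemann_lebesgue[OF A_int bv_mult[OF kap0_bv GG_minus_1_bv]])
	from sm_at_1[OF sm_le[OF this, of 1]] have 2: "sm 1 (\<lambda>p x. integral {0..1} (\<lambda>u. A u * (kap0 p u * (GG (snd p) 0 1 u - 1)) * emode (fst p) u))" by simp
	show ?thesis
	proof (rule sm_cong[OF sm_add[OF sm_add[OF 1 2] A_kap0_integral_sm]])
		show "\<forall>\<^sub>F p in near C0. \<forall>x\<in>{0..1::real}. (integral {0..1} (\<lambda>u. A u * PP (snd p) 0 1 u) + integral {0..1} (\<lambda>u. A u * (kap0 p u * (GG (snd p) 0 1 u - 1)) * emode (fst p) u))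
			 + (integral {0..1} (\<lambda>u. A u * kap0 p u * emode (fst p) u) - (-1) ^ Suc s * ((2*pi*\<i> * of_int (fst p)) ^ s * fcoef q (fst p)))
			 = integral {0..1} (\<lambda>u. A u * H (snd p) u) - (-1) ^ Suc s * ((2*pi*\<i> * of_int (fst p)) ^ s * fcoef q (fst p))"
			using near_basic
		proof eventually_elim
			case (elim p)
			then have mu: "1 + K <= norm (snd p)" by blast
			note c = PG_continuous[OF mu, of 0 1] ac_continuous[OF kap0_ac, of p] emode_continuous[of "{0..1}" "fst p"]
			have c2: "continuous_on {0..1} (\<lambda>u. kap0 p u * (GG (snd p) 0 1 u - 1))" by (intro continuous_intros c)
			have i1: "(\<lambda>u. A u * PP (snd p) 0 1 u) integrable_on {0..1}"
				by (intro L1_integrable L1_mult_continuous A_int c)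
			have i2: "(\<lambda>u. A u * (kap0 p u * (GG (snd p) 0 1 u - 1)) * emode (fst p) u) integrable_on {0..1}"
				by (intro L1_integrable L1_mult_continuous A_int c2 c)
			have i3: "(\<lambda>u. A u * kap0 p u * emode (fst p) u) integrable_on {0..1}"
				by (intro L1_integrable L1_mult_continuous A_int c)
			have "integral {0..1} (\<lambda>u. A u * H (snd p) u) = integral {0..1} (\<lambda>u. (A u * PP (snd p) 0 1 u + A u * (kap0 p u * (GG (snd p) 0 1 u - 1)) * emode (fst p) u) + A u * kap0 p u * emode (fst p) u)"
			proof (rule integral_cong)
				fix u :: real assume u: "u \<in> {0..1}"
				show "A u * H (snd p) u = (A u * PP (snd p) 0 1 u + A u * (kap0 p u * (GG (snd p) 0 1 u - 1)) * emode (fst p) u) + A u * kap0 p u * emode (fst p) u"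
					unfolding H_def kap_kap0[OF u, of "snd p" "fst p"] by (simp add: algebra_simps)
			qed
			also have "\<dots> = (integral {0..1} (\<lambda>u. A u * PP (snd p) 0 1 u) + integral {0..1} (\<lambda>u. A u * (kap0 p u * (GG (snd p) 0 1 u - 1)) * emode (fst p) u)) + integral {0..1} (\<lambda>u. A u * kap0 p u * emode (fst p) u)"
				unfolding integral_add[OF integrable_add[OF i1 i2] i3] integral_add[OF i1 i2] ..
			finally show ?case by simp
		qed
	qed
qed

text \<open>\<open>n12\<close> is the end value of \<open>PP\<close>, namely zeta^(s+1) (2 \<pi> i
  m)^s q_m + o(m^(-s-2)), times e^(i \<pi> m) E with E = 1 + O(1/m). Also 2 \<pi> i m zeta = 1 +
  O(1/m). Because q_m = o(m^(-s)), multiplying it by factors 1 + O(1/m) costs only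
  o(m^(-s-1)).\<close>

lemma n12_asymptotics_sm:
	"sm (Suc s) (\<lambda>p x. exp (- (\<i> * of_real pi * of_int (fst p))) * (2*pi*\<i> * of_int (fst p)) * n12 (snd p) - fcoef q (fst p))"
proof -
	define c where "c p = 2*pi*\<i> * complex_of_int (fst p)" for p :: "int \<times> complex"
	define E where "E p = exp (\<i> * (snd p - pim (fst p)) - integral {0..1} (T (zeta (- snd p))))" for p :: "int \<times> complex"
	define Z where "Z p = zeta (- snd p) ^ s * zeta (snd p)" for p :: "int \<times> complex"
	define I where "I p = integral {0..1} (\<lambda>u. A u * H (snd p) u)" for p :: "int \<times> complex"
	have cb: "\<forall>\<^sub>F p in near C0. norm (c p) = 2*pi * hh p" by (simp add: c_def norm_mult)
	have E1: "bd 1 (\<lambda>p x. E p - 1)"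
	proof (rule bdI[where c="2 * (C0 + K)"])
		show "\<forall>\<^sub>F p in near C0. \<forall>x\<in>{0..1::real}. norm (E p - 1) * hh p ^ 1 <= 2 * (C0 + K)"
			using near_basic hh_ge[of "2 * (C0 + K)"]
		proof eventually_elim
			case (elim p)
			have mu: "1 + K <= norm (- snd p)" "hh p <= norm (snd p)" "hh p > 0" "norm (snd p - pim (fst p)) <= C0 / hh p"
				using elim by auto
			have "norm (integral {0..1} (T (zeta (- snd p)))) <= K / (2 * norm (- snd p))" by (rule T_integral_bound[OF mu(1)])
			also have "\<dots> <= K / hh p" using mu K by (intro divide_left_mono mult_pos_pos) auto
			finally have t: "norm (integral {0..1} (T (zeta (- snd p)))) <= K / hh p" .
			have "norm (\<i> * (snd p - pim (fst p)) - integral {0..1} (T (zeta (- snd p)))) <= C0 / hh p + K / hh p"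
				by (rule order_trans[OF norm_triangle_ineq4 add_mono[OF _ t]]) (use mu(4) in \<open>simp add: norm_mult\<close>)
			then have n: "norm (\<i> * (snd p - pim (fst p)) - integral {0..1} (T (zeta (- snd p)))) <= (C0 + K) / hh p"
				by (simp add: add_divide_distrib)
			also have "\<dots> <= 1/2" using elim(2) mu(3) by (simp add: divide_le_eq)
			finally have "norm (E p - 1) <= 2 * norm (\<i> * (snd p - pim (fst p)) - integral {0..1} (T (zeta (- snd p))))"
				unfolding E_def by (rule norm_exp_minus_1)
			also have "\<dots> <= 2 * ((C0 + K) / hh p)" using n by linarith
			finally have "norm (E p - 1) * hh p <= 2 * ((C0 + K) / hh p) * hh p" using mu(3) by (intro mult_right_mono) auto
			then show ?case using mu(3) by simp
		qed
	qed
	have one: "bd 0 (\<lambda>p x. 1)" using bd_const[of "\<lambda>_. 1"] by simp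
	have Eb: "bd 0 (\<lambda>p x. E p)" using bd_add[OF bd_le[OF E1, of 0] one] by simp
	have cz: "bd 1 (\<lambda>p x. c p * zeta (snd p) - 1)"
	proof (rule bdI[where c=C0])
		show "\<forall>\<^sub>F p in near C0. \<forall>x\<in>{0..1::real}. norm (c p * zeta (snd p) - 1) * hh p ^ 1 <= C0"
			using near_basic
		proof eventually_elim
			case (elim p)
			have mu: "1 <= norm (snd p)" "hh p >= 1" "norm (snd p - pim (fst p)) <= C0 / hh p" using elim K by linarith+
			then have nz: "snd p \<noteq> 0" by auto
			have "c p * zeta (snd p) - 1 = - (snd p - pim (fst p)) / snd p"
				using nz by (simp add: c_def zeta_def field_simps)
			also have "norm \<dots> = norm (snd p - pim (fst p)) / norm (snd p)" by (simp only: norm_divide norm_minus_cancel)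
			also have "\<dots> <= (C0 / hh p) / 1" using mu C0 by (intro frac_le) auto
			finally have "norm (c p * zeta (snd p) - 1) * hh p <= C0 / hh p * hh p" using mu(2) by (intro mult_right_mono) auto
			then show ?case using mu(2) by simp
		qed
	qed
	have czb: "bd 0 (\<lambda>p x. c p * zeta (snd p))" using bd_add[OF bd_le[OF cz, of 0] one] by simp
	have czn: "bd 1 (\<lambda>p x. (c p * zeta (snd p)) ^ n - 1)" for n
	proof (induction n)
		case 0
		show ?case by (rule bdI[where c=0]) simp
	next
		case (Suc n)
		have "bd 1 (\<lambda>p x. c p * zeta (snd p) * ((c p * zeta (snd p)) ^ n - 1) + (c p * zeta (snd p) - 1))"
			using bd_add[OF bd_mult[OF czb Suc, simplified] cz[simplified]] by simp
		then show ?case by (simp add: algebra_simps)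
	qed
	have M: "bd 1 (\<lambda>p x. (c p * zeta (snd p)) ^ Suc s * E p - 1)"
	proof -
		have "bd 1 (\<lambda>p x. ((c p * zeta (snd p)) ^ Suc s - 1) * E p + (E p - 1))"
			using bd_add[OF bd_mult[OF czn[of "Suc s"] Eb, simplified] E1[simplified]] by simp
		then show ?thesis by (rule bd_cong) (simp add: left_diff_distrib)
	qed
	have 1: "sm (Suc s) (\<lambda>p x. fcoef q (fst p) * ((c p * zeta (snd p)) ^ Suc s * E p - 1))"
		using sm_mult[OF fcoef_sm M] by simp
	have Psm: "sm (Suc (Suc s)) (\<lambda>p x. PP (snd p) 0 1 1 + Z p * I p)"
		using sm_at_1[OF PP_first_order] by (simp only: Z_def I_def)
	have Ism: "sm 1 (\<lambda>p x. I p - (-1) ^ Suc s * (c p ^ s * fcoef q (fst p)))"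
		using IA_sm unfolding I_def c_def .
	have "sm (Suc (Suc s)) (\<lambda>p x. (I p - (-1) ^ Suc s * (c p ^ s * fcoef q (fst p))) * Z p)"
		using sm_mult[OF Ism zeta_powers_bd] by (simp add: Z_def)
	from sm_diff[OF Psm this]
	have P2: "sm (Suc (Suc s)) (\<lambda>p x. PP (snd p) 0 1 1 - zeta (snd p) ^ Suc s * (c p ^ s * fcoef q (fst p)))"
	proof (rule sm_cong, intro always_eventually allI ballI)
		fix p :: "int \<times> complex"
		have "Z p * (-1) ^ Suc s = - ((- zeta (snd p)) ^ s * (-1) ^ s) * zeta (snd p)" by (simp add: Z_def zeta_minus)
		also have "(- zeta (snd p)) ^ s * (-1) ^ s = zeta (snd p) ^ s" by (simp add: power_mult_distrib[symmetric])
		finally have "Z p * (-1) ^ Suc s = - (zeta (snd p) ^ Suc s)" by simp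
		then have "((-1) ^ Suc s * (c p ^ s * fcoef q (fst p))) * Z p = - (zeta (snd p) ^ Suc s) * (c p ^ s * fcoef q (fst p))"
			by (metis mult.assoc mult.commute)
		then show "PP (snd p) 0 1 1 + Z p * I p - (I p - (-1) ^ Suc s * (c p ^ s * fcoef q (fst p))) * Z p
			= PP (snd p) 0 1 1 - zeta (snd p) ^ Suc s * (c p ^ s * fcoef q (fst p))"
			by (simp only: left_diff_distrib) (simp add: algebra_simps)
	qed
	have P3: "sm (Suc s) (\<lambda>p x. c p * (PP (snd p) 0 1 1 - zeta (snd p) ^ Suc s * (c p ^ s * fcoef q (fst p))))"
		unfolding sm_def
	proof (intro allI impI)
		fix \<delta> :: real assume "\<delta> > 0"
		then have "\<delta> / (2*pi) > 0" by simp
		then have "\<forall>\<^sub>F p in near C0. \<forall>x\<in>{0..1::real}. norm (PP (snd p) 0 1 1 - zeta (snd p) ^ Suc s * (c p ^ s * fcoef q (fst p))) * hh p ^ Suc (Suc s) <= \<delta> / (2*pi)"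
			using P2 unfolding sm_def by blast
		then show "\<forall>\<^sub>F p in near C0. \<forall>x\<in>{0..1::real}. norm (c p * (PP (snd p) 0 1 1 - zeta (snd p) ^ Suc s * (c p ^ s * fcoef q (fst p)))) * hh p ^ Suc s <= \<delta>"
			using cb
		proof eventually_elim
			case (elim p)
			let ?N = "norm (PP (snd p) 0 1 1 - zeta (snd p) ^ Suc s * (c p ^ s * fcoef q (fst p)))"
			have "?N * hh p ^ Suc (Suc s) <= \<delta> / (2*pi)" using elim(1)[rule_format, of 0] by simp
			then have "2*pi * (?N * hh p ^ Suc (Suc s)) <= \<delta>" by (simp add: field_simps)
			then show ?case by (simp add: norm_mult elim(2) mult_ac)
		qed
	qed
	have 2: "sm (Suc s) (\<lambda>p x. c p * (PP (snd p) 0 1 1 - zeta (snd p) ^ Suc s * (c p ^ s * fcoef q (fst p))) * E p)"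
		using sm_mult[OF P3 Eb] by simp
	show ?thesis
	proof (rule sm_cong[OF sm_add[OF 1 2]])
		show "\<forall>\<^sub>F p in near C0. \<forall>x\<in>{0..1::real}. fcoef q (fst p) * ((c p * zeta (snd p)) ^ Suc s * E p - 1)
			 + c p * (PP (snd p) 0 1 1 - zeta (snd p) ^ Suc s * (c p ^ s * fcoef q (fst p))) * E p
			 = exp (- (\<i> * of_real pi * of_int (fst p))) * (2*pi*\<i> * of_int (fst p)) * n12 (snd p) - fcoef q (fst p)"
			using near_basic
		proof eventually_elim
			case (elim p)
			then have mu: "1 + K <= norm (snd p)" by blast
			have "n12 (snd p) = PP (snd p) 0 1 1 * (1 / ff (- snd p) 1)"
				unfolding PP_1[OF mu] using ff_nz[of "- snd p" 1] by simp
			also have "1 / ff (- snd p) 1 = exp (\<i> * of_real pi * of_int (fst p)) * E p"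
				unfolding ff_inverse E_def exp_add[symmetric] by (simp add: algebra_simps)
			finally have n: "n12 (snd p) = PP (snd p) 0 1 1 * (exp (\<i> * of_real pi * of_int (fst p)) * E p)" .
			have ee: "exp (- (\<i> * of_real pi * of_int (fst p))) * exp (\<i> * of_real pi * of_int (fst p)) = (1::complex)"
				by (simp add: exp_add[symmetric])
			have "exp (- (\<i> * of_real pi * of_int (fst p))) * (2*pi*\<i> * of_int (fst p)) * n12 (snd p)
				= (exp (- (\<i> * of_real pi * of_int (fst p))) * exp (\<i> * of_real pi * of_int (fst p))) * (c p * PP (snd p) 0 1 1 * E p)"
				unfolding n c_def by (simp only: mult_ac)
			also have "\<dots> = c p * PP (snd p) 0 1 1 * E p" unfolding ee by simp
			finally have L: "exp (- (\<i> * of_real pi * of_int (fst p))) * (2*pi*\<i> * of_int (fst p)) * n12 (snd p) = c p * PP (snd p) 0 1 1 * E p" .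
			show ?case unfolding L by (simp add: power_mult_distrib algebra_simps)
		qed
	qed
qed

end

lemma n12_asymptotics:
	assumes "\<epsilon> > 0"
	obtains N where "\<And>m \<mu>. real_of_int \<bar>m\<bar> >= N ==> norm (\<mu> - pim m) <= C / real_of_int \<bar>m\<bar> ==>
		 norm (exp (- (\<i> * of_real pi * of_int m)) * (2*pi*\<i> * of_int m) * n12 \<mu> - fcoef q m) * real_of_int \<bar>m\<bar> ^ Suc s <= \<epsilon>"
proof -
	interpret scale "near (max C 0)" fst by unfold_locales (rule near_lim)
	have "\<forall>\<^sub>F p in near (max C 0). \<forall>x\<in>{0..1::real}. norm (exp (- (\<i> * of_real pi * of_int (fst p))) * (2*pi*\<i> * of_int (fst p)) * n12 (snd p) - fcoef q (fst p)) * real_of_int \<bar>fst p\<bar> ^ Suc s <= \<epsilon>"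
		using n12_asymptotics_sm[of "max C 0"] assms unfolding sm_def by simp
	then obtain N where N: "\<And>m \<mu>. real_of_int \<bar>m\<bar> >= N ==> norm (\<mu> - pim m) <= max C 0 / real_of_int \<bar>m\<bar> ==>
		 \<forall>x\<in>{0..1::real}. norm (exp (- (\<i> * of_real pi * of_int m)) * (2*pi*\<i> * of_int m) * n12 \<mu> - fcoef q m) * real_of_int \<bar>m\<bar> ^ Suc s <= \<epsilon>"
		unfolding eventually_near by auto
	show ?thesis
	proof (rule that[of N])
		fix m :: int and \<mu> :: complex
		assume a: "real_of_int \<bar>m\<bar> >= N" "norm (\<mu> - pim m) <= C / real_of_int \<bar>m\<bar>"
		have "C / real_of_int \<bar>m\<bar> <= max C 0 / real_of_int \<bar>m\<bar>" by (intro divide_right_mono) auto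
		then show "norm (exp (- (\<i> * of_real pi * of_int m)) * (2*pi*\<i> * of_int m) * n12 \<mu> - fcoef q m) * real_of_int \<bar>m\<bar> ^ Suc s <= \<epsilon>"
			using N[OF a(1) order_trans[OF a(2)]] by auto
	qed
qed

end

section \<open>Construction of the gauge\<close>

text \<open>The periodic Sobolev scale: f admits j integrations by parts against a periodic mode
  without boundary terms, and the last derivative is merely integrable.\<close>

primrec per :: "nat => (real => complex) => bool" where
	"per 0 f \<longleftrightarrow> f absolutely_integrable_on {0..1}"
| "per (Suc j) f \<longleftrightarrow> (\<exists>g. per j g \<and> ac f g \<and> f 1 = f 0)"

lemma per_Suc: "per (Suc j) f ==> per j f"
proof (induction j arbitrary: f)
	case 0
	then show ?case by (auto simp del: One_nat_def intro: ac_absolutely_integrable)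
next
	case (Suc j)
	then obtain g where "per (Suc j) g" "ac f g" "f 1 = f 0" using per.simps(2)[of "Suc j" f] by blast
	then show ?case using Suc.IH by auto
qed

lemma per_le: "per k f ==> j <= k ==> per j f"
	by (induction k) (auto simp: le_Suc_eq simp del: per.simps dest: per_Suc)

lemma per_add: "per j f ==> per j g ==> per j (\<lambda>x. f x + g x)"
proof (induction j arbitrary: f g)
	case 0
	then show ?case unfolding per.simps by (rule set_integral_add(1))
next
	case (Suc j)
	then obtain f' g' where "per j f'" "ac f f'" "f 1 = f 0" "per j g'" "ac g g'" "g 1 = g 0" by auto
	then show ?case using Suc.IH ac_add by (auto intro!: exI[of _ "\<lambda>x. f' x + g' x"])
qed

lemma per_cmult: "per j f ==> per j (\<lambda>x. c * f x)"
proof (induction j arbitrary: f)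
	case 0
	then show ?case unfolding per.simps by (rule set_integrable_mult_right)
next
	case (Suc j)
	then obtain f' where "per j f'" "ac f f'" "f 1 = f 0" by auto
	then show ?case using Suc.IH ac_cmult by (auto intro!: exI[of _ "\<lambda>x. c * f' x"])
qed

lemma per_zero: "per j (\<lambda>x. 0)"
proof (induction j)
	case 0
	show ?case unfolding per.simps by (rule absolutely_integrable_continuous_real) simp
next
	case (Suc j)
	then show ?case using ac_const[of 0] by auto
qed

lemma per_diff: "per j f ==> per j g ==> per j (\<lambda>x. f x - g x)"
	using per_add[of j f "\<lambda>x. (-1) * g x"] per_cmult[of j g "-1"] by simp

text \<open>A product of two integrable functions need not be integrable; \<open>per 1 g\<close>
  provides a continuous factor when j = 0. In the induction step f is itself \<open>per 1\<close>,
  so the roles can be exchanged for f g'.\<close>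

lemma per_mult: "per j f ==> per j g ==> per 1 g ==> per j (\<lambda>x. f x * g x)"
proof (induction j arbitrary: f g)
	case 0
	then obtain g' where "ac g g'" by auto
	then show ?case using 0 unfolding per.simps by (intro L1_mult_continuous ac_continuous)
next
	case (Suc j)
	obtain f' where f': "per j f'" "ac f f'" "f 1 = f 0" using Suc.prems(1) by auto
	obtain g' where g': "per j g'" "ac g g'" "g 1 = g 0" using Suc.prems(2) by auto
	have f1: "per 1 f" by (rule per_le[OF Suc.prems(1)]) simp
	have "per j (\<lambda>x. f' x * g x + g' x * f x)"
		by (intro per_add Suc.IH f' g' per_Suc[OF Suc.prems(1)] per_Suc[OF Suc.prems(2)] Suc.prems(3) f1)
	then have "per j (\<lambda>x. f' x * g x + f x * g' x)" by (simp add: mult.commute)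
	then show ?case unfolding per.simps using ac_mult[OF f'(2) g'(2)] f'(3) g'(3) by auto
qed

text \<open>Polynomials in z with coefficients in \<open>per j\<close>, in Horner form, so that
  inductions need no bookkeeping of degrees.\<close>

inductive pol :: "nat => (complex => real => complex) => bool" for j where
	pol_const: "per j c ==> pol j (\<lambda>z. c)"
| pol_step: "per j c ==> pol j X ==> pol j (\<lambda>z x. c x + z * X z x)"

lemma pol_cong: "pol j X ==> (\<And>z x. X z x = Y z x) ==> pol j Y"
proof -
	assume "pol j X" "\<And>z x. X z x = Y z x"
	moreover from this(2) have "X = Y" by blast
	ultimately show ?thesis by simp
qed

lemma pol_add: "pol j X ==> pol j Y ==> pol j (\<lambda>z x. X z x + Y z x)"
proof (induction arbitrary: Y rule: pol.induct)
	case (pol_const c)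
	from pol_const(2) show ?case
	proof cases
		case (pol_const c')
		then show ?thesis using pol.pol_const[OF per_add[OF \<open>per j c\<close> pol_const(2)]] by simp
	next
		case (pol_step c' X')
		show ?thesis
			by (rule pol_cong[OF pol.pol_step[OF per_add[OF \<open>per j c\<close> pol_step(2)] pol_step(3)]]) (simp add: pol_step(1) algebra_simps)
	qed
next
	case (pol_step c X)
	from pol_step(4) show ?case
	proof cases
		case (pol_const c')
		show ?thesis
			by (rule pol_cong[OF pol.pol_step[OF per_add[OF pol_step.hyps(1) pol_const(2)] pol_step.hyps(2)]]) (simp add: pol_const(1) algebra_simps)
	next
		case (pol_step c' X')
		show ?thesis
			by (rule pol_cong[OF pol.pol_step[OF per_add[OF \<open>per j c\<close> pol_step(2)] \<open>\<And>Y. pol j Y ==> pol j (\<lambda>z x. X z x + Y z x)\<close>[OF pol_step(3)]]])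
				 (simp add: pol_step(1) algebra_simps)
	qed
qed

lemma pol_mult_per: "pol j X ==> per j f ==> per 1 f ==> pol j (\<lambda>z x. X z x * f x)"
proof (induction rule: pol.induct)
	case (pol_const c)
	then show ?case using pol.pol_const[OF per_mult] by simp
next
	case (pol_step c X)
	show ?case
		by (rule pol_cong[OF pol.pol_step[OF per_mult[OF pol_step(1,4,5)] pol_step(3)[OF pol_step(4,5)]]]) (simp add: algebra_simps)
qed

lemma pol_cmult: "pol j X ==> pol j (\<lambda>z x. a * X z x)"
proof (induction rule: pol.induct)
	case (pol_const c)
	then show ?case using pol.pol_const[OF per_cmult, of j c a] by simp
next
	case (pol_step c X)
	show ?case by (rule pol_cong[OF pol.pol_step[OF per_cmult[OF pol_step(1), of a] pol_step(3)]]) (simp add: algebra_simps)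
qed

lemma pol_times_z: "pol j X ==> pol j (\<lambda>z x. z * X z x)"
	using pol_step[OF per_zero] by simp

lemma pol_times_power: "pol j X ==> pol j (\<lambda>z x. z ^ n * X z x)"
proof (induction n)
	case (Suc n)
	show ?case by (rule pol_cong[OF pol_times_z[OF Suc.IH[OF Suc.prems]]]) simp
qed simp

lemma pol_le: "pol k X ==> j <= k ==> pol j X"
	by (induction rule: pol.induct) (auto intro: pol.intros per_le)

lemma pol_at_0: "pol j X ==> per j (X 0)"
	by (induction rule: pol.induct) simp_all

lemma pol_quotient:
	assumes "pol j X"
	obtains Y where "pol j Y" "\<And>z x. X z x = X 0 x + z * Y z x"
	using assms
proof cases
	case (pol_const c)
	then show ?thesis using that[of "\<lambda>z x. 0"] pol.pol_const[OF per_zero] by simp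
next
	case (pol_step c Y)
	then show ?thesis using that[of Y] by simp
qed

lemma pol_ac: "pol 1 X ==> \<exists>X'. \<forall>z. ac (X z) (X' z)"
proof (induction rule: pol.induct)
	case (pol_const c)
	then show ?case by auto
next
	case (pol_step c X)
	obtain c' where c: "ac c c'" using pol_step(1) by auto
	obtain X' where X: "\<And>z. ac (X z) (X' z)" using pol_step(3) by blast
	show ?case by (intro exI[of _ "\<lambda>z x. c' x + z * X' z x"] allI ac_add ac_cmult c X)
qed

lemma pol_per: "pol 1 X ==> X z 1 = X z 0"
	by (induction rule: pol.induct) auto

lemma pol_holomorphic: "pol j X ==> (\<lambda>z. X z x) holomorphic_on UNIV"
	by (induction rule: pol.induct) (auto intro!: holomorphic_intros)

lemma pol_bound: "pol 1 X ==> \<exists>B\<ge>0. \<forall>z x. norm z <= 1 --> x \<in> {0..1} --> norm (X z x) <= B"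
proof (induction rule: pol.induct)
	case (pol_const c)
	then obtain c' where "ac c c'" by auto
	then obtain B where "B > 0" "\<And>x. x \<in> {0..1} ==> norm (c x) <= B" using ac_bounded[OF ac_continuous] by blast
	then show ?case by (intro exI[of _ B]) auto
next
	case (pol_step c X)
	then obtain c' where "ac c c'" by auto
	then obtain B where B: "B > 0" "\<And>x. x \<in> {0..1} ==> norm (c x) <= B" using ac_bounded[OF ac_continuous] by blast
	obtain D where D: "D >= 0" "\<And>z x. norm z <= 1 ==> x \<in> {0..1} ==> norm (X z x) <= D" using pol_step(3) by blast
	show ?case
	proof (intro exI[of _ "B + D"] conjI allI impI)
		fix z :: complex and x :: real assume z: "norm z <= 1" and x: "x \<in> {0..1}"
		have "norm (z * X z x) <= 1*D" unfolding norm_mult by (intro mult_mono z D x) auto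
		then show "norm (c x + z * X z x) <= B + D" using B(2)[OF x] norm_triangle_ineq[of "c x" "z * X z x"] by linarith
	qed (use B D in auto)
qed

text \<open>Recursion for the Riccati equation with T = z T1. Since T/z = T1, subtracting z^k A from
  T1 cancels the leading residual z^k A and produces - z^(k+1) A' and quadratic terms. One
  derivative is spent per step. The top-order part of A stays (-1)^(k+1) times the k-th derivative
  of q, because A is differentiated with a change of sign; all else is collected in
  \<open>e\<close>, which is one degree smoother.\<close>

lemma wkb_expansion:
	fixes dd :: "nat => real => complex"
	assumes per: "\<And>k. k <= s ==> per (s - k) (dd k)" and der: "\<And>k. k < s ==> ac (dd k) (dd (Suc k))"
	shows "k <= s ==> \<exists>T1 T' A e X. pol (s - k + 1) T1 \<and> (\<forall>z. ac (\<lambda>x. z * T1 z x) (T' z)) \<and> per (s - k) A \<and>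
		 per (s - k + 1) e \<and> (\<forall>x. A x = (-1) ^ Suc k * dd k x + e x) \<and> pol (s - k + 1) X \<and>
		 (\<forall>z. \<forall>x\<in>{0..1}. T' z x + T1 z x + (z * T1 z x)\<^sup>2 - dd 0 x = z ^ k * A x + z ^ Suc k * X z x)"
proof (induction k)
	case 0
	have z: "pol (s - 0 + 1) (\<lambda>z x. 0)" by (rule pol_const[OF per_zero])
	show ?case
		using z per_zero[of "s - 0 + 1"] per_cmult[OF per[of 0], of "-1"] ac_const[of 0]
		by (intro exI[of _ "\<lambda>z x. 0"] exI[of _ "\<lambda>x. - dd 0 x"] exI[of _ "\<lambda>x. 0"]) simp
next
	case (Suc k)
	then have k: "k < s" "k <= s" by auto
	obtain T1 T' A e X where T1: "pol (s - k + 1) T1" and T': "\<And>z. ac (\<lambda>x. z * T1 z x) (T' z)" and A: "per (s - k) A"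
		and e: "per (s - k + 1) e" and Ae: "\<And>x. A x = (-1) ^ Suc k * dd k x + e x" and X: "pol (s - k + 1) X"
		and eq: "\<And>z x. x \<in> {0..1} ==> T' z x + T1 z x + (z * T1 z x)\<^sup>2 - dd 0 x = z ^ k * A x + z ^ Suc k * X z x"
		using Suc.IH[OF k(2)] by blast
	have sk: "s - k = s - Suc k + 1" using k by simp
	obtain e' where e': "per (s - k) e'" "ac e e'" using e by auto
	define A' where "A' x = (-1) ^ Suc k * dd (Suc k) x + e' x" for x
	have "ac (\<lambda>x. (-1) ^ Suc k * dd k x + e x) (\<lambda>x. (-1) ^ Suc k * dd (Suc k) x + e' x)"
		by (intro ac_add ac_cmult der k e')
	then have A': "ac A A'" by (rule ac_cong) (simp_all add: Ae A'_def)
	obtain Y where Y: "pol (s - k + 1) Y" "\<And>z x. X z x = X 0 x + z * Y z x" using pol_quotient[OF X] by blast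
	have A1: "per 1 A" by (rule per_le[OF A]) (use k in simp)
	define Tn where "Tn z x = T1 z x - z ^ k * A x" for z x
	define Tn' where "Tn' z x = T' z x - z ^ Suc k * A' x" for z x
	define en where "en x = X 0 x - e' x" for x
	define An where "An x = X 0 x - A' x" for x
	\<comment> \<open>The last two terms come from squaring z (T1 - z^k A), after removal of the common
	  factor z^(k+2).\<close>
	define Xn where "Xn z x = Y z x + ((-2) * (T1 z x * A x) + z ^ k * (A x * A x))" for z x
	have pT1: "pol (s - k) T1" by (rule pol_le[OF T1]) simp
	have 1: "pol (s - Suc k + 1) Tn"
		unfolding sk[symmetric]
		by (rule pol_cong[OF pol_add[OF pT1 pol_cmult[OF pol_times_power[OF pol_const[OF A], where n=k], of "-1"]]]) (simp add: Tn_def)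
	have 2: "ac (\<lambda>x. z * Tn z x) (Tn' z)" for z
		by (rule ac_cong[OF ac_diff[OF T' ac_cmult[OF A', of "z ^ Suc k"]]]) (simp_all add: Tn_def Tn'_def algebra_simps)
	have 3: "per (s - Suc k + 1) en"
		unfolding sk[symmetric] en_def by (rule per_diff[OF per_le[OF pol_at_0[OF X]] e'(1)]) simp
	have 5: "An x = (-1) ^ Suc (Suc k) * dd (Suc k) x + en x" for x by (simp add: An_def en_def A'_def)
	have 4: "per (s - Suc k) An"
	proof -
		have "per (s - Suc k) (\<lambda>x. (-1) ^ Suc (Suc k) * dd (Suc k) x + en x)"
			by (intro per_add per_cmult per per_le[OF 3]) (use k in auto)
		then show ?thesis by (simp only: 5[symmetric])
	qed
	have 6: "pol (s - Suc k + 1) Xn"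
		unfolding sk[symmetric] Xn_def
		by (intro pol_add pol_cmult pol_times_power pol_mult_per pol_const per_mult A A1 pT1 pol_le[OF Y(1)]) simp
	have 7: "Tn' z x + Tn z x + (z * Tn z x)\<^sup>2 - dd 0 x = z ^ Suc k * An x + z ^ Suc (Suc k) * Xn z x" if x: "x \<in> {0..1}" for z x
	proof -
		have "Tn' z x + Tn z x + (z * Tn z x)\<^sup>2 - dd 0 x
			= (T' z x + T1 z x + (z * T1 z x)\<^sup>2 - dd 0 x) - z ^ Suc k * A' x - z ^ k * A x
				 - 2*z ^ Suc (Suc k) * (T1 z x * A x) + z ^ Suc (Suc k) * (z ^ k * (A x * A x))"
			by (simp add: Tn_def Tn'_def power2_eq_square algebra_simps)
		also have "\<dots> = z ^ Suc k * An x + z ^ Suc (Suc k) * Xn z x"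
			unfolding eq[OF x] Y(2)[of z x] by (simp add: An_def Xn_def algebra_simps)
		finally show ?thesis .
	qed
	show ?case
		by (intro exI[of _ Tn] exI[of _ Tn'] exI[of _ An] exI[of _ en] exI[of _ Xn] conjI allI ballI 1 2 3 4 5 6 7)
qed

lemma integral_emode_deriv:
	assumes "ac f f'" "f 1 = f 0"
	shows "integral {0..1} (\<lambda>x. f' x * emode m x) = 2*pi*\<i> * of_int m * integral {0..1} (\<lambda>x. f x * emode m x)"
proof (cases "m = 0")
	case True
	have "integral {0..1} f' = 0" using acD(2)[OF assms(1), of 1] assms(2) by simp
	then show ?thesis using True by (simp add: emode_def)
next
	case False
	show ?thesis using integral_emode_parts[OF assms(1) False, of 1] False assms(2) by (simp add: emode_1)
qed

text \<open>The endpoint conditions act twice: they make the exponent and \<open>e\<close> periodic,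
  and they give the m-th coefficient of the s-th derivative as (2 \<pi> i m)^s q_m, with no boundary
  terms.\<close>

lemma gauge_exists:
	fixes dd :: "nat => real => complex"
	assumes int: "\<And>k. k <= s ==> dd k absolutely_integrable_on {0..1}" and der: "\<And>k. k < s ==> ac (dd k) (dd (Suc k))"
		and bc: "\<And>k. k < s ==> dd k 1 = dd k 0"
	obtains T T' X A e e' K where "gauge (dd 0) s T T' X A (dd s) e e' K"
proof -
	have per: "per j (dd k)" if "j + k = s" for j k
		using that
	proof (induction j arbitrary: k)
		case 0
		then show ?case using int by simp
	next
		case (Suc j)
		then show ?case using der[of k] bc[of k] Suc.IH[of "Suc k"] by auto
	qed
	obtain T1 T' A e X where T1: "pol 1 T1" and T': "\<And>z. ac (\<lambda>x. z * T1 z x) (T' z)" and A: "per 0 A"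
		and e: "per 1 e" and Ae: "\<And>x. A x = (-1) ^ Suc s * dd s x + e x" and X: "pol 1 X"
		and eq: "\<And>z x. x \<in> {0..1} ==> T' z x + T1 z x + (z * T1 z x)\<^sup>2 - dd 0 x = z ^ s * A x + z ^ Suc s * X z x"
		using wkb_expansion[of s dd s, OF per der] by fastforce
	obtain e' where e': "ac e e'" "e 1 = e 0" using e by auto
	obtain Y where Y: "pol 1 Y" "\<And>z x. X z x = X 0 x + z * Y z x" using pol_quotient[OF X] by blast
	obtain B1 where B1: "B1 >= 0" "\<And>z x. norm z <= 1 ==> x \<in> {0..1} ==> norm (T1 z x) <= B1" using pol_bound[OF T1] by blast
	obtain B2 where B2: "B2 >= 0" "\<And>z x. norm z <= 1 ==> x \<in> {0..1} ==> norm (X z x) <= B2" using pol_bound[OF X] by blast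
	obtain B3 where B3: "B3 >= 0" "\<And>z x. norm z <= 1 ==> x \<in> {0..1} ==> norm (Y z x) <= B3" using pol_bound[OF Y(1)] by blast
	obtain X' where X': "\<And>z. ac (X z) (X' z)" using pol_ac[OF X] by blast
	define K where "K = B1 + B2 + B3"
	have coef: "integral {0..1} (\<lambda>x. dd k x * emode m x) = (2*pi*\<i> * of_int m) ^ k * fcoef (dd 0) m" if "k <= s" for k m
		using that
	proof (induction k)
		case 0
		then show ?case by (simp add: fcoef_def emode_def)
	next
		case (Suc k)
		then show ?case using integral_emode_deriv[OF der[of k] bc[of k], of m] by (simp add: mult_ac)
	qed
	have "gauge (dd 0) s (\<lambda>z x. z * T1 z x) T' X A (dd s) e e' K"
	proof
		show "dd 0 absolutely_integrable_on {0..1}" "L1 (dd s)" by (rule int, simp)+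
		show "ac (\<lambda>x. z * T1 z x) (T' z)" for z by (rule T')
		show "z * T1 z 1 = z * T1 z 0" for z by (simp add: pol_per[OF T1])
		show "(\<lambda>z. z * T1 z 0) holomorphic_on UNIV" by (intro holomorphic_intros pol_holomorphic[OF T1])
		show "K >= 0" using B1 B2 B3 by (simp add: K_def)
		fix z :: complex and x :: real
		show "continuous_on {0..1} (X z)" by (rule ac_continuous[OF X'])
		assume x: "x \<in> {0..1}"
		show "A x = (-1) ^ Suc s * dd s x + e x" by (rule Ae)
		show "T' z x + z * T1 z x / z + (z * T1 z x)\<^sup>2 - dd 0 x = z ^ s * A x + z ^ Suc s * X z x" if "z \<noteq> 0"
			using eq[OF x, of z] that by simp
		assume z: "norm z <= 1"
		have "norm (T1 z x) <= K" using B1(2)[OF z x] B2 B3 by (simp add: K_def)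
		then show "norm (z * T1 z x) <= K * norm z" using mult_left_mono[of "norm (T1 z x)" K "norm z"] by (simp add: norm_mult mult.commute)
		show "norm (X z x) <= K" using B2(2)[OF z x] B1 B3 by (simp add: K_def)
		have "norm (Y z x) <= K" using B3(2)[OF z x] B1 B2 by (simp add: K_def)
		then show "norm (X z x - X 0 x) <= K * norm z" unfolding Y(2)[of z x] using mult_left_mono[of "norm (Y z x)" K "norm z"] by (simp add: norm_mult mult.commute)
	next
		show "L1 A" using A by simp
		show "integral {0..1} (\<lambda>x. dd s x * emode m x) = (2*pi*\<i> * of_int m) ^ s * fcoef (dd 0) m" for m
			by (rule coef) simp
		show "ac e e'" "e 1 = e 0" by fact+
	qed
	then show ?thesis by (rule that)
qed

text \<open>For plain exponentials e^(i\<mu>x) the residual is -q itself.\<close>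

lemma trivial_gauge:
	assumes "L1 q"
	shows "gauge q 0 (\<lambda>z x. 0) (\<lambda>z x. 0) (\<lambda>z x. 0) (\<lambda>x. - q x) q (\<lambda>x. 0) (\<lambda>x. 0) 0"
proof
	show "L1 (\<lambda>x. - q x)"
		using set_integrable_mult_right[of "-1" lebesgue "{0..1}" q] assms by simp
qed (use assms ac_const[of 0] in \<open>simp_all add: fcoef_def emode_def\<close>)

section \<open>Simplicity of the large eigenvalues\<close>

text \<open>e^(2i\<mu>) - 1 = 2i e^(i\<mu>) sin \<mu> is small, and taking a logarithm puts 2i\<mu>
  close to a multiple of 2 \<pi> i. The factor e comes from |e^(i\<mu>)| in the strip.\<close>

lemma near_multiple_of_pi:
	fixes \<mu> :: complex
	assumes im: "\<bar>Im \<mu>\<bar> <= 1" and s: "norm (sin \<mu>) <= \<delta>" and \<delta>: "2 * exp 1 * \<delta> < 1/2"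
	obtains m :: int where "norm (\<mu> - pim m) <= 2 * exp 1 * \<delta>"
proof -
	define v where "v = exp (2*\<i>*\<mu>) - 1"
	have "v = exp (\<i>*\<mu>) * (exp (\<i>*\<mu>) - exp (- (\<i>*\<mu>)))"
		unfolding v_def by (simp add: right_diff_distrib exp_add[symmetric] mult.assoc)
	also have "exp (\<i>*\<mu>) - exp (- (\<i>*\<mu>)) = 2*\<i> * sin \<mu>" by (simp add: sin_exp_eq)
	finally have "norm v = norm (exp (\<i>*\<mu>)) * (2 * norm (sin \<mu>))" by (simp add: norm_mult)
	also have "\<dots> <= exp 1 * (2*\<delta>)" using im s by (intro mult_mono) auto
	finally have v: "norm v <= 2 * exp 1 * \<delta>" by simp
	then have v2: "norm v < 1/2" using \<delta> by linarith
	then have nz: "1 + v \<noteq> 0" by (auto simp: add_eq_0_iff)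
	have "exp (2*\<i>*\<mu>) = exp (Ln (1 + v))" using nz by (simp add: v_def)
	then obtain n :: int where n: "2*\<i>*\<mu> = Ln (1 + v) + of_int (2*n) * of_real pi * \<i>"
		unfolding exp_eq by auto
	have L: "norm (Ln (1 + v)) <= 2 * norm v" by (rule norm_Ln_le[OF v2])
	have "2*\<i> * (\<mu> - pim n) = Ln (1 + v)" using n by (simp add: algebra_simps)
	then have "2 * norm (\<mu> - pim n) = norm (Ln (1 + v))" by (metis norm_mult norm_ii norm_numeral mult.right_neutral)
	then have "norm (\<mu> - pim n) <= norm v" using L by linarith
	then show ?thesis using that v by (meson order_trans)
qed

text \<open>\<open>Z\<close> lies outside a sector around the negative real axis, so a relatively
  small \<open>E\<close> cannot carry it there. If Re Z >= 0, both parts of Z are at most |E|,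
  whence |Z| <= 2 |E| < |Z|; otherwise the imaginary parts already disagree.\<close>

lemma not_nonpositive_perturbation:
	fixes Z E :: complex
	assumes Z: "Z \<noteq> 0" and S: "S >= 0" and eq: "of_real (- S) = Z + E" and E: "norm E <= \<kappa> * norm Z"
		and k: "\<kappa> < 1/2" "\<kappa> < \<epsilon>" and alt: "Re Z >= 0 \<or> \<bar>Im Z\<bar> >= \<epsilon> * norm Z"
	shows False
proof -
	have nz: "norm Z > 0" using Z by simp
	have re: "- S = Re Z + Re E" and im: "Im Z = - Im E" using arg_cong[OF eq, of Re] arg_cong[OF eq, of Im] by simp_all
	have e: "\<bar>Re E\<bar> <= norm E" "\<bar>Im E\<bar> <= norm E" by (simp_all add: abs_Re_le_cmod abs_Im_le_cmod)
	from alt show False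
	proof
		assume "Re Z >= 0"
		then have "norm Z <= 2 * norm E" using cmod_le[of Z] re im e S by linarith
		also have "\<dots> <= 2 * (\<kappa> * norm Z)" using E by linarith
		also have "\<dots> < norm Z" using k(1) nz by simp
		finally show False by simp
	next
		assume "\<bar>Im Z\<bar> >= \<epsilon> * norm Z"
		then have "\<epsilon> * norm Z <= \<kappa> * norm Z" using im e E by linarith
		then show False using k(2) nz by simp
	qed
qed

context gauge
begin

text \<open>Cauchy's estimate on unit discs, at the price of narrowing the strip from 2 to 1. The
  constant doubles because 1/|\<nu>| <= 2/|\<mu>| on such a disc.\<close>

lemma deriv_strip_bound:
	"\<exists>R C. R > 2 + K \<and> C >= 0 \<and> (\<forall>\<mu>. norm \<mu> >= R \<and> \<bar>Im \<mu>\<bar> <= 1 -->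
		 norm (n11 \<mu> - exp (\<i>*\<mu>)) <= C / norm \<mu> \<and> norm (n12 \<mu>) <= C / norm \<mu> \<and>
		 norm (deriv n11 \<mu> - \<i> * exp (\<i>*\<mu>)) <= C / norm \<mu> \<and> norm (deriv n12 \<mu>) <= C / norm \<mu> \<and>
		 n11 field_differentiable at \<mu> \<and> n12 field_differentiable at \<mu>)"
proof -
	obtain R0 C0 where R0: "R0 > 1 + K" and C0: "C0 >= 0"
		and b1: "\<And>\<mu>. norm \<mu> >= R0 ==> \<bar>Im \<mu>\<bar> <= 2 ==> norm (n11 \<mu> - exp (\<i>*\<mu>)) <= C0 / norm \<mu>"
		and b2: "\<And>\<mu>. norm \<mu> >= R0 ==> \<bar>Im \<mu>\<bar> <= 2 ==> norm (n12 \<mu>) <= C0 / norm \<mu>"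
		using strip_bound by blast
	let ?D = "{\<mu>::complex. norm \<mu> > 1 + K}"
	have oD: "open ?D" by (intro open_Collect_less continuous_intros)
	have near: "norm \<nu> >= R0 \<and> \<bar>Im \<nu>\<bar> <= 2 \<and> \<nu> \<in> ?D \<and> C0 / norm \<nu> <= 2*C0 / norm \<mu>"
		if mu: "norm \<mu> >= R0 + 1" "\<bar>Im \<mu>\<bar> <= 1" and nu: "norm (\<mu> - \<nu>) <= 1" for \<mu> \<nu>
	proof -
		have n: "norm \<nu> >= norm \<mu> - 1" using nu norm_triangle_sub[of \<mu> \<nu>] by linarith
		have i: "\<bar>Im \<nu>\<bar> <= 2" using abs_Im_le_cmod[of "\<mu> - \<nu>"] nu mu(2) by simp
		have R1: "R0 > 1" using R0 K by linarith
		have "C0 / norm \<nu> <= C0 / (norm \<mu> / 2)" using n mu(1) R1 C0 by (intro divide_left_mono mult_pos_pos) auto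
		then have "C0 / norm \<nu> <= 2*C0 / norm \<mu>" by (simp add: mult.commute)
		then show ?thesis using n i mu(1) R0 by simp
	qed
	have cauchy: "norm (deriv f \<mu>) <= B"
		if mu: "norm \<mu> >= R0 + 1" "\<bar>Im \<mu>\<bar> <= 1" and f: "f holomorphic_on ?D" and B: "\<And>\<nu>. norm (\<mu> - \<nu>) <= 1 ==> norm (f \<nu>) <= B" for f \<mu> B
	proof -
		have sub: "cball \<mu> 1 \<subseteq> ?D" using near[OF mu] by (auto simp: dist_norm)
		have "norm ((deriv ^^ 1) f \<mu>) <= fact 1 * B/1 ^ 1"
		proof (rule Cauchy_inequality)
			show "f holomorphic_on ball \<mu> 1" by (rule holomorphic_on_subset[OF f]) (use sub ball_subset_cball in blast)
			show "continuous_on (cball \<mu> 1) f" by (rule holomorphic_on_imp_continuous_on[OF holomorphic_on_subset[OF f sub]])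
		qed (use B in auto)
		then show ?thesis by simp
	qed
	have diff: "f field_differentiable at \<mu>" if "norm \<mu> >= R0 + 1" "f holomorphic_on ?D" for f \<mu>
		using holomorphic_on_imp_differentiable_at[OF that(2) oD] that(1) R0 by auto
	have e_hol: "(\<lambda>\<mu>. exp (\<i>*\<mu>)) holomorphic_on A" for A by (intro holomorphic_intros)
	have d1: "norm (deriv n11 \<mu> - \<i> * exp (\<i>*\<mu>)) <= 2*C0 / norm \<mu>" if mu: "norm \<mu> >= R0 + 1" "\<bar>Im \<mu>\<bar> <= 1" for \<mu>
	proof -
		have "norm (deriv (\<lambda>\<nu>. n11 \<nu> - exp (\<i>*\<nu>)) \<mu>) <= 2*C0 / norm \<mu>"
			by (rule cauchy[OF mu]) (use near[OF mu] b1 in \<open>auto intro!: holomorphic_intros n_holomorphic intro: order_trans\<close>)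
		also have "deriv (\<lambda>\<nu>. n11 \<nu> - exp (\<i>*\<nu>)) \<mu> = deriv n11 \<mu> - deriv (\<lambda>\<nu>. exp (\<i>*\<nu>)) \<mu>"
			by (rule deriv_diff[OF diff[OF mu(1) n_holomorphic(1)] holomorphic_on_imp_differentiable_at[OF e_hol open_UNIV]]) simp
		also have "deriv (\<lambda>\<nu>. exp (\<i>*\<nu>)) \<mu> = \<i> * exp (\<i>*\<mu>)"
			by (rule DERIV_imp_deriv) (auto intro!: derivative_eq_intros)
		finally show ?thesis .
	qed
	have d2: "norm (deriv n12 \<mu>) <= 2*C0 / norm \<mu>" if mu: "norm \<mu> >= R0 + 1" "\<bar>Im \<mu>\<bar> <= 1" for \<mu>
		by (rule cauchy[OF mu n_holomorphic(2)]) (use near[OF mu] b2 in \<open>auto intro: order_trans\<close>)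
	have R1: "R0 + 1 > 2 + K" using R0 by simp
	have le: "C0 / norm \<mu> <= 2*C0 / norm \<mu>" for \<mu> :: complex using C0 by (intro divide_right_mono) auto
	have "norm (n11 \<mu> - exp (\<i>*\<mu>)) <= 2*C0 / norm \<mu> \<and> norm (n12 \<mu>) <= 2*C0 / norm \<mu> \<and>
		 norm (deriv n11 \<mu> - \<i> * exp (\<i>*\<mu>)) <= 2*C0 / norm \<mu> \<and> norm (deriv n12 \<mu>) <= 2*C0 / norm \<mu> \<and>
		 n11 field_differentiable at \<mu> \<and> n12 field_differentiable at \<mu>"
		if mu: "norm \<mu> >= R0 + 1" "\<bar>Im \<mu>\<bar> <= 1" for \<mu>
	proof (intro conjI d1[OF mu] d2[OF mu] diff[OF mu(1)] n_holomorphic)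
		show "norm (n11 \<mu> - exp (\<i>*\<mu>)) <= 2*C0 / norm \<mu>" by (rule order_trans[OF b1 le]) (use mu in auto)
		show "norm (n12 \<mu>) <= 2*C0 / norm \<mu>" by (rule order_trans[OF b2 le]) (use mu in auto)
	qed
	then show ?thesis using R1 C0 by (intro exI[of _ "R0 + 1"] exI[of _ "2*C0"]) simp
qed

text \<open>Suppose the derivative vanishes. The derivatives of n11(\<mu>) and n11(-\<mu>) then
  cancel, which makes sin \<mu> small and places \<mu> near some \<pi> m. Differentiating the
  determinant identity bounds n11(\<mu>) - n11(-\<mu>) by O(1/\<mu>) times the size of the
  off-diagonal entries, so its square is negligible against their product. What remains puts q_m
  q_(-m) almost on the negative real axis.\<close>

lemma simple_right_half_plane:
	fixes c \<epsilon> B :: real and N0 :: int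
	assumes c: "c > 0" and ep: "\<epsilon> > 0" and B: "B > 0"
		and cond: "\<And>n. n > N0 ==> norm (fcoef q n) <= B * norm (fcoef q (-n)) \<and> norm (fcoef q (-n)) <= B * norm (fcoef q n) \<and>
				norm (fcoef q n) > c * real_of_int n powr (- real s - 1) \<and>
				(Re (fcoef q n * fcoef q (-n)) >= 0 \<or> \<bar>Im (fcoef q n * fcoef q (-n))\<bar> >= \<epsilon> * norm (fcoef q n * fcoef q (-n)))"
	obtains R where "\<And>\<mu> t. norm \<mu> >= R ==> \<bar>Im \<mu>\<bar> <= 1 ==> Re \<mu> >= 0 ==> hill q (\<mu>\<^sup>2) = 2 * cos (of_real t) ==> deriv (hill q) (\<mu>\<^sup>2) \<noteq> 0"
proof -
	obtain R0 C where R0: "R0 > 2 + K" and C: "C >= 0"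
		and strip: "\<forall>\<mu>. norm \<mu> >= R0 \<and> \<bar>Im \<mu>\<bar> <= 1 -->
		 norm (n11 \<mu> - exp (\<i>*\<mu>)) <= C / norm \<mu> \<and> norm (n12 \<mu>) <= C / norm \<mu> \<and>
		 norm (deriv n11 \<mu> - \<i> * exp (\<i>*\<mu>)) <= C / norm \<mu> \<and> norm (deriv n12 \<mu>) <= C / norm \<mu> \<and>
		 n11 field_differentiable at \<mu> \<and> n12 field_differentiable at \<mu>"
		using deriv_strip_bound by blast
	have d1: "\<And>\<mu>. norm \<mu> >= R0 ==> \<bar>Im \<mu>\<bar> <= 1 ==> norm (deriv n11 \<mu> - \<i> * exp (\<i>*\<mu>)) <= C / norm \<mu>"
		and d2: "\<And>\<mu>. norm \<mu> >= R0 ==> \<bar>Im \<mu>\<bar> <= 1 ==> norm (deriv n12 \<mu>) <= C / norm \<mu>"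
		and diff: "\<And>\<mu>. norm \<mu> >= R0 ==> \<bar>Im \<mu>\<bar> <= 1 ==> n11 field_differentiable at \<mu> \<and> n12 field_differentiable at \<mu>"
		using strip by blast+
	define C1 where "C1 = 2 * exp 1 * C"
	have C1: "C1 >= 0" using C by (simp add: C1_def)
	\<comment> \<open>Total relative error allowed by \<open>not_nonpositive_perturbation\<close>:
	  below 1/2 and below \<epsilon>.\<close>
	define \<kappa> where "\<kappa> = min (1/4) (\<epsilon>/2)"
	have k: "\<kappa> > 0" "\<kappa> < 1/2" "\<kappa> < \<epsilon>" "\<kappa> <= 1/4" using ep by (auto simp: \<kappa>_def)
	\<comment> \<open>Relative error allowed for each off-diagonal entry. Their product then has error
	  at most 3 \<theta> = \<kappa>/2; the other half of \<kappa> is left for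
	  \<open>W*W\<close>.\<close>
	define \<theta> where "\<theta> = \<kappa>/6"
	have th: "\<theta> > 0" "\<theta> <= 1" using k by (auto simp: \<theta>_def)
	\<comment> \<open>Turns the absolute error of \<open>n12_asymptotics\<close> into a relative one:
	  the lower bound c n^(-s-1) holds for |q_n|, and the division by max 1 B transfers it to
	  |q_(-n)|.\<close>
	define \<epsilon>1 where "\<epsilon>1 = \<theta>*c / max 1 B"
	have e1: "\<epsilon>1 > 0" using th c by (simp add: \<epsilon>1_def)
	obtain N1 where N1: "\<And>m \<mu>. real_of_int \<bar>m\<bar> >= N1 ==> norm (\<mu> - pim m) <= C1 / real_of_int \<bar>m\<bar> ==>
		 norm (exp (- (\<i> * of_real pi * of_int m)) * (2*pi*\<i> * of_int m) * n12 \<mu> - fcoef q m) * real_of_int \<bar>m\<bar> ^ Suc s <= \<epsilon>1"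
		using n12_asymptotics[OF e1, of C1] by blast
	define L where "L = 12*C * (1 + B)"
	have L: "L >= 0" using C B by (simp add: L_def)
	define R where "R = max R0 (max (4 * max N1 (max (of_int N0 + 1) 1) + 4) (max (16*C + 16*C1 + 16) (L\<^sup>2 * (2/\<kappa>) + 1)))"
	have Rb: "R >= R0" "R >= 4*N1 + 4" "R >= 4 * (of_int N0 + 1) + 4" "R >= 8" "R >= 16*C + 16*C1 + 16" "R >= L\<^sup>2 * (2/\<kappa>) + 1"
		unfolding R_def by (auto simp: le_max_iff_disj max_def)
	show ?thesis
	proof (rule that[of R], rule notI)
		fix \<mu> :: complex and t :: real
		assume mu: "norm \<mu> >= R" "\<bar>Im \<mu>\<bar> <= 1" "Re \<mu> >= 0" and h: "hill q (\<mu>\<^sup>2) = 2 * cos (of_real t)" and d0: "deriv (hill q) (\<mu>\<^sup>2) = 0"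
		define r where "r = norm \<mu>"
		have r: "r >= R" "r >= R0" "r > 0" using mu(1) Rb unfolding r_def by linarith+
		have mu1: "1 + K <= norm \<mu>" using r R0 unfolding r_def by linarith
		have mu': "norm (- \<mu>) >= R0" "\<bar>Im (- \<mu>)\<bar> <= 1" "norm \<mu> >= R0" using mu r unfolding r_def by auto
		define a b u v where "a = n11 \<mu>" "b = n11 (- \<mu>)" "u = n12 \<mu>" "v = n12 (- \<mu>)"
		define a' b' u' v' where "a' = deriv n11 \<mu>" "b' = - deriv n11 (- \<mu>)" "u' = deriv n12 \<mu>" "v' = - deriv n12 (- \<mu>)"
		have neg: "((\<lambda>\<nu>. f (- \<nu>)) has_field_derivative - deriv f (- \<mu>)) (at \<mu>)" if "f field_differentiable at (- \<mu>)" for f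
		proof -
			have "(f has_field_derivative deriv f (- \<mu>)) (at (- \<mu>))" using that by (simp add: field_differentiable_derivI)
			moreover have "(uminus has_field_derivative -1) (at \<mu>)" by (auto intro!: derivative_eq_intros)
			ultimately show ?thesis
				using DERIV_chain2[where f=f and g=uminus and x=\<mu> and s=UNIV and Da="deriv f (- \<mu>)" and Db="-1"] by simp
		qed
		have der: "(n11 has_field_derivative a') (at \<mu>)" "((\<lambda>\<nu>. n11 (- \<nu>)) has_field_derivative b') (at \<mu>)"
			 "(n12 has_field_derivative u') (at \<mu>)" "((\<lambda>\<nu>. n12 (- \<nu>)) has_field_derivative v') (at \<mu>)"
			unfolding a'_b'_u'_v'_def using diff[OF mu'(3) mu(2)] diff[OF mu'(1,2)] neg by (auto simp: field_differentiable_derivI)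
		have oD: "open {\<nu>::complex. norm \<nu> > 1 + K}" by (intro open_Collect_less continuous_intros)
		have muD: "\<mu> \<in> {\<nu>::complex. norm \<nu> > 1 + K}" using r R0 unfolding r_def by simp
		have "(hill q has_field_derivative deriv (hill q) (\<mu>\<^sup>2)) (at (\<mu>\<^sup>2))"
			using holomorphic_derivI[OF hill_holomorphic[OF q] open_UNIV] by simp
		moreover have "((\<lambda>\<nu>. \<nu>\<^sup>2) has_field_derivative 2 * \<mu>) (at \<mu>)" by (auto intro!: derivative_eq_intros)
		ultimately have "((\<lambda>\<nu>. hill q (\<nu>\<^sup>2)) has_field_derivative 0) (at \<mu>)"
			using DERIV_chain2[where f="hill q" and g="\<lambda>\<nu>. \<nu>\<^sup>2" and x=\<mu> and s=UNIV and Da=0 and Db="2*\<mu>"] d0 by simp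
		then have "((\<lambda>\<nu>. n11 \<nu> + n11 (- \<nu>)) has_field_derivative 0) (at \<mu>)"
			by (rule has_field_derivative_transform_within_open[OF _ oD muD]) (simp add: hill_eq(1))
		moreover have "((\<lambda>\<nu>. n11 \<nu> + n11 (- \<nu>)) has_field_derivative a' + b') (at \<mu>)" by (intro derivative_intros der)
		ultimately have ab0: "a' + b' = 0" using DERIV_unique by blast
		have "((\<lambda>\<nu>. n11 \<nu> * n11 (- \<nu>) - n12 \<nu> * n12 (- \<nu>)) has_field_derivative (a'*b + b'*a) - (u' * v + v'*u)) (at \<mu>)"
			unfolding a_b_u_v_def by (intro derivative_intros der)
		moreover have "((\<lambda>\<nu>. n11 \<nu> * n11 (- \<nu>) - n12 \<nu> * n12 (- \<nu>)) has_field_derivative 0) (at \<mu>)"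
			by (rule has_field_derivative_transform_within_open[OF DERIV_const oD muD]) (simp add: hill_eq(2))
		ultimately have "(a'*b + b'*a) - (u' * v + v'*u) = 0" using DERIV_unique by blast
		moreover have "b' = - a'" using ab0 by (simp add: add_eq_0_iff)
		\<comment> \<open>The derivative of the determinant identity, with b' = -a' inserted.\<close>
		ultimately have Peq: "a' * (a - b) = - (u' * v + v'*u)" by (simp add: algebra_simps add_eq_0_iff2)
		have Cr: "C/r <= 1/16"
		proof -
			have "16*C <= r" using Rb(5) r(1) C1 by linarith
			then show ?thesis using r(3) by (simp add: divide_le_eq)
		qed
		have a'd: "norm (a' - \<i> * exp (\<i>*\<mu>)) <= C/r" and b'd: "norm (- b' - \<i> * exp (- (\<i>*\<mu>))) <= C/r"
			using d1[OF mu'(3) mu(2)] d1[OF mu'(1,2)] by (simp_all add: a'_b'_u'_v'_def r_def)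
		have "a' - \<i> * exp (\<i>*\<mu>) - (- b' - \<i> * exp (- (\<i>*\<mu>))) = - \<i> * (exp (\<i>*\<mu>) - exp (- (\<i>*\<mu>)))"
			using ab0 by (simp add: algebra_simps add_eq_0_iff)
		also have "\<dots> = 2 * sin \<mu>" by (simp add: sin_exp_eq)
		finally have "2 * sin \<mu> = (a' - \<i> * exp (\<i>*\<mu>)) - (- b' - \<i> * exp (- (\<i>*\<mu>)))" by (rule sym)
		then have "norm (2 * sin \<mu>) <= C/r + C/r"
			using norm_triangle_ineq4[of "a' - \<i> * exp (\<i>*\<mu>)" "- b' - \<i> * exp (- (\<i>*\<mu>))"] a'd b'd by simp
		then have sn: "norm (sin \<mu>) <= C/r" by (simp add: norm_mult)
		have C1r: "2 * exp 1 * (C/r) = C1/r" by (simp add: C1_def)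
		have C1r2: "C1/r <= 1/16"
		proof -
			have "16*C1 <= r" using Rb(5) r(1) C by linarith
			then show ?thesis using r(3) by (simp add: divide_le_eq)
		qed
		obtain m :: int where m: "norm (\<mu> - pim m) <= C1/r"
		proof -
			have "2 * exp 1 * (C/r) < 1/2" using C1r C1r2 by linarith
			from near_multiple_of_pi[OF mu(2) sn this] show ?thesis using that unfolding C1r by blast
		qed
		have m': "norm (\<mu> - pim m) <= 1/16" using m C1r2 by linarith
		have mr: "\<bar>r - pi * \<bar>of_int m\<bar>\<bar> <= 1"
		proof -
			have "norm (pim m :: complex) = pi * \<bar>of_int m\<bar>" by (simp add: norm_mult)
			then show ?thesis using norm_triangle_ineq3[of \<mu> "pim m"] m' by (simp add: r_def)
		qed
		\<comment> \<open>The conditions on the coefficients are stated for positive index; the right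
		  half-plane and the size of \<mu> exclude the rest.\<close>
		have mpos: "m > 0"
		proof (rule ccontr)
			assume "\<not> m > 0"
			then have "pi * of_int m <= 0" by (simp add: mult_nonneg_nonpos)
			moreover have "\<bar>Re \<mu> - pi * of_int m\<bar> <= 1/16" using abs_Re_le_cmod[of "\<mu> - pim m"] m' by simp
			ultimately have "\<bar>Re \<mu>\<bar> <= 1/16" using mu(3) by linarith
			then have "norm \<mu> <= 2" using cmod_le[of \<mu>] mu(2) by linarith
			then show False using r(1) Rb(4) by (simp add: r_def)
		qed
		define n where "n = real_of_int m"
		have n: "n > 0" "\<bar>real_of_int m\<bar> = n" "pi*n <= r + 1" "r - 1 <= pi*n" using mpos mr by (auto simp: n_def)
		have nr: "n <= r" "r <= 4*n + 1"
		proof -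
			have "3*n <= pi*n" "pi*n <= 4*n" using pi_gt3 pi_less_4 n(1) by (auto intro!: mult_right_mono)
			then show "n <= r" "r <= 4*n + 1" using n r Rb(4) by linarith+
		qed
		have mN: "m > N0"
		proof -
			have gen: "x < n" if "4 * (x + 1) + 4 <= R" for x :: real
			proof -
				have "4 * (x + 1) + 4 <= 4*n + 1" by (rule order_trans[OF that order_trans[OF r(1) nr(2)]])
				then show ?thesis by (simp | argo)
			qed
			have "of_int N0 < n" by (rule gen[OF Rb(3)])
			then show ?thesis by (simp add: n_def)
		qed
		have nN1: "n >= N1" using nr(2) r(1) Rb(2) by linarith
		have C1n: "C1/r <= C1/n" using nr n C1 r by (intro divide_left_mono) auto
		note cm = cond[OF mN]
		define Q Q' where "Q = fcoef q m" "Q' = fcoef q (- m)"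
		have pw: "n powr (- real s - 1) = 1/n ^ Suc s"
		proof -
			have "- real s - 1 = - real (Suc s)" by simp
			then show ?thesis using n(1) by (simp only: powr_minus powr_realpow divide_inverse mult_1)
		qed
		have Q: "norm Q <= B * norm Q'" "norm Q' <= B * norm Q" "norm Q > c / n ^ Suc s"
			using cm pw by (auto simp: Q_Q'_def n_def)
		have npos: "n ^ Suc s > 0" using n(1) by simp
		have Qpos: "norm Q > 0"
		proof -
			have "c/n ^ Suc s > 0" using c npos by simp
			then show ?thesis using Q(3) by linarith
		qed
		then have Qpos': "norm Q' > 0" using Q(1) B by (metis less_le_not_le mult_zero_right norm_ge_zero order_le_less)
		define U where "U = exp (- (\<i> * of_real pi * of_int m)) * (2*pi*\<i> * of_int m) * u"
		define V where "V = exp (- (\<i> * of_real pi * of_int (- m))) * (2*pi*\<i> * of_int (- m)) * v"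
		have small: "\<epsilon>1/n ^ Suc s <= \<theta> * norm Q" "\<epsilon>1/n ^ Suc s <= \<theta> * norm Q'"
		proof -
			have "\<epsilon>1/n ^ Suc s = \<theta> * (c/n ^ Suc s) / max 1 B" by (simp add: \<epsilon>1_def)
			also have "\<dots> <= \<theta> * norm Q / max 1 B" using Q(3) th by (intro divide_right_mono mult_left_mono) auto
			finally have *: "\<epsilon>1/n ^ Suc s <= \<theta> * norm Q / max 1 B" .
			have "\<theta> * norm Q / max 1 B <= \<theta> * norm Q / 1" using th by (intro divide_left_mono) auto
			then show "\<epsilon>1/n ^ Suc s <= \<theta> * norm Q" using * by simp
			have "norm Q <= max 1 B * norm Q'" using Q(1) by (meson max.cobounded2 mult_right_mono norm_ge_zero order_trans)
			then have "\<theta> * norm Q / max 1 B <= \<theta> * norm Q'" using th by (simp add: divide_le_eq mult_ac)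
			then show "\<epsilon>1/n ^ Suc s <= \<theta> * norm Q'" using * by linarith
		qed
		have UQ: "norm (U - Q) <= \<theta> * norm Q"
		proof -
			have "norm (U - Q) * n ^ Suc s <= \<epsilon>1"
				using N1[of m \<mu>] nN1 m C1n n(2) unfolding U_def Q_Q'_def a_b_u_v_def by (simp add: order_trans)
			then have "norm (U - Q) <= \<epsilon>1/n ^ Suc s" using npos by (simp add: pos_le_divide_eq)
			then show ?thesis using small by linarith
		qed
		have VQ: "norm (V - Q') <= \<theta> * norm Q'"
		proof -
			have "- \<mu> - pim (- m) = - (\<mu> - pim m)" by simp
			then have "norm (- \<mu> - pim (- m)) = norm (\<mu> - pim m)" by (simp only: norm_minus_cancel)
			then have "norm (- \<mu> - pim (- m)) <= C1 / real_of_int \<bar>- m\<bar>" using m C1n n(2) by simp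
			from N1[OF _ this] have "norm (V - Q') * n ^ Suc s <= \<epsilon>1"
				using nN1 n(2) unfolding V_def Q_Q'_def a_b_u_v_def by simp
			then have "norm (V - Q') <= \<epsilon>1/n ^ Suc s" using npos by (simp add: pos_le_divide_eq)
			then show ?thesis using small by linarith
		qed
		have nU: "norm U = 2*pi*n * norm u" and nV: "norm V = 2*pi*n * norm v"
			unfolding U_def V_def using n(2) by (simp_all add: norm_mult)
		have UVuv: "U*V = of_real (4*pi\<^sup>2*n\<^sup>2) * (u * v)"
		proof -
			have ee: "exp (- (\<i> * of_real pi * of_int m)) * exp (- (\<i> * of_real pi * of_int (- m))) = (1::complex)"
				by (simp add: exp_add[symmetric])
			have "U*V = (exp (- (\<i> * of_real pi * of_int m)) * exp (- (\<i> * of_real pi * of_int (- m)))) * ((2*pi*\<i> * of_int m) * (2*pi*\<i> * of_int (- m))) * (u * v)"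
				unfolding U_def V_def by (simp only: mult_ac)
			also have "(2*pi*\<i> * of_int m) * (2*pi*\<i> * of_int (- m)) = of_real (4*pi\<^sup>2*n\<^sup>2)"
				by (simp add: n_def power2_eq_square algebra_simps)
			finally show ?thesis unfolding ee by simp
		qed
		have U2: "norm U <= 2 * norm Q" "norm V <= 2 * norm Q'"
		proof -
			have "\<theta> * norm Q <= 1 * norm Q" "\<theta> * norm Q' <= 1 * norm Q'" using th by (intro mult_right_mono; simp)+
			then show "norm U <= 2 * norm Q" "norm V <= 2 * norm Q'"
				using UQ VQ norm_triangle_sub[of U Q] norm_triangle_sub[of V Q'] by linarith+
		qed
		\<comment> \<open>Scaled so that W^2 + U V = -(2 \<pi> n sin t)^2 exactly, by the trace and
		  determinant identities.\<close>
		define W where "W = of_real (pi*n) * (a - b)"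
		have na': "norm a' >= 1/4"
		proof -
			have "exp (-1) <= norm (exp (\<i>*\<mu>))" using mu(2) by simp
			moreover have "exp (-1::real) >= 1/3" using exp_le by (simp add: exp_minus field_simps)
			ultimately have "norm (exp (\<i>*\<mu>)) >= 1/3" by (rule order_trans[rotated])
			then have "norm (\<i> * exp (\<i>*\<mu>)) >= 1/3" by (simp only: norm_mult norm_ii mult_1_left)
			moreover have "norm (\<i> * exp (\<i>*\<mu>)) <= norm a' + norm (a' - \<i> * exp (\<i>*\<mu>))" by (metis norm_minus_commute norm_triangle_sub)
			ultimately show ?thesis using a'd Cr by linarith
		qed
		have nab: "norm (a - b) <= 4 * (C/r * (norm u + norm v))"
		proof -
			have u'b: "norm u' <= C/r" "norm v' <= C/r" using d2[OF mu'(3) mu(2)] d2[OF mu'(1,2)] by (simp_all add: a'_b'_u'_v'_def r_def)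
			have "norm a' * norm (a - b) = norm (u' * v + v'*u)" using arg_cong[OF Peq, of norm] by (simp only: norm_mult norm_minus_cancel)
			also have "\<dots> <= norm u' * norm v + norm v' * norm u" by (rule order_trans[OF norm_triangle_ineq]) (simp add: norm_mult)
			also have "\<dots> <= C/r * norm v + C/r * norm u" by (intro add_mono mult_right_mono u'b) auto
			finally have "norm a' * norm (a - b) <= C/r * (norm u + norm v)" by (simp add: algebra_simps)
			moreover have "1/4 * norm (a - b) <= norm a' * norm (a - b)" using na' by (intro mult_right_mono) auto
			ultimately show ?thesis by linarith
		qed
		have nW: "norm W <= (L/r) * norm Q'"
		proof -
			have "norm W = pi*n * norm (a - b)" using n(1) by (simp add: W_def norm_mult)
			also have "\<dots> <= pi*n * (4 * (C/r * (norm u + norm v)))" using n(1) by (intro mult_left_mono nab) auto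
			also have "\<dots> = 2 * (C/r) * (norm U + norm V)" unfolding nU nV by (simp add: algebra_simps)
			also have "\<dots> <= 2 * (C/r) * (2 * norm Q + 2 * norm Q')" using U2 C r by (intro mult_left_mono add_mono) auto
			also have "\<dots> <= 2 * (C/r) * (2 * (B * norm Q') + 2 * norm Q')" using Q(1) C r by (intro mult_left_mono) auto
			also have "\<dots> = (4*C * (1 + B) / r) * norm Q'" by (simp add: algebra_simps add_divide_distrib)
			also have "\<dots> <= (L/r) * norm Q'" unfolding L_def using C B r by (intro mult_right_mono divide_right_mono) auto
			finally show ?thesis .
		qed
		have nW': "norm W <= (L/r) * norm Q"
		proof -
			have "norm W = pi*n * norm (a - b)" using n(1) by (simp add: W_def norm_mult)
			also have "\<dots> <= pi*n * (4 * (C/r * (norm u + norm v)))" using n(1) by (intro mult_left_mono nab) auto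
			also have "\<dots> = 2 * (C/r) * (norm U + norm V)" unfolding nU nV by (simp add: algebra_simps)
			also have "\<dots> <= 2 * (C/r) * (2 * norm Q + 2 * norm Q')" using U2 C r by (intro mult_left_mono add_mono) auto
			also have "\<dots> <= 2 * (C/r) * (2 * norm Q + 2 * (B * norm Q))" using Q(2) C r by (intro mult_left_mono) auto
			also have "\<dots> = (4*C * (1 + B) / r) * norm Q" by (simp add: algebra_simps add_divide_distrib)
			also have "\<dots> <= (L/r) * norm Q" unfolding L_def using C B r by (intro mult_right_mono divide_right_mono) auto
			finally show ?thesis .
		qed
		have Lr: "(L/r) * (L/r) <= \<kappa>/2"
		proof -
			have r1: "r >= 1" using r(1) Rb(4) by linarith
			have "L\<^sup>2 * (2/\<kappa>) <= r" using Rb(6) r(1) by linarith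
			also have "\<dots> <= r*r" using r1 by simp
			finally have "L\<^sup>2 <= \<kappa>/2 * (r*r)" using k(1) by (simp add: field_simps)
			then show ?thesis using r(3) by (simp add: power2_eq_square divide_le_eq)
		qed
		define Z where "Z = Q*Q'"
		have nZ: "norm Z > 0" using Qpos Qpos' by (simp add: Z_def norm_mult)
		have WW: "norm (W*W) <= \<kappa>/2 * norm Z"
		proof -
			have "norm (W*W) <= ((L/r) * norm Q) * ((L/r) * norm Q')"
				unfolding norm_mult by (intro mult_mono nW nW') (use L r in auto)
			also have "\<dots> = ((L/r) * (L/r)) * norm Z" by (simp add: Z_def norm_mult)
			also have "\<dots> <= \<kappa>/2 * norm Z" using nZ by (intro mult_right_mono Lr) auto
			finally show ?thesis .
		qed
		have UVZ: "norm (U*V - Z) <= \<kappa>/2 * norm Z"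
		proof -
			have "U*V - Z = (U - Q) * (V - Q') + (U - Q) * Q' + Q * (V - Q')" by (simp add: Z_def algebra_simps)
			also have "norm \<dots> <= norm (U - Q) * norm (V - Q') + norm (U - Q) * norm Q' + norm Q * norm (V - Q')"
				by (intro order_trans[OF norm_triangle_ineq] add_mono) (simp_all add: norm_mult)
			also have "\<dots> <= (\<theta> * norm Q) * (1 * norm Q') + (\<theta> * norm Q) * norm Q' + norm Q * (\<theta> * norm Q')"
			proof (intro add_mono mult_mono mult_right_mono mult_left_mono UQ VQ)
				have "\<theta> * norm Q' <= 1 * norm Q'" using th by (intro mult_right_mono) auto
				then show "norm (V - Q') <= 1 * norm Q'" using VQ by linarith
			qed (use th in auto)
			also have "\<dots> = 3*\<theta> * norm Z" by (simp add: Z_def norm_mult)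
			also have "\<dots> = \<kappa>/2 * norm Z" by (simp add: \<theta>_def)
			finally show ?thesis .
		qed
		have "(a + b)\<^sup>2 - 4 * (a*b - u * v) = (a - b)\<^sup>2 + 4 * (u * v)" by (simp add: power2_eq_square algebra_simps)
		moreover have "a*b - u * v = 1" using hill_eq(2)[OF mu1] by (simp add: a_b_u_v_def)
		moreover have "a + b = 2 * cos (of_real t)" using hill_eq(1)[OF mu1] h by (simp add: a_b_u_v_def)
		ultimately have "(2 * cos (of_real t))\<^sup>2 - 4 = (a - b)\<^sup>2 + 4 * (u * v)" by simp
		moreover have "(2 * cos (of_real t :: complex))\<^sup>2 - 4 = - 4 * (of_real (sin t))\<^sup>2"
			by (simp add: power_mult_distrib cos_squared_eq algebra_simps flip: sin_of_real)
		ultimately have sin2: "- 4 * (of_real (sin t))\<^sup>2 = (a - b)\<^sup>2 + 4 * (u * v)" by (simp only:)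
		have "of_real (pi\<^sup>2*n\<^sup>2) * (- 4 * (of_real (sin t))\<^sup>2) = W*W + of_real (4*pi\<^sup>2*n\<^sup>2) * (u * v)"
			unfolding sin2 by (simp add: W_def power2_eq_square algebra_simps)
		then have fin: "of_real (- (4*pi\<^sup>2*n\<^sup>2 * (sin t)\<^sup>2)) = Z + (W*W + (U*V - Z))"
			unfolding UVuv[symmetric] by (simp add: algebra_simps)
		show False
		proof (rule not_nonpositive_perturbation[OF _ _ fin _ k(2,3)])
			show "Z \<noteq> 0" using nZ by auto
			show "norm (W*W + (U*V - Z)) <= \<kappa> * norm Z" using norm_triangle_ineq[of "W*W" "U*V - Z"] WW UVZ by linarith
			show "Re Z >= 0 \<or> \<bar>Im Z\<bar> >= \<epsilon> * norm Z" using cm by (simp add: Z_def Q_Q'_def)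
		qed simp
	qed
qed

end

section \<open>Localisation of the eigenvalues\<close>

lemma exp_half_le_2: "exp (1/2 :: real) <= 2"
	using real_exp_bound_lemma[of "1/2"] by simp

lemma norm_sin_minus_le:
	fixes z :: complex
	assumes "norm z <= 1/2"
	shows "norm (sin z - z) <= norm z ^ 3"
proof -
	have "(\<Sum>k\<le>2. complex_of_real (sin_coeff k) * z ^ k) = z"
		by (simp add: numeral_2_eq_2 sin_coeff_def)
	then have "norm (sin z - z) <= exp \<bar>Im z\<bar> * norm z ^ Suc 2 / fact 2" using Taylor_sin[of z 2] by simp
	also have "\<dots> <= 2 * norm z ^ Suc 2 / fact 2"
	proof (intro divide_right_mono mult_right_mono)
		have "\<bar>Im z\<bar> <= 1/2" using abs_Im_le_cmod[of z] assms by linarith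
		then have "exp \<bar>Im z\<bar> <= exp (1/2)" by simp
		then show "exp \<bar>Im z\<bar> <= 2" using exp_half_le_2 by linarith
	qed auto
	also have "\<dots> = norm z ^ 3" by (simp add: numeral_3_eq_3 fact_numeral)
	finally show ?thesis .
qed

lemma norm_cos_minus_1_le:
	fixes z :: complex
	assumes "norm z <= 1/2"
	shows "norm (cos z - 1) <= 2 * (norm z)\<^sup>2"
proof -
	have c: "(\<Sum>k\<le>1. complex_of_real (cos_coeff k) * z ^ k) = 1"
		by (simp add: cos_coeff_def)
	have "norm (cos z - 1) <= exp \<bar>Im z\<bar> * norm z ^ Suc 1 / fact 1" using Taylor_cos[of z 1] unfolding c .
	also have "\<dots> <= 2 * norm z ^ Suc 1 / fact 1"
	proof (intro divide_right_mono mult_right_mono)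
		have "\<bar>Im z\<bar> <= 1/2" using abs_Im_le_cmod[of z] assms by linarith
		then have "exp \<bar>Im z\<bar> <= exp (1/2)" by simp
		then show "exp \<bar>Im z\<bar> <= 2" using exp_half_le_2 by linarith
	qed auto
	finally show ?thesis by (simp add: power2_eq_square)
qed

lemma norm_sin_le:
	fixes z :: complex
	assumes "norm z <= 1/2"
	shows "norm (sin z) <= 2 * norm z"
proof -
	have "norm z ^ 3 <= norm z" using assms power_decreasing[of 1 3 "norm z"] by simp
	then show ?thesis using norm_sin_minus_le[OF assms] norm_triangle_sub[of "sin z" z] by linarith
qed

text \<open>The error is relative to |u v|, so a comparison of sin(\<eta> - \<tau>) sin(\<eta> +
  \<tau>) with \<eta>^2 - \<tau>^2 remains meaningful when both nearly vanish.\<close>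

lemma sin_product_bound:
	fixes u v :: complex
	assumes \<sigma>: "norm u <= \<sigma>" "norm v <= \<sigma>" "\<sigma> <= 1/2"
	shows "norm (sin u * sin v - u * v) <= 3*\<sigma>\<^sup>2 * norm (u * v)"
proof -
	define a b where "a = sin u - u" "b = sin v - v"
	have s0: "\<sigma> >= 0" using \<sigma>(1) norm_ge_zero order_trans by blast
	have sq: "(norm u)\<^sup>2 <= \<sigma>\<^sup>2" "(norm v)\<^sup>2 <= \<sigma>\<^sup>2" using \<sigma> by (auto intro: power_mono)
	have a: "norm a <= \<sigma>\<^sup>2 * norm u"
	proof -
		have "norm a <= (norm u)\<^sup>2 * norm u" using norm_sin_minus_le[of u] \<sigma> by (simp add: a_b_def power3_eq_cube power2_eq_square)
		also have "\<dots> <= \<sigma>\<^sup>2 * norm u" by (intro mult_right_mono sq) auto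
		finally show ?thesis .
	qed
	have b: "norm b <= \<sigma>\<^sup>2 * norm v"
	proof -
		have "norm b <= (norm v)\<^sup>2 * norm v" using norm_sin_minus_le[of v] \<sigma> by (simp add: a_b_def power3_eq_cube power2_eq_square)
		also have "\<dots> <= \<sigma>\<^sup>2 * norm v" by (intro mult_right_mono sq) auto
		finally show ?thesis .
	qed
	have s1: "\<sigma>\<^sup>2 <= 1" using \<sigma>(3) s0 by (simp add: power_le_one)
	have "sin u * sin v - u * v = a * v + u*b + a*b" by (simp add: a_b_def algebra_simps)
	also have "norm \<dots> <= norm a * norm v + norm u * norm b + norm a * norm b"
		by (intro order_trans[OF norm_triangle_ineq] add_mono) (simp_all add: norm_mult)
	also have "\<dots> <= (\<sigma>\<^sup>2 * norm u) * norm v + norm u * (\<sigma>\<^sup>2 * norm v) + (\<sigma>\<^sup>2 * norm u) * (1 * norm v)"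
	proof (intro add_mono mult_mono mult_left_mono mult_right_mono a b)
		have "\<sigma>\<^sup>2 * norm v <= 1 * norm v" by (intro mult_right_mono s1) auto
		then show "norm b <= 1 * norm v" using b by linarith
	qed auto
	also have "\<dots> = 3*\<sigma>\<^sup>2 * norm (u * v)" by (simp add: norm_mult algebra_simps)
	finally show ?thesis .
qed

text \<open>Factor \<eta>^2 - w^2. If both factors exceeded 4c\<delta>, their product would exceed
  the bound, since |\<eta>| + |w| is at most the sum of the two factors' norms.\<close>

lemma root_dichotomy:
	fixes \<eta> w :: complex
	assumes c: "c >= 1" and d: "\<delta> > 0" and le: "norm (\<eta>\<^sup>2 - w\<^sup>2) <= c*\<delta> * (norm \<eta> + norm w + \<delta>)"
	shows "norm (\<eta> - w) <= 4*c*\<delta> \<or> norm (\<eta> + w) <= 4*c*\<delta>"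
proof (rule ccontr)
	assume neg: "\<not> (norm (\<eta> - w) <= 4*c*\<delta> \<or> norm (\<eta> + w) <= 4*c*\<delta>)"
	define x y where "x = norm (\<eta> - w)" "y = norm (\<eta> + w)"
	have xy: "x > 4 * c*\<delta>" "y > 4 * c*\<delta>" using neg by (auto simp: x_y_def)
	have cd: "c*\<delta> > 0" "\<delta> <= c*\<delta>" using c d by (auto intro: mult_pos_pos)
	have e: "norm (2*\<eta>) <= x + y" "norm (2*w) <= x + y"
	proof -
		have "2*\<eta> = (\<eta> - w) + (\<eta> + w)" by simp
		then show "norm (2*\<eta>) <= x + y" unfolding x_y_def by (metis norm_triangle_ineq)
		have "2*w = (\<eta> + w) - (\<eta> - w)" by simp
		then show "norm (2*w) <= x + y" unfolding x_y_def by (metis norm_triangle_ineq4 add.commute)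
	qed
	have sum: "norm \<eta> + norm w <= x + y" using e by (simp add: norm_mult)
	have dx: "\<delta> <= x" using xy(1) cd by linarith
	have "x*y = norm (\<eta>\<^sup>2 - w\<^sup>2)"
		unfolding x_y_def norm_mult[symmetric] by (simp add: power2_eq_square algebra_simps)
	also have "\<dots> <= c*\<delta> * (norm \<eta> + norm w + \<delta>)" by (rule le)
	also have "\<dots> <= c*\<delta> * (x + y + x)" using sum dx cd by (intro mult_left_mono) linarith+
	finally have 1: "x*y <= c*\<delta> * (2*x + y)" by (simp add: algebra_simps)
	have "4*c*\<delta>*y < x * y" using xy cd by (intro mult_strict_right_mono) linarith+
	moreover have "x * (4*c*\<delta>) < x * y" using xy cd by (intro mult_strict_left_mono) linarith+
	moreover have "c*\<delta>*x > 0" "c*\<delta>*y > 0" using xy cd by (auto intro!: mult_pos_pos)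
	ultimately show False using 1 by (simp add: algebra_simps)
qed

text \<open>The alternative on \<open>Z\<close> rules out cancellation with the nonnegative
  \<tau>^2. The constant comes from the second case: \<tau>^2 <= |V| + |Z| <= (1 + 1/\<epsilon>) |V|
  for V = \<tau>^2 + Z.\<close>

lemma quadratic_lower_bound:
	fixes Z :: complex and \<tau> :: real
	assumes ep: "\<epsilon> > 0" and alt: "Re Z >= 0 \<or> \<bar>Im Z\<bar> >= \<epsilon> * norm Z"
	shows "\<epsilon> / (1 + \<epsilon>) * \<tau>\<^sup>2 <= norm (of_real (\<tau>\<^sup>2) + Z)" "\<epsilon> / (1 + \<epsilon>) * norm Z <= norm (of_real (\<tau>\<^sup>2) + Z)"
proof -
	define k where "k = \<epsilon> / (1 + \<epsilon>)"
	have k: "k >= 0" "k <= 1" "k <= \<epsilon>" using ep by (auto simp: k_def field_simps)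
	let ?V = "of_real (\<tau>\<^sup>2) + Z"
	have "k*\<tau>\<^sup>2 <= norm ?V \<and> k * norm Z <= norm ?V"
		using alt
	proof
		assume re: "Re Z >= 0"
		have "\<tau>\<^sup>2 <= norm ?V" using complex_Re_le_cmod[of ?V] re by simp
		moreover have "norm Z <= norm ?V"
		proof -
			have "(Re Z)\<^sup>2 <= (\<tau>\<^sup>2 + Re Z)\<^sup>2" using re by (intro power_mono) auto
			then show ?thesis unfolding cmod_def by simp
		qed
		moreover have "k*\<tau>\<^sup>2 <= 1*\<tau>\<^sup>2" "k * norm Z <= 1 * norm Z" using k by (intro mult_right_mono; simp)+
		ultimately show ?thesis by auto
	next
		assume im: "\<bar>Im Z\<bar> >= \<epsilon> * norm Z"
		have 1: "\<epsilon> * norm Z <= norm ?V" using abs_Im_le_cmod[of ?V] im by simp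
		have "\<tau>\<^sup>2 = norm (?V - Z)" by (simp add: norm_power)
		also have "\<dots> <= norm ?V + norm Z" by (rule norm_triangle_ineq4)
		finally have "\<epsilon>*\<tau>\<^sup>2 <= \<epsilon> * norm ?V + \<epsilon> * norm Z" using ep by (simp add: distrib_left[symmetric])
		then have "\<epsilon>*\<tau>\<^sup>2 <= (1 + \<epsilon>) * norm ?V" using 1 by (simp add: distrib_right)
		then have "k*\<tau>\<^sup>2 <= norm ?V" using ep by (simp add: k_def field_simps)
		moreover have "k * norm Z <= \<epsilon> * norm Z" using k by (intro mult_right_mono) auto
		ultimately show ?thesis using 1 by simp
	qed
	then show "\<epsilon> / (1 + \<epsilon>) * \<tau>\<^sup>2 <= norm ?V" "\<epsilon> / (1 + \<epsilon>) * norm Z <= norm ?V" by (simp_all add: k_def)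
qed

abbreviation near_pi :: "int => complex => bool" where
	"near_pi m \<mu> \<equiv> norm (\<mu> - pim m) <= 1/8"

text \<open>Squaring removes the sign (-1)^m, so that t near 0 and t near \<pi> are treated
  together.\<close>

abbreviation floq_root :: "(real => complex) => real => complex => bool" where
	"floq_root q \<tau> \<mu> \<equiv> (hill q (\<mu>\<^sup>2))\<^sup>2 = of_real ((2 * cos \<tau>)\<^sup>2)"

abbreviation balanced_coefs :: "(real => complex) => real => real => int => bool" where
	"balanced_coefs q \<epsilon> B N0 \<equiv> (\<forall>n>N0. norm (fcoef q n) <= B * norm (fcoef q (-n)) \<and> norm (fcoef q (-n)) <= B * norm (fcoef q n) \<and>
				(Re (fcoef q n * fcoef q (-n)) >= 0 \<or> \<bar>Im (fcoef q n * fcoef q (-n))\<bar> >= \<epsilon> * norm (fcoef q n * fcoef q (-n))))"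

abbreviation nondegenerate :: "(real => complex) => real => bool" where
	"nondegenerate q R \<equiv> (\<forall>\<mu> t. norm \<mu> >= R --> \<bar>Im \<mu>\<bar> <= 1 --> Re \<mu> >= 0 --> hill q (\<mu>\<^sup>2) = 2 * cos (of_real t) --> deriv (hill q) (\<mu>\<^sup>2) \<noteq> 0)"

section \<open>The trivial gauge and the asymptotics it gives\<close>

locale hill_L1 =
	fixes q :: "real => complex"
	assumes q_int: "L1 q" and q_mean: "fcoef q 0 = 0"

sublocale hill_L1 \<subseteq> triv: gauge q 0 "\<lambda>z x. 0" "\<lambda>z x. 0" "\<lambda>z x. 0" "\<lambda>x. - q x" q "\<lambda>x. 0" "\<lambda>x. 0" 0
	by (rule trivial_gauge[OF q_int])

context hill_L1
begin

abbreviation n11 where "n11 \<equiv> triv.n11"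
abbreviation n12 where "n12 \<equiv> triv.n12"

lemma triv_simps:
	"triv.sg \<mu> x = \<i>*\<mu>" "triv.w \<mu> x = 2*\<i>*\<mu>" "triv.rr \<mu> x = - q x"
	by (simp_all add: triv.sg_def triv.w_def triv.rr_def)

lemma triv_ff: "x \<in> {0..1} ==> triv.ff \<mu> x = exp (\<i>*\<mu> * of_real x)"
	by (simp add: triv.ff_def triv_simps(1)[abs_def] scaleR_conv_of_real mult_ac)

lemma triv_kap: "x \<in> {0..1} ==> triv.kap \<mu> x = exp (- (2*\<i>*\<mu> * of_real x))"
	unfolding triv.kap_def triv_ff by (simp add: exp_diff[symmetric] mult_ac)

text \<open>The Fourier coefficient continued to complex frequency: at \<pi> m its value is
  \<open>fcoef q m\<close>.\<close>

definition qhat :: "complex => complex" where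
	"qhat \<mu> = integral {0..1} (\<lambda>x. q x * exp (- (2*\<i>*\<mu> * of_real x)))"

lemma integral_q: "integral {0..1} q = 0"
	using q_mean by (simp add: fcoef_def)

lemma mass_eq: "triv.mass = integral {0..1} (\<lambda>x. norm (q x))"
	by (simp add: triv.mass_def)

lemma triv_PP_1:
	assumes mu: "1 <= norm \<mu>"
	shows "triv.PP \<mu> a b 1 = a + 1 / (2*\<i>*\<mu>) * integral {0..1} (\<lambda>x. q x * (triv.PP \<mu> a b x + triv.kap \<mu> x * triv.GG \<mu> a b x))"
proof -
	have mu1: "1 + 0 <= norm \<mu>" using mu by simp
	have "triv.PP \<mu> a b 1 = a + integral {0..1} (\<lambda>x. - (triv.rr (- \<mu>) x / triv.w \<mu> x) * (triv.PP \<mu> a b x + triv.kap \<mu> x * triv.GG \<mu> a b x))"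
		using acD(2)[OF triv.PG_ac(1)[OF mu1], of 1 a b] triv.PG_0(1)[OF mu1, of a b] by simp
	also have "(\<lambda>x. - (triv.rr (- \<mu>) x / triv.w \<mu> x) * (triv.PP \<mu> a b x + triv.kap \<mu> x * triv.GG \<mu> a b x))
		 = (\<lambda>x. 1 / (2*\<i>*\<mu>) * (q x * (triv.PP \<mu> a b x + triv.kap \<mu> x * triv.GG \<mu> a b x)))"
		by (simp add: triv_simps)
	finally show ?thesis by (simp only: integral_mult_right)
qed

abbreviation exp_asymptotics :: "real => complex => bool" where
	"exp_asymptotics C \<mu> \<equiv> (norm (n11 \<mu> - exp (\<i>*\<mu>)) <= C / (norm \<mu>)\<^sup>2 \<and> norm (n12 \<mu>) <= C / norm \<mu> \<and>
		 norm (deriv n11 \<mu> - \<i> * exp (\<i>*\<mu>)) <= C / norm \<mu> \<and> norm (deriv n12 \<mu>) <= C / norm \<mu> \<and>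
		 n11 field_differentiable at \<mu> \<and> n12 field_differentiable at \<mu> \<and>
		 norm (2*\<i>*\<mu> * exp (- (\<i>*\<mu>)) * n12 \<mu> - qhat \<mu>) <= C / norm \<mu>)"

text \<open>The extra power in the first estimate is due to q_0 = 0: the term of order 1/\<mu> in
  \<open>n11\<close> is a multiple of the integral of q. The last estimate keeps \<mu> itself as
  frequency instead of \<pi> m; the passage to q_m is made in \<open>qhat_near\<close>.\<close>

lemma triv_asymptotics:
	"\<exists>R C. R > 2 \<and> C >= 1 \<and> (\<forall>\<mu>. norm \<mu> >= R \<and> \<bar>Im \<mu>\<bar> <= 1 -->
		 exp_asymptotics C \<mu>)"
proof -
	obtain R0 C0 where R0: "R0 > 2 + 0" and C0: "C0 >= 0"
		and strip: "\<forall>\<mu>. norm \<mu> >= R0 \<and> \<bar>Im \<mu>\<bar> <= 1 -->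
		 norm (n11 \<mu> - exp (\<i>*\<mu>)) <= C0 / norm \<mu> \<and> norm (n12 \<mu>) <= C0 / norm \<mu> \<and>
		 norm (deriv n11 \<mu> - \<i> * exp (\<i>*\<mu>)) <= C0 / norm \<mu> \<and> norm (deriv n12 \<mu>) <= C0 / norm \<mu> \<and>
		 n11 field_differentiable at \<mu> \<and> n12 field_differentiable at \<mu>"
		using triv.deriv_strip_bound by blast
	define D where "D = (1 + exp 5) * triv.mass"
	have D: "D >= 0" using triv.mass_nonneg by (simp add: D_def)
	define E where "E = triv.mass * ((1 + exp 5) * (2*D))"
	have E: "E >= 0" using triv.mass_nonneg D by (simp add: E_def)
	define R where "R = R0 + 4*D"
	define C where "C = C0 + exp 1 * E + E + 1"
	have CC: "C0 <= C" "exp 1 * E <= C" "E <= C" "1 <= C" using C0 E by (auto simp: C_def)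
	have extra: "norm (n11 \<mu> - exp (\<i>*\<mu>)) <= C / (norm \<mu>)\<^sup>2 \<and> norm (2*\<i>*\<mu> * exp (- (\<i>*\<mu>)) * n12 \<mu> - qhat \<mu>) <= C / norm \<mu>"
		if mu: "norm \<mu> >= R" "\<bar>Im \<mu>\<bar> <= 1" for \<mu>
	proof -
		have m1: "1 + 0 <= norm \<mu>" "1 <= norm \<mu>" "norm \<mu> > 0" "\<mu> \<noteq> 0" using mu R0 D unfolding R_def by auto
		have im: "\<bar>Im \<mu>\<bar> <= 2" using mu by simp
		have r: "triv.rate \<mu> <= 1/4" by (rule triv.rate_small) (use mu R0 in \<open>simp add: D_def R_def\<close>)
		have rD: "triv.rate \<mu> <= D / norm \<mu>" using triv.rate_le[OF m1(1)] by (simp add: D_def)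
		have pert: "norm (integral {0..1} (\<lambda>x. q x * f x)) <= E / norm \<mu>"
			if f: "continuous_on {0..1} f" "\<And>x. x \<in> {0..1} ==> norm (f x) <= (1 + exp 5) * (2 * triv.rate \<mu>)" for f
		proof -
			have "norm (integral {0..1} (\<lambda>x. q x * f x)) <= ((1 + exp 5) * (2 * triv.rate \<mu>)) * integral {0..1} (\<lambda>x. norm (q x))"
				by (rule norm_integral_mult_le[OF q_int f]) simp_all
			also have "\<dots> <= ((1 + exp 5) * (2 * (D / norm \<mu>))) * triv.mass"
				unfolding mass_eq[symmetric] using rD triv.mass_nonneg by (intro mult_right_mono mult_left_mono) auto
			also have "\<dots> = E / norm \<mu>" by (simp add: E_def)
			finally show ?thesis .
		qed
		have Pc: "continuous_on {0..1} (triv.PP \<mu> a b)" "continuous_on {0..1} (triv.GG \<mu> a b)" for a b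
			by (rule triv.PG_continuous[OF m1(1)])+
		note kc = triv.kap_continuous[of \<mu>]
		have ff: "n11 \<mu> * a + n12 \<mu> * b = triv.PP \<mu> a b 1 * exp (\<i>*\<mu>)" for a b
			unfolding triv.PP_1[OF m1(1)] triv_ff[of 1 "- \<mu>", simplified] by (simp add: exp_minus)
		have p: "norm (triv.PP \<mu> 1 0 x - 1) <= 2 * triv.rate \<mu>" "norm (triv.GG \<mu> 1 0 x) <= 2 * triv.rate \<mu>"
				 "norm (triv.PP \<mu> 0 1 x) <= 2 * triv.rate \<mu>" "norm (triv.GG \<mu> 0 1 x - 1) <= 2 * triv.rate \<mu>" if x: "x \<in> {0..1}" for x
			using triv.PG_bound(3,4)[OF m1(1) im r triv.PG_ac[OF m1(1)] _ _ x, of 1 0 1]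
						triv.PG_bound(3,4)[OF m1(1) im r triv.PG_ac[OF m1(1)] _ _ x, of 0 1 1] by (simp_all add: triv.PG_0[OF m1(1)])
		have kb: "norm (triv.kap \<mu> x) <= exp 5" if "x \<in> {0..1}" for x by (rule triv.kap_bound[OF m1(1) im that])
		have comb: "norm (A + triv.kap \<mu> x * B) <= (1 + exp 5) * (2 * triv.rate \<mu>)"
			if "norm A <= 2 * triv.rate \<mu>" "norm B <= 2 * triv.rate \<mu>" "x \<in> {0..1}" for A B x
		proof -
			have "norm (A + triv.kap \<mu> x * B) <= norm A + norm (triv.kap \<mu> x) * norm B"
				by (rule order_trans[OF norm_triangle_ineq]) (simp add: norm_mult)
			also have "\<dots> <= 2 * triv.rate \<mu> + exp 5 * (2 * triv.rate \<mu>)"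
				by (intro add_mono mult_mono kb that) auto
			finally show ?thesis by (simp add: algebra_simps)
		qed
		define I1 where "I1 = integral {0..1} (\<lambda>x. q x * ((triv.PP \<mu> 1 0 x - 1) + triv.kap \<mu> x * triv.GG \<mu> 1 0 x))"
		have I1: "norm I1 <= E / norm \<mu>"
			unfolding I1_def
		proof (rule pert)
			show "continuous_on {0..1} (\<lambda>x. (triv.PP \<mu> 1 0 x - 1) + triv.kap \<mu> x * triv.GG \<mu> 1 0 x)" by (intro continuous_intros Pc kc)
		qed (intro comb p)
		\<comment> \<open>Subtracting 1 from \<open>PP\<close> changes the integral by the mean of q,
		  which is 0.\<close>
		have I1eq: "integral {0..1} (\<lambda>x. q x * (triv.PP \<mu> 1 0 x + triv.kap \<mu> x * triv.GG \<mu> 1 0 x)) = I1"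
		proof -
			have i: "(\<lambda>x. q x * ((triv.PP \<mu> 1 0 x - 1) + triv.kap \<mu> x * triv.GG \<mu> 1 0 x)) integrable_on {0..1}"
				by (intro L1_integrable L1_mult_continuous q_int continuous_intros Pc kc)
			have "integral {0..1} (\<lambda>x. q x * (triv.PP \<mu> 1 0 x + triv.kap \<mu> x * triv.GG \<mu> 1 0 x))
				= integral {0..1} (\<lambda>x. q x * ((triv.PP \<mu> 1 0 x - 1) + triv.kap \<mu> x * triv.GG \<mu> 1 0 x) + q x)"
				by (rule integral_cong) (simp add: algebra_simps)
			also have "\<dots> = I1 + integral {0..1} q" unfolding I1_def by (rule integral_add[OF i L1_integrable[OF q_int]])
			finally show ?thesis by (simp add: integral_q)
		qed
		have em: "norm (exp (\<i>*\<mu>)) <= exp 1" using mu(2) by (intro triv.norm_exp_le) simp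
		have "n11 \<mu> - exp (\<i>*\<mu>) = exp (\<i>*\<mu>) * (1 / (2*\<i>*\<mu>) * I1)"
			using ff[of 1 0] triv_PP_1[OF m1(2), of 1 0] unfolding I1eq by (simp add: algebra_simps)
		also have "norm \<dots> <= exp 1 * (1 / norm \<mu> * (E / norm \<mu>))"
			unfolding norm_mult
		proof (intro mult_mono em I1)
			show "norm (1 / (2*\<i>*\<mu>)) <= 1 / norm \<mu>" using m1(3) by (simp add: norm_divide norm_mult field_simps)
		qed (use E in auto)
		also have "\<dots> = exp 1 * E / (norm \<mu>)\<^sup>2" by (simp add: power2_eq_square)
		also have "\<dots> <= C / (norm \<mu>)\<^sup>2" by (intro divide_right_mono CC) simp
		finally have A: "norm (n11 \<mu> - exp (\<i>*\<mu>)) <= C / (norm \<mu>)\<^sup>2" .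
		define I2 where "I2 = integral {0..1} (\<lambda>x. q x * (triv.PP \<mu> 0 1 x + triv.kap \<mu> x * (triv.GG \<mu> 0 1 x - 1)))"
		have I2: "norm I2 <= E / norm \<mu>"
			unfolding I2_def
		proof (rule pert)
			show "continuous_on {0..1} (\<lambda>x. triv.PP \<mu> 0 1 x + triv.kap \<mu> x * (triv.GG \<mu> 0 1 x - 1))" by (intro continuous_intros Pc kc)
		qed (intro comb p)
		have I2eq: "integral {0..1} (\<lambda>x. q x * (triv.PP \<mu> 0 1 x + triv.kap \<mu> x * triv.GG \<mu> 0 1 x)) = I2 + qhat \<mu>"
		proof -
			have i: "(\<lambda>x. q x * (triv.PP \<mu> 0 1 x + triv.kap \<mu> x * (triv.GG \<mu> 0 1 x - 1))) integrable_on {0..1}"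
				by (intro L1_integrable L1_mult_continuous q_int continuous_intros Pc kc)
			have j: "(\<lambda>x. q x * exp (- (2*\<i>*\<mu> * of_real x))) integrable_on {0..1}"
				by (intro L1_integrable L1_mult_continuous q_int continuous_intros)
			have "integral {0..1} (\<lambda>x. q x * (triv.PP \<mu> 0 1 x + triv.kap \<mu> x * triv.GG \<mu> 0 1 x))
				= integral {0..1} (\<lambda>x. q x * (triv.PP \<mu> 0 1 x + triv.kap \<mu> x * (triv.GG \<mu> 0 1 x - 1)) + q x * exp (- (2*\<i>*\<mu> * of_real x)))"
			proof (rule integral_cong)
				fix x :: real assume x: "x \<in> {0..1}"
				show "q x * (triv.PP \<mu> 0 1 x + triv.kap \<mu> x * triv.GG \<mu> 0 1 x)
					= q x * (triv.PP \<mu> 0 1 x + triv.kap \<mu> x * (triv.GG \<mu> 0 1 x - 1)) + q x * exp (- (2*\<i>*\<mu> * of_real x))"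
					unfolding triv_kap[OF x] by (simp add: algebra_simps)
			qed
			also have "\<dots> = I2 + qhat \<mu>" unfolding I2_def qhat_def by (rule integral_add[OF i j])
			finally show ?thesis .
		qed
		have "triv.PP \<mu> 0 1 1 = 1 / (2*\<i>*\<mu>) * (I2 + qhat \<mu>)"
			using triv_PP_1[OF m1(2), of 0 1] unfolding I2eq by simp
		then have n12: "n12 \<mu> = 1 / (2*\<i>*\<mu>) * (I2 + qhat \<mu>) * exp (\<i>*\<mu>)" using ff[of 0 1] by simp
		have ee: "exp (\<i>*\<mu>) * exp (- (\<i>*\<mu>)) = 1" by (simp add: exp_add[symmetric])
		have "2*\<i>*\<mu> * exp (- (\<i>*\<mu>)) * n12 \<mu> = (2*\<i>*\<mu> * (1 / (2*\<i>*\<mu>))) * (exp (\<i>*\<mu>) * exp (- (\<i>*\<mu>))) * (I2 + qhat \<mu>)"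
			unfolding n12 by (simp only: mult_ac)
		also have "\<dots> = I2 + qhat \<mu>" unfolding ee using m1(4) by simp
		finally have "norm (2*\<i>*\<mu> * exp (- (\<i>*\<mu>)) * n12 \<mu> - qhat \<mu>) <= E / norm \<mu>" using I2 by simp
		also have "\<dots> <= C / norm \<mu>" by (intro divide_right_mono CC) simp
		finally show ?thesis using A by blast
	qed
	have main: "exp_asymptotics C \<mu>"
		if mu: "norm \<mu> >= R" "\<bar>Im \<mu>\<bar> <= 1" for \<mu>
	proof -
		have "norm \<mu> >= R0" using mu(1) D by (simp add: R_def)
		then have s: "norm (n12 \<mu>) <= C0 / norm \<mu>" "norm (deriv n11 \<mu> - \<i> * exp (\<i>*\<mu>)) <= C0 / norm \<mu>" "norm (deriv n12 \<mu>) <= C0 / norm \<mu>"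
			 "n11 field_differentiable at \<mu>" "n12 field_differentiable at \<mu>" using strip mu(2) by blast+
		have "C0 / norm \<mu> <= C / norm \<mu>" by (intro divide_right_mono CC) simp
		then show ?thesis using s extra[OF mu] by (meson order_trans)
	qed
	have "R > 2" using R0 D by (simp add: R_def)
	then show ?thesis using main CC(4) by (intro exI[of _ R] exI[of _ C]) simp
qed

lemma qhat_near:
	assumes "norm (\<mu> - pim m) <= 1/4"
	shows "norm (qhat \<mu> - fcoef q m) <= 4 * triv.mass * norm (\<mu> - pim m)"
proof -
	define \<eta> where "\<eta> = \<mu> - pim m"
	have e: "exp (- (2*\<i>*\<mu> * of_real x)) = emode m x * exp (- (2*\<i>*\<eta> * of_real x))" for x
		unfolding emode_def exp_add[symmetric] by (simp add: \<eta>_def algebra_simps)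
	have i: "(\<lambda>x. q x * (emode m x * (exp (- (2*\<i>*\<eta> * of_real x)) - 1))) integrable_on {0..1}"
		by (intro L1_integrable L1_mult_continuous q_int continuous_intros emode_continuous)
	have j: "(\<lambda>x. q x * emode m x) integrable_on {0..1}"
		by (intro L1_integrable L1_mult_continuous q_int emode_continuous)
	have "qhat \<mu> = integral {0..1} (\<lambda>x. q x * (emode m x * (exp (- (2*\<i>*\<eta> * of_real x)) - 1)) + q x * emode m x)"
		unfolding qhat_def e by (rule integral_cong) (simp add: algebra_simps)
	also have "\<dots> = integral {0..1} (\<lambda>x. q x * (emode m x * (exp (- (2*\<i>*\<eta> * of_real x)) - 1))) + integral {0..1} (\<lambda>x. q x * emode m x)"
		by (rule integral_add[OF i j])
	also have "integral {0..1} (\<lambda>x. q x * emode m x) = fcoef q m" by (simp add: fcoef_def emode_def)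
	finally have "norm (qhat \<mu> - fcoef q m) = norm (integral {0..1} (\<lambda>x. q x * (emode m x * (exp (- (2*\<i>*\<eta> * of_real x)) - 1))))" by simp
	also have "\<dots> <= (4 * norm \<eta>) * integral {0..1} (\<lambda>x. norm (q x))"
	proof (rule norm_integral_mult_le[OF q_int])
		show "continuous_on {0..1} (\<lambda>x. emode m x * (exp (- (2*\<i>*\<eta> * of_real x)) - 1))" by (intro continuous_intros emode_continuous)
		fix x :: real assume x: "x \<in> {0..1}"
		have n: "norm (- (2*\<i>*\<eta> * of_real x)) <= 2 * norm \<eta>" using x by (simp add: norm_mult mult_left_le)
		also have "\<dots> <= 1/2" using assms by (simp add: \<eta>_def)
		finally have "norm (exp (- (2*\<i>*\<eta> * of_real x)) - 1) <= 2 * norm (- (2*\<i>*\<eta> * of_real x))" by (rule norm_exp_minus_1)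
		also have "\<dots> <= 4 * norm \<eta>" using n by simp
		finally show "norm (emode m x * (exp (- (2*\<i>*\<eta> * of_real x)) - 1)) <= 4 * norm \<eta>" by (simp add: norm_mult norm_emode)
	qed simp
	finally show ?thesis by (simp add: mass_eq \<eta>_def mult_ac)
qed

lemma fcoef_bounded: "norm (fcoef q m) <= triv.mass"
proof -
	have "norm (integral {0..1} (\<lambda>x. q x * emode m x)) <= 1 * integral {0..1} (\<lambda>x. norm (q x))"
		by (rule norm_integral_mult_le[OF q_int emode_continuous]) (simp_all add: norm_emode)
	then show ?thesis by (simp add: mass_eq fcoef_def emode_def)
qed

lemma sin_shift: "(sin (pim m + \<eta>))\<^sup>2 = (sin \<eta>)\<^sup>2" for \<eta> :: complex
proof -
	have s: "sin (pim m :: complex) = 0"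
	proof -
		have "sin (pi * real_of_int m) = 0" using sin_zero_iff_int2[of "pi * real_of_int m"] by (auto simp: mult.commute)
		then show ?thesis by (metis of_real_0 of_real_mult of_real_of_int_eq sin_of_real)
	qed
	have "(cos (pim m :: complex))\<^sup>2 = 1" using s sin_cos_squared_add[of "pim m :: complex"] by simp
	then show ?thesis using s by (simp add: sin_add power_mult_distrib)
qed

definition ZZ :: "int => complex" where "ZZ m = fcoef q m * fcoef q (- m)"

text \<open>The predicted offset of \<mu> from \<pi> m. The division by 2 \<pi> m stands outside the
  root so that 2 \<pi> m \<open>w0\<close> is, branch included, the square root in the eigenvalue
  formulas.\<close>

definition w0 :: "int => real => complex" where
	"w0 m \<tau> = csqrt (of_real ((2*pi * of_int m * \<tau>)\<^sup>2) + ZZ m) / of_real (2*pi * of_int m)"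

text \<open>The sign \<open>s\<close> selects which of the two unperturbed eigenvalues (\<pi> m +-
  \<tau>)^2 is the centre. For t near 0, 2 \<pi> n + t has m = 2n, \<tau> = t, s = 1; for t near
  \<pi> it has m = 2n + 1, \<tau> = \<pi> - t, s = -1.\<close>

abbreviation disc_roots :: "real => int => real => real => real => bool" where
	"disc_roots K m \<tau> s Rd \<equiv>
		(\<forall>z. norm (z - of_real ((pi * of_int m + s*\<tau>)\<^sup>2)) = Rd --> hill q z \<noteq> 2 * cos (of_real (pi * of_int m + \<tau>))) \<and>
		(\<exists>z1 z2. z1 \<noteq> z2 \<and> {z. hill q z = 2 * cos (of_real (pi * of_int m + \<tau>)) \<and> norm (z - of_real ((pi * of_int m + s*\<tau>)\<^sup>2)) < Rd} = {z1, z2} \<and>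
			norm (z1 - (of_real ((pi * of_int m)\<^sup>2 + \<tau>\<^sup>2) - csqrt (of_real ((2*pi * of_int m * \<tau>)\<^sup>2) + ZZ m))) <= K / of_int m \<and>
			norm (z2 - (of_real ((pi * of_int m)\<^sup>2 + \<tau>\<^sup>2) + csqrt (of_real ((2*pi * of_int m * \<tau>)\<^sup>2) + ZZ m))) <= K / of_int m)"

lemma w0_square:
	assumes "m > 0"
	shows "(w0 m \<tau>)\<^sup>2 = of_real (\<tau>\<^sup>2) + ZZ m / of_real ((2*pi * of_int m)\<^sup>2)"
	using assms unfolding w0_def power_divide power2_csqrt by (simp add: add_divide_distrib power_mult_distrib)

text \<open>The sum of the diagonal entries behaves like 2 cos \<mu> and is flat at \<pi> m. The
  half-difference behaves like sin \<mu>, which is nondegenerate there, so the eigenvalue equation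
  is rewritten for it.\<close>

lemma half_difference_square:
	assumes mu: "1 <= norm \<mu>" and ev: "floq_root q \<tau> \<mu>"
	shows "((n11 \<mu> - n11 (- \<mu>)) / (2*\<i>))\<^sup>2 = of_real ((sin \<tau>)\<^sup>2) + n12 \<mu> * n12 (- \<mu>)"
proof -
	have h: "hill q (\<mu>\<^sup>2) = n11 \<mu> + n11 (- \<mu>)" "n11 \<mu> * n11 (- \<mu>) - n12 \<mu> * n12 (- \<mu>) = 1"
		using triv.hill_eq[of \<mu>] mu by simp_all
	define a b \<beta> where "a = n11 \<mu>" "b = n11 (- \<mu>)" "\<beta> = n12 \<mu> * n12 (- \<mu>)"
	have 1: "(a + b)\<^sup>2 = of_real ((2 * cos \<tau>)\<^sup>2)" using ev h(1) by (simp add: a_b_\<beta>_def)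
	have 2: "a*b = 1 + \<beta>" using h(2) by (simp add: a_b_\<beta>_def algebra_simps)
	have c: "of_real ((2 * cos \<tau>)\<^sup>2) = (4 - 4 * of_real ((sin \<tau>)\<^sup>2) :: complex)"
	proof -
		have "(2 * cos \<tau>)\<^sup>2 = 4 - 4 * (sin \<tau>)\<^sup>2" by (simp add: power_mult_distrib cos_squared_eq)
		then show ?thesis by simp
	qed
	have "(a - b)\<^sup>2 = (a + b)\<^sup>2 - 4 * (a*b)" by (simp add: power2_eq_square algebra_simps)
	also have "\<dots> = - 4 * (of_real ((sin \<tau>)\<^sup>2) + \<beta>)" unfolding 1 2 c by (simp add: algebra_simps)
	finally have 3: "(a - b)\<^sup>2 = - 4 * (of_real ((sin \<tau>)\<^sup>2) + \<beta>)" .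
	have "((a - b) / (2*\<i>))\<^sup>2 = (a - b)\<^sup>2 / (- 4)" by (simp add: power_divide power_mult_distrib)
	also have "\<dots> = of_real ((sin \<tau>)\<^sup>2) + \<beta>" unfolding 3 by (rule nonzero_mult_div_cancel_left) simp
	finally have "((a - b) / (2*\<i>))\<^sup>2 = of_real ((sin \<tau>)\<^sup>2) + \<beta>" .
	then show ?thesis by (simp add: a_b_\<beta>_def)
qed

section \<open>Location of a single root near \<pi> m\<close>

context
	fixes \<epsilon> B :: real and N0 :: int
	assumes ep: "\<epsilon> > 0" and B: "B > 0"
		and cond: "balanced_coefs q \<epsilon> B N0"
begin

text \<open>The quantities in which errors are measured, \<tau> and |q_(+-m)|/m, are dominated by
  |w0|: \<open>quadratic_lower_bound\<close> prevents cancellation in w0^2, and comparability of the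
  coefficients bounds each squared modulus by |q_m q_(-m)|. The 7 stands for 2 \<pi>.\<close>

lemma w0_lower:
	obtains k where "k > 0" "k <= 1" "\<And>m \<tau>. m > max N0 0 ==> \<tau> >= 0 ==> k*\<tau> <= norm (w0 m \<tau>)"
		"\<And>m \<tau>. m > max N0 0 ==> k * (norm (fcoef q m) / of_int m) <= norm (w0 m \<tau>)"
		"\<And>m \<tau>. m > max N0 0 ==> k * (norm (fcoef q (- m)) / of_int m) <= norm (w0 m \<tau>)"
proof -
	define k0 where "k0 = \<epsilon> / (1 + \<epsilon>)"
	have k0: "k0 > 0" "k0 <= 1" using ep by (auto simp: k0_def)
	define B1 where "B1 = max 1 B"
	have B1: "B1 >= 1" "B1 >= B" by (auto simp: B1_def)
	define k where "k = k0 / (7*B1)"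
	have k: "k > 0" "k <= k0" "k * (7*B1) = k0" using k0 B1 by (auto simp: k_def divide_le_eq)
	have main: "k*\<tau> <= norm (w0 m \<tau>) \<and> k * (a / of_int m) <= norm (w0 m \<tau>)"
		if m: "m > max N0 0" and t: "\<tau> >= 0" and a: "a >= 0" "a\<^sup>2 <= B1 * norm (ZZ m)" for m \<tau> a
	proof -
		have m0: "real_of_int m > 0" using m by simp
		define h where "h = 2*pi * real_of_int m"
		have h: "h > 0" using m0 by (simp add: h_def)
		have hm: "h <= 7 * real_of_int m" unfolding h_def using pi_less_4 m0 pi_approx by (intro mult_right_mono) auto
		define V where "V = of_real (\<tau>\<^sup>2) + ZZ m / of_real (h\<^sup>2)"
		have alt: "Re (ZZ m / of_real (h\<^sup>2)) >= 0 \<or> \<bar>Im (ZZ m / of_real (h\<^sup>2))\<bar> >= \<epsilon> * norm (ZZ m / of_real (h\<^sup>2))"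
		proof -
			have "Re (ZZ m) >= 0 \<or> \<bar>Im (ZZ m)\<bar> >= \<epsilon> * norm (ZZ m)" using cond[rule_format, of m] m by (auto simp: ZZ_def)
			moreover have "Re (ZZ m / of_real (h\<^sup>2)) = Re (ZZ m) / h\<^sup>2" "Im (ZZ m / of_real (h\<^sup>2)) = Im (ZZ m) / h\<^sup>2"
				by (simp_all only: Re_divide_of_real Im_divide_of_real)
			moreover have "norm (ZZ m / of_real (h\<^sup>2)) = norm (ZZ m) / h\<^sup>2" by (simp add: norm_divide norm_power)
			ultimately show ?thesis using h by (auto simp: divide_right_mono abs_divide)
		qed
		have w2: "(norm (w0 m \<tau>))\<^sup>2 = norm V" unfolding norm_power[symmetric] w0_square[of m, OF m0[unfolded of_int_0_less_iff]] V_def h_def ..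
		have 1: "(k0*\<tau>)\<^sup>2 <= (norm (w0 m \<tau>))\<^sup>2"
		proof -
			have "k0\<^sup>2 <= k0" using k0 by (simp add: power2_eq_square mult_left_le)
			then have "(k0*\<tau>)\<^sup>2 <= k0*\<tau>\<^sup>2" unfolding power_mult_distrib by (intro mult_right_mono) auto
			also have "\<dots> <= norm V" using quadratic_lower_bound(1)[OF ep alt, of \<tau>] by (simp add: V_def k0_def)
			finally show ?thesis by (simp add: w2)
		qed
		then have "k0*\<tau> <= norm (w0 m \<tau>)" by (rule power2_le_imp_le) simp
		moreover have "k*\<tau> <= k0*\<tau>" using k t by (intro mult_right_mono) auto
		ultimately have A: "k*\<tau> <= norm (w0 m \<tau>)" by linarith
		have "(k0*a / (B1*h))\<^sup>2 <= (norm (w0 m \<tau>))\<^sup>2"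
		proof -
			have "(k0*a / (B1*h))\<^sup>2 = k0\<^sup>2*a\<^sup>2 / (B1\<^sup>2*h\<^sup>2)" by (simp add: power_mult_distrib power_divide)
			also have "\<dots> <= k0 * (B1\<^sup>2 * norm (ZZ m)) / (B1\<^sup>2*h\<^sup>2)"
			proof (intro divide_right_mono mult_mono)
				show "k0\<^sup>2 <= k0" using k0 by (simp add: power2_eq_square mult_left_le)
				have "B1 * norm (ZZ m) <= B1\<^sup>2 * norm (ZZ m)" using B1 by (intro mult_right_mono) (auto simp: power2_eq_square)
				then show "a\<^sup>2 <= B1\<^sup>2 * norm (ZZ m)" using a(2) by linarith
			qed (use k0 in auto)
			also have "\<dots> = k0 * (norm (ZZ m) / h\<^sup>2)" using B1 by simp
			also have "\<dots> <= norm V" using quadratic_lower_bound(2)[OF ep alt, of \<tau>] h by (simp add: V_def k0_def norm_divide norm_power)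
			finally show ?thesis by (simp add: w2)
		qed
		then have "k0*a / (B1*h) <= norm (w0 m \<tau>)" by (rule power2_le_imp_le) simp
		moreover have "k * (a / of_int m) <= k0*a / (B1*h)"
		proof -
			have "k * (a / of_int m) = k0*a / (B1 * (7 * of_int m))" by (simp add: k_def)
			also have "\<dots> <= k0*a / (B1*h)" using hm h B1 k0 a m0 by (intro divide_left_mono mult_left_mono mult_pos_pos mult_nonneg_nonneg) auto
			finally show ?thesis .
		qed
		ultimately show ?thesis using A by linarith
	qed
	have sq: "(norm (fcoef q m))\<^sup>2 <= B1 * norm (ZZ m)" "(norm (fcoef q (- m)))\<^sup>2 <= B1 * norm (ZZ m)" if m: "m > max N0 0" for m
	proof -
		have c: "norm (fcoef q m) <= B1 * norm (fcoef q (-m))" "norm (fcoef q (-m)) <= B1 * norm (fcoef q m)"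
		proof -
			have "B*x <= B1*x" if "x >= 0" for x using B1 that by (intro mult_right_mono)
			then show "norm (fcoef q m) <= B1 * norm (fcoef q (-m))" "norm (fcoef q (-m)) <= B1 * norm (fcoef q m)"
				using cond[rule_format, of m] m by (meson norm_ge_zero order_trans max_less_iff_conj)+
		qed
		show "(norm (fcoef q m))\<^sup>2 <= B1 * norm (ZZ m)" "(norm (fcoef q (- m)))\<^sup>2 <= B1 * norm (ZZ m)"
			using mult_left_mono[OF c(1), of "norm (fcoef q m)"] mult_left_mono[OF c(2), of "norm (fcoef q (- m))"]
			by (simp_all add: ZZ_def norm_mult power2_eq_square mult_ac)
	qed
	have w0pos: "norm (w0 m \<tau>) = norm (w0 m \<bar>\<tau>\<bar>)" for m \<tau> by (simp add: w0_def power_mult_distrib)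
	show ?thesis
	proof (rule that[of k])
		show "k > 0" "k <= 1" using k k0 by auto
		show "k*\<tau> <= norm (w0 m \<tau>)" if "m > max N0 0" "\<tau> >= 0" for m \<tau>
			using main[OF that norm_ge_zero sq(1)[OF that(1)]] by blast
		show "k * (norm (fcoef q m) / of_int m) <= norm (w0 m \<tau>)" "k * (norm (fcoef q (- m)) / of_int m) <= norm (w0 m \<tau>)" if "m > max N0 0" for m \<tau>
			unfolding w0pos[of m \<tau>]
			using main[OF that, of "\<bar>\<tau>\<bar>" "norm (fcoef q m)"] main[OF that, of "\<bar>\<tau>\<bar>" "norm (fcoef q (- m))"] sq[OF that] by auto
	qed
qed

text \<open>Three errors separate \<eta>^2 from w0^2: \<open>E\<close> from the diagonal entries,
  \<open>Y - D'\<close> from replacing sines by their arguments, and \<beta> minus its limit from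
  replacing the off-diagonal product by q_m q_(-m) / (2 \<pi> m)^2. Each is O(m^(-2)) times a sum of
  |\<eta>|, |w0| and m^(-2), where \<tau> and the coefficients are bounded through
  \<open>w0_lower\<close>.\<close>

lemma root_location:
	"\<exists>(M::real) C. C >= 1 \<and> M >= 1 \<and> (\<forall>m \<tau> \<mu>. of_int m >= M \<and> 0 <= \<tau> \<and> \<tau> <= 1/8 \<and> near_pi m \<mu> \<and>
			floq_root q \<tau> \<mu> -->
			norm ((\<mu> - pim m)\<^sup>2 - (w0 m \<tau>)\<^sup>2) <= C / (of_int m)\<^sup>2 * (norm (\<mu> - pim m) + norm (w0 m \<tau>) + 1 / (of_int m)\<^sup>2))"
proof -
	obtain R C0 where R: "R > 2" and C0: "C0 >= 1" and asy: "\<forall>\<mu>. norm \<mu> >= R \<and> \<bar>Im \<mu>\<bar> <= 1 -->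
		 exp_asymptotics C0 \<mu>"
		using triv_asymptotics by blast
	obtain k where k: "k > 0" "k <= 1" "\<And>m \<tau>. m > max N0 0 ==> \<tau> >= 0 ==> k*\<tau> <= norm (w0 m \<tau>)"
		"\<And>m \<tau>. m > max N0 0 ==> k * (norm (fcoef q m) / of_int m) <= norm (w0 m \<tau>)"
		"\<And>m \<tau>. m > max N0 0 ==> k * (norm (fcoef q (- m)) / of_int m) <= norm (w0 m \<tau>)"
		using w0_lower by blast
	define Q where "Q = triv.mass"
	have Q: "Q >= 0" by (simp add: Q_def triv.mass_nonneg)
	define D where "D = C0 + 4*Q"
	have D: "D >= 1" using C0 Q by (simp add: D_def)
	\<comment> \<open>Dominates the total coefficients of |\<eta>|, W/k and 1/r^2 in the final sum; the
	  later division by k pays for W/k.\<close>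
	define S where "S = 6*C0\<^sup>2 + 2*D*Q + 2*D\<^sup>2 + Q\<^sup>2 + 4*C0 + 2*D"
	have C02: "C0\<^sup>2 >= 1" using C0 by simp
	have S1: "S >= 1" using C0 C02 D Q unfolding S_def by (smt (verit) mult_nonneg_nonneg zero_le_power2)
	define M where "M = max R (real_of_int (max N0 0 + 1))"
	have "1 <= S/k" using S1 k(1,2) by (simp add: field_simps)
	moreover have "1 <= M" using R by (simp add: M_def)
	moreover have "norm ((\<mu> - pim m)\<^sup>2 - (w0 m \<tau>)\<^sup>2) <= (S/k) / (of_int m)\<^sup>2 * (norm (\<mu> - pim m) + norm (w0 m \<tau>) + 1 / (of_int m)\<^sup>2)"
		if mM: "of_int m >= M" and t: "0 <= \<tau>" "\<tau> <= 1/8" and near: "near_pi m \<mu>"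
			and ev: "floq_root q \<tau> \<mu>" for m \<tau> \<mu>
	proof -
		define r where "r = real_of_int m"
		have r: "r >= R" "r >= 2" and mN: "m > max N0 0"
		proof -
			show "r >= R" "r >= 2" using mM R by (auto simp: M_def r_def)
			have "real_of_int (max N0 0 + 1) <= of_int m" using mM by (simp add: M_def)
			then show "m > max N0 0" unfolding of_int_le_iff by linarith
		qed
		define \<eta> where "\<eta> = \<mu> - pim m"
		define W where "W = norm (w0 m \<tau>)"
		define P P' where "P = fcoef q m" and "P' = fcoef q (- m)"
		have kW: "k*\<tau> <= W" "k * (norm P / r) <= W" "k * (norm P' / r) <= W"
			using k(3)[OF mN t(1)] k(4,5)[OF mN, of \<tau>] by (simp_all add: W_def P_def P'_def r_def)
		have Wk: "\<tau> <= W/k" "norm P / r <= W/k" "norm P' / r <= W/k"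
			using kW k(1) by (simp_all add: pos_le_divide_eq mult_ac)
		have W0: "W >= 0" by (simp add: W_def)
		have \<mu>: "\<mu> = of_real (pi*r) + \<eta>" by (simp add: \<eta>_def r_def)
		have n\<eta>: "norm \<eta> <= 1/8" using near by (simp add: \<eta>_def)
		have npr: "norm (of_real (pi*r) :: complex) = pi*r" unfolding norm_of_real using r by simp
		have n\<mu>: "norm \<mu> >= 2*r"
		proof -
			have "norm (of_real (pi*r) :: complex) <= norm \<mu> + norm \<eta>"
				using norm_triangle_ineq4[of \<mu> \<eta>] by (simp add: \<mu> del: of_real_mult)
			moreover have "pi*r >= 3*r" using pi_gt3 r by (intro mult_right_mono) auto
			ultimately show ?thesis using n\<eta> r npr by linarith
		qed
		have im: "\<bar>Im \<mu>\<bar> <= 1" using abs_Im_le_cmod[of \<eta>] n\<eta> by (simp add: \<mu>)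
		have nR: "norm \<mu> >= R" "norm (- \<mu>) >= R" "\<bar>Im (- \<mu>)\<bar> <= 1" using n\<mu> r im by auto
		have \<mu>0: "\<mu> \<noteq> 0" using n\<mu> r by auto
		note as = asy[rule_format, OF conjI[OF nR(1) im]] asy[rule_format, OF conjI[OF nR(2,3)]]
		have C0r: "C0 / norm \<mu> <= C0/r" using n\<mu> r C0 by (intro divide_left_mono mult_pos_pos) linarith+
		have C0r2: "C0 / (norm \<mu>)\<^sup>2 <= C0/r\<^sup>2" using n\<mu> r C0 by (intro divide_left_mono power_mono mult_pos_pos) auto
		define \<epsilon>1 where "\<epsilon>1 = ((n11 \<mu> - exp (\<i>*\<mu>)) - (n11 (- \<mu>) - exp (\<i> * (- \<mu>)))) / (2*\<i>)"
		have \<epsilon>1: "norm \<epsilon>1 <= C0/r\<^sup>2"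
		proof -
			have "norm ((n11 \<mu> - exp (\<i>*\<mu>)) - (n11 (- \<mu>) - exp (\<i> * (- \<mu>)))) <= C0/r\<^sup>2 + C0/r\<^sup>2"
				by (intro order_trans[OF norm_triangle_ineq4] add_mono order_trans[OF conjunct1[OF as(1)] C0r2]
					order_trans[OF conjunct1[OF as(2)], unfolded norm_minus_cancel, OF C0r2])
			then show ?thesis by (simp add: \<epsilon>1_def norm_divide norm_mult mult.commute)
		qed
		define \<beta> where "\<beta> = n12 \<mu> * n12 (- \<mu>)"
		have \<beta>: "norm \<beta> <= C0\<^sup>2/r\<^sup>2"
		proof -
			have "norm \<beta> <= (C0/r) * (C0/r)" unfolding \<beta>_def norm_mult using as C0r r C0 by (intro mult_mono) auto
			then show ?thesis by (simp add: power2_eq_square)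
		qed
		have "(n11 \<mu> - n11 (- \<mu>)) / (2*\<i>) = sin \<mu> + \<epsilon>1" by (simp add: \<epsilon>1_def sin_exp_eq field_simps)
		then have X: "(sin \<mu> + \<epsilon>1)\<^sup>2 = of_real ((sin \<tau>)\<^sup>2) + \<beta>"
			using half_difference_square[OF _ ev] n\<mu> r by (simp add: \<beta>_def)
		have s2: "(sin \<mu>)\<^sup>2 = (sin \<eta>)\<^sup>2" using sin_shift[of m \<eta>] by (simp add: \<eta>_def)
		then have ns: "norm (sin \<mu>) = norm (sin \<eta>)" by (metis norm_ge_zero norm_power power2_eq_imp_eq)
		define E where "E = 2*\<epsilon>1 * sin \<mu> + \<epsilon>1\<^sup>2"
		have E: "norm E <= 1/r\<^sup>2 * (4*C0 * norm \<eta> + C0\<^sup>2/r\<^sup>2)"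
		proof -
			have "norm E <= norm (2*\<epsilon>1 * sin \<mu>) + norm (\<epsilon>1\<^sup>2)" unfolding E_def by (rule norm_triangle_ineq)
			also have "\<dots> = 2 * norm \<epsilon>1 * norm (sin \<eta>) + (norm \<epsilon>1)\<^sup>2" by (simp add: norm_mult norm_power ns)
			also have "\<dots> <= 2 * (C0/r\<^sup>2) * (2 * norm \<eta>) + (C0/r\<^sup>2)\<^sup>2"
				using \<epsilon>1 norm_sin_le[of \<eta>] n\<eta> C0 by (intro add_mono mult_mono power_mono mult_nonneg_nonneg) auto
			also have "\<dots> = 1/r\<^sup>2 * (4*C0 * norm \<eta> + C0\<^sup>2/r\<^sup>2)" by (simp add: power_divide power2_eq_square distrib_left)
			finally show ?thesis .
		qed
		define Y where "Y = (sin \<eta>)\<^sup>2 - of_real ((sin \<tau>)\<^sup>2)"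
		have Y: "Y = \<beta> - E"
		proof -
			have "(sin \<mu> + \<epsilon>1)\<^sup>2 = (sin \<eta>)\<^sup>2 + E" unfolding s2[symmetric] by (simp add: E_def power2_eq_square algebra_simps)
			then show ?thesis using X unfolding Y_def by algebra
		qed
		define D' where "D' = \<eta>\<^sup>2 - of_real (\<tau>\<^sup>2)"
		define \<sigma> where "\<sigma> = norm \<eta> + \<tau>"
		have \<sigma>: "\<sigma> >= 0" "\<sigma> <= 1/4" using t n\<eta> by (auto simp: \<sigma>_def)
		have pr: "sin (\<eta> - of_real \<tau>) * sin (\<eta> + of_real \<tau>) = Y"
		proof -
			have a: "(cos \<eta>)\<^sup>2 = 1 - (sin \<eta>)\<^sup>2" "(cos (complex_of_real \<tau>))\<^sup>2 = 1 - (sin (of_real \<tau>))\<^sup>2"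
				by (simp_all add: cos_squared_eq)
			have "sin (\<eta> - of_real \<tau>) * sin (\<eta> + of_real \<tau>) = (sin \<eta>)\<^sup>2 * (cos (complex_of_real \<tau>))\<^sup>2 - (cos \<eta>)\<^sup>2 * (sin (of_real \<tau>))\<^sup>2"
				by (simp add: sin_add sin_diff power2_eq_square algebra_simps)
			also have "\<dots> = (sin \<eta>)\<^sup>2 - (sin (of_real \<tau>))\<^sup>2" unfolding a by (simp add: algebra_simps)
			finally show ?thesis by (simp add: Y_def sin_of_real)
		qed
		have YD: "norm (Y - D') <= 3*\<sigma>\<^sup>2 * norm D'"
		proof -
			have "norm (\<eta> - of_real \<tau>) <= \<sigma>" "norm (\<eta> + of_real \<tau>) <= \<sigma>"
				unfolding \<sigma>_def using norm_triangle_ineq4[of \<eta> "of_real \<tau>"] norm_triangle_ineq[of \<eta> "of_real \<tau>"] t by simp_all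
			moreover have "(\<eta> - of_real \<tau>) * (\<eta> + of_real \<tau>) = D'" by (simp add: D'_def power2_eq_square algebra_simps)
			ultimately show ?thesis using sin_product_bound[of "\<eta> - of_real \<tau>" \<sigma> "\<eta> + of_real \<tau>"] \<sigma> pr by simp
		qed
		have \<sigma>2: "\<sigma>\<^sup>2 <= \<sigma>/4" using mult_left_mono[OF \<sigma>(2,1)] by (simp add: power2_eq_square)
		have D'Y: "norm D' <= 2 * norm Y"
		proof -
			have "3*\<sigma>\<^sup>2 * norm D' <= 1/2 * norm D'" using \<sigma>2 \<sigma>(2) by (intro mult_right_mono) auto
			then show ?thesis using YD norm_triangle_ineq4[of Y "Y - D'"] by simp
		qed
		have Y2: "norm Y <= 3*C0\<^sup>2/r\<^sup>2"
		proof -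
			have "4*C0 * norm \<eta> <= C0\<^sup>2"
			proof -
				have "4*C0 * norm \<eta> <= 4*C0 * (1/4)" using n\<eta> C0 by (intro mult_left_mono) auto
				also have "\<dots> <= C0\<^sup>2" using C0 by (simp add: power2_eq_square)
				finally show ?thesis .
			qed
			moreover have "C0\<^sup>2/r\<^sup>2 <= C0\<^sup>2/1" using r one_le_power[of r 2] by (intro divide_left_mono) auto
			ultimately have "1/r\<^sup>2 * (4*C0 * norm \<eta> + C0\<^sup>2/r\<^sup>2) <= 1/r\<^sup>2 * (2*C0\<^sup>2)" by (intro mult_left_mono) auto
			then have "norm E <= 2*C0\<^sup>2/r\<^sup>2" using E by simp
			then show ?thesis using \<beta> norm_triangle_ineq4[of \<beta> E] unfolding Y by (simp add: field_simps)
		qed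
		have T1: "norm (Y - D') <= 1/r\<^sup>2 * (5*C0\<^sup>2 * (norm \<eta> + W/k))"
		proof -
			have "norm (Y - D') <= 3*\<sigma>\<^sup>2 * (2 * norm Y)" using YD D'Y \<sigma> by (meson mult_left_mono order_trans zero_le_power2 mult_nonneg_nonneg zero_le_numeral)
			also have "\<dots> <= 3 * (\<sigma>/4) * (2 * (3*C0\<^sup>2/r\<^sup>2))" using \<sigma>2 Y2 \<sigma> by (intro mult_mono) auto
			also have "\<dots> = 1/r\<^sup>2 * (9/2*C0\<^sup>2*\<sigma>)" by (simp add: field_simps)
			also have "\<dots> <= 1/r\<^sup>2 * (5*C0\<^sup>2 * (norm \<eta> + W/k))"
				using Wk(1) t \<sigma> by (intro mult_left_mono mult_mono) (auto simp: \<sigma>_def)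
			finally show ?thesis .
		qed
		define b b' where "b = 2*\<i>*\<mu> * exp (- (\<i>*\<mu>)) * n12 \<mu>" and "b' = 2*\<i> * (- \<mu>) * exp (- (\<i> * (- \<mu>))) * n12 (- \<mu>)"
		\<comment> \<open>Distance of the normalised off-diagonal entries from q_m and q_(-m): C0/r from
		  the asymptotics, 4 Q |\<eta>| from moving the frequency to \<pi> m.\<close>
		define \<theta> where "\<theta> = D * (norm \<eta> + 1/r)"
		have \<theta>: "\<theta> >= 0" using D r by (simp add: \<theta>_def)
		have b: "norm (b - P) <= \<theta>" "norm (b' - P') <= \<theta>"
		proof -
			have "norm (b - qhat \<mu>) <= C0/r" "norm (b' - qhat (- \<mu>)) <= C0/r"
				unfolding b_def b'_def using as C0r by (auto intro: order_trans)
			moreover have "norm (qhat \<mu> - P) <= 4*Q * norm \<eta>" unfolding P_def Q_def \<eta>_def using n\<eta> by (intro qhat_near) (simp add: \<eta>_def)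
			moreover have "norm (qhat (- \<mu>) - P') <= 4*Q * norm \<eta>"
			proof -
				have e: "norm (- \<mu> - pim (- m)) = norm \<eta>" unfolding \<eta>_def by (metis (no_types) minus_diff_eq mult_minus_right norm_minus_commute of_int_minus uminus_add_conv_diff add.commute diff_minus_eq_add)
				show ?thesis using qhat_near[of "- \<mu>" "- m"] n\<eta> unfolding e P'_def Q_def by simp
			qed
			moreover have "C0/r + 4*Q * norm \<eta> <= \<theta>"
			proof -
				have "C0/r <= D/r" "4*Q * norm \<eta> <= D * norm \<eta>" using r Q C0 by (intro divide_right_mono mult_right_mono; simp add: D_def)+
				then show ?thesis by (simp add: \<theta>_def distrib_left)
			qed
			ultimately show "norm (b - P) <= \<theta>" "norm (b' - P') <= \<theta>"
				using norm_triangle_ineq[of "b - qhat \<mu>" "qhat \<mu> - P"] norm_triangle_ineq[of "b' - qhat (- \<mu>)" "qhat (- \<mu>) - P'"] by auto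
		qed
		have nP: "norm P <= Q" "norm P' <= Q" unfolding P_def P'_def Q_def by (rule fcoef_bounded)+
		have bb: "norm (b*b' - P*P') <= 2*D*Q * norm \<eta> + 2*D * (W/k) + 2*D\<^sup>2 * (norm \<eta> + 1/r\<^sup>2)"
		proof -
			have "b*b' - P*P' = (b - P) * P' + P * (b' - P') + (b - P) * (b' - P')" by (simp add: algebra_simps)
			also have "norm \<dots> <= norm (b - P) * norm P' + norm P * norm (b' - P') + norm (b - P) * norm (b' - P')"
				by (intro order_trans[OF norm_triangle_ineq] add_mono) (simp_all add: norm_mult)
			also have "\<dots> <= \<theta> * norm P' + norm P * \<theta> + \<theta>*\<theta>" using b \<theta> by (intro add_mono mult_mono) auto
			finally have 1: "norm (b*b' - P*P') <= \<theta> * norm P' + norm P * \<theta> + \<theta>*\<theta>" .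
			have 2: "\<theta>*x <= D*Q * norm \<eta> + D * (W/k)" if "x <= Q" "x/r <= W/k" for x
			proof -
				have "\<theta>*x = D * (x * norm \<eta>) + D * (x/r)" by (simp add: \<theta>_def field_simps)
				also have "\<dots> <= D * (Q * norm \<eta>) + D * (W/k)" using that D by (intro add_mono mult_left_mono mult_right_mono) auto
				finally show ?thesis by simp
			qed
			have 3: "\<theta>*\<theta> <= 2*D\<^sup>2 * (norm \<eta> + 1/r\<^sup>2)"
			proof -
				have "(norm \<eta> + 1/r)\<^sup>2 <= 2 * ((norm \<eta>)\<^sup>2 + (1/r)\<^sup>2)" using zero_le_power2[of "norm \<eta> - 1/r"] unfolding power2_sum power2_diff by (simp add: power_divide)
				also have "\<dots> <= 2 * (norm \<eta> + 1/r\<^sup>2)"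
				proof -
					have "(norm \<eta>)\<^sup>2 <= norm \<eta>" using n\<eta> by (simp add: power2_eq_square mult_left_le)
					then show ?thesis by (simp add: power_divide)
				qed
				finally have "D\<^sup>2 * (norm \<eta> + 1/r)\<^sup>2 <= D\<^sup>2 * (2 * (norm \<eta> + 1/r\<^sup>2))" by (intro mult_left_mono) auto
				moreover have "\<theta>*\<theta> = D\<^sup>2 * (norm \<eta> + 1/r)\<^sup>2" unfolding \<theta>_def power2_eq_square by (simp only: mult_ac)
				ultimately show ?thesis by (simp only: mult_ac)
			qed
			show ?thesis using 1 2[OF nP(1) Wk(2)] 2[OF nP(2) Wk(3)] 3 mult.commute[of "norm P" \<theta>] by linarith
		qed
		define h2 where "h2 = (4 * (complex_of_real (pi*r))\<^sup>2)"
		have h2: "h2 \<noteq> 0" using r by (simp add: h2_def)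
		have nh2: "norm h2 = 4 * (pi*r)\<^sup>2" unfolding h2_def norm_mult norm_power npr by simp
		have bb\<beta>: "b*b' = 4*\<mu>\<^sup>2*\<beta>"
		proof -
			have ee: "exp (- (\<i>*\<mu>)) * exp (- (\<i> * (- \<mu>))) = 1" by (simp add: exp_add[symmetric])
			have "b*b' = (2*\<i>) * (2*\<i>) * (\<mu> * - \<mu>) * (exp (- (\<i>*\<mu>)) * exp (- (\<i> * (- \<mu>)))) * \<beta>"
				unfolding b_def b'_def \<beta>_def by (simp only: mult_ac)
			then show ?thesis unfolding ee by (simp add: power2_eq_square)
		qed
		have w2: "(w0 m \<tau>)\<^sup>2 = of_real (\<tau>\<^sup>2) + P*P'/h2"
			using w0_square[of m \<tau>] mN by (simp add: ZZ_def P_def P'_def h2_def r_def power_mult_distrib)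
		have inv: "norm (1 / (4*\<mu>\<^sup>2) - 1/h2) <= norm \<eta> / r\<^sup>2"
		proof -
			have "1 / (4*\<mu>\<^sup>2) - 1/h2 = (h2 - 4*\<mu>\<^sup>2) / (4*\<mu>\<^sup>2*h2)" using \<mu>0 h2 by (simp add: diff_frac_eq mult.commute)
			also have "h2 - 4*\<mu>\<^sup>2 = - 4*\<eta> * (\<mu> + of_real (pi*r))" by (simp add: h2_def \<mu> power2_eq_square algebra_simps)
			finally have eq: "1 / (4*\<mu>\<^sup>2) - 1/h2 = - 4*\<eta> * (\<mu> + of_real (pi*r)) / (4*\<mu>\<^sup>2*h2)" .
			have "norm (1 / (4*\<mu>\<^sup>2) - 1/h2) = norm \<eta> * norm (\<mu> + of_real (pi*r)) / ((norm \<mu>)\<^sup>2 * (4 * (pi*r)\<^sup>2))"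
				unfolding eq norm_divide norm_mult nh2 by (simp add: norm_power)
			also have "\<dots> <= norm \<eta> * (norm \<mu> + pi*r) / ((norm \<mu>)\<^sup>2 * (4 * (pi*r)\<^sup>2))"
				using norm_triangle_ineq[of \<mu> "of_real (pi*r)"] unfolding npr by (intro divide_right_mono mult_left_mono mult_nonneg_nonneg) auto
			also have "\<dots> <= norm \<eta> * (norm \<mu> * (pi*r)) / ((norm \<mu>)\<^sup>2 * (4 * (pi*r)\<^sup>2))"
			proof (intro divide_right_mono mult_left_mono)
				have a: "norm \<mu> >= 2" "pi*r >= 2" using n\<mu> r pi_gt3 mult_mono[of 3 pi 2 r] by auto
				have "0 <= (norm \<mu> - 2) * (pi*r - 2) + ((norm \<mu> - 2) + (pi*r - 2))" using a by (intro add_nonneg_nonneg mult_nonneg_nonneg) auto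
				then show "norm \<mu> + pi*r <= norm \<mu> * (pi*r)" by (simp add: algebra_simps)
			qed auto
			also have "\<dots> = norm \<eta> / (4 * (norm \<mu> * (pi*r)))" using \<mu>0 r by (simp add: power2_eq_square)
			also have "\<dots> <= norm \<eta> / r\<^sup>2"
			proof (intro divide_left_mono)
				have "r * (1*r) <= norm \<mu> * (pi*r)" using n\<mu> r pi_gt3 by (intro mult_mono) auto
				then show "r\<^sup>2 <= 4 * (norm \<mu> * (pi*r))" using r by (simp add: power2_eq_square)
				show "0 < 4 * (norm \<mu> * (pi*r)) * r\<^sup>2" using \<mu>0 r by (intro mult_pos_pos) auto
			qed auto
			finally show ?thesis .
		qed
		have T2: "norm (\<beta> - P*P'/h2) <= 1/r\<^sup>2 * (2*D*Q * norm \<eta> + 2*D * (W/k) + 2*D\<^sup>2 * (norm \<eta> + 1/r\<^sup>2) + Q\<^sup>2 * norm \<eta>)"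
		proof -
			have "\<beta> - P*P'/h2 = 1 / (4*\<mu>\<^sup>2) * (b*b' - P*P') + P*P' * (1 / (4*\<mu>\<^sup>2) - 1/h2)"
				unfolding bb\<beta> using \<mu>0 h2 by (simp add: field_simps)
			also have "norm \<dots> <= norm (1 / (4*\<mu>\<^sup>2)) * norm (b*b' - P*P') + norm (P*P') * norm (1 / (4*\<mu>\<^sup>2) - 1/h2)"
				by (intro order_trans[OF norm_triangle_ineq] add_mono) (simp_all only: norm_mult order_refl)
			also have "\<dots> <= 1/r\<^sup>2 * (2*D*Q * norm \<eta> + 2*D * (W/k) + 2*D\<^sup>2 * (norm \<eta> + 1/r\<^sup>2)) + Q\<^sup>2 * (norm \<eta> / r\<^sup>2)"
			proof (intro add_mono mult_mono bb inv)
				have "1*r\<^sup>2 <= 4 * (norm \<mu>)\<^sup>2" using n\<mu> r by (intro mult_mono power_mono) auto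
				then show "norm (1 / (4*\<mu>\<^sup>2)) <= 1/r\<^sup>2" using r \<mu>0 by (simp add: norm_divide norm_mult norm_power frac_le)
				show "norm (P*P') <= Q\<^sup>2" unfolding norm_mult power2_eq_square using nP Q by (intro mult_mono) auto
			qed auto
			also have "\<dots> = 1/r\<^sup>2 * (2*D*Q * norm \<eta> + 2*D * (W/k) + 2*D\<^sup>2 * (norm \<eta> + 1/r\<^sup>2) + Q\<^sup>2 * norm \<eta>)" by (simp add: distrib_left)
			finally show ?thesis .
		qed
		have "\<eta>\<^sup>2 - (w0 m \<tau>)\<^sup>2 = (\<beta> - P*P'/h2) - (Y - D') - E" unfolding w2 by (simp add: D'_def Y)
		then have "norm (\<eta>\<^sup>2 - (w0 m \<tau>)\<^sup>2) <= norm (\<beta> - P*P'/h2) + norm (Y - D') + norm E"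
			using norm_triangle_ineq4[of "(\<beta> - P*P'/h2) - (Y - D')" E] norm_triangle_ineq4[of "\<beta> - P*P'/h2" "Y - D'"] by simp
		also have "\<dots> <= 1/r\<^sup>2 * (2*D*Q * norm \<eta> + 2*D * (W/k) + 2*D\<^sup>2 * (norm \<eta> + 1/r\<^sup>2) + Q\<^sup>2 * norm \<eta>)
			+ 1/r\<^sup>2 * (5*C0\<^sup>2 * (norm \<eta> + W/k)) + 1/r\<^sup>2 * (4*C0 * norm \<eta> + C0\<^sup>2/r\<^sup>2)"
			using T1 T2 E by linarith
		also have "\<dots> = 1/r\<^sup>2 * ((2*D*Q + 2*D\<^sup>2 + Q\<^sup>2 + 5*C0\<^sup>2 + 4*C0) * norm \<eta> + (2*D + 5*C0\<^sup>2) * (W/k) + (2*D\<^sup>2 + C0\<^sup>2) * (1/r\<^sup>2))"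
			by (simp add: algebra_simps)
		also have "\<dots> <= 1/r\<^sup>2 * ((S/k) * norm \<eta> + S * (W/k) + (S/k) * (1/r\<^sup>2))"
		proof -
			have nn: "0 <= D*Q" "0 <= D\<^sup>2" "0 <= Q\<^sup>2" "0 <= C0\<^sup>2" "0 <= C0" "0 <= D" using D Q C0 by auto
			have s: "2*D*Q + 2*D\<^sup>2 + Q\<^sup>2 + 5*C0\<^sup>2 + 4*C0 <= S" "2*D + 5*C0\<^sup>2 <= S" "2*D\<^sup>2 + C0\<^sup>2 <= S" using nn unfolding S_def by linarith+
			have "S * k <= S*1" using S1 k by (intro mult_left_mono) auto
			then have "S <= S/k" using k(1) by (simp add: pos_le_divide_eq)
			then show ?thesis using s W0 k(1) by (intro mult_left_mono add_mono mult_right_mono) auto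
		qed
		also have "\<dots> = (S/k) / r\<^sup>2 * (norm \<eta> + W + 1/r\<^sup>2)" using k(1) r(2) by (auto simp: field_simps)
		finally show ?thesis by (simp add: \<eta>_def W_def r_def)
	qed
	ultimately show ?thesis by (intro exI[of _ M] exI[of _ "S/k"]) simp
qed

end

end

section \<open>Pairing of two different roots\<close>

lemma norm_sin_ge:
	fixes z :: complex
	assumes "norm z <= 1/2"
	shows "norm z / 2 <= norm (sin z)"
proof -
	have "norm z ^ 3 = (norm z)\<^sup>2 * norm z" by (simp add: power3_eq_cube power2_eq_square)
	also have "\<dots> <= (1/2)\<^sup>2 * norm z" using assms by (intro mult_right_mono power_mono) auto
	finally have "norm z ^ 3 <= (1/2)\<^sup>2 * norm z" .
	moreover have "(1/2)\<^sup>2 * norm z <= norm z / 2" by (simp add: power2_eq_square)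
	ultimately have "norm z ^ 3 <= norm z / 2" by linarith
	then show ?thesis using norm_sin_minus_le[OF assms] norm_triangle_sub[of z "sin z"] norm_minus_commute[of z "sin z"] by linarith
qed

lemma norm_sin_diff_ge:
	fixes u v :: complex
	assumes "norm u <= 1/2" "norm v <= 1/2"
	shows "norm (u - v) / 4 <= norm (sin u - sin v)"
proof -
	define a b where "a = (u - v) / 2" and "b = (u + v) / 2"
	have a: "norm a <= 1/2" and b: "norm b <= 1/2"
		using norm_triangle_ineq4[of u v] norm_triangle_ineq[of u v] assms by (simp_all add: a_def b_def norm_divide)
	have "2 * (norm b)\<^sup>2 <= 2 * (1/2)\<^sup>2" using b by (intro mult_left_mono power_mono) auto
	then have "norm (cos b - 1) <= 1/2" using norm_cos_minus_1_le[OF b] by (simp add: power2_eq_square)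
	then have "1/2 <= norm (cos b)" using norm_triangle_sub[of 1 "cos b"] norm_minus_commute[of 1 "cos b"] by simp
	then have "(norm a / 2) * (1/2) <= norm (sin a) * norm (cos b)" using norm_sin_ge[OF a] by (intro mult_mono) auto
	then show ?thesis by (simp add: sin_diff_sin a_def[symmetric] b_def[symmetric] norm_mult) (simp add: a_def norm_divide)
qed

lemma sin_pi_int: "sin (pim m :: complex) = 0"
proof -
	have "sin (pi * real_of_int m) = 0" using sin_zero_iff_int2[of "pi * real_of_int m"] by (auto simp: mult.commute)
	then show ?thesis by (metis of_real_0 of_real_mult of_real_of_int_eq sin_of_real)
qed

lemma cos_pi_int: "cos (pim m :: complex) = (if even m then 1 else - 1)"
proof -
	have "cos (pi * real_of_int m) = (if even m then 1 else - 1)" using cos_int_2pin cos_npi_int[of m] by (simp add: mult.commute)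
	then show ?thesis by (metis cos_of_real of_real_1 of_real_minus of_real_mult of_real_of_int_eq)
qed

lemma near_pi_int:
	fixes \<mu> :: complex
	assumes r: "of_int m >= (2::real)" and near: "near_pi m \<mu>"
	shows "2 * of_int m <= norm \<mu>" "\<bar>Im \<mu>\<bar> <= 1" "Re \<mu> >= 0"
proof -
	define \<eta> r where "\<eta> = \<mu> - pim m" and "r = real_of_int m"
	have \<mu>: "\<mu> = of_real (pi*r) + \<eta>" by (simp add: \<eta>_def r_def)
	have r2: "r >= 2" using r by (simp add: r_def)
	have p: "pi*r >= 3*r" using pi_gt3 r2 by (intro mult_right_mono) auto
	have "\<bar>Re \<eta>\<bar> <= 1/8" "\<bar>Im \<eta>\<bar> <= 1/8" using abs_Re_le_cmod[of \<eta>] abs_Im_le_cmod[of \<eta>] near by (simp_all add: \<eta>_def)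
	moreover have "Re \<mu> = pi*r + Re \<eta>" "Im \<mu> = Im \<eta>" by (simp_all add: \<mu>)
	ultimately have "Re \<mu> >= 2*r" "\<bar>Im \<mu>\<bar> <= 1" using p r2 by linarith+
	then show "2 * of_int m <= norm \<mu>" "\<bar>Im \<mu>\<bar> <= 1" "Re \<mu> >= 0" using complex_Re_le_cmod[of \<mu>] r2 by (simp_all add: r_def)
qed

context hill_L1
begin

abbreviation strip_asymptotics :: "real => int => complex => bool" where
	"strip_asymptotics C m \<mu> \<equiv>
		(norm (n11 \<mu> - exp (\<i>*\<mu>)) <= C / (of_int m)\<^sup>2 \<and> norm (n11 (- \<mu>) - exp (\<i> * (- \<mu>))) <= C / (of_int m)\<^sup>2 \<and>
		 norm (n12 \<mu>) <= C / of_int m \<and> norm (n12 (- \<mu>)) <= C / of_int m \<and>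
		 norm (deriv n11 \<mu> - \<i> * exp (\<i>*\<mu>)) <= C / of_int m \<and> norm (deriv n11 (- \<mu>) - \<i> * exp (\<i> * (- \<mu>))) <= C / of_int m \<and>
		 norm (deriv n12 \<mu>) <= C / of_int m \<and> norm (deriv n12 (- \<mu>)) <= C / of_int m \<and>
		 n11 field_differentiable at \<mu> \<and> n12 field_differentiable at \<mu> \<and>
		 n11 field_differentiable at (- \<mu>) \<and> n12 field_differentiable at (- \<mu>))"

lemma strip_near:
	"\<exists>(M::real) C. M >= 2 \<and> C >= 1 \<and> (\<forall>m \<mu>. of_int m >= M \<and> near_pi m \<mu> -->
		 strip_asymptotics C m \<mu>)"
proof -
	obtain R C0 where R: "R > 2" and C0: "C0 >= 1" and asy: "\<forall>\<mu>. norm \<mu> >= R \<and> \<bar>Im \<mu>\<bar> <= 1 -->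
		 exp_asymptotics C0 \<mu>"
		using triv_asymptotics by blast
	have main: "norm (n11 \<mu> - exp (\<i>*\<mu>)) <= C0 / (of_int m)\<^sup>2 \<and> norm (n12 \<mu>) <= C0 / of_int m \<and>
		 norm (deriv n11 \<mu> - \<i> * exp (\<i>*\<mu>)) <= C0 / of_int m \<and> norm (deriv n12 \<mu>) <= C0 / of_int m \<and>
		 n11 field_differentiable at \<mu> \<and> n12 field_differentiable at \<mu>"
		if "of_int m >= R" "norm \<mu> >= 2 * of_int m" "\<bar>Im \<mu>\<bar> <= 1" for m \<mu>
	proof -
		have r: "real_of_int m > 0" "norm \<mu> >= of_int m" "norm \<mu> >= R" using that R by auto
		have le: "C0 / norm \<mu> <= C0 / of_int m" "C0 / (norm \<mu>)\<^sup>2 <= C0 / (of_int m)\<^sup>2"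
		proof -
			show "C0 / norm \<mu> <= C0 / of_int m" using r C0 by (intro divide_left_mono mult_pos_pos) linarith+
			have "(of_int m)\<^sup>2 <= (norm \<mu>)\<^sup>2" using r by (intro power_mono) auto
			moreover have "0 < (norm \<mu>)\<^sup>2 * (real_of_int m)\<^sup>2" using r by (intro mult_pos_pos zero_less_power) linarith+
			ultimately show "C0 / (norm \<mu>)\<^sup>2 <= C0 / (of_int m)\<^sup>2" using C0 by (intro divide_left_mono) auto
		qed
		show ?thesis using asy[rule_format, OF conjI[OF r(3) that(3)]] le by (meson order_trans)
	qed
	show ?thesis
	proof (rule exI[of _ R], rule exI[of _ C0], rule conjI[OF _ conjI[OF _ allI[OF allI[OF impI]]]])
		fix m :: int and \<mu> :: complex
		assume a: "R <= of_int m \<and> near_pi m \<mu>"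
		have n: "2 * of_int m <= norm \<mu>" "\<bar>Im \<mu>\<bar> <= 1" "2 * of_int m <= norm (- \<mu>)" "\<bar>Im (- \<mu>)\<bar> <= 1"
			using near_pi_int[of m \<mu>] a R by auto
		note main[OF conjunct1[OF a] n(1,2)] main[OF conjunct1[OF a] n(3,4)]
		then show "strip_asymptotics C0 m \<mu>" by blast
	qed (use R C0 in auto)
qed

text \<open>For X, the half-difference of the diagonal entries, X(\<mu>1)^2 - X(\<mu>2)^2 is the
  difference of the off-diagonal products, which are Lipschitz with constant O(m^(-2)). Dividing by
  X(\<mu>1) - X(\<mu>2), which is at least |\<mu>1 - \<mu>2| / 8, bounds the sum of the X. No
  division by \<open>w0\<close> occurs, so the case of nearly coinciding roots is covered.\<close>

lemma root_sum_bound: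
	"\<exists>(M::real) C. C >= 1 \<and> M >= 1 \<and> (\<forall>m \<tau> \<mu>1 \<mu>2. of_int m >= M \<and> near_pi m \<mu>1 \<and>
			near_pi m \<mu>2 \<and>
			floq_root q \<tau> \<mu>1 \<and> floq_root q \<tau> \<mu>2 \<and> \<mu>1 \<noteq> \<mu>2 -->
			norm ((\<mu>1 - pim m) + (\<mu>2 - pim m)) <= C / (of_int m)\<^sup>2)"
proof -
	obtain M0 :: real and C0 where M0: "M0 >= 2" and C0: "C0 >= 1" and asy: "\<forall>m \<mu>. of_int m >= M0 \<and> near_pi m \<mu> -->
		 strip_asymptotics C0 m \<mu>"
		using strip_near by blast
	have main: "norm ((\<mu>1 - pim m) + (\<mu>2 - pim m)) <= 72*C0\<^sup>2 / (of_int m)\<^sup>2"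
		if mM: "of_int m >= max M0 (8*C0)" and near: "near_pi m \<mu>1" "near_pi m \<mu>2"
			and ev: "floq_root q \<tau> \<mu>1" "floq_root q \<tau> \<mu>2" and ne: "\<mu>1 \<noteq> \<mu>2"
		for m \<tau> \<mu>1 \<mu>2
	proof -
		define r where "r = real_of_int m"
		have r: "r >= M0" "r >= 8*C0" "r >= 2" using mM M0 by (auto simp: r_def)
		define S where "S = cball (pim m :: complex) (1/8)"
		have S: "\<mu> \<in> S \<longleftrightarrow> near_pi m \<mu>" for \<mu> by (simp add: S_def dist_norm norm_minus_commute)
		have in_S: "\<mu>1 \<in> S" "\<mu>2 \<in> S" using near by (simp_all add: S)
		have cS: "convex S" by (simp add: S_def)
		define \<epsilon>1 where "\<epsilon>1 z = ((n11 z - exp (\<i>*z)) - (n11 (- z) - exp (\<i> * (- z)))) / (2*\<i>)" for z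
		define \<beta> where "\<beta> z = n12 z * n12 (- z)" for z
		have asz: "norm (n11 z - exp (\<i>*z)) <= C0/r\<^sup>2" "norm (n11 (- z) - exp (\<i> * (- z))) <= C0/r\<^sup>2"
			"norm (n12 z) <= C0/r" "norm (n12 (- z)) <= C0/r"
			"norm (deriv n11 z - \<i> * exp (\<i>*z)) <= C0/r" "norm (deriv n11 (- z) - \<i> * exp (\<i> * (- z))) <= C0/r"
			"norm (deriv n12 z) <= C0/r" "norm (deriv n12 (- z)) <= C0/r"
			"n11 field_differentiable at z" "n12 field_differentiable at z"
			"n11 field_differentiable at (- z)" "n12 field_differentiable at (- z)" if "z \<in> S" for z
			using asy[rule_format, of m z, OF conjI] that r(1) unfolding S r_def by blast+
		have d: "(n11 has_field_derivative deriv n11 z) (at z)" "(n12 has_field_derivative deriv n12 z) (at z)"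
			"((\<lambda>z. n11 (- z)) has_field_derivative deriv n11 (- z) * (- 1)) (at z)" "((\<lambda>z. n12 (- z)) has_field_derivative deriv n12 (- z) * (- 1)) (at z)"
			if "z \<in> S" for z
		proof -
			show "(n11 has_field_derivative deriv n11 z) (at z)" "(n12 has_field_derivative deriv n12 z) (at z)"
				using asz(9,10)[OF that] by (simp_all only: field_differentiable_derivI)
			have u: "(uminus has_field_derivative (- 1)) (at z)" by (auto intro!: derivative_eq_intros)
			show "((\<lambda>z. n11 (- z)) has_field_derivative deriv n11 (- z) * (- 1)) (at z)"
				by (rule DERIV_chain2[OF field_differentiable_derivI[OF asz(11)[OF that]] u])
			show "((\<lambda>z. n12 (- z)) has_field_derivative deriv n12 (- z) * (- 1)) (at z)"
				by (rule DERIV_chain2[OF field_differentiable_derivI[OF asz(12)[OF that]] u])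
		qed
		have L1: "norm (\<epsilon>1 \<mu>1 - \<epsilon>1 \<mu>2) <= C0/r * norm (\<mu>1 - \<mu>2)"
		proof (rule field_differentiable_bound[OF cS _ _ in_S])
			fix z assume z: "z \<in> S"
			have "((\<lambda>z. (n11 z - exp (\<i>*z)) - (n11 (- z) - exp (\<i> * (- z)))) has_field_derivative
					((deriv n11 z - \<i> * exp (\<i>*z)) + (deriv n11 (- z) - \<i> * exp (\<i> * (- z))))) (at z)"
				by (rule derivative_eq_intros d[OF z] refl | simp add: algebra_simps)+
			from DERIV_cdivide[OF this, of "2*\<i>"]
			have "(\<epsilon>1 has_field_derivative ((deriv n11 z - \<i> * exp (\<i>*z)) + (deriv n11 (- z) - \<i> * exp (\<i> * (- z)))) / (2*\<i>)) (at z)"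
				unfolding \<epsilon>1_def[abs_def] .
			then show "(\<epsilon>1 has_field_derivative ((deriv n11 z - \<i> * exp (\<i>*z)) + (deriv n11 (- z) - \<i> * exp (\<i> * (- z)))) / (2*\<i>)) (at z within S)"
				by (rule has_field_derivative_at_within)
			have "norm ((deriv n11 z - \<i> * exp (\<i>*z)) + (deriv n11 (- z) - \<i> * exp (\<i> * (- z)))) <= C0/r + C0/r"
				by (rule norm_triangle_mono[OF asz(5,6)[OF z]])
			then show "norm (((deriv n11 z - \<i> * exp (\<i>*z)) + (deriv n11 (- z) - \<i> * exp (\<i> * (- z)))) / (2*\<i>)) <= C0/r"
				unfolding norm_divide by (simp add: norm_mult mult.commute)
		qed
		have L2: "norm (\<beta> \<mu>1 - \<beta> \<mu>2) <= 2*C0\<^sup>2/r\<^sup>2 * norm (\<mu>1 - \<mu>2)"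
		proof (rule field_differentiable_bound[OF cS _ _ in_S])
			fix z assume z: "z \<in> S"
			show "(\<beta> has_field_derivative (n12 z * (deriv n12 (- z) * (- 1)) + deriv n12 z * n12 (- z))) (at z within S)"
				unfolding \<beta>_def[abs_def] by (rule has_field_derivative_at_within, rule DERIV_mult'[OF d(2,4)[OF z]])
			have p: "norm (x*y) <= C0\<^sup>2/r\<^sup>2" if "norm x <= C0/r" "norm y <= C0/r" for x y :: complex
			proof -
				have "norm x * norm y <= (C0/r) * (C0/r)" using that C0 r by (intro mult_mono) auto
				then show ?thesis by (simp add: norm_mult power2_eq_square)
			qed
			have "norm (n12 z * (deriv n12 (- z) * (- 1)) + deriv n12 z * n12 (- z)) <= C0\<^sup>2/r\<^sup>2 + C0\<^sup>2/r\<^sup>2"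
				by (intro norm_triangle_mono p asz[OF z]) (use asz(8)[OF z] in simp)
			then show "norm (n12 z * (deriv n12 (- z) * (- 1)) + deriv n12 z * n12 (- z)) <= 2*C0\<^sup>2/r\<^sup>2" by simp
		qed
		define \<kappa> where "\<kappa> = cos (pim m :: complex)"
		have \<kappa>: "norm \<kappa> = 1" by (simp add: \<kappa>_def cos_pi_int)
		define \<eta>1 \<eta>2 where "\<eta>1 = \<mu>1 - pim m" and "\<eta>2 = \<mu>2 - pim m"
		have n: "norm \<eta>1 <= 1/8" "norm \<eta>2 <= 1/8" using near by (simp_all add: \<eta>1_def \<eta>2_def)
		have sm: "sin \<mu> = \<kappa> * sin (\<mu> - pim m)" for \<mu>
			using sin_add[of "pim m" "\<mu> - pim m"] by (simp add: \<kappa>_def sin_pi_int)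
		define X where "X z = (n11 z - n11 (- z)) / (2*\<i>)" for z
		have X: "X z = sin z + \<epsilon>1 z" for z by (simp add: X_def \<epsilon>1_def sin_exp_eq field_simps)
		have X2: "(X \<mu>1)\<^sup>2 = of_real ((sin \<tau>)\<^sup>2) + \<beta> \<mu>1" "(X \<mu>2)\<^sup>2 = of_real ((sin \<tau>)\<^sup>2) + \<beta> \<mu>2"
		proof -
			have "2 <= real_of_int m" using r by (simp add: r_def)
			then have "1 <= norm \<mu>1" "1 <= norm \<mu>2" using near_pi_int(1)[of m \<mu>1] near_pi_int(1)[of m \<mu>2] near by auto
			then show "(X \<mu>1)\<^sup>2 = of_real ((sin \<tau>)\<^sup>2) + \<beta> \<mu>1" "(X \<mu>2)\<^sup>2 = of_real ((sin \<tau>)\<^sup>2) + \<beta> \<mu>2"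
				unfolding X_def \<beta>_def using half_difference_square[OF _ ev(1)] half_difference_square[OF _ ev(2)] by blast+
		qed
		define \<Delta> where "\<Delta> = norm (\<mu>1 - \<mu>2)"
		have \<Delta>: "\<Delta> > 0" using ne by (simp add: \<Delta>_def)
		\<comment> \<open>The sine part gives at least 1/4 of the distance; the perturbation is Lipschitz
		  with constant C0/r <= 1/8.\<close>
		have Xd: "\<Delta> / 8 <= norm (X \<mu>1 - X \<mu>2)"
		proof -
			have e: "\<eta>1 - \<eta>2 = \<mu>1 - \<mu>2" by (simp add: \<eta>1_def \<eta>2_def)
			have "X \<mu>1 - X \<mu>2 = \<kappa> * (sin \<eta>1 - sin \<eta>2) + (\<epsilon>1 \<mu>1 - \<epsilon>1 \<mu>2)" unfolding X sm[of \<mu>1] sm[of \<mu>2] \<eta>1_def \<eta>2_def by (simp add: algebra_simps)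
			then have "norm (\<kappa> * (sin \<eta>1 - sin \<eta>2)) <= norm (X \<mu>1 - X \<mu>2) + norm (\<epsilon>1 \<mu>1 - \<epsilon>1 \<mu>2)" by (metis add_diff_cancel_right' norm_triangle_ineq4)
			then have "norm (sin \<eta>1 - sin \<eta>2) <= norm (X \<mu>1 - X \<mu>2) + norm (\<epsilon>1 \<mu>1 - \<epsilon>1 \<mu>2)" by (simp add: norm_mult \<kappa>)
			moreover have "\<Delta> / 4 <= norm (sin \<eta>1 - sin \<eta>2)" unfolding \<Delta>_def e[symmetric] using n by (intro norm_sin_diff_ge) auto
			moreover have "C0/r * \<Delta> <= 1/8 * \<Delta>" using r \<Delta> by (intro mult_right_mono) (auto simp: divide_le_eq)
			ultimately show ?thesis using L1 unfolding \<Delta>_def by linarith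
		qed
		have sum: "norm (X \<mu>1 + X \<mu>2) <= 16*C0\<^sup>2/r\<^sup>2"
		proof -
			have "norm (X \<mu>1 + X \<mu>2) * (\<Delta> / 8) <= norm (X \<mu>1 + X \<mu>2) * norm (X \<mu>1 - X \<mu>2)" using Xd by (intro mult_left_mono) auto
			also have "\<dots> = norm (\<beta> \<mu>1 - \<beta> \<mu>2)"
			proof -
				have "(X \<mu>1 + X \<mu>2) * (X \<mu>1 - X \<mu>2) = (X \<mu>1)\<^sup>2 - (X \<mu>2)\<^sup>2" by (simp add: power2_eq_square algebra_simps)
				then show ?thesis unfolding X2 norm_mult[symmetric] by simp
			qed
			also have "\<dots> <= 2*C0\<^sup>2/r\<^sup>2 * \<Delta>" using L2 by (simp add: \<Delta>_def)
			finally have "norm (X \<mu>1 + X \<mu>2) * \<Delta> <= (16*C0\<^sup>2/r\<^sup>2) * \<Delta>" by simp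
			then show ?thesis using \<Delta> by (rule mult_right_le_imp_le)
		qed
		have e1: "norm (\<epsilon>1 z) <= C0/r\<^sup>2" if "z \<in> S" for z
		proof -
			have "norm ((n11 z - exp (\<i>*z)) - (n11 (- z) - exp (\<i> * (- z)))) <= C0/r\<^sup>2 + C0/r\<^sup>2"
				by (intro order_trans[OF norm_triangle_ineq4] add_mono asz[OF that])
			then show ?thesis unfolding \<epsilon>1_def norm_divide by (simp add: norm_mult mult.commute)
		qed
		have "X \<mu>1 + X \<mu>2 = \<kappa> * (sin \<eta>1 + sin \<eta>2) + (\<epsilon>1 \<mu>1 + \<epsilon>1 \<mu>2)" unfolding X sm[of \<mu>1] sm[of \<mu>2] \<eta>1_def \<eta>2_def by (simp add: algebra_simps)
		then have "norm (\<kappa> * (sin \<eta>1 + sin \<eta>2)) <= norm (X \<mu>1 + X \<mu>2) + norm (\<epsilon>1 \<mu>1 + \<epsilon>1 \<mu>2)" by (metis add_diff_cancel_right' norm_triangle_ineq4)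
		also have "norm (\<epsilon>1 \<mu>1 + \<epsilon>1 \<mu>2) <= C0/r\<^sup>2 + C0/r\<^sup>2" by (intro norm_triangle_mono e1 in_S)
		\<comment> \<open>16 C0^2 + 2 C0 <= 18 C0^2, and passing from the sines to their arguments costs a
		  factor 4; hence 72.\<close>
		finally have "norm (sin \<eta>1 + sin \<eta>2) <= 16*C0\<^sup>2/r\<^sup>2 + 2 * (C0/r\<^sup>2)" using sum by (simp add: norm_mult \<kappa>)
		moreover have "C0/r\<^sup>2 <= C0\<^sup>2/r\<^sup>2" using C0 by (intro divide_right_mono) (simp_all add: power2_eq_square)
		moreover have "norm (\<eta>1 + \<eta>2) / 4 <= norm (sin \<eta>1 + sin \<eta>2)" using norm_sin_diff_ge[of \<eta>1 "- \<eta>2"] n by simp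
		ultimately show ?thesis unfolding \<eta>1_def[symmetric] \<eta>2_def[symmetric] r_def[symmetric] by simp
	qed
	have "72*C0\<^sup>2 >= 1" using C0 one_le_power[of C0 2] by linarith
	moreover have "max M0 (8*C0) >= 1" using C0 by auto
	ultimately show ?thesis using main by (intro exI[of _ "72*C0\<^sup>2"] exI[of _ "max M0 (8*C0)"] conjI allI impI) blast+
qed

context
	fixes \<epsilon> B :: real and N0 :: int
	assumes ep: "\<epsilon> > 0" and B: "B > 0"
		and cond: "balanced_coefs q \<epsilon> B N0"
begin

text \<open>\<open>root_dichotomy\<close> places each root near w0 or -w0, but would allow both near
  the same one. Since the offsets add up to O(m^(-2)), once one root is near one sign the other is
  near the opposite sign.\<close>

lemma root_pair:
	"\<exists>(M::real) C. C >= 1 \<and> M >= 1 \<and> (\<forall>m \<tau> \<mu>1 \<mu>2. of_int m >= M \<and> 0 <= \<tau> \<and> \<tau> <= 1/8 \<and> near_pi m \<mu>1 \<and>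
			near_pi m \<mu>2 \<and>
			floq_root q \<tau> \<mu>1 \<and> floq_root q \<tau> \<mu>2 \<and> \<mu>1 \<noteq> \<mu>2 -->
			norm (\<mu>1 - pim m + w0 m \<tau>) <= C / (of_int m)\<^sup>2 \<and> norm (\<mu>2 - pim m - w0 m \<tau>) <= C / (of_int m)\<^sup>2 \<or>
			norm (\<mu>2 - pim m + w0 m \<tau>) <= C / (of_int m)\<^sup>2 \<and> norm (\<mu>1 - pim m - w0 m \<tau>) <= C / (of_int m)\<^sup>2)"
proof -
	obtain M1 :: real and C1 where C1: "C1 >= 1" "M1 >= 1" and loc: "\<forall>m \<tau> \<mu>. of_int m >= M1 \<and> 0 <= \<tau> \<and> \<tau> <= 1/8 \<and> near_pi m \<mu> \<and>
			floq_root q \<tau> \<mu> -->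
			norm ((\<mu> - pim m)\<^sup>2 - (w0 m \<tau>)\<^sup>2) <= C1 / (of_int m)\<^sup>2 * (norm (\<mu> - pim m) + norm (w0 m \<tau>) + 1 / (of_int m)\<^sup>2)"
		using root_location[OF ep B cond] by blast
	obtain M2 :: real and C2 where C2: "C2 >= 1" "M2 >= 1" and sum: "\<forall>m \<tau> \<mu>1 \<mu>2. of_int m >= M2 \<and> near_pi m \<mu>1 \<and>
			near_pi m \<mu>2 \<and>
			floq_root q \<tau> \<mu>1 \<and> floq_root q \<tau> \<mu>2 \<and> \<mu>1 \<noteq> \<mu>2 -->
			norm ((\<mu>1 - pim m) + (\<mu>2 - pim m)) <= C2 / (of_int m)\<^sup>2"
		using root_sum_bound by blast
	have main: "norm (\<eta>1 + w) <= (4*C1 + C2) / r\<^sup>2 \<and> norm (\<eta>2 - w) <= (4*C1 + C2) / r\<^sup>2 \<or>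
			norm (\<eta>2 + w) <= (4*C1 + C2) / r\<^sup>2 \<and> norm (\<eta>1 - w) <= (4*C1 + C2) / r\<^sup>2"
		if r: "r > 0" and e: "norm (\<eta>1\<^sup>2 - w\<^sup>2) <= C1/r\<^sup>2 * (norm \<eta>1 + norm w + 1/r\<^sup>2)"
			"norm (\<eta>2\<^sup>2 - w\<^sup>2) <= C1/r\<^sup>2 * (norm \<eta>2 + norm w + 1/r\<^sup>2)" and s: "norm (\<eta>1 + \<eta>2) <= C2/r\<^sup>2"
		for r :: real and \<eta>1 \<eta>2 w :: complex
	proof -
		define K where "K = (4*C1 + C2) / r\<^sup>2"
		have K: "K = 4*C1 * (1/r\<^sup>2) + C2/r\<^sup>2" by (simp add: K_def add_divide_distrib)
		have "C2/r\<^sup>2 >= 0" using C2 by simp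
		then have K1: "4*C1 * (1/r\<^sup>2) <= K" by (simp add: K)
		have p: "1/r\<^sup>2 > 0" using r by simp
		have "norm (\<eta>1 - w) <= 4*C1 * (1/r\<^sup>2) \<or> norm (\<eta>1 + w) <= 4*C1 * (1/r\<^sup>2)"
			using root_dichotomy[OF C1(1) p, of \<eta>1 w] e(1) by simp
		moreover have "norm (\<eta>2 - w) <= 4*C1 * (1/r\<^sup>2) \<or> norm (\<eta>2 + w) <= 4*C1 * (1/r\<^sup>2)"
			using root_dichotomy[OF C1(1) p, of \<eta>2 w] e(2) by simp
		moreover have "norm (\<eta>2 + w) <= K" if "norm (\<eta>1 - w) <= 4*C1 * (1/r\<^sup>2)"
			using norm_triangle_ineq4[of "\<eta>1 + \<eta>2" "\<eta>1 - w"] that s unfolding K by (simp add: algebra_simps)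
		moreover have "norm (\<eta>2 - w) <= K" if "norm (\<eta>1 + w) <= 4*C1 * (1/r\<^sup>2)"
			using norm_triangle_ineq4[of "\<eta>1 + \<eta>2" "\<eta>1 + w"] that s unfolding K by (simp add: algebra_simps)
		ultimately show ?thesis unfolding K_def[symmetric] using K1 by (meson order_trans)
	qed
	show ?thesis
	proof (rule exI[of _ "max M1 M2"], rule exI[of _ "4*C1 + C2"], rule conjI[OF _ conjI[OF _ allI[OF allI[OF allI[OF allI[OF impI]]]]]])
		show "1 <= 4*C1 + C2" "1 <= max M1 M2" using C1 C2 by auto
		fix m :: int and \<tau> \<mu>1 \<mu>2
		assume a: "max M1 M2 <= of_int m \<and> 0 <= \<tau> \<and> \<tau> <= 1/8 \<and> near_pi m \<mu>1 \<and>
			near_pi m \<mu>2 \<and>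
			floq_root q \<tau> \<mu>1 \<and> floq_root q \<tau> \<mu>2 \<and> \<mu>1 \<noteq> \<mu>2"
		show "norm (\<mu>1 - pim m + w0 m \<tau>) <= (4*C1 + C2) / (of_int m)\<^sup>2 \<and> norm (\<mu>2 - pim m - w0 m \<tau>) <= (4*C1 + C2) / (of_int m)\<^sup>2 \<or>
			norm (\<mu>2 - pim m + w0 m \<tau>) <= (4*C1 + C2) / (of_int m)\<^sup>2 \<and> norm (\<mu>1 - pim m - w0 m \<tau>) <= (4*C1 + C2) / (of_int m)\<^sup>2"
		proof (rule main)
			show "real_of_int m > 0" using a C1(2) by linarith
		qed (use a loc sum in auto)
	qed
qed

end

end

section \<open>Exactly two eigenvalues in a disc, by Rouche's theorem\<close>

lemma two_zeros_in_ball: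
	fixes F :: "complex => complex"
	assumes F: "F holomorphic_on UNIV" and a: "a \<noteq> 0" and l: "l1 \<in> ball c r" "l2 \<in> ball c r"
		and close: "\<And>z. norm (z - c) = r ==> norm (F z - a * (z - l1) * (z - l2)) < norm (a * (z - l1) * (z - l2))"
		and simple: "\<And>z. z \<in> ball c r ==> F z = 0 ==> deriv F z \<noteq> 0"
	obtains z1 z2 where "z1 \<noteq> z2" "{z. F z = 0 \<and> norm (z - c) < r} = {z1, z2}"
proof -
	have r: "r > 0" using l(1) by (metis ball_eq_empty empty_iff not_le)
	define f where "f z = a * (z - l1) * (z - l2)" for z
	define g where "g z = F z - f z" for z
	\<comment> \<open>Twice the radius, so that the circle lies inside an open connected set; zeros
	  outside the small disc have winding number 0.\<close>
	define S where "S = ball c (2*r)"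
	define \<gamma> where "\<gamma> = circlepath c r"
	have fh: "f holomorphic_on S" unfolding f_def[abs_def] by (intro holomorphic_intros)
	have gh: "g holomorphic_on S" unfolding g_def[abs_def] by (intro holomorphic_intros fh holomorphic_on_subset[OF F]) auto
	have img: "path_image \<gamma> = sphere c r" using r by (simp add: \<gamma>_def)
	have onc: "norm (g z) < norm (f z)" if "z \<in> sphere c r" for z
		using close[of z] that by (simp add: g_def f_def dist_norm norm_minus_commute)
	have finF: "finite {p\<in>S. F p = 0}"
	proof (cases "F constant_on UNIV")
		case True
		then obtain k where k: "\<And>z. F z = k" by (auto simp: constant_on_def)
		have "k \<noteq> 0"
		proof
			assume "k = 0"
			moreover have "c + of_real r \<in> sphere c r" using r by (simp add: dist_norm)
			ultimately show False using onc[of "c + of_real r"] k by (simp add: g_def)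
		qed
		then show ?thesis by (simp add: k)
	next
		case False
		have "finite {z \<in> cball c (2*r). F z = 0}"
			by (rule holomorphic_compact_finite_zeros[OF F]) (use False in auto)
		then show ?thesis by (rule rev_finite_subset) (auto simp: S_def)
	qed
	have zf: "{p\<in>S. f p = 0} = {l1, l2}" using a l r by (auto simp: f_def S_def)
	have wn: "winding_number \<gamma> p = (if norm (p - c) < r then 1 else 0)" if "p \<notin> sphere c r" for p
	proof (cases "norm (p - c) < r")
		case True
		then show ?thesis by (simp add: \<gamma>_def winding_number_circlepath)
	next
		case False
		then have "p \<notin> cball c r" using that by (auto simp: dist_norm norm_minus_commute)
		then have "winding_number \<gamma> p = 0"
			by (intro winding_number_zero_outside[where s = "cball c r"]) (use r in \<open>auto simp: \<gamma>_def\<close>)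
		then show ?thesis using False by simp
	qed
	\<comment> \<open>Rouche's theorem compares the counts with multiplicity: 2 for the quadratic, and
	  the number of points for \<open>F\<close>, whose zeros in the disc are simple.\<close>
	have R: "(\<Sum>p\<in>{p\<in>S. F p = 0}. winding_number \<gamma> p * zorder F p) = (\<Sum>p\<in>{p\<in>S. f p = 0}. winding_number \<gamma> p * zorder f p)"
	proof -
		have fg: "f p + g p = F p" for p by (simp add: g_def)
		have "(\<Sum>p\<in>{p\<in>S. f p + g p = 0}. winding_number \<gamma> p * zorder (\<lambda>p. f p + g p) p) = (\<Sum>p\<in>{p\<in>S. f p = 0}. winding_number \<gamma> p * zorder f p)"
	proof (rule Rouche_theorem[of S f g \<gamma>])
		show "finite {p\<in>S. f p = 0}" unfolding zf by simp
		show "path_image \<gamma> \<subseteq> S" using r by (auto simp: img S_def)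
		show "\<forall>z\<in>path_image \<gamma>. norm (g z) < norm (f z)" unfolding img using onc by blast
		show "\<forall>z. z \<notin> S --> winding_number \<gamma> z = 0"
		proof (intro allI impI)
			fix z assume "z \<notin> S"
			then have "norm (z - c) >= 2*r" by (simp add: S_def dist_norm norm_minus_commute)
			then show "winding_number \<gamma> z = 0" using wn[of z] r by (auto simp: dist_norm norm_minus_commute)
		qed
		show "finite {p\<in>S. f p + g p = 0}" unfolding fg by (rule finF)
	qed (use fh gh in \<open>auto simp: S_def \<gamma>_def\<close>)
		then show ?thesis unfolding fg .
	qed
	have lr: "norm (l1 - c) < r" "norm (l2 - c) < r" using l by (simp_all add: dist_norm norm_minus_commute)
	\<comment> \<open>For \<tau> = 0 the two model zeros coincide and are counted through a zero of
	  order 2.\<close>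
	have sumf: "(\<Sum>p\<in>{p\<in>S. f p = 0}. winding_number \<gamma> p * zorder f p) = 2"
	proof (cases "l1 = l2")
		case True
		have "zorder f l1 = 2"
			by (rule zorder_eqI[of UNIV _ "\<lambda>_. a"]) (use a True in \<open>auto simp: f_def power2_eq_square\<close>)
		moreover have "winding_number \<gamma> l1 = 1" using wn[of l1] lr by (auto simp: dist_norm norm_minus_commute)
		ultimately show ?thesis unfolding zf using True by simp
	next
		case False
		have "zorder f l1 = 1"
			by (rule simple_zeroI[of UNIV _ "\<lambda>w. a * (w - l2)"]) (use a False in \<open>auto simp: f_def intro!: holomorphic_intros\<close>)
		moreover have "zorder f l2 = 1"
			by (rule simple_zeroI[of UNIV _ "\<lambda>w. a * (w - l1)"]) (use a False in \<open>auto simp: f_def intro!: holomorphic_intros\<close>)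
		moreover have "winding_number \<gamma> l1 = 1" "winding_number \<gamma> l2 = 1" using wn[of l1] wn[of l2] lr by (auto simp: dist_norm norm_minus_commute)
		ultimately show ?thesis unfolding zf using False by simp
	qed
	define Z where "Z = {z. F z = 0 \<and> norm (z - c) < r}"
	have "(\<Sum>p\<in>{p\<in>S. F p = 0}. winding_number \<gamma> p * zorder F p) = (\<Sum>p\<in>{p\<in>S. F p = 0}. if p \<in> Z then 1 else 0)"
	proof (rule sum.cong[OF refl])
		fix p assume p: "p \<in> {p\<in>S. F p = 0}"
		have ns: "p \<notin> sphere c r" using onc[of p] p by (auto simp: g_def)
		show "winding_number \<gamma> p * zorder F p = (if p \<in> Z then 1 else 0)"
		proof (cases "p \<in> Z")
			case True
			then have "deriv F p \<noteq> 0" using simple[of p] by (auto simp: Z_def dist_norm norm_minus_commute)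
			then have "zorder F p = 1" using True by (intro zorder_zero_eqI[OF F open_UNIV UNIV_I]) (auto simp: Z_def)
			then show ?thesis using wn[OF ns] True by (simp add: Z_def)
		next
			case False
			then show ?thesis using wn[OF ns] p by (auto simp: Z_def)
		qed
	qed
	also have "\<dots> = of_nat (card ({p\<in>S. F p = 0} \<inter> Z))" using finF by (simp add: sum.If_cases Int_def)
	also have "{p\<in>S. F p = 0} \<inter> Z = Z" using r by (auto simp: Z_def S_def dist_norm norm_minus_commute)
	finally have "(of_nat (card Z) :: complex) = of_nat 2" using R sumf by simp
	then have "card Z = 2" unfolding of_nat_eq_iff .
	then obtain z1 z2 where "Z = {z1, z2}" "z1 \<noteq> z2" by (auto simp: card_2_iff)
	then show ?thesis using that by (simp add: Z_def)
qed

text \<open>The product formula writes the cosine difference with sines of (\<eta> +- \<tau>)/2,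
  both at most (1/8 + 1/80)/2 < 1/14, so the error is relative to |\<eta>^2 - \<tau>^2|.\<close>

lemma two_cos_diff_bound:
	fixes \<eta> :: complex
	assumes "norm \<eta> <= 1/8" "0 <= \<tau>" "\<tau> <= 1/80"
	shows "norm (2 * cos \<eta> - 2 * cos (of_real \<tau>) + (\<eta>\<^sup>2 - of_real (\<tau>\<^sup>2))) <= norm (\<eta>\<^sup>2 - of_real (\<tau>\<^sup>2)) / 16"
proof -
	define u v where "u = (\<eta> + of_real \<tau>) / 2" and "v = (\<eta> - of_real \<tau>) / 2"
	define D where "D = \<eta>\<^sup>2 - of_real (\<tau>\<^sup>2)"
	have n: "norm u <= 1/14" "norm v <= 1/14"
		using norm_triangle_ineq[of \<eta> "of_real \<tau>"] norm_triangle_ineq4[of \<eta> "of_real \<tau>"] assms by (simp_all add: u_def v_def norm_divide)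
	have uv: "4 * (u * v) = D"
	proof -
		have "4 * (u * v) = (\<eta> + of_real \<tau>) * (\<eta> - of_real \<tau>)" unfolding u_def v_def times_divide_times_eq by simp
		then show ?thesis by (simp add: D_def power2_eq_square algebra_simps)
	qed
	have "2 * cos \<eta> - 2 * cos (of_real \<tau>) = 2 * (2 * sin u * sin ((of_real \<tau> - \<eta>) / 2))"
		unfolding right_diff_distrib[symmetric] cos_diff_cos u_def ..
	also have "(of_real \<tau> - \<eta>) / 2 = - v" by (simp add: v_def diff_divide_distrib)
	finally have "2 * cos \<eta> - 2 * cos (of_real \<tau>) + D = - 4 * (sin u * sin v - u * v)" unfolding uv[symmetric] by (simp add: algebra_simps)
	then have "norm (2 * cos \<eta> - 2 * cos (of_real \<tau>) + D) = 4 * norm (sin u * sin v - u * v)" by (simp only: norm_mult norm_minus_cancel norm_numeral)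
	also have "\<dots> <= 4 * (3 * (1/14)\<^sup>2 * norm (u * v))" using sin_product_bound[OF n] by (intro mult_left_mono) auto
	also have "\<dots> = 3 * (1/14)\<^sup>2 * norm D" unfolding uv[symmetric] by (simp add: norm_mult)
	also have "\<dots> <= norm D / 16" by (simp add: power2_eq_square)
	finally show ?thesis by (simp add: D_def)
qed

lemma cos_pi_int_add: "cos (of_real (pi * of_int m + \<tau>)) = cos (pim m) * cos (of_real \<tau> :: complex)"
	using cos_add[of "pim m" "of_real \<tau> :: complex"] by (simp add: sin_pi_int)

text \<open>From z - (\<pi> m)^2, divided by a sum of modulus at least \<pi> m. The 10 is 15/2 for
  the radius, 2 for the shift of the centre and 1/2 for its square. With \<rho> <= 1/80 it keeps the
  root within the 1/8 of \<open>near_pi\<close>.\<close>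

lemma csqrt_near:
	fixes z :: complex and \<tau> s :: real
	assumes m: "real_of_int m >= 1" and \<rho>: "\<rho> > 0" "\<rho> <= 1/80" and t: "0 <= \<tau>" "\<tau> <= \<rho>" and s: "\<bar>s\<bar> = 1"
		and z: "norm (z - of_real ((pi * of_int m + s*\<tau>)\<^sup>2)) <= 15/2*pi * of_int m * \<rho>"
	shows "norm (csqrt z - pim m) <= 10*\<rho>"
proof -
	define r \<mu> where "r = real_of_int m" and "\<mu> = csqrt z"
	have r: "r >= 1" using m by (simp add: r_def)
	have pr: "pi*r >= 3" using mult_mono[of 3 pi 1 r] pi_gt3 r by auto
	have \<mu>: "\<mu>\<^sup>2 = z" "Re \<mu> >= 0" using csqrt_principal[of z] by (auto simp: \<mu>_def)
	have "(\<mu> - of_real (pi*r)) * (\<mu> + of_real (pi*r)) = (z - of_real ((pi*r + s*\<tau>)\<^sup>2)) + of_real ((pi*r + s*\<tau>)\<^sup>2 - (pi*r)\<^sup>2)"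
		by (simp add: \<mu>(1)[symmetric] power2_eq_square algebra_simps)
	then have "norm (\<mu> - of_real (pi*r)) * norm (\<mu> + of_real (pi*r)) <= norm (z - of_real ((pi*r + s*\<tau>)\<^sup>2)) + norm (of_real ((pi*r + s*\<tau>)\<^sup>2 - (pi*r)\<^sup>2) :: complex)"
		by (metis norm_mult norm_triangle_ineq)
	also have "norm (of_real ((pi*r + s*\<tau>)\<^sup>2 - (pi*r)\<^sup>2) :: complex) <= 2 * (pi*r) * \<rho> + \<rho>*\<rho>"
	proof -
		have "(pi*r + s*\<tau>)\<^sup>2 - (pi*r)\<^sup>2 = 2 * (pi*r) * (s*\<tau>) + (s*\<tau>) * (s*\<tau>)" by (simp add: power2_eq_square algebra_simps)
		also have "\<bar>\<dots>\<bar> <= 2 * (pi*r) * \<bar>s * \<tau>\<bar> + \<bar>s * \<tau>\<bar> * \<bar>s * \<tau>\<bar>" using r by (intro order_trans[OF abs_triangle_ineq]) (simp add: abs_mult)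
		also have "\<bar>s * \<tau>\<bar> = \<tau>" using s t by (simp add: abs_mult)
		also have "2 * (pi*r) * \<tau> + \<tau>*\<tau> <= 2 * (pi*r) * \<rho> + \<rho>*\<rho>" using t r by (intro add_mono mult_mono mult_nonneg_nonneg) auto
		finally show ?thesis unfolding norm_of_real .
	qed
	also have "norm (z - of_real ((pi*r + s*\<tau>)\<^sup>2)) <= 15/2 * (pi*r) * \<rho>" using z by (simp add: r_def mult.assoc)
	finally have "norm (\<mu> - of_real (pi*r)) * norm (\<mu> + of_real (pi*r)) <= 15/2 * (pi*r) * \<rho> + (2 * (pi*r) * \<rho> + \<rho>*\<rho>)" by simp
	also have "\<dots> <= 10*\<rho> * (pi*r)"
	proof -
		have "\<rho>*\<rho> <= (1/2 * (pi*r)) * \<rho>" using pr \<rho> by (intro mult_right_mono) auto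
		then show ?thesis by (simp add: algebra_simps)
	qed
	also have "\<dots> <= 10*\<rho> * norm (\<mu> + of_real (pi*r))"
	proof (intro mult_left_mono)
		show "pi*r <= norm (\<mu> + of_real (pi*r))" using complex_Re_le_cmod[of "\<mu> + of_real (pi*r)"] \<mu>(2) by simp
	qed (use \<rho> in simp)
	finally have "norm (\<mu> - of_real (pi*r)) * norm (\<mu> + of_real (pi*r)) <= 10*\<rho> * norm (\<mu> + of_real (pi*r))" .
	moreover have "0 < norm (\<mu> + of_real (pi*r))"
	proof -
		have "0 < Re (\<mu> + of_real (pi*r))" using \<mu>(2) pr by simp
		then show ?thesis using complex_Re_le_cmod[of "\<mu> + of_real (pi*r)"] by linarith
	qed
	ultimately have "norm (\<mu> - of_real (pi*r)) <= 10*\<rho>" by (rule mult_right_le_imp_le)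
	then show ?thesis by (simp add: r_def \<mu>_def)
qed

context hill_L1
begin

lemma hill_near_cos:
	"\<exists>(M::real) C. M >= 2 \<and> C >= 1 \<and> (\<forall>m \<mu>. of_int m >= M \<and> near_pi m \<mu> -->
		 norm (cos (pim m) * hill q (\<mu>\<^sup>2) - 2 * cos (\<mu> - pim m)) <= C / (of_int m)\<^sup>2)"
proof -
	obtain M0 :: real and C0 where M0: "M0 >= 2" and C0: "C0 >= 1" and asy: "\<forall>m \<mu>. of_int m >= M0 \<and> near_pi m \<mu> -->
		 norm (n11 \<mu> - exp (\<i>*\<mu>)) <= C0 / (of_int m)\<^sup>2 \<and> norm (n11 (- \<mu>) - exp (\<i> * (- \<mu>))) <= C0 / (of_int m)\<^sup>2"
		using strip_near by blast
	have main: "norm (cos (pim m) * hill q (\<mu>\<^sup>2) - 2 * cos (\<mu> - pim m)) <= 2*C0 / (of_int m)\<^sup>2"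
		if m: "of_int m >= M0" and near: "near_pi m \<mu>" for m \<mu>
	proof -
		define \<kappa> where "\<kappa> = cos (pim m :: complex)"
		have \<kappa>: "norm \<kappa> = 1" "\<kappa>*\<kappa> = 1" by (simp_all add: \<kappa>_def cos_pi_int)
		have n: "1 <= norm \<mu>" using near_pi_int(1)[OF _ near] m M0 by linarith
		have c: "cos \<mu> = \<kappa> * cos (\<mu> - pim m)"
			using cos_add[of "pim m" "\<mu> - pim m"] by (simp add: \<kappa>_def sin_pi_int)
		have ce: "2 * cos \<mu> = exp (\<i>*\<mu>) + exp (\<i> * (- \<mu>))" by (simp add: cos_exp_eq)
		have h: "hill q (\<mu>\<^sup>2) = n11 \<mu> + n11 (- \<mu>)" using triv.hill_eq(1)[of \<mu>] n by simp
		have "2 * cos (\<mu> - pim m) = \<kappa> * (2 * cos \<mu>)" unfolding c using \<kappa>(2)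
			by (simp add: mult.left_commute[of \<kappa>] mult.assoc[symmetric])
		then have "\<kappa> * hill q (\<mu>\<^sup>2) - 2 * cos (\<mu> - pim m) = \<kappa> * ((n11 \<mu> - exp (\<i>*\<mu>)) + (n11 (- \<mu>) - exp (\<i> * (- \<mu>))))"
			unfolding h ce by (simp add: algebra_simps)
		then have "norm (\<kappa> * hill q (\<mu>\<^sup>2) - 2 * cos (\<mu> - pim m)) = norm ((n11 \<mu> - exp (\<i>*\<mu>)) + (n11 (- \<mu>) - exp (\<i> * (- \<mu>))))"
			by (simp add: norm_mult \<kappa>)
		also have "\<dots> <= C0 / (of_int m)\<^sup>2 + C0 / (of_int m)\<^sup>2" using asy m near by (intro norm_triangle_mono) blast+
		finally show ?thesis by (simp add: \<kappa>_def)
	qed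
	show ?thesis using main M0 C0 by (intro exI[of _ "2*C0"] exI[of _ M0] conjI allI impI) auto
qed

context
	fixes \<epsilon> B :: real and N0 :: int
	assumes ep: "\<epsilon> > 0" and B: "B > 0"
		and cond: "balanced_coefs q \<epsilon> B N0"
begin

text \<open>The radius ranges over a window because 15 \<pi> n \<rho> equals 15/2 \<pi> m \<rho> for
  m = 2n but is slightly smaller for m = 2n + 1. With \<eta> = csqrt z - \<pi> m, the function
  (-1)^m \<open>hill\<close> - 2 cos \<tau> is close to -(\<eta>^2 - \<tau>^2), hence to the
  quadratic in z with zeros (\<pi> m +- \<tau>)^2 used as comparison function.\<close>

lemma localisation:
	assumes \<rho>: "0 < \<rho>" "\<rho> <= 1/80"
		and simp: "nondegenerate q R"
	shows "\<exists>(M::real) K. \<forall>m \<tau> s Rd. of_int m >= M \<and> 0 <= \<tau> \<and> \<tau> <= \<rho> \<and> \<bar>s\<bar> = 1 \<and> 7*pi * of_int m * \<rho> <= Rd \<and> Rd <= 15/2*pi * of_int m * \<rho> -->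
		disc_roots K m \<tau> s Rd"
proof -
	obtain M1 :: real and C where M1: "M1 >= 2" and C: "C >= 1" and hc: "\<forall>m \<mu>. of_int m >= M1 \<and> near_pi m \<mu> -->
		 norm (cos (pim m) * hill q (\<mu>\<^sup>2) - 2 * cos (\<mu> - pim m)) <= C / (of_int m)\<^sup>2"
		using hill_near_cos by blast
	obtain M2 :: real and C2 where C2: "C2 >= 1" "M2 >= 1" and pair: "\<forall>m \<tau> \<mu>1 \<mu>2. of_int m >= M2 \<and> 0 <= \<tau> \<and> \<tau> <= 1/8 \<and> near_pi m \<mu>1 \<and>
			near_pi m \<mu>2 \<and>
			floq_root q \<tau> \<mu>1 \<and> floq_root q \<tau> \<mu>2 \<and> \<mu>1 \<noteq> \<mu>2 -->
			norm (\<mu>1 - pim m + w0 m \<tau>) <= C2 / (of_int m)\<^sup>2 \<and> norm (\<mu>2 - pim m - w0 m \<tau>) <= C2 / (of_int m)\<^sup>2 \<or>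
			norm (\<mu>2 - pim m + w0 m \<tau>) <= C2 / (of_int m)\<^sup>2 \<and> norm (\<mu>1 - pim m - w0 m \<tau>) <= C2 / (of_int m)\<^sup>2"
		using root_pair[OF ep B cond] by blast
	define M where "M = max (max M1 M2) (max R (C/\<rho>))"
	define K where "K = 7*C2 + 2*C"
	have main: "disc_roots K m \<tau> s Rd"
		if mM: "of_int m >= M" and t: "0 <= \<tau>" "\<tau> <= \<rho>" and s: "\<bar>s\<bar> = 1" and Rd: "7*pi * of_int m * \<rho> <= Rd" "Rd <= 15/2*pi * of_int m * \<rho>"
		for m \<tau> s Rd
	proof -
		define r where "r = real_of_int m"
		have r: "r >= M1" "r >= M2" "r >= R" "C/\<rho> <= r" "r >= 2" using mM M1 by (auto simp: M_def r_def)
		have pr: "pi*r >= 6" using mult_mono[of 3 pi 2 r] pi_gt3 r by auto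
		define \<kappa> where "\<kappa> = cos (pim m :: complex)"
		have \<kappa>: "norm \<kappa> = 1" "\<kappa>*\<kappa> = 1" by (simp_all add: \<kappa>_def cos_pi_int)
		have \<kappa>0: "\<kappa> \<noteq> 0" using \<kappa>(1) by auto
		define c0 :: complex where "c0 = of_real ((pi*r + s*\<tau>)\<^sup>2)"
		define l1 l2 :: complex where "l1 = of_real ((pi*r + \<tau>)\<^sup>2)" and "l2 = of_real ((pi*r - \<tau>)\<^sup>2)"
		define h :: complex where "h = of_real (2*pi*r)"
		have nh: "norm h = 2 * (pi*r)" unfolding h_def norm_of_real using r by (simp add: abs_mult)
		have h0: "h \<noteq> 0" using nh pr by auto
		\<comment> \<open>Near (\<pi> m)^2 one has z - (\<pi> m)^2 = h \<eta> + \<eta>^2, so this leading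
		  coefficient makes the quadratic in z match -(\<eta>^2 - \<tau>^2).\<close>
		define a where "a = - (1/h\<^sup>2)"
		have a: "a \<noteq> 0" using h0 by (simp add: a_def)
		define F where "F z = \<kappa> * hill q z - 2 * cos (of_real \<tau>)" for z
		define f where "f z = a * (z - l1) * (z - l2)" for z
		have F0: "F z = 0 \<longleftrightarrow> hill q z = 2 * cos (of_real (pi * of_int m + \<tau>))" for z
		proof -
			have k: "\<kappa> * (\<kappa>*x) = x" for x by (simp add: \<kappa>(2) mult.assoc[symmetric])
			have "F z = 0 \<longleftrightarrow> \<kappa> * hill q z = \<kappa> * (\<kappa> * (2 * cos (of_real \<tau>)))" unfolding F_def k by simp
			then have "F z = 0 \<longleftrightarrow> hill q z = \<kappa> * (2 * cos (of_real \<tau>))" using \<kappa>0 by simp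
			then show ?thesis unfolding cos_pi_int_add \<kappa>_def[symmetric] by (simp add: mult.left_commute)
		qed
		have hsq: "(hill q z)\<^sup>2 = of_real ((2 * cos \<tau>)\<^sup>2)" if "F z = 0" for z
		proof -
			have "hill q z = 2 * (\<kappa> * cos (of_real \<tau>))" using that unfolding F0 cos_pi_int_add \<kappa>_def[symmetric] .
			then have "(hill q z)\<^sup>2 = (\<kappa>*\<kappa>) * (2 * cos (of_real \<tau>))\<^sup>2" by (simp add: power2_eq_square mult_ac)
			then show ?thesis unfolding \<kappa>(2) by (simp add: cos_of_real)
		qed
		have near: "norm (csqrt z - pim m) <= 1/8" "norm (csqrt z - pim m) <= 10*\<rho>" if "norm (z - c0) <= Rd" for z
		proof -
			have "norm (z - of_real ((pi * of_int m + s*\<tau>)\<^sup>2)) <= 15/2*pi * of_int m * \<rho>" using that Rd(2) by (simp add: c0_def r_def)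
			then show "norm (csqrt z - pim m) <= 10*\<rho>" using csqrt_near[OF _ \<rho> t s] r(5) by (simp add: r_def)
			then show "norm (csqrt z - pim m) <= 1/8" using \<rho> by linarith
		qed
		define \<eta> where "\<eta> z = csqrt z - pim m" for z
		define D where "D z = (\<eta> z)\<^sup>2 - of_real (\<tau>\<^sup>2)" for z
		have z_eq: "z = (of_real (pi*r) + \<eta> z)\<^sup>2" for z using power2_csqrt[of z] by (simp add: \<eta>_def r_def)
		have FD: "norm (F z + D z) <= C/r\<^sup>2 + norm (D z) / 16" if z: "norm (z - c0) <= Rd" for z
		proof -
			have "norm (\<kappa> * hill q z - 2 * cos (\<eta> z)) <= C/r\<^sup>2" using hc[rule_format, of m "csqrt z"] near(1)[OF z] r(1) by (simp add: \<kappa>_def r_def \<eta>_def)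
			moreover have "norm (2 * cos (\<eta> z) - 2 * cos (of_real \<tau>) + D z) <= norm (D z) / 16"
				unfolding D_def using near(1)[OF z] t \<rho> by (intro two_cos_diff_bound) (auto simp: \<eta>_def)
			moreover have "F z + D z = (\<kappa> * hill q z - 2 * cos (\<eta> z)) + (2 * cos (\<eta> z) - 2 * cos (of_real \<tau>) + D z)" by (simp add: F_def)
			ultimately show ?thesis by (metis norm_triangle_mono)
		qed
		have fD: "norm (f z + D z) <= norm (D z) / 16" if z: "norm (z - c0) <= Rd" for z
		proof -
			define x y where "x = (\<eta> z + of_real \<tau>) / h" and "y = (\<eta> z - of_real \<tau>) / h"
			have n\<eta>: "norm (\<eta> z) <= 1/8" using near(1)[OF z] by (simp add: \<eta>_def)
			have "norm (\<eta> z + of_real \<tau>) <= 3/10" "norm (\<eta> z - of_real \<tau>) <= 3/10"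
				using norm_triangle_ineq[of "\<eta> z" "of_real \<tau>"] norm_triangle_ineq4[of "\<eta> z" "of_real \<tau>"] n\<eta> t \<rho> by simp_all
			then have xy: "norm x <= 1/40" "norm y <= 1/40" using frac_le[of "3/10" _ 12 "norm h"] pr nh
				unfolding x_def y_def norm_divide by (auto intro!: order_trans[OF frac_le[of "3/10" _ 12 "norm h"]])
			have e: "z - l1 = (\<eta> z - of_real \<tau>) * (h * (1 + x))" "z - l2 = (\<eta> z + of_real \<tau>) * (h * (1 + y))"
			proof -
				have hX: "h * (X/h) = X" for X using h0 by simp
				have "h * (1 + x) = h + (\<eta> z + of_real \<tau>)" "h * (1 + y) = h + (\<eta> z - of_real \<tau>)" unfolding x_def y_def distrib_left mult_1_right hX by (rule refl)+
				moreover have "z - l1 = (\<eta> z - of_real \<tau>) * (h + (\<eta> z + of_real \<tau>))" "z - l2 = (\<eta> z + of_real \<tau>) * (h + (\<eta> z - of_real \<tau>))"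
					by (subst (1) z_eq[of z], simp add: l1_def l2_def h_def power2_eq_square algebra_simps)+
				ultimately show "z - l1 = (\<eta> z - of_real \<tau>) * (h * (1 + x))" "z - l2 = (\<eta> z + of_real \<tau>) * (h * (1 + y))" by simp_all
			qed
			have "f z = (a*h\<^sup>2) * ((\<eta> z - of_real \<tau>) * (\<eta> z + of_real \<tau>)) * ((1 + x) * (1 + y))" unfolding f_def e power2_eq_square by (simp only: mult_ac)
			also have "a*h\<^sup>2 = - 1" using h0 by (simp add: a_def)
			also have "(\<eta> z - of_real \<tau>) * (\<eta> z + of_real \<tau>) = D z" by (simp add: D_def power2_eq_square algebra_simps)
			finally have fz: "f z = - 1 * D z * ((1 + x) * (1 + y))" .
			have "f z + D z = - (D z * (x + y + x*y))" unfolding fz by (simp add: algebra_simps)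
			then have "norm (f z + D z) = norm (D z) * norm (x + y + x*y)" by (simp add: norm_mult)
			also have "\<dots> <= norm (D z) * (1/40 + 1/40 + (1/40) * (1/40))"
			proof (intro mult_left_mono)
				have "norm x * norm y <= (1/40) * (1/40)" using xy by (intro mult_mono) auto
				then show "norm (x + y + x*y) <= 1/40 + 1/40 + (1/40) * (1/40)" by (intro norm_triangle_mono xy) (simp add: norm_mult)
			qed simp
			also have "\<dots> <= norm (D z) / 16" by simp
			finally show ?thesis .
		qed
		have Ff: "norm (F z - f z) <= C/r\<^sup>2 + norm (f z) / 4" if z: "norm (z - c0) <= Rd" for z
		proof -
			have "norm (D z) <= norm (f z) + norm (f z + D z)" using norm_triangle_ineq4[of "f z + D z" "f z"] by simp
			then have "norm (D z) <= 2 * norm (f z)" using fD[OF z] norm_ge_zero[of "D z"] norm_ge_zero[of "f z"] by linarith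
			moreover have "norm (F z - f z) <= norm (F z + D z) + norm (f z + D z)" using norm_triangle_ineq4[of "F z + D z" "f z + D z"] by simp
			ultimately show ?thesis using FD[OF z] fD[OF z] by linarith
		qed
		\<comment> \<open>One of the two model zeros is the centre itself; the other is at distance 4
		  \<pi> r \<tau>.\<close>
		have dist: "norm (l1 - c0) <= 4 * (pi*r) * \<rho>" "norm (l2 - c0) <= 4 * (pi*r) * \<rho>"
		proof -
			have b: "4 * (pi*r) * \<tau> <= 4 * (pi*r) * \<rho>" using t r by (intro mult_left_mono) auto
			have b0: "0 <= 4 * (pi*r) * \<tau>" using t r by (intro mult_nonneg_nonneg) auto
			have zb: "0 <= 4 * (pi*r) * \<rho>" using b b0 by linarith
			have eq: "(pi*r + \<tau>)\<^sup>2 - (pi*r - \<tau>)\<^sup>2 = 4 * (pi*r) * \<tau>" by (simp add: power2_eq_square algebra_simps)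
			have n: "norm (l1 - l2) = 4 * (pi*r) * \<tau>" "norm (l2 - l1) = 4 * (pi*r) * \<tau>"
				unfolding l1_def l2_def of_real_diff[symmetric] norm_of_real using eq b0 by linarith+
			have "s = 1 \<or> s = - 1" using s by linarith
			then have "c0 = l1 \<or> c0 = l2" by (auto simp: c0_def l1_def l2_def)
			then show "norm (l1 - c0) <= 4 * (pi*r) * \<rho>" "norm (l2 - c0) <= 4 * (pi*r) * \<rho>" using zb by (elim disjE; simp only: n zb b diff_self norm_zero)+
		qed
		have Rd': "7 * (pi*r) * \<rho> <= Rd" using Rd(1) by (simp add: r_def mult.assoc)
		have p\<rho>: "(pi*r) * \<rho> > 0" using r by (intro mult_pos_pos \<rho>) auto
		\<comment> \<open>A circle of radius at least 7 \<pi> r \<rho> stays 3 \<pi> r \<rho> away from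
		  both model zeros; dividing the product by (2 \<pi> r)^2 leaves 9/4 \<rho>^2.\<close>
		have lb: "2*\<rho>\<^sup>2 <= norm (f z)" if z: "norm (z - c0) = Rd" for z
		proof -
			have "3 * (pi*r) * \<rho> <= norm (z - l1)" "3 * (pi*r) * \<rho> <= norm (z - l2)"
				using norm_triangle_ineq[of "z - l1" "l1 - c0"] norm_triangle_ineq[of "z - l2" "l2 - c0"] dist Rd' p\<rho> z by auto
			then have "(3 * (pi*r) * \<rho>) * (3 * (pi*r) * \<rho>) <= norm (z - l1) * norm (z - l2)" using p\<rho> by (intro mult_mono) (linarith | simp)+
			then have "(3 * (pi*r) * \<rho>) * (3 * (pi*r) * \<rho>) / (2 * (pi*r))\<^sup>2 <= norm (z - l1) * norm (z - l2) / (norm h)\<^sup>2" unfolding nh by (intro divide_right_mono) auto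
			also have "\<dots> = norm (f z)" by (simp add: f_def a_def norm_mult norm_divide norm_power)
			also have "(3 * (pi*r) * \<rho>) * (3 * (pi*r) * \<rho>) / (2 * (pi*r))\<^sup>2 = 9/4*\<rho>\<^sup>2" using r by (simp add: power2_eq_square)
			finally have "9/4*\<rho>\<^sup>2 <= norm (f z)" .
			then show ?thesis using zero_le_power2[of \<rho>] by linarith
		qed
		have Cr: "C/r\<^sup>2 <= \<rho>\<^sup>2"
		proof -
			have "C <= r*\<rho>" using r(4) \<rho> by (simp add: pos_divide_le_eq)
			moreover have "C <= C*C" using C mult_left_mono[of 1 C C] by simp
			moreover have "C*C <= (r*\<rho>) * (r*\<rho>)" using \<open>C <= r * \<rho>\<close> C by (intro mult_mono) auto
			ultimately have "C <= r\<^sup>2*\<rho>\<^sup>2" by (simp add: power2_eq_square mult_ac)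
			then show ?thesis using r by (simp add: pos_divide_le_eq mult.commute)
		qed
		have \<rho>2: "\<rho>\<^sup>2 > 0" using \<rho> by simp
		have close: "norm (F z - f z) < norm (f z)" if z: "norm (z - c0) = Rd" for z
		proof -
			have "norm (F z - f z) <= C/r\<^sup>2 + norm (f z) / 4" using Ff z by simp
			then show ?thesis using lb[OF z] Cr \<rho>2 by linarith
		qed
		have part1: "F z \<noteq> 0" if "norm (z - c0) = Rd" for z using close[OF that] by auto
		have holF: "F holomorphic_on UNIV" unfolding F_def[abs_def] by (intro holomorphic_intros hill_holomorphic q_int)
		\<comment> \<open>\<open>nondegenerate\<close> applies to csqrt z, which lies near \<pi> m in the
		  right half-plane.\<close>
		have simple: "deriv F z \<noteq> 0" if z: "z \<in> ball c0 Rd" "F z = 0" for z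
		proof -
			have zz: "norm (z - c0) <= Rd" using z by (simp add: dist_norm norm_minus_commute)
			have "2 <= real_of_int m" using r by (simp add: r_def)
			note np = near_pi_int[OF this near(1)[OF zz]]
			have "R <= norm (csqrt z)" using np(1) r(3,5) by (simp add: r_def)
			then have d: "deriv (hill q) z \<noteq> 0" using simp[rule_format, of "csqrt z" "pi * of_int m + \<tau>"] np z(2) unfolding F0 power2_csqrt by blast
			have "hill q holomorphic_on UNIV" by (rule hill_holomorphic[OF q_int])
			then have "hill q field_differentiable at z" by (simp add: holomorphic_on_imp_differentiable_at)
			then have "(hill q has_field_derivative deriv (hill q) z) (at z)" by (rule field_differentiable_derivI)
			then have "(F has_field_derivative \<kappa> * deriv (hill q) z) (at z)" unfolding F_def[abs_def] by (auto intro!: derivative_eq_intros)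
			then show ?thesis using d \<kappa>0 by (metis DERIV_imp_deriv mult_eq_0_iff)
		qed
		have lin: "l1 \<in> ball c0 Rd" "l2 \<in> ball c0 Rd" using dist Rd' p\<rho> by (auto simp: dist_norm norm_minus_commute)
		obtain z1 z2 where ne: "z1 \<noteq> z2" and Z: "{z. F z = 0 \<and> norm (z - c0) < Rd} = {z1, z2}"
			using two_zeros_in_ball[OF holF a lin close[unfolded f_def] simple] by blast
		have zz: "F z1 = 0" "norm (z1 - c0) <= Rd" "F z2 = 0" "norm (z2 - c0) <= Rd"
		proof -
			have "z1 \<in> {z. F z = 0 \<and> norm (z - c0) < Rd}" "z2 \<in> {z. F z = 0 \<and> norm (z - c0) < Rd}" unfolding Z by auto
			then show "F z1 = 0" "norm (z1 - c0) <= Rd" "F z2 = 0" "norm (z2 - c0) <= Rd" by auto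
		qed
		have est: "norm (z - (of_real ((pi*r)\<^sup>2 + \<tau>\<^sup>2) + h*w)) <= K/r"
			if z: "F z = 0" "norm (z - c0) <= Rd" and w: "norm (\<eta> z - w) <= C2/r\<^sup>2" for z w
		proof -
			have "norm (D z) <= C/r\<^sup>2 + norm (D z) / 16" using FD[OF z(2)] z(1) by simp
			moreover have "C/r\<^sup>2 <= C/r" using r C by (intro divide_left_mono) (auto simp: power2_eq_square)
			ultimately have Dz: "norm (D z) <= 2*C/r" using norm_ge_zero[of "D z"] by linarith
			have "z - (of_real ((pi*r)\<^sup>2 + \<tau>\<^sup>2) + h*w) = h * (\<eta> z - w) + D z"
				by (subst (1) z_eq[of z]) (simp add: D_def h_def power2_eq_square algebra_simps)
			then have "norm (z - (of_real ((pi*r)\<^sup>2 + \<tau>\<^sup>2) + h*w)) <= norm h * norm (\<eta> z - w) + norm (D z)" by (metis norm_mult norm_triangle_ineq)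
			also have "norm h * norm (\<eta> z - w) <= (7*r) * (C2/r\<^sup>2)"
			proof (intro mult_mono)
				have "2*pi*r <= 7*r" using r pi_approx by (intro mult_right_mono) auto
				then show "norm h <= 7*r" by (simp add: nh)
			qed (use w r in auto)
			also have "(7*r) * (C2/r\<^sup>2) = 7*C2/r" using r by (simp add: power2_eq_square)
			finally show ?thesis using Dz by (simp add: K_def add_divide_distrib)
		qed
		have hw: "h * w0 m \<tau> = csqrt (of_real ((2*pi * of_int m * \<tau>)\<^sup>2) + ZZ m)"
			using h0 unfolding w0_def h_def r_def by simp
		have est': "norm (z - (of_real ((pi * of_int m)\<^sup>2 + \<tau>\<^sup>2) + csqrt (of_real ((2*pi * of_int m * \<tau>)\<^sup>2) + ZZ m))) <= K / of_int m"
			if "F z = 0" "norm (z - c0) <= Rd" "norm (\<eta> z - w0 m \<tau>) <= C2/r\<^sup>2" for z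
			using est[OF that] unfolding hw r_def .
		have est'': "norm (z - (of_real ((pi * of_int m)\<^sup>2 + \<tau>\<^sup>2) - csqrt (of_real ((2*pi * of_int m * \<tau>)\<^sup>2) + ZZ m))) <= K / of_int m"
			if "F z = 0" "norm (z - c0) <= Rd" "norm (\<eta> z + w0 m \<tau>) <= C2/r\<^sup>2" for z
		proof -
			have "norm (\<eta> z - (- w0 m \<tau>)) <= C2/r\<^sup>2" using that(3) by simp
			from est[OF that(1,2) this] show ?thesis unfolding mult_minus_right hw r_def by simp
		qed
		have "csqrt z1 \<noteq> csqrt z2" using ne by (metis power2_csqrt)
		then have "norm (\<eta> z1 + w0 m \<tau>) <= C2/r\<^sup>2 \<and> norm (\<eta> z2 - w0 m \<tau>) <= C2/r\<^sup>2 \<or>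
			norm (\<eta> z2 + w0 m \<tau>) <= C2/r\<^sup>2 \<and> norm (\<eta> z1 - w0 m \<tau>) <= C2/r\<^sup>2"
			using pair[rule_format, of m \<tau> "csqrt z1" "csqrt z2"] near(1)[OF zz(2)] near(1)[OF zz(4)] hsq[OF zz(1)] hsq[OF zz(3)] t \<rho> r(2)
			unfolding \<eta>_def r_def power2_csqrt by auto
		then have "\<exists>z1 z2. z1 \<noteq> z2 \<and> {z. F z = 0 \<and> norm (z - c0) < Rd} = {z1, z2} \<and>
			norm (z1 - (of_real ((pi * of_int m)\<^sup>2 + \<tau>\<^sup>2) - csqrt (of_real ((2*pi * of_int m * \<tau>)\<^sup>2) + ZZ m))) <= K / of_int m \<and>
			norm (z2 - (of_real ((pi * of_int m)\<^sup>2 + \<tau>\<^sup>2) + csqrt (of_real ((2*pi * of_int m * \<tau>)\<^sup>2) + ZZ m))) <= K / of_int m"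
		proof
			assume w: "norm (\<eta> z1 + w0 m \<tau>) <= C2/r\<^sup>2 \<and> norm (\<eta> z2 - w0 m \<tau>) <= C2/r\<^sup>2"
			show ?thesis
				by (rule exI[of _ z1], rule exI[of _ z2], intro conjI ne Z est''[OF zz(1,2)] est'[OF zz(3,4)] conjunct1[OF w] conjunct2[OF w])
		next
			assume w: "norm (\<eta> z2 + w0 m \<tau>) <= C2/r\<^sup>2 \<and> norm (\<eta> z1 - w0 m \<tau>) <= C2/r\<^sup>2"
			have Z': "{z. F z = 0 \<and> norm (z - c0) < Rd} = {z2, z1}" unfolding Z by (rule insert_commute)
			show ?thesis
				by (rule exI[of _ z2], rule exI[of _ z1], intro conjI ne[symmetric] Z' est''[OF zz(3,4)] est'[OF zz(1,2)] conjunct1[OF w] conjunct2[OF w])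
		qed
		moreover have "\<forall>z. norm (z - c0) = Rd --> F z \<noteq> 0" using part1 by blast
		ultimately show ?thesis unfolding F0 c0_def r_def by (rule conjI[rotated])
	qed
	show ?thesis
	proof (rule exI[of _ M], rule exI[of _ K], intro allI impI)
		fix m :: int and \<tau> s Rd :: real
		assume a: "M <= of_int m \<and> 0 <= \<tau> \<and> \<tau> <= \<rho> \<and> \<bar>s\<bar> = 1 \<and> 7*pi * of_int m * \<rho> <= Rd \<and> Rd <= 15/2*pi * of_int m * \<rho>"
		from a show "disc_roots K m \<tau> s Rd"
			by (elim conjE) (rule main)
	qed
qed

end

end

section \<open>Eigenfunctions away from the resonances\<close>

lemma csqrt_near_real:
	fixes l :: complex and \<nu> x M0 :: real
	assumes x: "x >= 1" and nu: "3*x <= \<bar>\<nu>\<bar>" and l: "norm (l - of_real (\<nu>\<^sup>2)) <= M0 * ln x / x"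
	shows "norm (csqrt l - of_real \<bar>\<nu>\<bar>) <= \<bar>M0\<bar> / x"
proof -
	define \<mu> where "\<mu> = csqrt l"
	have \<mu>: "\<mu>\<^sup>2 = l" "Re \<mu> >= 0" using csqrt_principal[of l] by (auto simp: \<mu>_def)
	have "(\<mu> - of_real \<bar>\<nu>\<bar>) * (\<mu> + of_real \<bar>\<nu>\<bar>) = \<mu>\<^sup>2 - (of_real \<bar>\<nu>\<bar>)\<^sup>2" by (simp add: power2_eq_square algebra_simps)
	also have "\<dots> = l - of_real (\<nu>\<^sup>2)" unfolding \<mu>(1) of_real_power[symmetric] power2_abs ..
	finally have "norm (\<mu> - of_real \<bar>\<nu>\<bar>) * norm (\<mu> + of_real \<bar>\<nu>\<bar>) = norm (l - of_real (\<nu>\<^sup>2))" by (metis norm_mult)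
	also have "\<dots> <= \<bar>M0\<bar>"
	proof -
		have "ln x <= x" using ln_bound[of x] x by simp
		then have q: "0 <= ln x / x" "ln x / x <= 1" using x by (auto simp: divide_le_eq)
		have "M0 * ln x / x = M0 * (ln x / x)" by simp
		also have "\<dots> <= \<bar>M0\<bar> * 1" using q by (intro mult_mono) auto
		finally show ?thesis using l by simp
	qed
	finally have 1: "norm (\<mu> - of_real \<bar>\<nu>\<bar>) * norm (\<mu> + of_real \<bar>\<nu>\<bar>) <= \<bar>M0\<bar>" .
	have "x <= norm (\<mu> + of_real \<bar>\<nu>\<bar>)" using complex_Re_le_cmod[of "\<mu> + of_real \<bar>\<nu>\<bar>"] \<mu>(2) nu x by simp
	then have "norm (\<mu> - of_real \<bar>\<nu>\<bar>) * x <= norm (\<mu> - of_real \<bar>\<nu>\<bar>) * norm (\<mu> + of_real \<bar>\<nu>\<bar>)" by (intro mult_left_mono) auto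
	then have "norm (\<mu> - of_real \<bar>\<nu>\<bar>) * x <= \<bar>M0\<bar>" using 1 by linarith
	then show ?thesis using x by (simp add: \<mu>_def pos_le_divide_eq)
qed

lemma abs_two_pi_int_add:
	assumes "\<bar>n\<bar> >= 1" "0 <= t" "t <= pi"
	shows "3 * real_of_int \<bar>n\<bar> <= \<bar>2*pi * of_int n + t\<bar>"
proof -
	have n: "real_of_int \<bar>n\<bar> >= 1" using assms(1) by linarith
	have "\<bar>2*pi * of_int n\<bar> = 2*pi * real_of_int \<bar>n\<bar>" by (simp add: abs_mult)
	moreover have "pi*1 <= pi * real_of_int \<bar>n\<bar>" using n by (intro mult_left_mono) auto
	moreover have "3 * real_of_int \<bar>n\<bar> <= pi * real_of_int \<bar>n\<bar>" using n pi_gt3 by (intro mult_right_mono) auto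
	ultimately show ?thesis using assms(2,3) by linarith
qed

text \<open>The mean-square norm N differs from 1 by at most \<delta>. Dividing by it moves the
  function by at most (3/2) \<delta> / (1/2) = 3\<delta>, and the original error adds one more
  \<delta>.\<close>

lemma normalise_near_unimodular:
	fixes \<Phi> E :: "real => complex"
	assumes c: "continuous_on {0..1} \<Phi>" and E: "\<And>x. x \<in> {0..1} ==> norm (E x) = 1"
		and near: "\<And>x. x \<in> {0..1} ==> norm (\<Phi> x - E x) <= \<delta>" and \<delta>: "\<delta> <= 1/2"
	obtains N :: real where "N > 0" "integral {0..1} (\<lambda>x. (norm (\<Phi> x / of_real N))\<^sup>2) = 1"
		"\<And>x. x \<in> {0..1} ==> norm (\<Phi> x / of_real N - E x) <= 4*\<delta>"
proof -
	have \<delta>0: "\<delta> >= 0" using order_trans[OF norm_ge_zero near[of 0]] by simp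
	have b: "1 - \<delta> <= norm (\<Phi> x)" "norm (\<Phi> x) <= 1 + \<delta>" if x: "x \<in> {0..1}" for x
		using near[OF x] E[OF x] norm_triangle_ineq2[of "\<Phi> x" "E x"] norm_triangle_ineq2[of "E x" "\<Phi> x"] norm_minus_commute[of "\<Phi> x" "E x"] by linarith+
	have i: "(\<lambda>x. (norm (\<Phi> x))\<^sup>2) integrable_on {0..1}"
		by (intro integrable_continuous_real continuous_intros c)
	define I where "I = integral {0..1} (\<lambda>x. (norm (\<Phi> x))\<^sup>2)"
	have "integral {0..1} (\<lambda>x::real. (1 - \<delta>)\<^sup>2) <= I" unfolding I_def
		by (rule integral_le[OF integrable_const_ivl i]) (use b \<delta> in \<open>auto intro!: power_mono\<close>)
	then have I1: "(1 - \<delta>)\<^sup>2 <= I" by simp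
	have "I <= integral {0..1} (\<lambda>x::real. (1 + \<delta>)\<^sup>2)" unfolding I_def
		by (rule integral_le[OF i integrable_const_ivl]) (use b \<delta> in \<open>auto intro!: power_mono\<close>)
	then have I2: "I <= (1 + \<delta>)\<^sup>2" by simp
	define N where "N = sqrt I"
	have N1: "1 - \<delta> <= N" unfolding N_def by (rule real_le_rsqrt[OF I1])
	have N2: "N <= 1 + \<delta>" unfolding N_def using I2 \<delta>0 by (intro real_le_lsqrt) auto
	have N0: "N >= 1/2" using N1 \<delta> by linarith
	have NI: "N\<^sup>2 = I" unfolding N_def using I1 zero_le_power2[of "1 - \<delta>"] by (intro real_sqrt_pow2) linarith
	show ?thesis
	proof (rule that[of N])
		show "N > 0" using N0 by simp
		have "integral {0..1} (\<lambda>x. (norm (\<Phi> x / of_real N))\<^sup>2) = integral {0..1} (\<lambda>x. (norm (\<Phi> x))\<^sup>2 / I)"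
			using N0 by (simp add: norm_divide power_divide NI)
		also have "\<dots> = I/I" unfolding I_def by (rule integral_divide)
		also have "\<dots> = 1"
		proof -
			have "I \<noteq> 0" using NI N0 by auto
			then show ?thesis by simp
		qed
		finally show "integral {0..1} (\<lambda>x. (norm (\<Phi> x / of_real N))\<^sup>2) = 1" .
		fix x :: real assume x: "x \<in> {0..1}"
		have "\<Phi> x / of_real N - \<Phi> x = \<Phi> x * of_real ((1 - N) / N)" using N0 by (simp add: field_simps)
		then have "norm (\<Phi> x / of_real N - \<Phi> x) = norm (\<Phi> x) * (\<bar>1 - N\<bar> / N)" using N0 by (simp only: norm_mult norm_of_real abs_divide)
		also have "\<dots> <= (3/2) * (\<delta> / (1/2))"
		proof (intro mult_mono frac_le)
			show "norm (\<Phi> x) <= 3/2" using b(2)[OF x] \<delta> by linarith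
			show "\<bar>1 - N\<bar> <= \<delta>" using N1 N2 by linarith
		qed (use N0 \<delta>0 in auto)
		finally have "norm (\<Phi> x / of_real N - \<Phi> x) <= 3*\<delta>" by simp
		moreover have "norm (\<Phi> x / of_real N - E x) <= norm (\<Phi> x / of_real N - \<Phi> x) + norm (\<Phi> x - E x)"
			using norm_triangle_ineq[of "\<Phi> x / of_real N - \<Phi> x" "\<Phi> x - E x"] by simp
		ultimately show "norm (\<Phi> x / of_real N - E x) <= 4*\<delta>" using near[OF x] by linarith
	qed
qed

context hill_L1
begin

text \<open>The Floquet condition multiplies the amplitude G of e^(-i\<mu>x) by e^(i(t+\<mu>)) over
  the period, while the equation lets it change only by O(1/\<mu>). As this multiplier is at least
  \<open>g\<close> away from 1, the amplitude must be small compared with that of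
  e^(i\<mu>x).\<close>

lemma floquet_solution_near_exp:
	assumes mu: "1 + 4 * ((1 + exp 5) * triv.mass) <= norm \<mu>" "\<bar>Im \<mu>\<bar> <= 1"
		and y: "floq_sol q t (\<mu>\<^sup>2) (\<lambda>_. 0) y y1" and nz: "\<exists>x\<in>{0..1}. y x \<noteq> 0"
		and g: "0 < g" "g <= norm (exp (\<i> * (of_real t + \<mu>)) - 1)" and small: "4 * ((1 + exp 5) * triv.mass) / norm \<mu> <= g"
	obtains a where "a \<noteq> 0" "\<And>x. x \<in> {0..1} ==> norm (2*\<i>*\<mu>/a * y x - exp (\<i>*\<mu> * of_real x)) <= 12 * ((1 + exp 5) * triv.mass) * (1 + 1/g) / norm \<mu>"
proof -
	define \<rho> where "\<rho> = (1 + exp 5) * triv.mass / norm \<mu>"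
	have ms: "(1 + exp 5) * triv.mass >= 0" using triv.mass_nonneg by simp
	have \<rho>: "\<rho> >= 0" using ms by (simp add: \<rho>_def)
	have mu1: "1 + 0 <= norm \<mu>" "\<mu> \<noteq> 0" using mu(1) ms by auto
	have sy: "sol (\<lambda>x. q x - \<mu>\<^sup>2) (\<lambda>_. 0) y y1" and b1: "y 1 = exp (\<i> * of_real t) * y 0" and b2: "y1 1 = exp (\<i> * of_real t) * y1 0"
		using y unfolding floq_sol_iff[OF q_int continuous_on_const] by blast+
	define P G where "P x = (y1 x - triv.sg (- \<mu>) x * y x) * triv.ff (- \<mu>) x" and "G x = (triv.sg \<mu> x * y x - y1 x) * triv.ff \<mu> x" for x
	have acP: "ac P (\<lambda>x. - (triv.rr (- \<mu>) x / triv.w \<mu> x) * (P x + triv.kap \<mu> x * G x))" unfolding P_def[abs_def] G_def[abs_def] by (rule triv.gauge_sol_P[OF mu1(1) sy])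
	have acG: "ac G (\<lambda>x. (triv.rr \<mu> x / triv.w \<mu> x) * (P x / triv.kap \<mu> x + G x))" unfolding P_def[abs_def] G_def[abs_def] by (rule triv.gauge_sol_G[OF mu1(1) sy])
	have Px: "P x = (y1 x + \<i>*\<mu> * y x) * exp (- (\<i>*\<mu> * of_real x))" if "x \<in> {0..1}" for x
		using triv_ff[OF that, of "- \<mu>"] by (simp add: P_def triv_simps)
	have Gx: "G x = (\<i>*\<mu> * y x - y1 x) * exp (\<i>*\<mu> * of_real x)" if "x \<in> {0..1}" for x
		using triv_ff[OF that, of "\<mu>"] by (simp add: G_def triv_simps)
	define a b where "a = y1 0 + \<i>*\<mu> * y 0" and "b = \<i>*\<mu> * y 0 - y1 0"
	have P0: "P 0 = a" "G 0 = b" using Px[of 0] Gx[of 0] by (simp_all add: a_def b_def)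
	have G1: "G 1 = exp (\<i> * (of_real t + \<mu>)) * b"
		using Gx[of 1] by (simp add: b_def b1 b2 distrib_left exp_add algebra_simps)
	define M where "M = max (norm a) (norm b)"
	have rt: "triv.rate \<mu> <= 1/4" using triv.rate_small[of \<mu>] mu(1) by simp
	have rle: "triv.rate \<mu> <= \<rho>" using triv.rate_le[OF mu1(1)] by (simp add: \<rho>_def)
	have M0: "M >= 0" by (simp add: M_def le_max_iff_disj)
	have B: "norm (P x - a) <= 2*M*\<rho>" "norm (G x - b) <= 2*M*\<rho>" if x: "x \<in> {0..1}" for x
	proof -
		have "\<bar>Im \<mu>\<bar> <= 2" using mu(2) by simp
		moreover have "norm (P 0) <= M" "norm (G 0) <= M" by (simp_all add: P0 M_def)
		ultimately have "norm (P x - P 0) <= 2*M * triv.rate \<mu>" "norm (G x - G 0) <= 2*M * triv.rate \<mu>"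
			using triv.PG_bound(3,4)[OF mu1(1) _ rt acP acG _ _ x] by blast+
		moreover have "2*M * triv.rate \<mu> <= 2*M*\<rho>" using rle M0 by (intro mult_left_mono) auto
		ultimately show "norm (P x - a) <= 2*M*\<rho>" "norm (G x - b) <= 2*M*\<rho>" unfolding P0 by linarith+
	qed
	have gb: "g * norm b <= 2*M*\<rho>"
	proof -
		have "g * norm b <= norm (exp (\<i> * (of_real t + \<mu>)) - 1) * norm b" using g by (intro mult_right_mono) auto
		also have "\<dots> = norm (G 1 - b)" unfolding G1 norm_mult[symmetric] by (simp add: algebra_simps)
		finally show ?thesis using B(2)[of 1] by simp
	qed
	\<comment> \<open>Both amplitudes vanishing at 0 would make the initial vector of y vanish.\<close>
	have Mpos: "M > 0"
	proof (rule ccontr)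
		assume "\<not> M > 0"
		then have ab: "a = 0" "b = 0" by (auto simp: M_def not_less max_def split: if_splits)
		have "a + b = 2*\<i>*\<mu> * y 0" "a - b = 2 * y1 0" by (simp_all add: a_def b_def)
		then have "y 0 = 0" "y1 0 = 0" using ab mu1 by auto
		then show False using nz sol_nonzero_iff[OF q_int sy] by blast
	qed
	have s4: "4*\<rho> <= g" using small by (simp add: \<rho>_def)
	have "norm b <= M/2"
	proof -
		have "2*M*\<rho> <= g * (M/2)" using mult_right_mono[OF s4, of "M/2"] Mpos by (simp add: algebra_simps)
		then show ?thesis using gb g(1) by (meson mult_le_cancel_left_pos order_trans)
	qed
	then have Ma: "M = norm a" using Mpos by (auto simp: M_def max_def split: if_splits)
	then have a0: "a \<noteq> 0" using Mpos by auto
	have bb: "norm b <= 2 * norm a * \<rho>/g" using gb g(1) by (simp add: Ma pos_le_divide_eq mult.commute)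
	show ?thesis
	proof (rule that[OF a0])
		fix x :: real assume x: "x \<in> {0..1}"
		define e1 e2 where "e1 = exp (\<i>*\<mu> * of_real x)" and "e2 = exp (- (\<i>*\<mu> * of_real x))"
		have ee: "e1*e2 = 1" by (simp add: e1_def e2_def exp_add[symmetric])
		have en: "norm e1 <= 3" "norm e2 <= 3"
		proof -
			have "\<bar>Im \<mu> * x\<bar> <= 1*1" unfolding abs_mult using mu(2) x by (intro mult_mono) auto
			then have "norm e1 <= exp 1" "norm e2 <= exp 1" by (auto simp: e1_def e2_def)
			then show "norm e1 <= 3" "norm e2 <= 3" using exp_le by linarith+
		qed
		have "P x * e1 + G x * e2 = (y1 x + \<i>*\<mu> * y x) * (e1*e2) + (\<i>*\<mu> * y x - y1 x) * (e1*e2)"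
			unfolding Px[OF x] Gx[OF x] e1_def[symmetric] e2_def[symmetric] by (simp only: mult_ac)
		then have rep: "2*\<i>*\<mu> * y x = P x * e1 + G x * e2" unfolding ee by simp
		have "2*\<i>*\<mu>/a * y x - e1 = ((P x - a) * e1 + G x * e2) / a" using a0 rep by (simp add: field_simps)
		then have "norm (2*\<i>*\<mu>/a * y x - e1) = norm ((P x - a) * e1 + G x * e2) / norm a" by (simp add: norm_divide)
		also have "\<dots> <= (2 * norm a * \<rho>*3 + (2 * norm a * \<rho>/g + 2 * norm a * \<rho>) * 3) / norm a"
		proof (intro divide_right_mono norm_triangle_mono)
			show "norm ((P x - a) * e1) <= 2 * norm a * \<rho>*3" unfolding norm_mult using B(1)[OF x] en \<rho> unfolding Ma by (intro mult_mono) auto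
			have "norm (G x) <= 2 * norm a * \<rho>/g + 2 * norm a * \<rho>" using B(2)[OF x] bb norm_triangle_ineq[of "G x - b" b] unfolding Ma by simp
			then show "norm (G x * e2) <= (2 * norm a * \<rho>/g + 2 * norm a * \<rho>) * 3" unfolding norm_mult using en \<rho> g by (intro mult_mono) auto
		qed simp
		also have "\<dots> = 12*\<rho> + 6*\<rho>/g" using a0 g by (simp add: field_simps)
		also have "\<dots> <= 12*\<rho> * (1 + 1/g)"
		proof -
			have "\<rho>/g >= 0" using \<rho> g by simp
			then show ?thesis by (simp add: distrib_left)
		qed
		also have "\<dots> = 12 * ((1 + exp 5) * triv.mass) * (1 + 1/g) / norm \<mu>" by (simp add: \<rho>_def)
		finally show "norm (2*\<i>*\<mu>/a * y x - exp (\<i>*\<mu> * of_real x)) <= 12 * ((1 + exp 5) * triv.mass) * (1 + 1/g) / norm \<mu>" unfolding e1_def .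
	qed
qed

text \<open>Feeds the enumeration's estimate of the eigenvalue into
  \<open>floquet_solution_near_exp\<close> and then normalises. Away from t = 0 and t = \<pi> the
  multiplier e^(i(t+\<mu>)) is close to e^(2it), whose distance from 1 is 2 sin t >= 2 sin \<rho>;
  half of that survives the perturbation.\<close>

lemma middle_eigenfunction:
	assumes \<rho>: "0 < \<rho>" "\<rho> < pi / 2"
	shows "\<exists>M N. \<forall>(n::int) t l. t \<in> {\<rho>..pi-\<rho>} \<and> \<bar>n\<bar> > N \<and> norm (l - of_real ((2*pi * of_int n + t)\<^sup>2)) <= M0 * ln \<bar>n\<bar> / \<bar>n\<bar> \<and> is_eigenvalue q t l -->
		(\<exists>\<Psi> \<Psi>1. floq_sol q t l (\<lambda>_. 0) \<Psi> \<Psi>1 \<and> integral {0..1} (\<lambda>x. (norm (\<Psi> x))\<^sup>2) = 1 \<and>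
			(\<forall>x\<in>{0..1}. norm (\<Psi> x - exp (\<i> * of_real ((2*pi * of_int n + t) * x))) <= M / \<bar>n\<bar>))"
proof -
	define E where "E = (1 + exp 5) * triv.mass"
	have E: "E >= 0" using triv.mass_nonneg by (simp add: E_def)
	define g where "g = sin \<rho>"
	have g: "g > 0" unfolding g_def using \<rho> by (intro sin_gt_zero) auto
	define C1 where "C1 = 12*E * (1 + 1/g) + 2 * \<bar>M0\<bar>"
	have E1: "12*E * (1 + 1/g) >= 0" using E g by simp
	define L where "L = 1 + 2 * \<bar>M0\<bar> + 2 * \<bar>M0\<bar> / g + 4*E + 4*E/g + 2*C1"
	have main: "\<exists>\<Psi> \<Psi>1. floq_sol q t l (\<lambda>_. 0) \<Psi> \<Psi>1 \<and> integral {0..1} (\<lambda>x. (norm (\<Psi> x))\<^sup>2) = 1 \<and>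
			(\<forall>x\<in>{0..1}. norm (\<Psi> x - exp (\<i> * of_real ((2*pi * of_int n + t) * x))) <= 4*C1 / \<bar>n\<bar>)"
		if t: "t \<in> {\<rho>..pi-\<rho>}" and n: "\<bar>n\<bar> > \<lceil>L\<rceil>" and l: "norm (l - of_real ((2*pi * of_int n + t)\<^sup>2)) <= M0 * ln \<bar>n\<bar> / \<bar>n\<bar>"
			and ev: "is_eigenvalue q t l" for n :: int and t l
	proof -
		define x where "x = real_of_int \<bar>n\<bar>"
		have xL: "x >= L" using n unfolding x_def by linarith
		have nn: "0 <= \<bar>M0\<bar> / g" "0 <= E/g" "0 <= C1" using g E E1 by (auto simp: C1_def)
		have xx: "x >= 1" "2 * \<bar>M0\<bar> <= x" "2 * \<bar>M0\<bar> / g <= x" "1 + 4*E <= x" "4*E/g <= x" "2*C1 <= x"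
			using xL E nn unfolding L_def by (auto simp: )
		have x0: "x > 0" using xx(1) by simp
		define \<nu> where "\<nu> = 2*pi * of_int n + t"
		have t2: "0 <= t" "t <= pi" using t \<rho> by auto
		have nu: "3*x <= \<bar>\<nu>\<bar>" unfolding x_def \<nu>_def using abs_two_pi_int_add[of n t] xx(1) t2 by (simp add: x_def)
		have l': "norm (l - of_real (\<nu>\<^sup>2)) <= M0 * ln x / x" using l unfolding \<nu>_def x_def .
		\<comment> \<open>For negative n the root close to 2 \<pi> n + t is the negative of the principal
		  one.\<close>
		define \<mu> where "\<mu> = of_real (sgn \<nu>) * csqrt l"
		have \<nu>0: "\<nu> \<noteq> 0" using nu xx(1) by auto
		have sg2: "(of_real (sgn \<nu>) :: complex)\<^sup>2 = 1" using \<nu>0 by (auto simp: sgn_if)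
		have \<mu>l: "\<mu>\<^sup>2 = l" by (simp add: \<mu>_def power_mult_distrib sg2)
		have d: "norm (\<mu> - of_real \<nu>) <= \<bar>M0\<bar> / x"
		proof -
			have "\<nu> = sgn \<nu> * \<bar>\<nu>\<bar>" by (simp add: sgn_mult_abs)
			then have "\<mu> - of_real \<nu> = of_real (sgn \<nu>) * (csqrt l - of_real \<bar>\<nu>\<bar>)" unfolding \<mu>_def by (metis of_real_mult right_diff_distrib)
			then have "norm (\<mu> - of_real \<nu>) = norm (csqrt l - of_real \<bar>\<nu>\<bar>)" using \<nu>0 by (simp add: norm_mult)
			then show ?thesis using csqrt_near_real[OF xx(1) nu l'] by simp
		qed
		have dh: "\<bar>M0\<bar> / x <= 1/2" using xx(2) x0 by (simp add: pos_divide_le_eq)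
		have im: "\<bar>Im \<mu>\<bar> <= 1" using order_trans[OF abs_Im_le_cmod[of "\<mu> - of_real \<nu>"] order_trans[OF d dh]] by simp
		have n\<mu>: "x <= norm \<mu>" using norm_triangle_ineq4[of \<mu> "\<mu> - of_real \<nu>"] order_trans[OF d dh] nu xx(1) by simp
		have ex: "norm (exp (\<i> * (\<mu> - of_real \<nu>) * of_real u) - 1) <= 2 * (\<bar>M0\<bar> / x)" if "u \<in> {0..1}" for u
		proof -
			have "norm (\<i> * (\<mu> - of_real \<nu>) * of_real u) <= norm (\<mu> - of_real \<nu>) * 1" unfolding norm_mult using that by (auto intro!: mult_left_le)
			then have "norm (\<i> * (\<mu> - of_real \<nu>) * of_real u) <= \<bar>M0\<bar> / x" using d by linarith
			then show ?thesis using norm_exp_minus_1[of "\<i> * (\<mu> - of_real \<nu>) * of_real u"] dh by linarith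
		qed
		have gap: "g <= norm (exp (\<i> * (of_real t + \<mu>)) - 1)"
		proof -
			have "exp (\<i> * of_real \<nu>) = exp (\<i> * of_real t) * exp (\<i> * of_real (2*pi * of_int n))" unfolding \<nu>_def exp_add[symmetric] by (simp add: algebra_simps)
			also have "exp (\<i> * of_real (2*pi * of_int n)) = 1" using exp_integer_2pi[of "of_int n"] by (simp add: mult_ac)
			finally have en: "exp (\<i> * of_real \<nu>) = exp (\<i> * of_real t)" by simp
			define e where "e = exp (\<i> * complex_of_real t)"
			have ne: "norm e = 1" by (simp add: e_def)
			have s: "e*e - 1 = e * (2*\<i> * sin (of_real t))"
			proof -
				have "e * exp (- (\<i> * complex_of_real t)) = 1" by (simp add: e_def exp_add[symmetric])
				moreover have "2*\<i> * sin (of_real t) = e - exp (- (\<i> * complex_of_real t))" by (simp add: sin_exp_eq e_def)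
				ultimately show ?thesis by (simp add: right_diff_distrib)
			qed
			have "sin \<rho> <= sin t"
			proof (cases "t <= pi/2")
				case True
				then show ?thesis using t \<rho> by (intro sin_monotone_2pi_le) auto
			next
				case False
				have "sin \<rho> <= sin (pi - t)" using False t \<rho> by (intro sin_monotone_2pi_le) auto
				then show ?thesis by simp
			qed
			then have "2*g <= norm (e*e - 1)" unfolding s norm_mult ne sin_of_real g_def by simp
			moreover have "exp (\<i> * (of_real t + \<mu>)) = e*e * exp (\<i> * (\<mu> - of_real \<nu>) * of_real 1)"
			proof -
				have "exp (\<i> * (of_real t + \<mu>)) = e * exp (\<i> * of_real \<nu>) * exp (\<i> * (\<mu> - of_real \<nu>) * of_real 1)" unfolding e_def exp_add[symmetric] by (simp add: algebra_simps)
				then show ?thesis unfolding en e_def .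
			qed
			moreover have "norm (e*e * exp (\<i> * (\<mu> - of_real \<nu>) * of_real 1) - e*e) <= g"
			proof -
				have "norm (e*e * exp (\<i> * (\<mu> - of_real \<nu>) * of_real 1) - e*e) = norm (exp (\<i> * (\<mu> - of_real \<nu>) * of_real 1) - 1)"
					using norm_mult[of "e*e" "exp (\<i> * (\<mu> - of_real \<nu>) * of_real 1) - 1"] ne by (simp add: norm_mult right_diff_distrib)
				also have "\<dots> <= 2 * (\<bar>M0\<bar> / x)" by (rule ex) simp
				also have "\<dots> <= g" using xx(3) g x0 by (simp add: field_simps)
				finally show ?thesis .
			qed
			ultimately show ?thesis
				using norm_triangle_ineq4[of "exp (\<i> * (of_real t + \<mu>)) - 1" "e*e * exp (\<i> * (\<mu> - of_real \<nu>) * of_real 1) - e*e"] by simp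
		qed
		obtain y y1 where y: "floq_sol q t (\<mu>\<^sup>2) (\<lambda>_. 0) y y1" and ynz: "\<exists>x\<in>{0..1}. y x \<noteq> 0"
			using ev unfolding is_eigenvalue_def \<mu>l by blast
		have c1: "1 + 4 * ((1 + exp 5) * triv.mass) <= norm \<mu>" using xx(4) n\<mu> by (simp add: E_def)
		have c2: "4 * ((1 + exp 5) * triv.mass) / norm \<mu> <= g"
		proof -
			have "4*E <= x*g" using xx(5) g by (simp add: pos_divide_le_eq)
			also have "\<dots> <= norm \<mu> * g" using n\<mu> g by (intro mult_right_mono) auto
			finally have "4*E <= g * norm \<mu>" by (simp add: mult.commute)
			moreover have "norm \<mu> > 0" using n\<mu> x0 by linarith
			ultimately show ?thesis unfolding E_def[symmetric] by (simp add: pos_divide_le_eq)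
		qed
		obtain a where a: "a \<noteq> 0" and near: "\<And>u. u \<in> {0..1} ==> norm (2*\<i>*\<mu>/a * y u - exp (\<i>*\<mu> * of_real u)) <= 12*E * (1 + 1/g) / norm \<mu>"
			using floquet_solution_near_exp[OF c1 im y ynz g gap c2] unfolding E_def[symmetric] by blast
		define c where "c = 2*\<i>*\<mu>/a"
		have near2: "norm (c * y u - exp (\<i> * of_real (\<nu>*u))) <= C1/x" if u: "u \<in> {0..1}" for u
		proof -
			have 1: "norm (c * y u - exp (\<i>*\<mu> * of_real u)) <= 12*E * (1 + 1/g) / x"
			proof -
				have "12*E * (1 + 1/g) / norm \<mu> <= 12*E * (1 + 1/g) / x" using n\<mu> x0 E1 by (intro divide_left_mono mult_pos_pos) auto
				then show ?thesis using near[OF u] unfolding c_def by linarith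
			qed
			have "exp (\<i>*\<mu> * of_real u) = exp (\<i> * of_real (\<nu>*u)) * exp (\<i> * (\<mu> - of_real \<nu>) * of_real u)" unfolding exp_add[symmetric] by (simp add: algebra_simps)
			then have "exp (\<i>*\<mu> * of_real u) - exp (\<i> * of_real (\<nu>*u)) = exp (\<i> * of_real (\<nu>*u)) * (exp (\<i> * (\<mu> - of_real \<nu>) * of_real u) - 1)" by (simp add: right_diff_distrib)
			then have "norm (exp (\<i>*\<mu> * of_real u) - exp (\<i> * of_real (\<nu>*u))) = norm (exp (\<i> * (\<mu> - of_real \<nu>) * of_real u) - 1)" by (simp only: norm_mult norm_exp_i_times mult_1)
			then have 2: "norm (exp (\<i>*\<mu> * of_real u) - exp (\<i> * of_real (\<nu>*u))) <= 2 * (\<bar>M0\<bar> / x)" using ex[OF u] by simp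
			have "norm (c * y u - exp (\<i> * of_real (\<nu>*u))) <= 12*E * (1 + 1/g) / x + 2 * (\<bar>M0\<bar> / x)"
				using norm_triangle_mono[OF 1 2] by simp
			then show ?thesis by (simp add: C1_def add_divide_distrib)
		qed
		have sy: "sol (\<lambda>x. q x - \<mu>\<^sup>2) (\<lambda>_. 0) y y1" and b1: "y 1 = exp (\<i> * of_real t) * y 0" and b2: "y1 1 = exp (\<i> * of_real t) * y1 0"
			using y unfolding floq_sol_iff[OF q_int continuous_on_const] by blast+
		have "ac y y1" using sy by (simp add: sol_def)
		then have cy: "continuous_on {0..1} (\<lambda>u. c * y u)" by (intro continuous_intros ac_continuous)
		have d2: "C1/x <= 1/2" using xx(6) x0 by (simp add: pos_divide_le_eq)
		obtain N :: real where N: "N > 0" "integral {0..1} (\<lambda>u. (norm (c * y u / of_real N))\<^sup>2) = 1"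
			"\<And>u. u \<in> {0..1} ==> norm (c * y u / of_real N - exp (\<i> * of_real (\<nu>*u))) <= 4 * (C1/x)"
			using normalise_near_unimodular[OF cy _ near2 d2] by (metis norm_exp_i_times)
		define k where "k = c / of_real N"
		have ke: "c * y u / of_real N = k * y u" for u by (simp add: k_def)
		have "sol (\<lambda>x. q x - \<mu>\<^sup>2) (\<lambda>_. 0) (\<lambda>u. k * y u) (\<lambda>u. k * y1 u)"
			using sol_linear[OF sy sy, of k 0] by simp
		then have "floq_sol q t l (\<lambda>_. 0) (\<lambda>u. k * y u) (\<lambda>u. k * y1 u)"
			unfolding floq_sol_iff[OF q_int continuous_on_const] \<mu>l using b1 b2 by (simp add: mult.left_commute)
		then show ?thesis using N(2,3) unfolding ke \<nu>_def x_def by (intro exI[of _ "\<lambda>u. k * y u"] exI[of _ "\<lambda>u. k * y1 u"] conjI ballI) simp_all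
	qed
	show ?thesis
		by (rule exI[of _ "4*C1"], rule exI[of _ "\<lceil>L\<rceil>"], intro allI impI, elim conjE) (rule main)
qed

end

section \<open>Insensitivity to changes of the potential on a null set\<close>

lemma AE_lebesgue_on_imp_negligible:
	fixes f g :: "real => complex"
	assumes "AE x in lebesgue_on {0..1}. f x = g x"
	shows "negligible {x \<in> {0..1}. f x \<noteq> g x}"
proof -
	have "AE x in lebesgue. x \<in> {0..1} --> f x = g x" using assms by (subst (asm) AE_restrict_space_iff) auto
	then obtain N where N: "{x \<in> space lebesgue. \<not> (x \<in> {0..1} --> f x = g x)} \<subseteq> N" "emeasure lebesgue N = 0" "N \<in> sets lebesgue"
		by (rule AE_E)
	have "negligible N" unfolding negligible_iff_null_sets using N(2,3) by (rule null_setsI)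
	moreover have "{x \<in> {0..1}. f x \<noteq> g x} \<subseteq> N" using N(1) by auto
	ultimately show ?thesis by (rule negligible_subset)
qed

lemma fcoef_spike:
	assumes "negligible {x \<in> {0..1}. f x \<noteq> g x}"
	shows "fcoef f = fcoef g"
	unfolding fcoef_def[abs_def] by (intro ext integral_spike[OF assms]) auto

text \<open>The potential enters only under integrals, so it may be exchanged for its absolutely
  continuous representative.\<close>

lemma floq_sol_spike:
	assumes neg: "negligible {x \<in> {0..1}. f x \<noteq> g x}"
	shows "floq_sol f = floq_sol g"
proof (intro ext)
	fix t l h y y1
	have 1: "(\<lambda>s. (f s - l) * y s - h s) integrable_on {0..1} \<longleftrightarrow> (\<lambda>s. (g s - l) * y s - h s) integrable_on {0..1}"
		using integrable_spike[OF _ neg, of "\<lambda>s. (f s - l) * y s - h s" "{0..1}" "\<lambda>s. (g s - l) * y s - h s"]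
			integrable_spike[OF _ neg, of "\<lambda>s. (g s - l) * y s - h s" "{0..1}" "\<lambda>s. (f s - l) * y s - h s"] by auto
	have 2: "integral {0..x} (\<lambda>s. (f s - l) * y s - h s) = integral {0..x} (\<lambda>s. (g s - l) * y s - h s)" if "x \<in> {0..1}" for x
		by (rule integral_spike[OF neg]) (use that in auto)
	have 3: "(\<forall>x\<in>{0..1}. y1 x = y1 0 + integral {0..x} (\<lambda>s. (f s - l) * y s - h s)) \<longleftrightarrow>
			(\<forall>x\<in>{0..1}. y1 x = y1 0 + integral {0..x} (\<lambda>s. (g s - l) * y s - h s))"
		by (intro ball_cong refl) (simp only: 2)
	show "floq_sol f t l h y y1 = floq_sol g t l h y y1"
		unfolding floq_sol_def 1 3 ..
qed

section \<open>Simplicity along the continuous enumeration\<close>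

lemma continuous_stays_below:
	fixes \<phi> :: "real => real"
	assumes c: "continuous_on {a..b} \<phi>" and t: "t0 \<in> {a..b}" "t1 \<in> {a..b}" and lt: "\<phi> t0 < R"
		and ne: "\<And>t. t \<in> {a..b} ==> \<phi> t \<noteq> R"
	shows "\<phi> t1 < R"
proof (rule ccontr)
	assume "\<not> \<phi> t1 < R"
	then have "R \<in> {\<phi> t0..\<phi> t1}" using lt by auto
	moreover have "{\<phi> t0..\<phi> t1} \<subseteq> \<phi> ` {a..b}"
		by (intro connected_contains_Icc connected_continuous_image c) (use t in auto)
	ultimately show False using ne by blast
qed

lemma cos_even_pi_add: "even m ==> cos (pi * of_int m + \<tau>) = cos \<tau>"
	by (simp add: cos_add cos_npi_int)

lemma cos_odd_pi_add: "odd m ==> cos (pi * of_int m + (pi - t)) = cos t"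
	by (simp add: cos_add cos_npi_int cos_diff sin_diff)

context hill_L1
begin

text \<open>The enumeration is uncontrolled near t = 0 and t = \<pi>, but continuous. Starting
  inside the moving disc at t0 and never meeting its boundary circle, which carries no eigenvalues,
  \<lambda> stays inside; its principal root is then near \<pi> m, where
  \<open>nondegenerate\<close> applies.\<close>

lemma eigenvalue_disc_trap:
	assumes simp: "nondegenerate q R"
		and m: "of_int m >= (2::real)" "of_int m >= R" and \<rho>: "0 < \<rho>" "\<rho> <= 1/80" and s: "\<bar>s\<bar> = 1"
		and l: "continuous_on {a..b} l" and \<tau>: "continuous_on {a..b} \<tau>" "\<And>t. t \<in> {a..b} ==> 0 <= \<tau> t \<and> \<tau> t <= \<rho> \<and> cos (pi * of_int m + \<tau> t) = cos t"
		and circ: "\<And>t z. t \<in> {a..b} ==> norm (z - of_real ((pi * of_int m + s * \<tau> t)\<^sup>2)) = 7*pi * of_int m * \<rho> ==> hill q z \<noteq> 2 * cos (of_real (pi * of_int m + \<tau> t))"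
		and ev: "\<And>t. t \<in> {a..b} ==> is_eigenvalue q t (l t)"
		and t0: "t0 \<in> {a..b}" "norm (l t0 - of_real ((pi * of_int m + s * \<tau> t0)\<^sup>2)) < 7 * pi * of_int m * \<rho>" and t: "t \<in> {a..b}"
	shows "simple_eigenvalue q t (l t)"
proof -
	have h: "hill q (l t) = 2 * cos (of_real t)" if "t \<in> {a..b}" for t
		using ev[OF that] unfolding is_eigenvalue_iff[OF q_int] .
	have "norm (l t - of_real ((pi * of_int m + s * \<tau> t)\<^sup>2)) < 7 * pi * of_int m * \<rho>"
	proof (rule continuous_stays_below[where \<phi> = "\<lambda>t. norm (l t - of_real ((pi * of_int m + s * \<tau> t)\<^sup>2))", OF _ t0(1) t t0(2)])
		show "continuous_on {a..b} (\<lambda>t. norm (l t - of_real ((pi * of_int m + s * \<tau> t)\<^sup>2)))" by (intro continuous_intros l \<tau>(1))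
		fix t assume t: "t \<in> {a..b}"
		have "of_real (cos (pi * of_int m + \<tau> t)) = (of_real (cos t) :: complex)" using \<tau>(2)[OF t] by simp
		then have "hill q (l t) = 2 * cos (of_real (pi * of_int m + \<tau> t))" using h[OF t] unfolding cos_of_real by simp
		then show "norm (l t - of_real ((pi * of_int m + s * \<tau> t)\<^sup>2)) \<noteq> 7*pi * of_int m * \<rho>" using circ[OF t] by blast
	qed
	moreover have "7*pi * of_int m * \<rho> <= 15/2*pi * of_int m * \<rho>" using m(1) \<rho> by (intro mult_right_mono) auto
	ultimately have "norm (l t - of_real ((pi * of_int m + s * \<tau> t)\<^sup>2)) <= 15/2*pi * of_int m * \<rho>" by linarith
	then have n: "norm (csqrt (l t) - pim m) <= 10*\<rho>"
		using csqrt_near[OF _ \<rho> _ _ s, of m "\<tau> t" "l t"] \<tau>(2)[OF t] m(1) by simp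
	then have "norm (csqrt (l t) - pim m) <= 1/8" using \<rho> by linarith
	note np = near_pi_int[OF m(1) this]
	have "R <= norm (csqrt (l t))" using np(1) m by linarith
	then have "deriv (hill q) (l t) \<noteq> 0" using simp[rule_format, of "csqrt (l t)" t] np h[OF t] unfolding power2_csqrt by blast
	then show ?thesis by (rule simple_eigenvalueI[OF q_int h[OF t]])
qed

context
	fixes \<epsilon> B :: real and N0 :: int
	assumes ep: "\<epsilon> > 0" and B: "B > 0"
		and cond: "balanced_coefs q \<epsilon> B N0"
begin

text \<open>In the middle range the enumeration's own estimate places the root in the strip. In the
  two end ranges \<open>eigenvalue_disc_trap\<close> starts from the adjacent end of the middle
  range, t0 = \<rho> or t0 = \<pi> - \<rho>, where that estimate is available.\<close>

lemma enumeration_simple: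
	assumes simp: "nondegenerate q R"
		and enum: "eig_enumeration q lam"
	shows "\<exists>N. \<forall>n. \<forall>t\<in>{0..pi}. \<bar>n\<bar> > N --> simple_eigenvalue q t (lam n t)"
proof -
	\<comment> \<open>Any fixed value up to 1/80 would do; it is fixed first because the constant
	  \<open>M0\<close> may depend on it.\<close>
	define \<rho> :: real where "\<rho> = 1/100"
	have \<rho>: "0 < \<rho>" "\<rho> <= 1/80" "\<rho> < pi/2" using pi_gt3 by (simp_all add: \<rho>_def)
	obtain M :: real and K where loc: "\<forall>m \<tau> s Rd. of_int m >= M \<and> 0 <= \<tau> \<and> \<tau> <= \<rho> \<and> \<bar>s\<bar> = 1 \<and> 7*pi * of_int m * \<rho> <= Rd \<and> Rd <= 15/2*pi * of_int m * \<rho> -->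
		disc_roots K m \<tau> s Rd"
		using localisation[OF ep B cond \<rho>(1,2) simp] by blast
	obtain N1 where ev: "\<And>n t. \<bar>n\<bar> >= N1 ==> t \<in> {0..pi} ==> is_eigenvalue q t (lam n t)" and cont: "\<And>n. \<bar>n\<bar> >= N1 ==> continuous_on {0..pi} (lam n)"
		using enum unfolding eig_enumeration_def by blast
	have "\<exists>M N'. \<forall>n. \<forall>t\<in>{\<rho>..pi-\<rho>}. \<bar>n\<bar> >= N' --> norm (lam n t - (of_real ((2*pi *  of_int n + t)^2))) <= M * ln \<bar>n\<bar> / \<bar>n\<bar>"
		using enum \<rho> unfolding eig_enumeration_def by blast
	then obtain M0 N2 where mid: "\<And>n t. t \<in> {\<rho>..pi-\<rho>} ==> \<bar>n\<bar> >= N2 ==> norm (lam n t - (of_real ((2*pi * of_int n + t)\<^sup>2))) <= M0 * ln \<bar>n\<bar> / \<bar>n\<bar>"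
		by blast
	define L where "L = max (max 2 R) (max M (10 * \<bar>M0\<bar> + 1))"
	define N where "N = max (max N1 N2) \<lceil>L\<rceil>"
	have main: "simple_eigenvalue q t (lam n t)" if t: "t \<in> {0..pi}" and n: "\<bar>n\<bar> > N" for n t
	proof -
		define x where "x = real_of_int \<bar>n\<bar>"
		have nN: "\<bar>n\<bar> >= N1" "\<bar>n\<bar> >= N2" "\<bar>n\<bar> > \<lceil>L\<rceil>" using n by (auto simp: N_def)
		have "x > L" unfolding x_def using nN(3) by linarith
		then have x: "x > 2" "x > R" "x > M" "x > 10 * \<bar>M0\<bar> + 1" by (auto simp: L_def)
		have n1: "\<bar>n\<bar> >= 1" using x(1) unfolding x_def by linarith
		have ct: "continuous_on {a..b} (lam n)" if "0 <= a" "b <= pi" for a b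
			by (rule continuous_on_subset[OF cont[OF nN(1)]]) (use that in auto)
		\<comment> \<open>The enumeration's error stays bounded by |M0|, whereas the radius of the disc
		  grows like m.\<close>
		have start: "norm (lam n u - of_real ((2*pi * of_int n + u)\<^sup>2)) < 7 * pi * of_int m * \<rho>"
			if u: "u \<in> {\<rho>..pi-\<rho>}" and m: "real_of_int m >= x" for u m
		proof -
			have "ln x <= x" using ln_bound[of x] x by simp
			then have q: "0 <= ln x / x" "ln x / x <= 1" using x by (auto simp: divide_le_eq)
			have "M0 * ln x / x = M0 * (ln x / x)" by simp
			also have "\<dots> <= \<bar>M0\<bar> * 1" using q by (intro mult_mono) auto
			finally have "norm (lam n u - of_real ((2*pi * of_int n + u)\<^sup>2)) <= \<bar>M0\<bar>" using mid[OF u nN(2)] unfolding x_def by simp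
			also have "\<bar>M0\<bar> < 7 * 3*x*\<rho>" using x(4) by (simp add: \<rho>_def)
			also have "7*3*x*\<rho> <= 7*pi * of_int m * \<rho>" using m pi_gt3 x \<rho> by (intro mult_right_mono mult_mono) auto
			finally show ?thesis .
		qed
		have zone: "simple_eigenvalue q t (lam n t)"
			if ab: "0 <= a" "b <= pi" "t \<in> {a..b}" "t0 \<in> {a..b}" "t0 \<in> {\<rho>..pi-\<rho>}" and m: "real_of_int m >= x" and s: "\<bar>s\<bar> = 1"
				and \<tau>: "continuous_on {a..b} \<tau>" "\<And>t. t \<in> {a..b} ==> 0 <= \<tau> t \<and> \<tau> t <= \<rho> \<and> cos (pi * of_int m + \<tau> t) = cos t"
				and sq: "(pi * of_int m + s * \<tau> t0)\<^sup>2 = (2*pi * of_int n + t0)\<^sup>2"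
			for a b t0 m s \<tau>
		proof (rule eigenvalue_disc_trap[OF simp _ _ \<rho>(1,2) s ct[OF ab(1,2)] \<tau> _ _ ab(4) _ ab(3)])
			show "real_of_int m >= 2" "real_of_int m >= R" using m x by linarith+
			show "is_eigenvalue q u (lam n u)" if "u \<in> {a..b}" for u using ev[OF nN(1)] that ab by auto
			show "norm (lam n t0 - of_real ((pi * of_int m + s * \<tau> t0)\<^sup>2)) < 7 * pi * of_int m * \<rho>" unfolding sq by (rule start[OF ab(5) m])
			fix u and z :: complex assume u: "u \<in> {a..b}" and z: "norm (z - of_real ((pi * of_int m + s * \<tau> u)\<^sup>2)) = 7*pi * of_int m * \<rho>"
			have mm: "real_of_int m >= M" "7*pi * of_int m * \<rho> <= 15/2*pi * of_int m * \<rho>"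
			proof -
				show "real_of_int m >= M" using m x by linarith
				show "7*pi * of_int m * \<rho> <= 15/2*pi * of_int m * \<rho>" using m x \<rho> by (intro mult_right_mono) auto
			qed
			have "of_int m >= M \<and> 0 <= \<tau> u \<and> \<tau> u <= \<rho> \<and> \<bar>s\<bar> = 1 \<and> 7*pi * of_int m * \<rho> <= 7*pi * of_int m * \<rho> \<and> 7*pi * of_int m * \<rho> <= 15/2*pi * of_int m * \<rho>"
				using mm \<tau>(2)[OF u] s by simp
			from conjunct1[OF loc[rule_format, OF this]] z
			show "hill q z \<noteq> 2 * cos (of_real (pi * of_int m + \<tau> u))" by blast
		qed
		consider "t <= \<rho>" | "\<rho> <= t" "t <= pi - \<rho>" | "pi - \<rho> <= t" by linarith
		then show ?thesis
		proof cases
			case 1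
			have ne: "n \<noteq> 0" using n1 by auto
			show ?thesis
			\<comment> \<open>For negative n, (2 \<pi> n + t)^2 = (2 \<pi> |n| - t)^2, so the sign of n
			  becomes the sign \<open>s\<close>.\<close>
			proof (rule zone[of 0 \<rho> \<rho> "2 * \<bar>n\<bar>" "of_int (sgn n)" "\<lambda>t. t"])
				show "(pi * of_int (2 * \<bar>n\<bar>) + of_int (sgn n) * \<rho>)\<^sup>2 = (2*pi * of_int n + \<rho>)\<^sup>2"
					using ne by (cases "n > 0") (simp_all add: power2_eq_square algebra_simps)
				show "continuous_on {0..\<rho>} (\<lambda>t. t)" by (rule continuous_on_id)
				show "\<bar>real_of_int (sgn n)\<bar> = 1" using ne by (auto simp: sgn_if)
				show "0 <= u \<and> u <= \<rho> \<and> cos (pi * of_int (2 * \<bar>n\<bar>) + u) = cos u" if "u \<in> {0..\<rho>}" for u using that cos_even_pi_add[of "2 * \<bar>n\<bar>" u] by auto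
				show "real_of_int (2 * \<bar>n\<bar>) >= x" using x by (simp add: x_def)
			qed (use t 1 \<rho> in auto)
		next
			case 2
			define \<mu> where "\<mu> = csqrt (lam n t)"
			define \<nu> where "\<nu> = 2*pi * of_int n + t"
			have nu: "3*x <= \<bar>\<nu>\<bar>" unfolding x_def \<nu>_def using abs_two_pi_int_add[OF n1] t by simp
			have d: "norm (\<mu> - of_real \<bar>\<nu>\<bar>) <= \<bar>M0\<bar> / x"
				unfolding \<mu>_def by (rule csqrt_near_real[OF _ nu]) (use mid[of t n] 2 nN(2) x in \<open>simp_all add: x_def \<nu>_def\<close>)
			also have "\<dots> <= 1" using x by (simp add: pos_divide_le_eq)
			finally have d: "norm (\<mu> - of_real \<bar>\<nu>\<bar>) <= 1" .
			have im: "\<bar>Im \<mu>\<bar> <= 1" using abs_Im_le_cmod[of "\<mu> - of_real \<bar>\<nu>\<bar>"] d by simp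
			have nR: "norm \<mu> >= R" using norm_triangle_ineq4[of \<mu> "\<mu> - of_real \<bar>\<nu>\<bar>"] d nu x by simp
			have h: "hill q (lam n t) = 2 * cos (of_real t)" using ev[OF nN(1) t] unfolding is_eigenvalue_iff[OF q_int] .
			have "Re \<mu> >= 0" using csqrt_principal[of "lam n t"] by (auto simp: \<mu>_def)
			then have "deriv (hill q) (lam n t) \<noteq> 0" using simp[rule_format, OF nR im] h unfolding \<mu>_def power2_csqrt by blast
			then show ?thesis by (rule simple_eigenvalueI[OF q_int h])
		next
			case 3
			\<comment> \<open>For n <= 0, 2 \<pi> n + t = -(\<pi> (-2n - 1) + (\<pi> - t)), so the square has
			  the positive index m = -2n - 1 and s = 1.\<close>
			define m where "m = (if n > 0 then 2 * n + 1 else - 2*n - 1)"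
			define s :: real where "s = (if n > 0 then - 1 else 1)"
			have om: "odd m" by (simp add: m_def)
			show ?thesis
			proof (rule zone[of "pi - \<rho>" pi "pi - \<rho>" m s "\<lambda>t. pi - t"])
				show "(pi * of_int m + s * (pi - (pi - \<rho>)))\<^sup>2 = (2*pi * of_int n + (pi - \<rho>))\<^sup>2"
					by (simp add: m_def s_def power2_eq_square algebra_simps)
				show "continuous_on {pi - \<rho>..pi} (\<lambda>t. pi - t)" by (intro continuous_intros)
				show "\<bar>s\<bar> = 1" by (simp add: s_def)
				show "0 <= pi - u \<and> pi - u <= \<rho> \<and> cos (pi * of_int m + (pi - u)) = cos u" if "u \<in> {pi - \<rho>..pi}" for u using that cos_odd_pi_add[OF om, of u] by auto
				have "\<bar>n\<bar> <= m" using n1 by (auto simp: m_def)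
				then show "real_of_int m >= x" unfolding x_def of_int_le_iff .
			qed (use t 3 \<rho> in auto)
		qed
	qed
	show ?thesis by (rule exI[of _ N]) (use main in blast)
qed

end

end

theorem theorem5:
	fixes q :: "real \<Rightarrow> complex" and p s :: nat and d :: "nat \<Rightarrow> real \<Rightarrow> complex"
		and lam :: "int \<Rightarrow> real \<Rightarrow> complex"
	assumes periodic: "\<forall>x. q (x + 1) = q x"
		and L1: "q absolutely_integrable_on {0..1}"
		and q0: "fcoef q 0 = 0"
		and W: "sobolev_W1 q p d"
		and sp: "s \<le> p"
		and bc: "\<forall>k<s. d k 0 = d k 1"
		and cond: "\<exists>c \<epsilon> K N0. c > 0 \<and> \<epsilon> > 0 \<and> K > 0 \<and> (\<forall>n::int. n > N0 \<longrightarrow>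
				norm (fcoef q n) \<le> K * norm (fcoef q (-n)) \<and> norm (fcoef q (-n)) \<le> K * norm (fcoef q n) \<and>
				norm (fcoef q n) > c * real_of_int n powr (- real s - 1) \<and>
				(Re (fcoef q n * fcoef q (-n)) \<ge> 0 \<or>
				 \<bar>Im (fcoef q n * fcoef q (-n))\<bar> \<ge> \<epsilon> * norm (fcoef q n * fcoef q (-n))))"
		and enum: "eig_enumeration q lam"
	shows "(\<exists>N. \<forall>n. \<forall>t\<in>{0..pi}. \<bar>n\<bar> > N \<longrightarrow> simple_eigenvalue q t (lam n t)) \<and>
		(\<exists>\<rho>0>0. \<forall>\<rho>. 0 < \<rho> \<and> \<rho> < \<rho>0 \<and> \<rho> < pi/2 \<longrightarrow>
			(\<exists>M N. \<forall>n::nat. \<forall>t\<in>{0..\<rho>}. n > N \<longrightarrow>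
				 (\<exists>\<mu>1 \<mu>2. \<mu>1 \<noteq> \<mu>2 \<and>
						{l. is_eigenvalue q t l \<and> norm (l - of_real ((2*pi*n + t)^2)) < 15*pi*n*\<rho>} = {\<mu>1, \<mu>2} \<and>
						norm (\<mu>1 - (of_real ((2*pi*n + t)^2 - 4*pi*n*t)
							 - csqrt (of_real ((4*pi*n*t)^2) + fcoef q (2*int n) * fcoef q (-2*int n)))) \<le> M / n \<and>
						norm (\<mu>2 - (of_real ((2*pi*n + t)^2 - 4*pi*n*t)
							 + csqrt (of_real ((4*pi*n*t)^2) + fcoef q (2*int n) * fcoef q (-2*int n)))) \<le> M / n)) \<and>
			(\<exists>M N. \<forall>n::nat. \<forall>t\<in>{pi-\<rho>..pi}. n > N \<longrightarrow>
				 (\<exists>\<mu>1 \<mu>2. \<mu>1 \<noteq> \<mu>2 \<and>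
						{l. is_eigenvalue q t l \<and> norm (l - of_real ((2*pi*n + t)^2)) < 15*pi*n*\<rho>} = {\<mu>1, \<mu>2} \<and>
						norm (\<mu>1 - (of_real ((2*pi*n + t)^2 - 2*pi*(2*n+1)*(t-pi))
							 - csqrt (of_real ((2*pi*(2*n+1)*(t-pi))^2) + fcoef q (2*int n+1) * fcoef q (-2*int n-1)))) \<le> M / n \<and>
						norm (\<mu>2 - (of_real ((2*pi*n + t)^2 - 2*pi*(2*n+1)*(t-pi))
							 + csqrt (of_real ((2*pi*(2*n+1)*(t-pi))^2) + fcoef q (2*int n+1) * fcoef q (-2*int n-1)))) \<le> M / n)) \<and>
			(\<exists>M N. \<forall>n::int. \<forall>t\<in>{\<rho>..pi-\<rho>}. \<bar>n\<bar> > N \<longrightarrow>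
				 norm (lam n t - of_real ((2*pi*n + t)^2)) \<le> M * ln \<bar>n\<bar> / \<bar>n\<bar> \<and>
				 (\<exists>\<Psi> \<Psi>1. floq_sol q t (lam n t) (\<lambda>_. 0) \<Psi> \<Psi>1 \<and>
						integral {0..1} (\<lambda>x. (norm (\<Psi> x))^2) = 1 \<and>
						(\<forall>x\<in>{0..1}. norm (\<Psi> x - exp (\<i> * of_real ((2*pi*n + t) * x))) \<le> M / \<bar>n\<bar>))))"
proof -
	\<comment> \<open>\<open>q\<close> agrees with \<open>d 0\<close> only almost everywhere, while the
	  gauge needs the absolutely continuous representative. Fourier coefficients, solutions and the
	  enumeration are all carried over to it.\<close>
	define Q where "Q = d 0"
	have dint: "\<And>k. k <= p ==> d k absolutely_integrable_on {0..1}" and ae: "AE x in lebesgue_on {0..1}. d 0 x = q x"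
		and dder: "\<And>k x. k < p ==> x \<in> {0..1} ==> d k x = d k 0 + integral {0..x} (d (Suc k))"
		using W unfolding sobolev_W1_def by blast+
	have neg: "negligible {x \<in> {0..1}. Q x \<noteq> q x}" unfolding Q_def by (rule AE_lebesgue_on_imp_negligible[OF ae])
	have eF: "fcoef q = fcoef Q" by (rule fcoef_spike[OF neg, symmetric])
	have eS: "floq_sol q = floq_sol Q" by (rule floq_sol_spike[OF neg, symmetric])
	have eE: "is_eigenvalue q = is_eigenvalue Q" unfolding is_eigenvalue_def[abs_def] eS ..
	have eM: "simple_eigenvalue q = simple_eigenvalue Q" unfolding simple_eigenvalue_def[abs_def] eS ..
	have eN: "eig_enumeration Q lam" using enum unfolding eig_enumeration_def eE .
	obtain c \<epsilon> B N0 where c: "c > 0" and ep: "\<epsilon> > 0" and B: "B > 0"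
		and cond1: "\<And>n. n > N0 ==> norm (fcoef Q n) <= B * norm (fcoef Q (-n)) \<and> norm (fcoef Q (-n)) <= B * norm (fcoef Q n) \<and>
				norm (fcoef Q n) > c * real_of_int n powr (- real s - 1) \<and>
				(Re (fcoef Q n * fcoef Q (-n)) >= 0 \<or> \<bar>Im (fcoef Q n * fcoef Q (-n))\<bar> >= \<epsilon> * norm (fcoef Q n * fcoef Q (-n)))"
		using cond unfolding eF by blast
	have cond2: "balanced_coefs Q \<epsilon> B N0"
		using cond1 by blast
	interpret H: hill_L1 Q
	proof
		show "L1 Q" unfolding Q_def by (rule dint) simp
		show "fcoef Q 0 = 0" using q0 unfolding eF .
	qed
	have ac_d: "ac (d k) (d (Suc k))" if "k < s" for k
	proof (rule acI)
		have k: "Suc k <= p" "k < p" using that sp by simp_all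
		show "d (Suc k) absolutely_integrable_on {0..1}" by (rule dint[OF k(1)])
		show "d k x = d k 0 + integral {0..x} (d (Suc k))" if "x \<in> {0..1}" for x by (rule dder[OF k(2) that])
	qed
	have int_d: "L1 (d k)" if "k <= s" for k by (rule dint) (use that sp in simp)
	have bc_d: "d k 1 = d k 0" if "k < s" for k using bc that by simp
	obtain T T' X A e e' K where g: "gauge (d 0) s T T' X A (d s) e e' K"
	proof (rule gauge_exists[of s d], goal_cases)
		case (1 k)
		show ?case by (rule int_d[OF 1(2)])
	next
		case (2 k)
		show ?case by (rule ac_d[OF 2(2)])
	next
		case (3 k)
		show ?case by (rule bc_d[OF 3(2)])
	next
		case (4 T T' X A e e' K)
		show ?case by (rule that[OF 4(2)])
	qed
	interpret gg: gauge Q s T T' X A "d s" e e' K unfolding Q_def by (rule g)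
	obtain R where R: "nondegenerate Q R"
	proof (rule gg.simple_right_half_plane[OF c ep B, of N0], goal_cases)
		case (1 n)
		show ?case by (rule cond1[OF 1(2)])
	next
		case (2 R)
		show ?case by (rule that[of R]) (use 2(2) in blast)
	qed
	have simple: "\<exists>N. \<forall>n. \<forall>t\<in>{0..pi}. \<bar>n\<bar> > N --> simple_eigenvalue Q t (lam n t)"
		by (rule H.enumeration_simple[OF ep B cond2 R eN])
	show ?thesis unfolding eF eS eE eM
	proof (rule conjI[OF simple], rule exI[of _ "1/80"], rule conjI, simp, intro allI impI, elim conjE, goal_cases)
		case (1 \<rho>)
		note \<rho> = 1
		have \<rho>': "\<rho> <= 1/80" using \<rho> by simp
		obtain M :: real and K where loc: "\<forall>m \<tau> s Rd. of_int m >= M \<and> 0 <= \<tau> \<and> \<tau> <= \<rho> \<and> \<bar>s\<bar> = 1 \<and> 7*pi * of_int m * \<rho> <= Rd \<and> Rd <= 15/2*pi * of_int m * \<rho> -->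
			H.disc_roots K m \<tau> s Rd"
			using H.localisation[OF ep B cond2 \<rho>(1) \<rho>' R] by blast
		\<comment> \<open>Restates \<open>localisation\<close> with centre, shift, radicand and product of
		  coefficients as parameters, so that both end ranges only have to supply algebraic identities for
		  them.\<close>
		have disc: "\<exists>z1 z2. z1 \<noteq> z2 \<and> {l. is_eigenvalue Q t l \<and> norm (l - of_real cc) < Rd} = {z1, z2} \<and>
				norm (z1 - (of_real a - csqrt (of_real X + Z))) <= \<bar>K\<bar> / n \<and> norm (z2 - (of_real a + csqrt (of_real X + Z))) <= \<bar>K\<bar> / n"
			if m: "of_int m >= M" "0 <= \<tau>" "\<tau> <= \<rho>" "\<bar>s\<bar> = 1" "7*pi * of_int m * \<rho> <= Rd" "Rd <= 15/2*pi * of_int m * \<rho>"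
				and eq: "cos (pi * of_int m + \<tau>) = cos t" "cc = (pi * of_int m + s*\<tau>)\<^sup>2" "a = (pi * of_int m)\<^sup>2 + \<tau>\<^sup>2" "X = (2*pi * of_int m * \<tau>)\<^sup>2" "Z = H.ZZ m"
				and n: "0 < n" "n <= of_int m" for m \<tau> s Rd t cc a X Z and n :: real
		proof -
			have "of_int m >= M \<and> 0 <= \<tau> \<and> \<tau> <= \<rho> \<and> \<bar>s\<bar> = 1 \<and> 7*pi * of_int m * \<rho> <= Rd \<and> Rd <= 15/2*pi * of_int m * \<rho>" using m by simp
			from conjunct2[OF loc[rule_format, OF this]]
			obtain z1 z2 where z: "z1 \<noteq> z2" "{z. hill Q z = 2 * cos (of_real (pi * of_int m + \<tau>)) \<and> norm (z - of_real ((pi * of_int m + s*\<tau>)\<^sup>2)) < Rd} = {z1, z2}"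
				"norm (z1 - (of_real ((pi * of_int m)\<^sup>2 + \<tau>\<^sup>2) - csqrt (of_real ((2*pi * of_int m * \<tau>)\<^sup>2) + H.ZZ m))) <= K / of_int m"
				"norm (z2 - (of_real ((pi * of_int m)\<^sup>2 + \<tau>\<^sup>2) + csqrt (of_real ((2*pi * of_int m * \<tau>)\<^sup>2) + H.ZZ m))) <= K / of_int m" by blast
			have Kn: "K / of_int m <= \<bar>K\<bar> / n" using n by (intro frac_le) auto
			have h: "is_eigenvalue Q t l \<longleftrightarrow> hill Q l = 2 * cos (of_real (pi * of_int m + \<tau>))" for l
				unfolding is_eigenvalue_iff[OF H.q_int] cos_of_real eq(1) ..
			show ?thesis unfolding h eq(2-5)
				by (rule exI[of _ z1], rule exI[of _ z2], intro conjI z(1,2) order_trans[OF z(3) Kn] order_trans[OF z(4) Kn])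
		qed
		\<comment> \<open>From n = 7 on, 7 (2n + 1) <= 15 n, so the radius 15 \<pi> n \<rho> falls into
		  the window of \<open>localisation\<close> for odd m.\<close>
		define N where "N = max 7 (nat \<lceil>M\<rceil>)"
		have N: "real n >= M" "n >= 7" if "n > N" for n
		proof -
			have "nat \<lceil>M\<rceil> < n" using that unfolding N_def max_less_iff_conj by blast
			then show "real n >= M" by linarith
			show "n >= 7" using that by (simp add: N_def)
		qed
		show ?case
		proof (intro conjI, goal_cases)
			case 1
			show ?case
			proof (rule exI[of _ "\<bar>K\<bar>"], rule exI[of _ N], intro allI ballI impI, goal_cases)
				case (1 n t)
				note t = 1(1) and n = 1(2)
				show ?case
			proof (rule disc[of "2 * int n" t 1])
				show "7*pi * of_int (2 * int n) * \<rho> <= 15*pi*n*\<rho>" using \<rho> by (intro mult_right_mono) auto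
				show "cos (pi * of_int (2 * int n) + t) = cos t" by (rule cos_even_pi_add) simp
				show "(2*pi*n + t)\<^sup>2 - 4*pi*n*t = (pi * of_int (2 * int n))\<^sup>2 + t\<^sup>2" by (simp add: power2_eq_square algebra_simps)
			qed (use N[OF n] t in \<open>simp_all add: H.ZZ_def\<close>)
		qed
		next
			case 2
			show ?case
			proof (rule exI[of _ "\<bar>K\<bar>"], rule exI[of _ N], intro allI ballI impI, goal_cases)
				case (1 n t)
				note t = 1(1) and n = 1(2)
				show ?case
			\<comment> \<open>Uses 2 \<pi> n + t = \<pi> (2n + 1) - (\<pi> - t): the centre is the lower of
			  the two unperturbed eigenvalues.\<close>
			proof (rule disc[of "2 * int n + 1" "pi - t" "- 1"])
				have "7*pi * of_int (2 * int n + 1) <= 15*pi*n" using N(2)[OF n] by (simp add: algebra_simps)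
				then show "7*pi * of_int (2 * int n + 1) * \<rho> <= 15*pi*n*\<rho>" using \<rho> by (intro mult_right_mono) auto
				have "15*pi*n <= 15/2*pi * of_int (2 * int n + 1)" by (simp add: algebra_simps)
				then show "15*pi*n*\<rho> <= 15/2*pi * of_int (2 * int n + 1) * \<rho>" using \<rho> by (intro mult_right_mono) auto
				show "cos (pi * of_int (2 * int n + 1) + (pi - t)) = cos t" by (rule cos_odd_pi_add) simp
				show "(2*pi*n + t)\<^sup>2 - 2*pi*(2*n+1)*(t-pi) = (pi * of_int (2 * int n + 1))\<^sup>2 + (pi - t)\<^sup>2" by (simp add: power2_eq_square algebra_simps)
				show "(2*pi*n + t)\<^sup>2 = (pi * of_int (2 * int n + 1) + - 1 * (pi - t))\<^sup>2" by (simp add: power2_eq_square algebra_simps)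
				show "(2*pi*(2*n+1)*(t-pi))\<^sup>2 = (2*pi * of_int (2 * int n + 1) * (pi - t))\<^sup>2" by (simp add: power2_eq_square algebra_simps)
				show "fcoef Q (2*int n+1) * fcoef Q (-2*int n-1) = H.ZZ (2 * int n + 1)" by (simp add: H.ZZ_def)
			qed (use N[OF n] t in simp_all)
		qed
		next
			case 3
		have "\<exists>M N'. \<forall>n. \<forall>t\<in>{\<rho>..pi-\<rho>}. \<bar>n\<bar> >= N' --> norm (lam n t - (of_real ((2*pi *  of_int n + t)^2))) <= M * ln \<bar>n\<bar> / \<bar>n\<bar>"
			using eN \<rho> unfolding eig_enumeration_def by blast
		then obtain M0 N1 where mid: "\<And>n t. t \<in> {\<rho>..pi-\<rho>} ==> \<bar>n\<bar> >= N1 ==> norm (lam n t - (of_real ((2*pi * of_int n + t)\<^sup>2))) <= M0 * ln \<bar>n\<bar> / \<bar>n\<bar>"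
			by blast
		obtain N2 where ev: "\<And>n t. \<bar>n\<bar> >= N2 ==> t \<in> {0..pi} ==> is_eigenvalue Q t (lam n t)"
			using eN unfolding eig_enumeration_def by blast
		obtain M1 N3 where eig: "\<forall>(n::int) t l. t \<in> {\<rho>..pi-\<rho>} \<and> \<bar>n\<bar> > N3 \<and> norm (l - of_real ((2*pi * of_int n + t)\<^sup>2)) <= M0 * ln \<bar>n\<bar> / \<bar>n\<bar> \<and> is_eigenvalue Q t l -->
			(\<exists>\<Psi> \<Psi>1. floq_sol Q t l (\<lambda>_. 0) \<Psi> \<Psi>1 \<and> integral {0..1} (\<lambda>x. (norm (\<Psi> x))\<^sup>2) = 1 \<and>
				(\<forall>x\<in>{0..1}. norm (\<Psi> x - exp (\<i> * of_real ((2*pi * of_int n + t) * x))) <= M1 / \<bar>n\<bar>))"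
			using H.middle_eigenfunction[OF \<rho>(1,3), of M0] by blast
		show ?case
		proof (rule exI[of _ "max M0 M1"], rule exI[of _ "max (max N1 N2) (max N3 1)"], intro allI ballI impI, goal_cases)
			case (1 n t)
			note t = 1(1) and n = 1(2)
			have nn: "\<bar>n\<bar> >= N1" "\<bar>n\<bar> >= N2" "\<bar>n\<bar> > N3" "\<bar>n\<bar> > 1" using n by auto
			have x: "real_of_int \<bar>n\<bar> >= 1" using nn(4) by linarith
			have e: "norm (lam n t - of_real ((2*pi * of_int n + t)\<^sup>2)) <= M0 * ln \<bar>n\<bar> / \<bar>n\<bar>" using mid[OF t nn(1)] by simp
			have "t \<in> {0..pi}" using t \<rho> by auto
			then have 2: "is_eigenvalue Q t (lam n t)" by (rule ev[OF nn(2)])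
			obtain \<Psi> \<Psi>1 where \<Psi>: "floq_sol Q t (lam n t) (\<lambda>_. 0) \<Psi> \<Psi>1" "integral {0..1} (\<lambda>x. (norm (\<Psi> x))\<^sup>2) = 1"
				"\<forall>x\<in>{0..1}. norm (\<Psi> x - exp (\<i> * of_real ((2*pi * of_int n + t) * x))) <= M1 / \<bar>n\<bar>"
				using eig t nn(3) e 2 by blast
			have 3: "M0 * ln \<bar>n\<bar> / \<bar>n\<bar> <= max M0 M1 * ln \<bar>n\<bar> / \<bar>n\<bar>" using x by (intro divide_right_mono mult_right_mono) auto
			have 4: "M1 / \<bar>n\<bar> <= max M0 M1 / \<bar>n\<bar>" using x by (intro divide_right_mono) auto
			have 5: "\<forall>x\<in>{0..1}. norm (\<Psi> x - exp (\<i> * of_real ((2*pi * of_int n + t) * x))) <= max M0 M1 / \<bar>n\<bar>"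
				using \<Psi>(3) 4 by (meson order_trans)
			show ?case
				by (rule conjI[OF order_trans[OF e 3]], rule exI[of _ \<Psi>], rule exI[of _ \<Psi>1], intro conjI \<Psi>(1,2) 5)
		qed
		qed
	qed
qed

end
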